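(* Let $X$ be a complex manifold, $f$ a holomorphic function on $X$, and $\mathcal M$ a holonomic left $\mathcal D_X$-module on which $f$ acts bijectively. Let $\alpha,\beta\in\mathbb C$ with $\beta\le\alpha$. Then there is a short exact sequence of $\mathcal D_X[s]$-modules $$0\to V^\beta\iota_+\mathcal M\xrightarrow{\ s+\alpha\ }V^\beta\iota_+\mathcal M\xrightarrow{\ ev_{s=-\alpha}\ }\mathcal M\cdot f^{-\alpha}\to0.$$
   Context: $\mathbb C$ has the lexicographic order: $\alpha<\beta$ iff $\mathrm{Re}\,\alpha<\mathrm{Re}\,\beta$, or $\mathrm{Re}\,\alpha=\mathrm{Re}\,\beta$ and $\mathrm{Im}\,\alpha<\mathrm{Im}\,\beta$. $\mathcal M[s]f^s$ is a left $\mathcal D_X\langle s,t\rangle$-module (with $st=t(s-1)$) via $\xi\cdot(ms^jf^s)=\bigl(\xi(m)s^j+ms^{j+1}\tfrac{\xi(f)}{f}\bigr)f^s$ for vector fields $\xi$, $s\cdot(ms^jf^s)=ms^{j+1}f^s$, $t\cdot(ms^jf^s)=\bigl(m(s+1)^jf\bigr)f^s$. Set $\mathcal M\cdot f^{-\alpha}:=\mathcal M[s]f^s/(s+\alpha)\mathcal M[s]f^s$. Let $\iota:X\to X\times\mathbb C_t$ be the graph embedding of $f$ and $\iota_+\mathcal M=\sum_{j\ge0}\mathcal M\otimes\partial_t^j$, identified with $\mathcal M[s]f^s$ via $ms^jf^s\mapsto m\otimes(-\partial_tt)^j$. The map $ev_{s=-\alpha}$ is the restriction of the quotient map $\iota_+\mathcal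 M\cong\mathcal M[s]f^s\to\mathcal M\cdot f^{-\alpha}$, $s\mapsto-\alpha$. $V^\bullet\iota_+\mathcal M$ is the $\mathbb C$-indexed Kashiwara–Malgrange filtration along $\{t=0\}$: the unique decreasing, exhaustive, left-continuous filtration with (locally) jumps in $A+\mathbb Z$, $A\subseteq\mathbb C$ finite, good over $V^\bullet\mathcal D_{X\times\mathbb C}$ with each $V^\gamma$ coherent over $V^0\mathcal D_{X\times\mathbb C}$, and with $-\partial_tt+\gamma$ nilpotent on $\mathrm{gr}_V^\gamma=V^\gamma/V^{>\gamma}$. *)

theory Defs
  imports "HOL-Analysis.Analysis" "HOL-Algebra.Module" "HOL-Algebra.AbelCoset"
begin

section \<open>The lexicographic order on the complex numbers\<close>

definition clex_less :: "complex \<Rightarrow> complex \<Rightarrow> bool" where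
  "clex_less a b \<longleftrightarrow> Re a < Re b \<or> (Re a = Re b \<and> Im a < Im b)"

definition clex_le :: "complex \<Rightarrow> complex \<Rightarrow> bool" where
  "clex_le a b \<longleftrightarrow> clex_less a b \<or> a = b"


section \<open>Complex manifolds\<close>

text \<open>The space \<open>C^n\<close> is rendered as a set of finitely supported sequences, so that the dimension is
  a natural number (possibly 0) and the product of a manifold with \<open>C\<close> has dimension \<open>n + 1\<close>.
  The topology is the one induced by the product topology, i.e. the usual one.\<close>

definition cspace :: "nat \<Rightarrow> (nat \<Rightarrow> complex) set" where
  "cspace n = {z. \<forall>i\<ge>n. z i = 0}"

text \<open>Holomorphic functions of several variables: continuous, and holomorphic in each variable
  separately (\<open>G\<close> is always a relatively open subset of \<open>cspace n\<close>).\<close>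

definition hol_on :: "nat \<Rightarrow> (nat \<Rightarrow> complex) set \<Rightarrow> ((nat \<Rightarrow> complex) \<Rightarrow> complex) \<Rightarrow> bool" where
  "hol_on n G g \<longleftrightarrow> continuous_on G g \<and>
     (\<forall>z\<in>G. \<forall>i<n. (\<lambda>w. g (z(i := w))) field_differentiable (at (z i)))"

type_synonym 'a chart = "'a set \<times> ('a \<Rightarrow> nat \<Rightarrow> complex)"

record 'a cmfd =
  cdim :: nat
  atlas :: "'a chart set"

text \<open>The underlying space is the whole type \<open>'a\<close>; Hausdorff and second countable by its sort.\<close>

definition complex_manifold :: "('a::{t2_space,second_countable_topology}) cmfd \<Rightarrow> bool" where
  "complex_manifold X \<longleftrightarrow>
     (\<Union>c\<in>atlas X. fst c) = UNIV \<and>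
     (\<forall>(U, \<phi>)\<in>atlas X. open U \<and> openin (top_of_set (cspace (cdim X))) (\<phi> ` U) \<and>
        (\<exists>\<psi>. homeomorphism U (\<phi> ` U) \<phi> \<psi>)) \<and>
     (\<forall>(U, \<phi>)\<in>atlas X. \<forall>(W, \<psi>)\<in>atlas X. \<forall>i<cdim X.
        hol_on (cdim X) (\<phi> ` (U \<inter> W)) (\<lambda>z. \<psi> (inv_into U \<phi> z) i))"

definition times_C :: "'a cmfd \<Rightarrow> ('a \<times> complex) cmfd" where
  "times_C X = \<lparr> cdim = Suc (cdim X),
     atlas = (\<lambda>(U, \<phi>). (U \<times> UNIV, \<lambda>p. (\<phi> (fst p))(cdim X := snd p))) ` atlas X \<rparr>"

text \<open>Sections of the structure sheaf over \<open>U\<close>; they are total functions, normalised to vanish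
  outside \<open>U\<close>.\<close>

definition hol_sec :: "('a::topological_space) cmfd \<Rightarrow> 'a set \<Rightarrow> ('a \<Rightarrow> complex) set" where
  "hol_sec X U = {g. (\<forall>x. x \<notin> U \<longrightarrow> g x = 0) \<and>
     (\<forall>(W, \<phi>)\<in>atlas X. hol_on (cdim X) (\<phi> ` (U \<inter> W)) (\<lambda>z. g (inv_into W \<phi> z)))}"

definition fres :: "'a set \<Rightarrow> ('a \<Rightarrow> complex) \<Rightarrow> 'a \<Rightarrow> complex" where
  "fres V g = (\<lambda>x. if x \<in> V then g x else 0)"


section \<open>The sheaf of differential operators\<close>

text \<open>A section over \<open>U\<close> of the sheaf of \<open>C\<close>-linear endomorphisms of the structure sheaf is a family
  \<open>P V\<close> (\<open>V \<subseteq> U\<close> open) of linear maps on holomorphic functions on \<open>V\<close>, compatible with restriction.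
  Outside of its domain it is normalised to be 0.\<close>

type_synonym 'a dop = "'a set \<Rightarrow> ('a \<Rightarrow> complex) \<Rightarrow> 'a \<Rightarrow> complex"

definition op_dom :: "('a::topological_space) cmfd \<Rightarrow> 'a set \<Rightarrow> 'a set \<Rightarrow> ('a \<Rightarrow> complex) \<Rightarrow> bool" where
  "op_dom X U V g \<longleftrightarrow> open V \<and> V \<subseteq> U \<and> g \<in> hol_sec X V"

definition end_sec :: "('a::topological_space) cmfd \<Rightarrow> 'a set \<Rightarrow> 'a dop set" where
  "end_sec X U = {P.
     (\<forall>V g. \<not> op_dom X U V g \<longrightarrow> P V g = (\<lambda>x. 0)) \<and>
     (\<forall>V g. op_dom X U V g \<longrightarrow> P V g \<in> hol_sec X V \<and>
        (\<forall>W. open W \<and> W \<subseteq> V \<longrightarrow> P W (fres W g) = fres W (P V g))) \<and>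
     (\<forall>V g h a. op_dom X U V g \<and> op_dom X U V h \<longrightarrow>
        P V (\<lambda>x. a * g x + h x) = (\<lambda>x. a * P V g x + P V h x))}"

definition op_res :: "'a set \<Rightarrow> 'a dop \<Rightarrow> 'a dop" where
  "op_res U P = (\<lambda>V g. if V \<subseteq> U then P V g else (\<lambda>x. 0))"

definition op_add :: "'a dop \<Rightarrow> 'a dop \<Rightarrow> 'a dop" where
  "op_add P Q = (\<lambda>V g x. P V g x + Q V g x)"

definition op_comp :: "'a dop \<Rightarrow> 'a dop \<Rightarrow> 'a dop" where
  "op_comp P Q = (\<lambda>V g. P V (Q V g))"

definition op_id :: "('a::topological_space) cmfd \<Rightarrow> 'a set \<Rightarrow> 'a dop" where
  "op_id X U = (\<lambda>V g. if op_dom X U V g then g else (\<lambda>x. 0))"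

definition op_ring :: "('a::topological_space) cmfd \<Rightarrow> ('a set \<Rightarrow> 'a dop set) \<Rightarrow> 'a set \<Rightarrow> 'a dop ring" where
  "op_ring X R U = \<lparr> carrier = R U, mult = op_comp, one = op_id X U,
     zero = (\<lambda>V g x. 0), add = op_add \<rparr>"

definition mul_op :: "('a::topological_space) cmfd \<Rightarrow> 'a set \<Rightarrow> ('a \<Rightarrow> complex) \<Rightarrow> 'a dop" where
  "mul_op X U h = (\<lambda>V g. if op_dom X U V g then (\<lambda>x. h x * g x) else (\<lambda>x. 0))"

definition coord_deriv :: "'a chart \<Rightarrow> nat \<Rightarrow> ('a \<Rightarrow> complex) \<Rightarrow> 'a \<Rightarrow> complex" where
  "coord_deriv c i g x =
     deriv (\<lambda>w. g (inv_into (fst c) (snd c) ((snd c x)(i := w)))) (snd c x i)"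

definition vector_fields :: "('a::topological_space) cmfd \<Rightarrow> 'a set \<Rightarrow> 'a dop set" where
  "vector_fields X U = {\<xi> \<in> end_sec X U. \<forall>c\<in>atlas X. \<exists>a.
     (\<forall>i<cdim X. a i \<in> hol_sec X (U \<inter> fst c)) \<and>
     (\<forall>V g. op_dom X (U \<inter> fst c) V g \<longrightarrow>
        (\<forall>x\<in>V. \<xi> V g x = (\<Sum>i<cdim X. a i x * coord_deriv c i g x)))}"

text \<open>The subalgebra generated by functions and vector fields, with its filtration by order.\<close>

inductive has_order :: "('a::topological_space) cmfd \<Rightarrow> 'a set \<Rightarrow> nat \<Rightarrow> 'a dop \<Rightarrow> bool"
  for X U where
  mult: "h \<in> hol_sec X U \<Longrightarrow> has_order X U 0 (mul_op X U h)"
| vf: "\<xi> \<in> vector_fields X U \<Longrightarrow> has_order X U 1 \<xi>"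
| add: "has_order X U k P \<Longrightarrow> has_order X U k Q \<Longrightarrow> has_order X U k (op_add P Q)"
| comp: "has_order X U k P \<Longrightarrow> has_order X U l Q \<Longrightarrow> has_order X U (k + l) (op_comp P Q)"
| mono: "has_order X U k P \<Longrightarrow> k \<le> l \<Longrightarrow> has_order X U l P"

definition F_sec :: "('a::topological_space) cmfd \<Rightarrow> nat \<Rightarrow> 'a set \<Rightarrow> 'a dop set" where
  "F_sec X k U = {P \<in> end_sec X U.
     \<forall>x\<in>U. \<exists>V. open V \<and> x \<in> V \<and> V \<subseteq> U \<and> has_order X V k (op_res V P)}"

definition D_sec :: "('a::topological_space) cmfd \<Rightarrow> 'a set \<Rightarrow> 'a dop set" where
  "D_sec X U = {P \<in> end_sec X U.
     \<forall>x\<in>U. \<exists>V k. open V \<and> x \<in> V \<and> V \<subseteq> U \<and> has_order X V k (op_res V P)}"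

definition D_ring :: "('a::topological_space) cmfd \<Rightarrow> 'a set \<Rightarrow> 'a dop ring" where
  "D_ring X = op_ring X (D_sec X)"

definition O_ring :: "('a::topological_space) cmfd \<Rightarrow> 'a set \<Rightarrow> 'a dop ring" where
  "O_ring X = op_ring X (\<lambda>U. mul_op X U ` hol_sec X U)"


section \<open>Sheaves of left modules over a sheaf of rings of operators\<close>

text \<open>The library's locale \<open>module\<close> requires a commutative ring of scalars.\<close>

locale left_module = R?: ring R + M?: abelian_group M
  for R :: "('r, 'u) ring_scheme" (structure) and M :: "('r, 'm, 'v) module_scheme" (structure) +
  assumes smult_closed: "\<lbrakk>a \<in> carrier R; x \<in> carrier M\<rbrakk> \<Longrightarrow> a \<odot>\<^bsub>M\<^esub> x \<in> carrier M"
    and smult_l_distr: "\<lbrakk>a \<in> carrier R; b \<in> carrier R; x \<in> carrier M\<rbrakk> \<Longrightarrow>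
      (a \<oplus> b) \<odot>\<^bsub>M\<^esub> x = a \<odot>\<^bsub>M\<^esub> x \<oplus>\<^bsub>M\<^esub> b \<odot>\<^bsub>M\<^esub> x"
    and smult_r_distr: "\<lbrakk>a \<in> carrier R; x \<in> carrier M; y \<in> carrier M\<rbrakk> \<Longrightarrow>
      a \<odot>\<^bsub>M\<^esub> (x \<oplus>\<^bsub>M\<^esub> y) = a \<odot>\<^bsub>M\<^esub> x \<oplus>\<^bsub>M\<^esub> a \<odot>\<^bsub>M\<^esub> y"
    and smult_assoc: "\<lbrakk>a \<in> carrier R; b \<in> carrier R; x \<in> carrier M\<rbrakk> \<Longrightarrow>
      (a \<otimes> b) \<odot>\<^bsub>M\<^esub> x = a \<odot>\<^bsub>M\<^esub> (b \<odot>\<^bsub>M\<^esub> x)"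
    and smult_one: "x \<in> carrier M \<Longrightarrow> \<one> \<odot>\<^bsub>M\<^esub> x = x"

record ('a, 'm) msheaf =
  sect :: "'a set \<Rightarrow> ('a dop, 'm) module"
  restr :: "'a set \<Rightarrow> 'a set \<Rightarrow> 'm \<Rightarrow> 'm"

text \<open>\<open>restr E U V\<close> restricts from \<open>U\<close> to \<open>V\<close>. Only the values at open sets are meaningful.\<close>

definition module_sheaf ::
  "('a set \<Rightarrow> 'a dop ring) \<Rightarrow> ('a::topological_space, 'm, 'z) msheaf_scheme \<Rightarrow> bool" where
  "module_sheaf R E \<longleftrightarrow>
     (\<forall>U. open U \<longrightarrow> left_module (R U) (sect E U)) \<and>
     (\<forall>U V. open U \<and> open V \<and> V \<subseteq> U \<longrightarrow>
        (\<forall>m\<in>carrier (sect E U). restr E U V m \<in> carrier (sect E V)) \<and>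
        (\<forall>m\<in>carrier (sect E U). \<forall>m'\<in>carrier (sect E U).
           restr E U V (m \<oplus>\<^bsub>sect E U\<^esub> m') = restr E U V m \<oplus>\<^bsub>sect E V\<^esub> restr E U V m') \<and>
        (\<forall>P\<in>carrier (R U). \<forall>m\<in>carrier (sect E U).
           restr E U V (P \<odot>\<^bsub>sect E U\<^esub> m) = op_res V P \<odot>\<^bsub>sect E V\<^esub> restr E U V m)) \<and>
     (\<forall>U. open U \<longrightarrow> (\<forall>m\<in>carrier (sect E U). restr E U U m = m)) \<and>
     (\<forall>U V W. open U \<and> open V \<and> open W \<and> W \<subseteq> V \<and> V \<subseteq> U \<longrightarrow>
        (\<forall>m\<in>carrier (sect E U). restr E V W (restr E U V m) = restr E U W m)) \<and>
     (\<forall>\<U>. (\<forall>V\<in>\<U>. open V) \<longrightarrow>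
        (\<forall>m\<in>carrier (sect E (\<Union>\<U>)). \<forall>m'\<in>carrier (sect E (\<Union>\<U>)).
           (\<forall>V\<in>\<U>. restr E (\<Union>\<U>) V m = restr E (\<Union>\<U>) V m') \<longrightarrow> m = m') \<and>
        (\<forall>\<sigma>. (\<forall>V\<in>\<U>. \<sigma> V \<in> carrier (sect E V)) \<and>
             (\<forall>V\<in>\<U>. \<forall>W\<in>\<U>. restr E V (V \<inter> W) (\<sigma> V) = restr E W (V \<inter> W) (\<sigma> W)) \<longrightarrow>
           (\<exists>m\<in>carrier (sect E (\<Union>\<U>)). \<forall>V\<in>\<U>. restr E (\<Union>\<U>) V m = \<sigma> V)))"

definition sheaf_hom ::
  "('a set \<Rightarrow> 'a dop ring) \<Rightarrow> ('a::topological_space, 'm, 'z) msheaf_scheme \<Rightarrow>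
   ('a, 'n, 'y) msheaf_scheme \<Rightarrow> ('a set \<Rightarrow> 'm \<Rightarrow> 'n) \<Rightarrow> bool" where
  "sheaf_hom R E G h \<longleftrightarrow> (\<forall>U. open U \<longrightarrow>
     (\<forall>m\<in>carrier (sect E U). h U m \<in> carrier (sect G U)) \<and>
     (\<forall>m\<in>carrier (sect E U). \<forall>m'\<in>carrier (sect E U).
        h U (m \<oplus>\<^bsub>sect E U\<^esub> m') = h U m \<oplus>\<^bsub>sect G U\<^esub> h U m') \<and>
     (\<forall>P\<in>carrier (R U). \<forall>m\<in>carrier (sect E U).
        h U (P \<odot>\<^bsub>sect E U\<^esub> m) = P \<odot>\<^bsub>sect G U\<^esub> h U m) \<and>
     (\<forall>V. open V \<and> V \<subseteq> U \<longrightarrow>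
        (\<forall>m\<in>carrier (sect E U). h V (restr E U V m) = restr G U V (h U m))))"

text \<open>\<open>S\<close> is a subsheaf of \<open>R\<close>-submodules of \<open>E\<close> over the open set \<open>T\<close>.\<close>

definition submodule_sheaf ::
  "('a set \<Rightarrow> 'a dop ring) \<Rightarrow> ('a::topological_space, 'm, 'z) msheaf_scheme \<Rightarrow>
   ('a set \<Rightarrow> 'm set) \<Rightarrow> 'a set \<Rightarrow> bool" where
  "submodule_sheaf R E S T \<longleftrightarrow> (\<forall>U. open U \<and> U \<subseteq> T \<longrightarrow>
     S U \<subseteq> carrier (sect E U) \<and> \<zero>\<^bsub>sect E U\<^esub> \<in> S U \<and>
     (\<forall>m\<in>S U. \<forall>m'\<in>S U. m \<oplus>\<^bsub>sect E U\<^esub> m' \<in> S U) \<and>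
     (\<forall>P\<in>carrier (R U). \<forall>m\<in>S U. P \<odot>\<^bsub>sect E U\<^esub> m \<in> S U) \<and>
     (\<forall>V. open V \<and> V \<subseteq> U \<longrightarrow> (\<forall>m\<in>S U. restr E U V m \<in> S V)) \<and>
     (\<forall>m\<in>carrier (sect E U).
        (\<forall>x\<in>U. \<exists>V. open V \<and> x \<in> V \<and> V \<subseteq> U \<and> restr E U V m \<in> S V) \<longrightarrow> m \<in> S U))"

text \<open>The subsheaf of local finite sums of products of sections of \<open>C\<close> and of \<open>S\<close>.\<close>

definition prod_sheaf ::
  "('a set \<Rightarrow> 'a dop set) \<Rightarrow> ('a::topological_space, 'm, 'z) msheaf_scheme \<Rightarrow>
   ('a set \<Rightarrow> 'm set) \<Rightarrow> 'a set \<Rightarrow> 'm set" where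
  "prod_sheaf C E S U = {m \<in> carrier (sect E U).
     \<forall>x\<in>U. \<exists>V. open V \<and> x \<in> V \<and> V \<subseteq> U \<and>
       (\<exists>(r::nat) P u. (\<forall>i<r. P i \<in> C V \<and> u i \<in> S V) \<and>
          restr E U V m = (\<Oplus>\<^bsub>sect E V\<^esub>i\<in>{..<r}. P i \<odot>\<^bsub>sect E V\<^esub> u i))}"

definition generated_by ::
  "('a set \<Rightarrow> 'a dop ring) \<Rightarrow> ('a::topological_space, 'm, 'z) msheaf_scheme \<Rightarrow>
   ('a set \<Rightarrow> 'm set) \<Rightarrow> 'a set \<Rightarrow> nat \<Rightarrow> (nat \<Rightarrow> 'm) \<Rightarrow> bool" where
  "generated_by R E S T r m \<longleftrightarrow> (\<forall>i<r. m i \<in> S T) \<and>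
     (\<forall>U. open U \<and> U \<subseteq> T \<longrightarrow> (\<forall>u\<in>S U. \<forall>x\<in>U. \<exists>V. open V \<and> x \<in> V \<and> V \<subseteq> U \<and>
        (\<exists>P. (\<forall>i<r. P i \<in> carrier (R V)) \<and>
           restr E U V u = (\<Oplus>\<^bsub>sect E V\<^esub>i\<in>{..<r}. P i \<odot>\<^bsub>sect E V\<^esub> restr E T V (m i)))))"

definition finite_type ::
  "('a set \<Rightarrow> 'a dop ring) \<Rightarrow> ('a::topological_space, 'm, 'z) msheaf_scheme \<Rightarrow>
   ('a set \<Rightarrow> 'm set) \<Rightarrow> 'a set \<Rightarrow> bool" where
  "finite_type R E S T \<longleftrightarrow>
     (\<forall>x\<in>T. \<exists>U r m. open U \<and> x \<in> U \<and> U \<subseteq> T \<and> generated_by R E S U r m)"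

text \<open>\<open>P\<close> is, over \<open>V\<close>, an \<open>R\<close>-linear relation between the sections \<open>m 0, \<dots>, m (r - 1)\<close> over \<open>U\<close>.\<close>

definition is_relation ::
  "('a set \<Rightarrow> 'a dop ring) \<Rightarrow> ('a::topological_space, 'm, 'z) msheaf_scheme \<Rightarrow>
   'a set \<Rightarrow> nat \<Rightarrow> (nat \<Rightarrow> 'm) \<Rightarrow> 'a set \<Rightarrow> (nat \<Rightarrow> 'a dop) \<Rightarrow> bool" where
  "is_relation R E U r m V P \<longleftrightarrow> (\<forall>i<r. P i \<in> carrier (R V)) \<and>
     (\<Oplus>\<^bsub>sect E V\<^esub>i\<in>{..<r}. P i \<odot>\<^bsub>sect E V\<^esub> restr E U V (m i)) = \<zero>\<^bsub>sect E V\<^esub>"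

text \<open>Coherence: finite type, and for finitely many sections over an open set the sheaf of their
  relations is of finite type.\<close>

definition coherent ::
  "('a set \<Rightarrow> 'a dop ring) \<Rightarrow> ('a::topological_space, 'm, 'z) msheaf_scheme \<Rightarrow>
   ('a set \<Rightarrow> 'm set) \<Rightarrow> 'a set \<Rightarrow> bool" where
  "coherent R E S T \<longleftrightarrow> finite_type R E S T \<and>
     (\<forall>U r m. open U \<and> U \<subseteq> T \<and> (\<forall>i<r. m i \<in> S U) \<longrightarrow>
        (\<forall>x\<in>U. \<exists>V (q::nat) Q. open V \<and> x \<in> V \<and> V \<subseteq> U \<and>
           (\<forall>j<q. is_relation R E U r m V (Q j)) \<and>
           (\<forall>W P. open W \<and> W \<subseteq> V \<and> is_relation R E U r m W P \<longrightarrow>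
              (\<forall>y\<in>W. \<exists>W'. open W' \<and> y \<in> W' \<and> W' \<subseteq> W \<and>
                 (\<exists>B. (\<forall>j<q. B j \<in> carrier (R W')) \<and>
                    (\<forall>i<r. op_res W' (P i) =
                       (\<Oplus>\<^bsub>R W'\<^esub>j\<in>{..<q}. B j \<otimes>\<^bsub>R W'\<^esub> op_res W' (Q j i))))))))"


section \<open>Holonomic D-modules\<close>

definition good_filtration ::
  "('a::topological_space) cmfd \<Rightarrow> ('a, 'm, 'z) msheaf_scheme \<Rightarrow> 'a set \<Rightarrow>
   (int \<Rightarrow> 'a set \<Rightarrow> 'm set) \<Rightarrow> bool" where
  "good_filtration X E T F \<longleftrightarrow>
     (\<forall>k. submodule_sheaf (O_ring X) E (F k) T \<and> coherent (O_ring X) E (F k) T) \<and>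
     (\<forall>k U. open U \<and> U \<subseteq> T \<longrightarrow> F k U \<subseteq> F (k + 1) U) \<and>
     (\<exists>k0. \<forall>k\<le>k0. \<forall>U. open U \<and> U \<subseteq> T \<longrightarrow> F k U = {\<zero>\<^bsub>sect E U\<^esub>}) \<and>
     (\<forall>U. open U \<and> U \<subseteq> T \<longrightarrow> (\<forall>m\<in>carrier (sect E U). \<forall>x\<in>U. \<exists>V k.
        open V \<and> x \<in> V \<and> V \<subseteq> U \<and> restr E U V m \<in> F k V)) \<and>
     (\<forall>j k U. open U \<and> U \<subseteq> T \<longrightarrow>
        (\<forall>P\<in>F_sec X j U. \<forall>m\<in>F k U. P \<odot>\<^bsub>sect E U\<^esub> m \<in> F (k + int j) U)) \<and>
     (\<exists>k0. \<forall>k\<ge>k0. \<forall>j U. open U \<and> U \<subseteq> T \<longrightarrow>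
        F (k + int j) U \<subseteq> prod_sheaf (F_sec X j) E (F k) U)"

text \<open>The principal symbol of an operator \<open>P\<close> of order \<open>\<le> k\<close>, at the covector
  \<open>\<Sum>i. \<xi> i dz\<^sub>i\<close> over \<open>x\<close>: if \<open>P = \<Sum>\<^sub>\<nu> a\<^sub>\<nu> \<partial>\<^sup>\<nu>\<close> in the chart, then applying \<open>P\<close> to the \<open>k\<close>-th power of
  \<open>\<Sum>i. \<xi> i (z\<^sub>i - z\<^sub>i(x))\<close> and evaluating at \<open>x\<close> yields \<open>k!\<close> times the sum of the
  \<open>a\<^sub>\<nu>(x) \<xi>\<^sup>\<nu>\<close> over \<open>|\<nu>| = k\<close>.\<close>

definition symbol ::
  "nat \<Rightarrow> ('a \<Rightarrow> nat \<Rightarrow> complex) \<Rightarrow> nat \<Rightarrow> 'a set \<Rightarrow> 'a dop \<Rightarrow> 'a \<Rightarrow> (nat \<Rightarrow> complex) \<Rightarrow> complex" where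
  "symbol n \<phi> k V P x \<xi> = P V (fres V (\<lambda>y. (\<Sum>i<n. \<xi> i * (\<phi> y i - \<phi> x i)) ^ k)) x / fact k"

text \<open>The characteristic variety over a chart \<open>(W, \<phi>)\<close>, as a subset of \<open>C^n \<times> C^n = C^(2 n)\<close>: the
  common zeros of the annihilator in \<open>gr\<^sup>F D\<close> of the graded module of a (local) good filtration.
  The annihilator is homogeneous; the symbol of \<open>P\<close> of order \<open>\<le> k\<close> belongs to it iff
  \<open>P F\<^sub>i \<subseteq> F\<^bsub>i + k - 1\<^esub>\<close> for all \<open>i\<close>. The result does not depend on the good filtration.\<close>

definition char_var ::
  "('a::topological_space) cmfd \<Rightarrow> ('a, 'm, 'z) msheaf_scheme \<Rightarrow> 'a chart \<Rightarrow> (nat \<Rightarrow> complex) set" where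
  "char_var X E c = {z \<in> cspace (2 * cdim X). \<exists>x T F.
     open T \<and> x \<in> T \<and> T \<subseteq> fst c \<and> (\<forall>i<cdim X. z i = snd c x i) \<and> good_filtration X E T F \<and>
     (\<forall>V k. \<forall>P\<in>F_sec X k V. open V \<and> x \<in> V \<and> V \<subseteq> T \<and>
        (\<forall>i V'. open V' \<and> V' \<subseteq> V \<longrightarrow>
           (\<forall>m\<in>F i V'. op_res V' P \<odot>\<^bsub>sect E V'\<^esub> m \<in> F (i + int k - 1) V')) \<longrightarrow>
        symbol (cdim X) (snd c) k V P x (\<lambda>i. z (cdim X + i)) = 0)}"

text \<open>\<open>S \<subseteq> C^N\<close> contains the image of a holomorphic immersion of a nonempty open subset of \<open>C^d\<close>. The
  dimension of an analytic set is the largest such \<open>d\<close>.\<close>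

definition contains_submanifold :: "nat \<Rightarrow> nat \<Rightarrow> (nat \<Rightarrow> complex) set \<Rightarrow> bool" where
  "contains_submanifold N d S \<longleftrightarrow> (\<exists>G \<psi>.
     openin (top_of_set (cspace d)) G \<and> G \<noteq> {} \<and> \<psi> ` G \<subseteq> S \<and>
     (\<forall>i<N. hol_on d G (\<lambda>w. \<psi> w i)) \<and>
     (\<forall>w\<in>G. \<forall>v. (\<forall>i<N. (\<Sum>k<d. v k * deriv (\<lambda>\<zeta>. \<psi> (w(k := \<zeta>)) i) (w k)) = 0) \<longrightarrow>
        (\<forall>k<d. v k = 0)))"

text \<open>Holonomic: coherent, and either zero or with characteristic variety of dimension \<open>dim X\<close>.\<close>

definition holonomic ::
  "('a::topological_space) cmfd \<Rightarrow> ('a, 'm, 'z) msheaf_scheme \<Rightarrow> bool" where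
  "holonomic X M \<longleftrightarrow> module_sheaf (D_ring X) M \<and>
     coherent (D_ring X) M (\<lambda>U. carrier (sect M U)) UNIV \<and>
     ((\<forall>U. open U \<longrightarrow> carrier (sect M U) = {\<zero>\<^bsub>sect M U\<^esub>}) \<or>
      ((\<exists>c\<in>atlas X. contains_submanifold (2 * cdim X) (cdim X) (char_var X M c)) \<and>
       (\<forall>c\<in>atlas X. \<forall>d. contains_submanifold (2 * cdim X) d (char_var X M c) \<longrightarrow> d \<le> cdim X)))"

definition acts_bijectively ::
  "('a::topological_space) cmfd \<Rightarrow> ('a, 'm, 'z) msheaf_scheme \<Rightarrow> ('a \<Rightarrow> complex) \<Rightarrow> bool" where
  "acts_bijectively X M f \<longleftrightarrow> (\<forall>U. open U \<longrightarrow>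
     bij_betw (\<lambda>m. mul_op X U (fres U f) \<odot>\<^bsub>sect M U\<^esub> m) (carrier (sect M U)) (carrier (sect M U)))"


section \<open>\<open>D\<^sub>X[s]\<close>-modules and short exact sequences\<close>

text \<open>As \<open>s\<close> is central in \<open>D\<^sub>X[s]\<close>, a \<open>D\<^sub>X[s]\<close>-module is a \<open>D\<^sub>X\<close>-module with a \<open>D\<^sub>X\<close>-linear endomorphism.\<close>

record ('a, 'm) smsheaf = "('a, 'm) msheaf" +
  s_act :: "'a set \<Rightarrow> 'm \<Rightarrow> 'm"

definition Ds_module_sheaf :: "('a::topological_space) cmfd \<Rightarrow> ('a, 'm) smsheaf \<Rightarrow> bool" where
  "Ds_module_sheaf X E \<longleftrightarrow> module_sheaf (D_ring X) E \<and> sheaf_hom (D_ring X) E E (s_act E)"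

definition Ds_hom ::
  "('a::topological_space) cmfd \<Rightarrow> ('a, 'm) smsheaf \<Rightarrow> ('a, 'n) smsheaf \<Rightarrow> ('a set \<Rightarrow> 'm \<Rightarrow> 'n) \<Rightarrow> bool" where
  "Ds_hom X E G h \<longleftrightarrow> sheaf_hom (D_ring X) E G h \<and>
     (\<forall>U. open U \<longrightarrow> (\<forall>m\<in>carrier (sect E U). h U (s_act E U m) = s_act G U (h U m)))"

text \<open>Exactness of \<open>0 \<rightarrow> E \<rightarrow> F \<rightarrow> G \<rightarrow> 0\<close> in the category of sheaves: images are local.\<close>

definition short_exact ::
  "('a::topological_space) cmfd \<Rightarrow> ('a, 'm) smsheaf \<Rightarrow> ('a set \<Rightarrow> 'm \<Rightarrow> 'n) \<Rightarrow>
   ('a, 'n) smsheaf \<Rightarrow> ('a set \<Rightarrow> 'n \<Rightarrow> 'p) \<Rightarrow> ('a, 'p) smsheaf \<Rightarrow> bool" where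
  "short_exact X E h F k G \<longleftrightarrow>
     Ds_module_sheaf X E \<and> Ds_module_sheaf X F \<and> Ds_module_sheaf X G \<and>
     Ds_hom X E F h \<and> Ds_hom X F G k \<and>
     (\<forall>U. open U \<longrightarrow> inj_on (h U) (carrier (sect E U))) \<and>
     (\<forall>U. open U \<longrightarrow> (\<forall>m\<in>carrier (sect F U). k U m = \<zero>\<^bsub>sect G U\<^esub> \<longleftrightarrow>
        (\<forall>x\<in>U. \<exists>V. open V \<and> x \<in> V \<and> V \<subseteq> U \<and> restr F U V m \<in> h V ` carrier (sect E V)))) \<and>
     (\<forall>U. open U \<longrightarrow> (\<forall>g\<in>carrier (sect G U).
        \<forall>x\<in>U. \<exists>V. open V \<and> x \<in> V \<and> V \<subseteq> U \<and> restr G U V g \<in> k V ` carrier (sect F V)))"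

definition s_plus ::
  "('a::topological_space) cmfd \<Rightarrow> complex \<Rightarrow> ('a, 'm) smsheaf \<Rightarrow> 'a set \<Rightarrow> 'm \<Rightarrow> 'm" where
  "s_plus X \<alpha> E U m =
     s_act E U m \<oplus>\<^bsub>sect E U\<^esub> mul_op X U (fres U (\<lambda>x. \<alpha>)) \<odot>\<^bsub>sect E U\<^esub> m"

text \<open>The presheaf quotient of \<open>E\<close> by the image of \<open>h\<close>, on cosets.\<close>

definition quotient_by :: "('a, 'm) smsheaf \<Rightarrow> ('a set \<Rightarrow> 'm \<Rightarrow> 'm) \<Rightarrow> ('a, 'm set) smsheaf" where
  "quotient_by E h = (let I = (\<lambda>U. h U ` carrier (sect E U)) in
     \<lparr> sect = (\<lambda>U. \<lparr> carrier = a_rcosets\<^bsub>sect E U\<^esub> (I U), mult = undefined, one = undefined,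
         zero = I U, add = (\<lambda>K K'. K <+>\<^bsub>sect E U\<^esub> K'),
         smult = (\<lambda>P K. I U <+>\<^bsub>sect E U\<^esub> (\<lambda>m. P \<odot>\<^bsub>sect E U\<^esub> m) ` K) \<rparr>),
       restr = (\<lambda>U V K. I V <+>\<^bsub>sect E V\<^esub> restr E U V ` K),
       s_act = (\<lambda>U K. I U <+>\<^bsub>sect E U\<^esub> s_act E U ` K) \<rparr>)"


section \<open>The modules \<open>M[s] f^s\<close> and \<open>M f^(-\<alpha>)\<close>\<close>

text \<open>Sections over \<open>U\<close> of the sheaf direct sum of countably many copies of \<open>M\<close>: sequences which are
  locally finite (not necessarily finite if \<open>U\<close> is not compact).\<close>

definition seq_sec ::
  "('a::topological_space, 'm, 'z) msheaf_scheme \<Rightarrow> 'a set \<Rightarrow> (nat \<Rightarrow> 'm) set" where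
  "seq_sec M U = {m. (\<forall>j. m j \<in> carrier (sect M U)) \<and>
     (\<forall>x\<in>U. \<exists>V d. open V \<and> x \<in> V \<and> V \<subseteq> U \<and> (\<forall>j\<ge>d. restr M U V (m j) = \<zero>\<^bsub>sect M V\<^esub>))}"

definition seq_group ::
  "('a::topological_space, 'm, 'z) msheaf_scheme \<Rightarrow> 'a set \<Rightarrow> ('r, nat \<Rightarrow> 'm) module \<Rightarrow> bool" where
  "seq_group M U S \<longleftrightarrow> carrier S = seq_sec M U \<and> \<zero>\<^bsub>S\<^esub> = (\<lambda>j. \<zero>\<^bsub>sect M U\<^esub>) \<and>
     (\<forall>m\<in>seq_sec M U. \<forall>m'\<in>seq_sec M U. m \<oplus>\<^bsub>S\<^esub> m' = (\<lambda>j. m j \<oplus>\<^bsub>sect M U\<^esub> m' j))"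

definition shift :: "'m \<Rightarrow> (nat \<Rightarrow> 'm) \<Rightarrow> nat \<Rightarrow> 'm" where
  "shift z m = (\<lambda>j. case j of 0 \<Rightarrow> z | Suc i \<Rightarrow> m i)"

definition div_by ::
  "('a::topological_space) cmfd \<Rightarrow> ('a, 'm, 'z) msheaf_scheme \<Rightarrow> ('a \<Rightarrow> complex) \<Rightarrow> 'a set \<Rightarrow> 'm \<Rightarrow> 'm" where
  "div_by X M f U = inv_into (carrier (sect M U)) (\<lambda>m. mul_op X U (fres U f) \<odot>\<^bsub>sect M U\<^esub> m)"

text \<open>\<open>L = M[s] f^s\<close>, where \<open>m :: nat \<Rightarrow> 'm\<close> stands for \<open>\<Sum>j. m j s^j f^s\<close>. Since functions and vector
  fields generate \<open>D\<^sub>X\<close> locally, the clauses determine the \<open>D\<^sub>X\<close>-action.\<close>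

definition is_Ms_fs ::
  "('a::topological_space) cmfd \<Rightarrow> ('a, 'm) msheaf \<Rightarrow> ('a \<Rightarrow> complex) \<Rightarrow> ('a, nat \<Rightarrow> 'm) smsheaf \<Rightarrow> bool" where
  "is_Ms_fs X M f L \<longleftrightarrow> module_sheaf (D_ring X) L \<and>
     (\<forall>U. open U \<longrightarrow> seq_group M U (sect L U) \<and>
        (\<forall>V. open V \<and> V \<subseteq> U \<longrightarrow> (\<forall>m\<in>seq_sec M U. restr L U V m = (\<lambda>j. restr M U V (m j)))) \<and>
        (\<forall>h\<in>hol_sec X U. \<forall>m\<in>seq_sec M U.
           mul_op X U h \<odot>\<^bsub>sect L U\<^esub> m = (\<lambda>j. mul_op X U h \<odot>\<^bsub>sect M U\<^esub> m j)) \<and>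
        (\<forall>\<xi>\<in>vector_fields X U. \<forall>m\<in>seq_sec M U.
           \<xi> \<odot>\<^bsub>sect L U\<^esub> m =
             (\<lambda>j. \<xi> \<odot>\<^bsub>sect M U\<^esub> m j \<oplus>\<^bsub>sect M U\<^esub>
                shift \<zero>\<^bsub>sect M U\<^esub>
                  (\<lambda>i. div_by X M f U (mul_op X U (\<xi> U (fres U f)) \<odot>\<^bsub>sect M U\<^esub> m i)) j)) \<and>
        (\<forall>m\<in>seq_sec M U. s_act L U m = shift \<zero>\<^bsub>sect M U\<^esub> m))"

text \<open>\<open>M f^(-\<alpha>)\<close>. The presheaf quotient is already a sheaf here: evaluation at \<open>s = -\<alpha>\<close> identifies its
  underlying sheaf of abelian groups with \<open>M\<close>.\<close>

definition Mf_power ::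
  "('a::topological_space) cmfd \<Rightarrow> ('a, nat \<Rightarrow> 'm) smsheaf \<Rightarrow> complex \<Rightarrow> ('a, (nat \<Rightarrow> 'm) set) smsheaf" where
  "Mf_power X L \<alpha> = quotient_by L (s_plus X \<alpha> L)"


section \<open>The direct image under the graph embedding\<close>

definition graph_pre :: "('a \<Rightarrow> complex) \<Rightarrow> ('a \<times> complex) set \<Rightarrow> 'a set" where
  "graph_pre f W = {x. (x, f x) \<in> W}"

definition dt_op :: "('a::topological_space) cmfd \<Rightarrow> ('a \<times> complex) set \<Rightarrow> ('a \<times> complex) dop" where
  "dt_op X W = (\<lambda>V g. if op_dom (times_C X) W V g
     then fres V (\<lambda>p. deriv (\<lambda>t. g (fst p, t)) (snd p)) else (\<lambda>p. 0))"

definition t_op :: "('a::topological_space) cmfd \<Rightarrow> ('a \<times> complex) set \<Rightarrow> ('a \<times> complex) dop" where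
  "t_op X W = mul_op (times_C X) W (fres W snd)"

text \<open>The operator \<open>P\<close> acting on the variables of \<open>X\<close> only, with \<open>t\<close> as a parameter.\<close>

definition lift_op :: "('a::topological_space) cmfd \<Rightarrow> 'a set \<Rightarrow> 'a dop \<Rightarrow> ('a \<times> complex) dop" where
  "lift_op X U P = (\<lambda>V g. if op_dom (times_C X) (U \<times> UNIV) V g
     then (\<lambda>p. P {y. (y, snd p) \<in> V} (\<lambda>y. g (y, snd p)) (fst p)) else (\<lambda>p. 0))"

definition delta :: "'m \<Rightarrow> 'm \<Rightarrow> nat \<Rightarrow> 'm" where
  "delta z m = (\<lambda>j. if j = 0 then m else z)"

text \<open>\<open>N\<close> is the direct image of \<open>M\<close> under the graph embedding \<open>\<iota>\<close>, \<open>x \<mapsto> (x, f x)\<close>, of \<open>f\<close>: the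
  sequence \<open>m\<close> stands for \<open>\<Sum>j. m j \<otimes> \<partial>\<^sub>t^j\<close> and \<open>delta \<zero> m\<close> for \<open>m \<otimes> 1\<close>. The
  clauses are \<open>h (m \<otimes> 1) = (h \<circ> \<iota>) m \<otimes> 1\<close>, \<open>\<partial>\<^sub>t (m \<otimes> \<partial>\<^sub>t^j) = m \<otimes> \<partial>\<^sub>t^(j+1)\<close>
  and \<open>\<xi> (m \<otimes> 1) = \<xi> m \<otimes> 1 - \<xi>(f) m \<otimes> \<partial>\<^sub>t\<close>; they determine the action, e.g.
  \<open>t (m \<otimes> \<partial>\<^sub>t^j) = f m \<otimes> \<partial>\<^sub>t^j - j m \<otimes> \<partial>\<^sub>t^(j-1)\<close>.\<close>

definition is_graph_direct_image ::
  "('a::topological_space) cmfd \<Rightarrow> ('a, 'm) msheaf \<Rightarrow> ('a \<Rightarrow> complex) \<Rightarrow>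
   ('a \<times> complex, nat \<Rightarrow> 'm) msheaf \<Rightarrow> bool" where
  "is_graph_direct_image X M f N \<longleftrightarrow> module_sheaf (D_ring (times_C X)) N \<and>
     (\<forall>W. open W \<longrightarrow> seq_group M (graph_pre f W) (sect N W) \<and>
        (\<forall>V. open V \<and> V \<subseteq> W \<longrightarrow> (\<forall>m\<in>seq_sec M (graph_pre f W).
           restr N W V m = (\<lambda>j. restr M (graph_pre f W) (graph_pre f V) (m j)))) \<and>
        (\<forall>h\<in>hol_sec (times_C X) W. \<forall>m\<in>carrier (sect M (graph_pre f W)).
           mul_op (times_C X) W h \<odot>\<^bsub>sect N W\<^esub> delta \<zero>\<^bsub>sect M (graph_pre f W)\<^esub> m =
             delta \<zero>\<^bsub>sect M (graph_pre f W)\<^esub>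
               (mul_op X (graph_pre f W) (\<lambda>x. h (x, f x)) \<odot>\<^bsub>sect M (graph_pre f W)\<^esub> m)) \<and>
        (\<forall>m\<in>seq_sec M (graph_pre f W).
           dt_op X W \<odot>\<^bsub>sect N W\<^esub> m = shift \<zero>\<^bsub>sect M (graph_pre f W)\<^esub> m)) \<and>
     (\<forall>U. open U \<longrightarrow> (\<forall>\<xi>\<in>vector_fields X U. \<forall>m\<in>carrier (sect M U).
        lift_op X U \<xi> \<odot>\<^bsub>sect N (U \<times> UNIV)\<^esub> delta \<zero>\<^bsub>sect M U\<^esub> m =
          (\<lambda>j. if j = 0 then \<xi> \<odot>\<^bsub>sect M U\<^esub> m
               else if j = 1 then \<ominus>\<^bsub>sect M U\<^esub> (mul_op X U (\<xi> U (fres U f)) \<odot>\<^bsub>sect M U\<^esub> m)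
               else \<zero>\<^bsub>sect M U\<^esub>)))"

text \<open>The action of \<open>-\<partial>\<^sub>t t\<close>.\<close>

definition minus_dt_t ::
  "('a::topological_space) cmfd \<Rightarrow> ('a \<times> complex, 'n) msheaf \<Rightarrow> ('a \<times> complex) set \<Rightarrow> 'n \<Rightarrow> 'n" where
  "minus_dt_t X N W u =
     \<ominus>\<^bsub>sect N W\<^esub> (dt_op X W \<odot>\<^bsub>sect N W\<^esub> (t_op X W \<odot>\<^bsub>sect N W\<^esub> u))"


section \<open>The Kashiwara-Malgrange filtration along \<open>t = 0\<close>\<close>

text \<open>Sections of the \<open>j\<close>-th power of the ideal of \<open>t = 0\<close>; the structure sheaf for \<open>j \<le> 0\<close>.\<close>

definition t_ideal_power ::
  "('a::topological_space) cmfd \<Rightarrow> int \<Rightarrow> ('a \<times> complex) set \<Rightarrow> ('a \<times> complex \<Rightarrow> complex) set" where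
  "t_ideal_power X j V = {(\<lambda>p. snd p ^ nat j * h p) | h. h \<in> hol_sec (times_C X) V}"

definition VD_sec ::
  "('a::topological_space) cmfd \<Rightarrow> int \<Rightarrow> ('a \<times> complex) set \<Rightarrow> ('a \<times> complex) dop set" where
  "VD_sec X k W = {P \<in> D_sec (times_C X) W. \<forall>V j. open V \<and> V \<subseteq> W \<longrightarrow>
     (\<forall>g\<in>t_ideal_power X j V. P V g \<in> t_ideal_power X (j + k) V)}"

definition V0D_ring ::
  "('a::topological_space) cmfd \<Rightarrow> ('a \<times> complex) set \<Rightarrow> ('a \<times> complex) dop ring" where
  "V0D_ring X = op_ring (times_C X) (VD_sec X 0)"

definition V_greater ::
  "('a \<times> complex, 'n) msheaf \<Rightarrow> (complex \<Rightarrow> ('a::topological_space \<times> complex) set \<Rightarrow> 'n set) \<Rightarrow>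
   complex \<Rightarrow> ('a \<times> complex) set \<Rightarrow> 'n set" where
  "V_greater N V \<gamma> W = {u \<in> carrier (sect N W).
     \<forall>p\<in>W. \<exists>T \<delta>. open T \<and> p \<in> T \<and> T \<subseteq> W \<and> clex_less \<gamma> \<delta> \<and> restr N W T u \<in> V \<delta> T}"

text \<open>In the last clause, jumps contained in \<open>A + \<int>\<close> means that the filtration is constant between
  indices \<open>\<gamma> \<le> \<delta>\<close> such that no element of \<open>A + \<int>\<close> lies in the half-open interval from \<open>\<gamma>\<close>
  (included) to \<open>\<delta>\<close> (excluded). As the lexicographic order is not complete, vanishing of the graded
  pieces outside \<open>A + \<int>\<close> would not suffice.\<close>

definition is_C_filtration ::
  "('a::topological_space \<times> complex, 'n) msheaf \<Rightarrow>
   (complex \<Rightarrow> ('a \<times> complex) set \<Rightarrow> 'n set) \<Rightarrow> bool" where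
  "is_C_filtration N V \<longleftrightarrow>
     (\<forall>\<gamma> \<delta> W. open W \<and> clex_le \<gamma> \<delta> \<longrightarrow> V \<delta> W \<subseteq> V \<gamma> W) \<and>
     (\<forall>W. open W \<longrightarrow> (\<forall>u\<in>carrier (sect N W). \<forall>p\<in>W. \<exists>T \<gamma>.
        open T \<and> p \<in> T \<and> T \<subseteq> W \<and> restr N W T u \<in> V \<gamma> T)) \<and>
     (\<forall>\<gamma> W. open W \<longrightarrow> V \<gamma> W = (\<Inter>\<delta>\<in>{\<delta>. clex_less \<delta> \<gamma>}. V \<delta> W)) \<and>
     (\<forall>p. \<exists>T A. open T \<and> p \<in> T \<and> finite A \<and>
        (\<forall>\<gamma> \<delta>. clex_le \<gamma> \<delta> \<and>
           (\<forall>a\<in>A. \<forall>k::int. \<not> (clex_le \<gamma> (a + of_int k) \<and> clex_less (a + of_int k) \<delta>)) \<longrightarrow>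
           (\<forall>W. open W \<and> W \<subseteq> T \<longrightarrow> V \<gamma> W = V \<delta> W)))"

text \<open>Good over \<open>V\<^sup>\<bullet>D\<close>: compatible with the action, and locally generated from a single index in either
  direction.\<close>

definition is_V_good ::
  "('a::topological_space) cmfd \<Rightarrow> ('a \<times> complex, 'n) msheaf \<Rightarrow>
   (complex \<Rightarrow> ('a \<times> complex) set \<Rightarrow> 'n set) \<Rightarrow> bool" where
  "is_V_good X N V \<longleftrightarrow>
     (\<forall>\<gamma> k W. open W \<longrightarrow>
        (\<forall>P\<in>VD_sec X k W. \<forall>u\<in>V \<gamma> W. P \<odot>\<^bsub>sect N W\<^esub> u \<in> V (\<gamma> + of_int k) W)) \<and>
     (\<forall>\<gamma> p. \<exists>T (k0::nat). open T \<and> p \<in> T \<and>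
        (\<forall>(k::nat) W. open W \<and> W \<subseteq> T \<longrightarrow>
           V (\<gamma> + of_nat k0 + of_nat k) W
             \<subseteq> prod_sheaf (VD_sec X (int k)) N (V (\<gamma> + of_nat k0)) W \<and>
           V (\<gamma> - of_nat k0 - of_nat k) W
             \<subseteq> prod_sheaf (VD_sec X (- int k)) N (V (\<gamma> - of_nat k0)) W))"

definition is_KM_filtration ::
  "('a::topological_space) cmfd \<Rightarrow> ('a \<times> complex, 'n) msheaf \<Rightarrow>
   (complex \<Rightarrow> ('a \<times> complex) set \<Rightarrow> 'n set) \<Rightarrow> bool" where
  "is_KM_filtration X N V \<longleftrightarrow>
     (\<forall>\<gamma>. submodule_sheaf (V0D_ring X) N (V \<gamma>) UNIV \<and> coherent (V0D_ring X) N (V \<gamma>) UNIV) \<and>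
     is_C_filtration N V \<and> is_V_good X N V \<and>
     (\<forall>\<gamma> p. \<exists>T (\<nu>::nat). open T \<and> p \<in> T \<and> (\<forall>W. open W \<and> W \<subseteq> T \<longrightarrow> (\<forall>u\<in>V \<gamma> W.
        ((\<lambda>v. minus_dt_t X N W v \<oplus>\<^bsub>sect N W\<^esub>
              mul_op (times_C X) W (fres W (\<lambda>q. \<gamma>)) \<odot>\<^bsub>sect N W\<^esub> v) ^^ \<nu>) u \<in> V_greater N V \<gamma> W)))"


section \<open>The sheaves and maps of the exact sequence\<close>

text \<open>\<open>V^\<beta>\<close> as a sheaf of \<open>D\<^sub>X[s]\<close>-modules on \<open>X\<close>. As \<open>N\<close> is supported on the graph of \<open>f\<close>, pulling it
  back to \<open>X\<close> along the graph embedding is the same as taking sections over the sets \<open>U \<times> C\<close>.\<close>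

definition V_on_X ::
  "('a::topological_space) cmfd \<Rightarrow> ('a \<times> complex, 'n) msheaf \<Rightarrow>
   (complex \<Rightarrow> ('a \<times> complex) set \<Rightarrow> 'n set) \<Rightarrow> complex \<Rightarrow> ('a, 'n) smsheaf" where
  "V_on_X X N V \<beta> =
     \<lparr> sect = (\<lambda>U. \<lparr> carrier = V \<beta> (U \<times> UNIV), mult = undefined, one = undefined,
         zero = \<zero>\<^bsub>sect N (U \<times> UNIV)\<^esub>, add = (\<lambda>u v. u \<oplus>\<^bsub>sect N (U \<times> UNIV)\<^esub> v),
         smult = (\<lambda>P u. lift_op X U P \<odot>\<^bsub>sect N (U \<times> UNIV)\<^esub> u) \<rparr>),
       restr = (\<lambda>U U'. restr N (U \<times> UNIV) (U' \<times> UNIV)),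
       s_act = (\<lambda>U. minus_dt_t X N (U \<times> UNIV)) \<rparr>"

text \<open>The identification of \<open>M[s] f^s\<close> with the direct image,
  \<open>\<Sum>j. m j s^j f^s \<mapsto> \<Sum>j. m j \<otimes> (-\<partial>\<^sub>t t)^j\<close>, where \<open>m \<otimes> (-\<partial>\<^sub>t t)^j\<close> is \<open>(-\<partial>\<^sub>t t)^j\<close> applied to \<open>m \<otimes> 1\<close>. The
  sum being only locally finite, its value is characterised by its restrictions to the open sets on
  which it is finite.\<close>

definition graph_ident ::
  "('a::topological_space) cmfd \<Rightarrow> ('a, 'm) msheaf \<Rightarrow> ('a \<times> complex, nat \<Rightarrow> 'm) msheaf \<Rightarrow>
   'a set \<Rightarrow> (nat \<Rightarrow> 'm) \<Rightarrow> nat \<Rightarrow> 'm" where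
  "graph_ident X M N U m = (THE u. u \<in> carrier (sect N (U \<times> UNIV)) \<and>
     (\<forall>V d. open V \<and> V \<subseteq> U \<and> (\<forall>j\<ge>d. restr M U V (m j) = \<zero>\<^bsub>sect M V\<^esub>) \<longrightarrow>
        restr N (U \<times> UNIV) (V \<times> UNIV) u =
          (\<Oplus>\<^bsub>sect N (V \<times> UNIV)\<^esub>j\<in>{..<d}.
             (minus_dt_t X N (V \<times> UNIV) ^^ j) (delta \<zero>\<^bsub>sect M V\<^esub> (restr M U V (m j))))))"

definition ev ::
  "('a::topological_space) cmfd \<Rightarrow> ('a, 'm) msheaf \<Rightarrow> ('a, nat \<Rightarrow> 'm) smsheaf \<Rightarrow>
   ('a \<times> complex, nat \<Rightarrow> 'm) msheaf \<Rightarrow> complex \<Rightarrow> 'a set \<Rightarrow> (nat \<Rightarrow> 'm) \<Rightarrow> (nat \<Rightarrow> 'm) set" where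
  "ev X M L N \<alpha> U u =
     (s_plus X \<alpha> L U ` carrier (sect L U)) +>\<^bsub>sect L U\<^esub>
       inv_into (carrier (sect L U)) (graph_ident X M N U) u"

end

theory Submission
  imports Defs "HOL-Complex_Analysis.Cauchy_Integral_Formula"
begin

text \<open>The point is that \<open>s + \<alpha>\<close> is invertible on \<open>\<iota>\<^sub>+M / V\<^sup>\<beta>\<close>. On \<open>gr\<^sub>V\<^sup>\<gamma>\<close> the
  operator \<open>s + \<gamma>\<close> is nilpotent and differs from \<open>s + \<alpha>\<close> by a constant, nonzero for \<open>\<gamma> \<noteq> \<alpha>\<close>, in
  which case \<open>s + \<alpha>\<close> is bijective there; this applies to all \<open>\<gamma> < \<beta>\<close>, because
  \<open>\<beta> \<le> \<alpha>\<close>. Near a point the filtration jumps only in \<open>A + \<int>\<close> with \<open>A\<close> finite, and between two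
  indices there are finitely many elements of \<open>A + \<int>\<close>. A section lies locally in some \<open>V\<^sup>\<gamma>\<close>, and
  climbing from \<open>\<gamma>\<close> to \<open>\<beta>\<close> one jump at a time yields two facts: if \<open>(s + \<alpha>) w\<close> is in \<open>V\<^sup>\<beta>\<close>,
  then so is \<open>w\<close> (\<open>climb_kernel\<close>, \<open>kernel_in_V\<close>), and locally every section of \<open>\<iota>\<^sub>+M\<close> is
  the sum of some \<open>(s + \<alpha>) y\<close> and a section of \<open>V\<^sup>\<beta>\<close> (\<open>climb_cokernel\<close>, \<open>cokernel_from_V\<close>).
  Hence \<open>V\<^sup>\<beta> / (s + \<alpha>) V\<^sup>\<beta> = \<iota>\<^sub>+M / (s + \<alpha>) \<iota>\<^sub>+M\<close>. The right-hand side is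
  \<open>M[s] f\<^sup>s / (s + \<alpha>) M[s] f\<^sup>s\<close>, and \<open>s + \<alpha>\<close> is injective because multiplication by \<open>s\<close> shifts
  the coefficients of a polynomial in \<open>s\<close> (\<open>hL_tail_zero\<close>).

  Two ingredients make this precise for sheaves. The first is the isomorphism
  \<open>M[s] f\<^sup>s \<cong> \<iota>\<^sub>+M\<close>. On \<open>\<iota>\<^sub>+M\<close> the operator \<open>t\<close> multiplies the top coefficient in
  \<open>\<partial>\<^sub>t\<close> by \<open>f\<close>, so \<open>s = -\<partial>\<^sub>t t\<close> raises the degree by one and multiplies the top coefficient by
  \<open>-f\<close>. As \<open>f\<close> acts bijectively, every element of bounded degree can be written in exactly one way
  as \<open>\<Sum>j. s\<^sup>j (m\<^sub>j \<otimes> 1)\<close>, found by Horner's scheme (\<open>horner_exists\<close>, \<open>horner_unique\<close>); these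
  local descriptions are glued (\<open>ident_bij\<close>). Linearity over \<open>D\<^sub>X\<close> (\<open>ident_smult\<close>) is checked
  on functions and vector fields applied to \<open>m \<otimes> 1\<close> and propagated by the fact that operators in
  the variables of \<open>X\<close> commute with \<open>\<partial>\<^sub>t\<close> and \<open>t\<close>. In order that such an operator act on
  functions of \<open>(x, t)\<close>, its result must be holomorphic in both variables; this and the commutation
  rest on the fact that partial derivatives of holomorphic functions are holomorphic and commute
  (\<open>hol_on_partial_deriv\<close>, \<open>partial_deriv_commute\<close>, \<open>lift_op_local\<close>), which follows from
  Cauchy's formula.

  The second is that the presheaf quotient by \<open>s + \<alpha>\<close> is a sheaf. Division with remainder by the
  monic polynomial \<open>s + \<alpha>\<close> shows that each class has exactly one representative of degree 0
  (\<open>normal_form\<close>), and a quotient with unique normal forms inherits gluing from the sheaf itself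
  (\<open>normal_form_quotient\<close>).\<close>

section \<open>Partial derivatives of holomorphic functions of several variables\<close>

text \<open>The integrand of Cauchy's formula for the derivative at \<open>w\<close>, over the
  circle of radius \<open>r\<close> around \<open>z\<close> and pulled back to \<open>[0,
  1]\<close>; the factor \<open>1 / (2 \<pi> \<i>)\<close> has been cancelled against the derivative
  of the circle.\<close>

definition circ_kernel :: "complex \<Rightarrow> real \<Rightarrow> complex \<Rightarrow> real \<Rightarrow> complex" where
  "circ_kernel z r w x = of_real r * exp (2 * of_real pi * \<i> * of_real x) / (circlepath z r x - w)\<^sup>2"

lemma circlepath_in_sphere: "0 \<le> r \<Longrightarrow> 0 \<le> x \<Longrightarrow> x \<le> 1 \<Longrightarrow> dist z (circlepath z r x) = r"
  using path_image_circlepath_nonneg[of r z] unfolding path_image_def sphere_def by force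

lemma circlepath_neq_of_ball: "w \<in> ball z r \<Longrightarrow> 0 \<le> x \<Longrightarrow> x \<le> 1 \<Longrightarrow> circlepath z r x \<noteq> w"
  using circlepath_in_sphere[of r x z] zero_le_dist[of z w] by auto

lemma circlepath_in_cball: "w \<in> ball z r \<Longrightarrow> 0 \<le> x \<Longrightarrow> x \<le> 1 \<Longrightarrow> circlepath z r x \<in> cball z r"
  using circlepath_in_sphere[of r x z] zero_le_dist[of z w] by auto

lemma deriv_eq_circle_integral:
  assumes "continuous_on (cball z r) g" "g holomorphic_on ball z r" "w \<in> ball z r"
  shows "deriv g w = integral (cbox 0 1) (\<lambda>x. g (circlepath z r x) * circ_kernel z r w x)"
proof -
  have "(2 * pi * \<i>) * deriv g w = contour_integral (circlepath z r) (\<lambda>u. g u / (u - w)^2)"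
    using Cauchy_contour_integral_circlepath_2[OF assms] by simp
  also have "\<dots> = integral {0..1} (\<lambda>x. (2 * pi * \<i>) * (g (circlepath z r x) * circ_kernel z r w x))"
    unfolding contour_integral_integral vector_derivative_circlepath circ_kernel_def
    by (intro integral_cong) (simp add: field_simps)
  also have "\<dots> = (2 * pi * \<i>) * integral {0..1} (\<lambda>x. g (circlepath z r x) * circ_kernel z r w x)"
    by simp
  finally show ?thesis by simp
qed

lemma continuous_on_circ_kernel:
  "continuous_on (ball z r \<times> cbox 0 1) (\<lambda>p. circ_kernel z r (fst p) (snd p))"
  unfolding circ_kernel_def circlepath
  by (intro continuous_intros) (use circlepath_neq_of_ball[of _ z r] in \<open>auto simp: circlepath\<close>)

text \<open>Cauchy's formula writes the derivative as an integral over a fixed circle, which depends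
  continuously on parameters.\<close>

lemma continuous_on_deriv_param:
  fixes F :: "'p::topological_space \<Rightarrow> complex \<Rightarrow> complex"
  assumes cont: "continuous_on (N \<times> cball z r) (\<lambda>q. F (fst q) (snd q))"
    and hol: "\<And>p. p \<in> N \<Longrightarrow> F p holomorphic_on ball z r"
  shows "continuous_on (N \<times> ball z r) (\<lambda>q. deriv (F (fst q)) (snd q))"
proof -
  have eq: "deriv (F (fst q)) (snd q) =
      integral (cbox 0 1) (\<lambda>x. F (fst q) (circlepath z r x) * circ_kernel z r (snd q) x)"
    if q: "q \<in> N \<times> ball z r" for q
  proof (rule deriv_eq_circle_integral)
    have "continuous_on (cball z r) ((\<lambda>q. F (fst q) (snd q)) \<circ> (\<lambda>w. (fst q, w)))"
      by (rule continuous_on_compose, intro continuous_intros)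
        (rule continuous_on_subset[OF cont], use q in auto)
    then show "continuous_on (cball z r) (F (fst q))" by (simp add: o_def)
  qed (use q hol in auto)
  have mem: "circlepath z r x \<in> cball z r" if "0 \<le> x" "x \<le> 1" "w \<in> ball z r" for x w
    using circlepath_in_cball that by blast
  have c1: "continuous_on ((N \<times> ball z r) \<times> cbox 0 1)
     ((\<lambda>q. F (fst q) (snd q)) \<circ> (\<lambda>q. (fst (fst q), circlepath z r (snd q))))"
    apply (rule continuous_on_compose)
    subgoal unfolding circlepath by (intro continuous_intros)
    subgoal by (rule continuous_on_subset[OF cont]) (use mem in auto)
    done
  have c2: "continuous_on ((N \<times> ball z r) \<times> cbox 0 1)
     ((\<lambda>p. circ_kernel z r (fst p) (snd p)) \<circ> (\<lambda>q. (snd (fst q), snd q)))"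
    by (rule continuous_on_compose, intro continuous_intros)
       (rule continuous_on_subset[OF continuous_on_circ_kernel], auto)
  have "continuous_on (N \<times> ball z r)
     (\<lambda>q. integral (cbox 0 1) (\<lambda>x. F (fst q) (circlepath z r x) * circ_kernel z r (snd q) x))"
    apply (rule integral_continuous_on_param)
    using continuous_on_mult[OF c1 c2] by (simp add: o_def case_prod_unfold)
  then show ?thesis using eq by (simp cong: continuous_on_cong)
qed

text \<open>Holomorphy of several variables is continuity together with separate holomorphy, and every
  question about two of the variables is one about a function of this kind.\<close>

definition bihol :: "complex \<Rightarrow> complex \<Rightarrow> real \<Rightarrow> (complex \<Rightarrow> complex \<Rightarrow> complex) \<Rightarrow> bool" where
  "bihol a b R F \<longleftrightarrow> continuous_on (ball a R \<times> ball b R) (\<lambda>q. F (fst q) (snd q)) \<and>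
     (\<forall>u\<in>ball a R. F u holomorphic_on ball b R) \<and>
     (\<forall>w\<in>ball b R. (\<lambda>u. F u w) holomorphic_on ball a R)"

lemma bihol_swap: "bihol a b R F \<Longrightarrow> bihol b a R (\<lambda>w u. F u w)"
proof -
  assume b: "bihol a b R F"
  have "continuous_on (ball b R \<times> ball a R) ((\<lambda>q. F (fst q) (snd q)) \<circ> prod.swap)"
    using b unfolding bihol_def
    by (intro continuous_on_compose continuous_on_swap) (simp add: product_swap)
  then show ?thesis using b unfolding bihol_def by (simp add: o_def)
qed

lemma bihol_continuous_deriv:
  assumes F: "bihol a b R F"
  shows "continuous_on (ball a R \<times> ball b R) (\<lambda>q. deriv (F (fst q)) (snd q))"
proof -
  have "continuous_on (ball a R \<times> ball b r) (\<lambda>q. deriv (F (fst q)) (snd q))" if "r < R" for r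
  proof (rule continuous_on_deriv_param)
    show "continuous_on (ball a R \<times> cball b r) (\<lambda>q. F (fst q) (snd q))"
      using F that unfolding bihol_def by (elim conjE continuous_on_subset) auto
    show "F p holomorphic_on ball b r" if "p \<in> ball a R" for p
      using F that \<open>r < R\<close> unfolding bihol_def
      by (meson holomorphic_on_subset less_imp_le subset_ball)
  qed
  then have "continuous_on (\<Union>r\<in>{..<R}. ball a R \<times> ball b r) (\<lambda>q. deriv (F (fst q)) (snd q))"
    by (intro continuous_on_open_UN) (auto intro: open_Times)
  moreover have "(\<Union>r\<in>{..<R}. ball a R \<times> ball b r) = ball a R \<times> ball b R"
  proof (intro equalityI subsetI)
    fix q assume q: "q \<in> ball a R \<times> ball b R"
    then obtain r where "dist b (snd q) < r" "r < R" using dense[of "dist b (snd q)" R] by auto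
    with q show "q \<in> (\<Union>r\<in>{..<R}. ball a R \<times> ball b r)" by (cases q) auto
  qed auto
  ultimately show ?thesis by simp
qed

text \<open>Differentiation under the integral sign in Cauchy's formula for the derivative in the
  second variable. The integral contains the derivative in the first variable, whose joint
  continuity is what the Leibniz rule asks for.\<close>

lemma bihol_integral_derivative:
  assumes F: "bihol a b R F" and w: "w \<in> ball b r" and r: "r < R" and u: "u \<in> ball a R"
  shows "((\<lambda>u. deriv (F u) w) has_field_derivative
     integral (cbox 0 1) (\<lambda>x. deriv (\<lambda>u. F u (circlepath b r x)) u * circ_kernel b r w x)) (at u)"
proof -
  have mem: "circlepath b r x \<in> ball b R" if "0 \<le> x" "x \<le> 1" for x
    using circlepath_in_cball[OF w that] r by auto
  have k: "continuous_on (cbox 0 1) (\<lambda>x. circ_kernel b r w x)"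
  proof -
    have "continuous_on (cbox 0 1) ((\<lambda>p. circ_kernel b r (fst p) (snd p)) \<circ> (\<lambda>x. (w, x)))"
      by (rule continuous_on_compose, intro continuous_intros)
        (rule continuous_on_subset[OF continuous_on_circ_kernel], use w in auto)
    then show ?thesis by (simp add: o_def)
  qed
  have cF: "continuous_on (ball a R \<times> ball b R) (\<lambda>q. F (fst q) (snd q))"
    using F by (simp add: bihol_def)
  have "((\<lambda>u. integral (cbox 0 1) (\<lambda>x. F u (circlepath b r x) * circ_kernel b r w x)) has_field_derivative
     integral (cbox 0 1) (\<lambda>x. deriv (\<lambda>u. F u (circlepath b r x)) u * circ_kernel b r w x)) (at u within ball a R)"
  proof (rule leibniz_rule_field_derivative)
    fix u x assume ux: "u \<in> ball a R" "x \<in> cbox 0 (1::real)"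
    have "(\<lambda>u. F u (circlepath b r x)) holomorphic_on ball a R"
      using F mem[of x] ux by (simp add: bihol_def)
    then have "(\<lambda>u. F u (circlepath b r x)) field_differentiable at u"
      using ux by (intro holomorphic_on_imp_differentiable_at[of _ "ball a R"]) auto
    then show "((\<lambda>u. F u (circlepath b r x) * circ_kernel b r w x) has_field_derivative
        deriv (\<lambda>u. F u (circlepath b r x)) u * circ_kernel b r w x) (at u within ball a R)"
      by (intro DERIV_cmult_right) (simp add: DERIV_deriv_iff_field_differentiable has_field_derivative_at_within)
  next
    fix u assume u: "u \<in> ball a R"
    have "continuous_on (cbox 0 1) ((\<lambda>q. F (fst q) (snd q)) \<circ> (\<lambda>x. (u, circlepath b r x)))"
      apply (rule continuous_on_compose)
      subgoal unfolding circlepath by (intro continuous_intros)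
      subgoal by (rule continuous_on_subset[OF cF]) (use u mem in auto)
      done
    then show "(\<lambda>x. F u (circlepath b r x) * circ_kernel b r w x) integrable_on cbox 0 1"
      by (intro integrable_continuous continuous_on_mult k) (simp add: o_def)
  next
    have c1: "continuous_on (ball a R \<times> cbox 0 1)
      ((\<lambda>q. deriv (\<lambda>u. F u (fst q)) (snd q)) \<circ> (\<lambda>q. (circlepath b r (snd q), fst q)))"
      apply (rule continuous_on_compose)
      subgoal unfolding circlepath by (intro continuous_intros)
      subgoal by (rule continuous_on_subset[OF bihol_continuous_deriv[OF bihol_swap[OF F]]]) (use mem in auto)
      done
    have c2: "continuous_on (ball a R \<times> cbox 0 1) (circ_kernel b r w \<circ> snd)"
      by (rule continuous_on_compose, intro continuous_intros) (rule continuous_on_subset[OF k], auto)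
    show "continuous_on (ball a R \<times> cbox 0 1)
      (\<lambda>(u, x). deriv (\<lambda>u. F u (circlepath b r x)) u * circ_kernel b r w x)"
      using continuous_on_mult[OF c1 c2] by (simp only: o_def case_prod_unfold fst_conv snd_conv)
  qed (use u in auto)
  then have *: "((\<lambda>u. integral (cbox 0 1) (\<lambda>x. F u (circlepath b r x) * circ_kernel b r w x)) has_field_derivative
     integral (cbox 0 1) (\<lambda>x. deriv (\<lambda>u. F u (circlepath b r x)) u * circ_kernel b r w x)) (at u)"
    using u by (simp only: at_within_open[OF u open_ball])
  show ?thesis
  proof (rule has_field_derivative_transform_within_open[OF *])
    fix u assume u: "u \<in> ball a R"
    have h: "F u holomorphic_on ball b R" using F u by (simp add: bihol_def)
    show "integral (cbox 0 1) (\<lambda>x. F u (circlepath b r x) * circ_kernel b r w x) = deriv (F u) w"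
      using w r by (intro deriv_eq_circle_integral[symmetric] holomorphic_on_imp_continuous_on
        holomorphic_on_subset[OF h]) auto
  qed (use u in auto)
qed

text \<open>With the roles of the variables exchanged, \<open>bihol_integral_derivative\<close> says
  that the derivative in the first variable is holomorphic in the second. Cauchy's formula therefore
  applies to it and evaluates the integral as the mixed derivative.\<close>

lemma bihol_mixed_partials:
  assumes F: "bihol a b R F" and w: "w \<in> ball b R" and u: "u \<in> ball a R"
  shows "((\<lambda>u. deriv (F u) w) has_field_derivative deriv (\<lambda>w. deriv (\<lambda>u. F u w) u) w) (at u)"
proof -
  obtain r where r: "r < R" "w \<in> ball b r" using w dense[of "dist b w" R] by auto
  have H: "(\<lambda>w. deriv (\<lambda>u. F u w) u) holomorphic_on ball b R"
  proof (rule holomorphic_onI)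
    fix w assume w: "w \<in> ball b R"
    obtain r' where "r' < R" "u \<in> ball a r'" using u dense[of "dist a u" R] by auto
    then show "(\<lambda>w. deriv (\<lambda>u. F u w) u) field_differentiable at w within ball b R"
      using bihol_integral_derivative[OF bihol_swap[OF F], of u r' w] w
      by (auto simp: field_differentiable_def intro: has_field_derivative_at_within)
  qed
  have "deriv (\<lambda>w. deriv (\<lambda>u. F u w) u) w =
      integral (cbox 0 1) (\<lambda>x. deriv (\<lambda>u. F u (circlepath b r x)) u * circ_kernel b r w x)"
    using r by (intro deriv_eq_circle_integral holomorphic_on_imp_continuous_on holomorphic_on_subset[OF H]) auto
  with bihol_integral_derivative[OF F r(2,1) u] show ?thesis by simp
qed

definition partial_deriv :: "nat \<Rightarrow> ((nat \<Rightarrow> complex) \<Rightarrow> complex) \<Rightarrow> (nat \<Rightarrow> complex) \<Rightarrow> complex" where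
  "partial_deriv i g z = deriv (\<lambda>w. g (z(i := w))) (z i)"

lemma continuous_on_fun_upd2 [continuous_intros]:
  fixes f :: "'p::topological_space \<Rightarrow> nat \<Rightarrow> complex"
  assumes "continuous_on S f" "continuous_on S g"
  shows "continuous_on S (\<lambda>p. (f p)(i := g p))"
proof (rule continuous_on_coordinatewise_then_product)
  fix j show "continuous_on S (\<lambda>p. ((f p)(i := g p)) j)"
    using assms continuous_on_product_then_coordinatewise[OF assms(1), of j] by (cases "j = i") auto
qed

text \<open>The radius is the same for all points near \<open>z\<close>, so that Cauchy's formula
  can be used on one circle while the other coordinates vary.\<close>

lemma openin_cspace_update_nbhd:
  assumes G: "openin (top_of_set (cspace n)) G" and z: "z \<in> G" and i: "i < n"
  obtains r N where "r > 0" "open N" "z \<in> N" "\<And>y w. y \<in> N \<inter> G \<Longrightarrow> w \<in> ball (z i) r \<Longrightarrow> y(i := w) \<in> G"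
proof -
  obtain O' where O: "open O'" "G = cspace n \<inter> O'" using G by (auto simp: openin_open)
  have "continuous_on UNIV (\<lambda>q::(nat\<Rightarrow>complex)\<times>complex. (fst q)(i := snd q))"
    by (intro continuous_intros)
  then have "open ((\<lambda>q::(nat\<Rightarrow>complex)\<times>complex. (fst q)(i := snd q)) -` O')"
    using O(1) by (simp add: open_vimage)
  moreover have "(z, z i) \<in> (\<lambda>q. (fst q)(i := snd q)) -` O'" using z O by simp
  ultimately obtain N B where NB: "open N" "open B" "z \<in> N" "z i \<in> B"
    "N \<times> B \<subseteq> (\<lambda>q. (fst q)(i := snd q)) -` O'" by (rule open_prod_elim) auto
  then obtain r where r: "r > 0" "ball (z i) r \<subseteq> B" by (meson openE)
  have "y(i := w) \<in> G" if "y \<in> N \<inter> G" "w \<in> ball (z i) r" for y w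
  proof -
    have "(y, w) \<in> N \<times> B" using that r(2) by auto
    then have "y(i := w) \<in> O'" using NB(5) by fastforce
    then show ?thesis using that O(2) i by (auto simp: cspace_def)
  qed
  then show thesis using that r NB by blast
qed

lemma openin_cspace_update2:
  assumes G: "openin (top_of_set (cspace n)) G" and z: "z \<in> G" and i: "i < n" and k: "k < n"
  obtains R where "R > 0" "\<And>u w. u \<in> ball (z k) R \<Longrightarrow> w \<in> ball (z i) R \<Longrightarrow> z(k := u, i := w) \<in> G"
proof -
  obtain r N where r: "r > 0" "open N" "z \<in> N"
    "\<And>y w. y \<in> N \<inter> G \<Longrightarrow> w \<in> ball (z i) r \<Longrightarrow> y(i := w) \<in> G"
    using openin_cspace_update_nbhd[OF G z i] by blast
  have "openin (top_of_set (cspace n)) (G \<inter> N)" using G r(2) by (simp add: openin_Int_open)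
  then obtain r' N' where r': "r' > 0" "open N'" "z \<in> N'"
    "\<And>y w. y \<in> N' \<inter> (G \<inter> N) \<Longrightarrow> w \<in> ball (z k) r' \<Longrightarrow> y(k := w) \<in> G \<inter> N"
    using openin_cspace_update_nbhd[OF _ _ k, of "G \<inter> N" z] r(3) z by blast
  show thesis
    by (rule that[of "min r r'"]) (use r r' z in auto)
qed

lemma hol_on_bihol:
  assumes g: "hol_on n G g" and i: "i < n" and k: "k < n" and ik: "i \<noteq> k"
    and R: "\<And>u w. u \<in> ball (z k) R \<Longrightarrow> w \<in> ball (z i) R \<Longrightarrow> z(k := u, i := w) \<in> G"
  shows "bihol (z k) (z i) R (\<lambda>u w. g (z(k := u, i := w)))"
proof -
  have fd: "(\<lambda>v. g (y(j := v))) field_differentiable (at (y j))" if "y \<in> G" "j < n" for y j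
    using g that by (auto simp: hol_on_def)
  have "continuous_on (ball (z k) R \<times> ball (z i) R) (g \<circ> (\<lambda>q. z(k := fst q, i := snd q)))"
    apply (rule continuous_on_compose)
    subgoal by (intro continuous_intros)
    subgoal using g R by (auto simp: hol_on_def intro: continuous_on_subset)
    done
  moreover have "(\<lambda>w. g (z(k := u, i := w))) holomorphic_on ball (z i) R" if "u \<in> ball (z k) R" for u
    using fd[OF R[OF that] i] by (auto simp: holomorphic_on_def intro: field_differentiable_at_within)
  moreover have "(\<lambda>u. g (z(k := u, i := w))) holomorphic_on ball (z k) R" if w: "w \<in> ball (z i) R" for w
  proof -
    have "(\<lambda>v. g (z(k := v, i := w))) field_differentiable at u" if "u \<in> ball (z k) R" for u
    proof -
      have "z(k := u, i := w, k := v) = z(k := v, i := w)" for v using ik by (simp add: fun_eq_iff)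
      then show ?thesis using fd[OF R[OF that w] k] ik by simp
    qed
    then show ?thesis by (auto simp: holomorphic_on_def intro: field_differentiable_at_within)
  qed
  ultimately show ?thesis by (simp add: bihol_def o_def)
qed

lemma partial_deriv_continuous:
  assumes g: "hol_on n G g" and G: "openin (top_of_set (cspace n)) G" and i: "i < n"
  shows "continuous_on G (partial_deriv i g)"
  unfolding continuous_on_eq_continuous_within
proof
  fix z assume z: "z \<in> G"
  obtain r N where r: "r > 0" "open N" "z \<in> N"
    "\<And>y w. y \<in> N \<inter> G \<Longrightarrow> w \<in> ball (z i) r \<Longrightarrow> y(i := w) \<in> G"
    using openin_cspace_update_nbhd[OF G z i] by blast
  have rr: "y(i := w) \<in> G" if "y \<in> N \<inter> G" "w \<in> cball (z i) (r/2)" for y w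
    using r(4)[OF that(1)] that(2) r(1) by auto
  have "continuous_on ((N \<inter> G) \<times> ball (z i) (r/2)) (\<lambda>q. deriv (\<lambda>w. g ((fst q)(i := w))) (snd q))"
  proof (rule continuous_on_deriv_param)
    have "continuous_on ((N \<inter> G) \<times> cball (z i) (r/2)) (g \<circ> (\<lambda>q. (fst q)(i := snd q)))"
      apply (rule continuous_on_compose)
      subgoal by (intro continuous_intros)
      subgoal using g rr by (auto simp: hol_on_def intro!: continuous_on_subset[of G g])
      done
    then show "continuous_on ((N \<inter> G) \<times> cball (z i) (r/2)) (\<lambda>q. g ((fst q)(i := snd q)))"
      by (simp add: o_def)
    fix p assume p: "p \<in> N \<inter> G"
    have "(\<lambda>w. g (p(i := w))) field_differentiable at w" if "w \<in> ball (z i) (r/2)" for w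
    proof -
      have "p(i := w) \<in> G" using rr[OF p, of w] that by auto
      then have "(\<lambda>v. g ((p(i := w))(i := v))) field_differentiable at ((p(i := w)) i)"
        using g i unfolding hol_on_def by blast
      then show ?thesis by simp
    qed
    then show "(\<lambda>w. g (p(i := w))) holomorphic_on ball (z i) (r/2)"
      by (auto simp: holomorphic_on_def intro: field_differentiable_at_within)
  qed
  moreover define S where "S = G \<inter> (N \<inter> (\<lambda>y. y i) -` ball (z i) (r/2))"
  ultimately have "continuous_on S
     ((\<lambda>q. deriv (\<lambda>w. g ((fst q)(i := w))) (snd q)) \<circ> (\<lambda>y. (y, y i)))"
    apply (intro continuous_on_compose continuous_on_Pair continuous_on_id
        continuous_on_subset[OF continuous_on_product_coordinates])
    by (auto simp: S_def elim!: continuous_on_subset)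
  then have "continuous_on S (partial_deriv i g)" by (simp add: o_def partial_deriv_def[abs_def])
  moreover have z': "z \<in> S" using z r by (simp add: S_def)
  ultimately have "continuous (at z within S) (partial_deriv i g)"
    by (simp add: continuous_on_eq_continuous_within)
  moreover have "open (N \<inter> (\<lambda>y. y i) -` ball (z i) (r/2))"
    using r(2) by (intro open_Int open_vimage) (auto intro: continuous_on_product_coordinates)
  then have "at z within S = at z within G" using z' unfolding S_def
    by (intro at_within_nhd[of z "N \<inter> (\<lambda>y. y i) -` ball (z i) (r/2)"]) auto
  ultimately show "continuous (at z within G) (partial_deriv i g)"
    by (simp add: continuous_within)
qed

lemma partial_deriv_commute:
  assumes g: "hol_on n G g" and G: "openin (top_of_set (cspace n)) G"
    and i: "i < n" and k: "k < n" and ik: "i \<noteq> k" and z: "z \<in> G"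
  shows "((\<lambda>u. partial_deriv i g (z(k := u))) has_field_derivative
           partial_deriv i (partial_deriv k g) z) (at (z k))"
proof -
  obtain R where R: "R > 0" "\<And>u w. u \<in> ball (z k) R \<Longrightarrow> w \<in> ball (z i) R \<Longrightarrow> z(k := u, i := w) \<in> G"
    using openin_cspace_update2[OF G z i k] by blast
  have "bihol (z k) (z i) R (\<lambda>u w. g (z(k := u, i := w)))"
    by (rule hol_on_bihol[OF g i k ik R(2)])
  from bihol_mixed_partials[OF this, of "z i" "z k"] R(1) ik fun_upd_twist[OF ik, of z]
  show ?thesis by (simp add: partial_deriv_def[abs_def])
qed

text \<open>In the direction of the derivative itself this is the one-variable theorem on
  derivatives of holomorphic functions; in the other directions, the mixed derivative
  exists.\<close>

lemma hol_on_partial_deriv: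
  assumes g: "hol_on n G g" and G: "openin (top_of_set (cspace n)) G" and i: "i < n"
  shows "hol_on n G (partial_deriv i g)"
  unfolding hol_on_def
proof (intro conjI ballI allI impI)
  show "continuous_on G (partial_deriv i g)" by (rule partial_deriv_continuous[OF assms])
  fix z k assume z: "z \<in> G" and k: "k < n"
  show "(\<lambda>w. partial_deriv i g (z(k := w))) field_differentiable at (z k)"
  proof (cases "i = k")
    case False
    then show ?thesis using partial_deriv_commute[OF g G i k False z] by (auto simp: field_differentiable_def)
  next
    case True
    obtain r N where r: "r > 0" "open N" "z \<in> N"
      "\<And>y w. y \<in> N \<inter> G \<Longrightarrow> w \<in> ball (z i) r \<Longrightarrow> y(i := w) \<in> G"
      using openin_cspace_update_nbhd[OF G z i] by blast
    have "(\<lambda>w. g (z(i := w))) field_differentiable at w" if "w \<in> ball (z i) r" for w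
    proof -
      have "z(i := w) \<in> G" using r(4)[of z w] r(3) z that by auto
      then have "(\<lambda>v. g ((z(i := w))(i := v))) field_differentiable at ((z(i := w)) i)"
        using g i unfolding hol_on_def by blast
      then show ?thesis by simp
    qed
    then have "(\<lambda>w. g (z(i := w))) holomorphic_on ball (z i) r"
      by (auto simp: holomorphic_on_def intro: field_differentiable_at_within)
    then have "deriv (\<lambda>w. g (z(i := w))) holomorphic_on ball (z i) r"
      by (intro holomorphic_deriv) auto
    then have "deriv (\<lambda>w. g (z(i := w))) field_differentiable at (z i)"
      using r(1) by (auto intro: holomorphic_on_imp_differentiable_at)
    then show ?thesis using True by (simp add: partial_deriv_def[abs_def])
  qed
qed


section \<open>Holomorphic functions on a charted space and on its product with the line\<close>

text \<open>The local computations use a covering by charts. They are carried out on any charted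
  space because they are needed both for a manifold and for its product with the line.\<close>

definition charted :: "('a::topological_space) cmfd \<Rightarrow> bool" where
  "charted X \<longleftrightarrow> (\<Union>c\<in>atlas X. fst c) = UNIV \<and>
     (\<forall>c\<in>atlas X. open (fst c) \<and> openin (top_of_set (cspace (cdim X))) (snd c ` fst c) \<and>
        (\<exists>\<psi>. homeomorphism (fst c) (snd c ` fst c) (snd c) \<psi>))"

lemma complex_manifold_charted: "complex_manifold X \<Longrightarrow> charted X"
  unfolding complex_manifold_def charted_def split_beta by blast

text \<open>The point whose \<open>i\<close>-th coordinate is \<open>w\<close> and whose other
  coordinates are those of \<open>x\<close>. It exists for \<open>w\<close> near the
  \<open>i\<close>-th coordinate of \<open>x\<close>; elsewhere the value is arbitrary, which is why
  the facts below hold eventually.\<close>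

definition coord_move :: "'a chart \<Rightarrow> nat \<Rightarrow> 'a \<Rightarrow> complex \<Rightarrow> 'a" where
  "coord_move c i x w = inv_into (fst c) (snd c) ((snd c x)(i := w))"

lemma coord_deriv_coord_move: "coord_deriv c i g x = deriv (\<lambda>w. g (coord_move c i x w)) (snd c x i)"
  by (simp add: coord_deriv_def coord_move_def)

text \<open>Holomorphy in a chart, stated for the function on the manifold itself: then two
  functions that agree on the manifold need not be transported to coordinates to be
  exchanged.\<close>

definition hol_in_chart :: "nat \<Rightarrow> 'a::topological_space chart \<Rightarrow> 'a set \<Rightarrow> ('a \<Rightarrow> complex) \<Rightarrow> bool" where
  "hol_in_chart n c V g \<longleftrightarrow> continuous_on (V \<inter> fst c) g \<and>
     (\<forall>x\<in>V \<inter> fst c. \<forall>i<n. (\<lambda>w. g (coord_move c i x w)) field_differentiable at (snd c x i))"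

context
  fixes X :: "('a::topological_space) cmfd" and c
  assumes X: "charted X" and c: "c \<in> atlas X"
begin

lemma chart_open: "open (fst c)"
  using X c by (simp add: charted_def)

lemma chart_homeo: "\<exists>\<psi>. homeomorphism (fst c) (snd c ` fst c) (snd c) \<psi>"
  using X c by (simp add: charted_def)

lemma chart_image_openin: "openin (top_of_set (cspace (cdim X))) (snd c ` fst c)"
  using X c by (simp add: charted_def)

lemma chart_inj: "inj_on (snd c) (fst c)"
proof -
  obtain \<psi> where "homeomorphism (fst c) (snd c ` fst c) (snd c) \<psi>" using chart_homeo by blast
  then show ?thesis by (intro inj_on_inverseI[of _ \<psi>]) (simp add: homeomorphism_def)
qed

lemma chart_inv [simp]: "x \<in> fst c \<Longrightarrow> inv_into (fst c) (snd c) (snd c x) = x"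
  using chart_inj by simp

lemma chart_continuous: "continuous_on (fst c) (snd c)"
  using chart_homeo by (auto simp: homeomorphism_def)

lemma chart_inv_continuous: "continuous_on (snd c ` fst c) (inv_into (fst c) (snd c))"
proof -
  obtain \<psi> where \<psi>: "homeomorphism (fst c) (snd c ` fst c) (snd c) \<psi>" using chart_homeo by blast
  then have "continuous_on (snd c ` fst c) \<psi>" by (simp add: homeomorphism_def)
  moreover have "inv_into (fst c) (snd c) z = \<psi> z" if "z \<in> snd c ` fst c" for z
    using \<psi> that by (auto simp: homeomorphism_def)
  ultimately show ?thesis by (simp cong: continuous_on_cong)
qed

lemma chart_image_open: 
  assumes "open V"
  shows "openin (top_of_set (cspace (cdim X))) (snd c ` (V \<inter> fst c))"
proof -
  obtain \<psi> where \<psi>: "homeomorphism (fst c) (snd c ` fst c) (snd c) \<psi>" using chart_homeo by blast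
  have "openin (top_of_set (fst c)) (V \<inter> fst c)" using assms by (auto simp: openin_open)
  from homeomorphism_imp_open_map[OF \<psi> this] show ?thesis
    using chart_image_openin openin_trans by blast
qed

lemma chart_cspace: "x \<in> fst c \<Longrightarrow> k \<ge> cdim X \<Longrightarrow> snd c x k = 0"
  using chart_image_openin openin_imp_subset by (fastforce simp: cspace_def)

lemma eventually_chart_update:
  assumes "open V" "x \<in> V \<inter> fst c" "i < cdim X"
  shows "eventually (\<lambda>w. (snd c x)(i := w) \<in> snd c ` (V \<inter> fst c)) (nhds (snd c x i))"
proof -
  have xi: "snd c x \<in> snd c ` (V \<inter> fst c)" using assms by blast
  show ?thesis
  proof (rule openin_cspace_update_nbhd[OF chart_image_open[OF assms(1)] xi assms(3)])
    fix r N
    assume r: "r > 0" "snd c x \<in> N" "\<And>y w. y \<in> N \<inter> snd c ` (V \<inter> fst c) \<Longrightarrow>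
      w \<in> ball (snd c x i) r \<Longrightarrow> y(i := w) \<in> snd c ` (V \<inter> fst c)"
    have "eventually (\<lambda>w. w \<in> ball (snd c x i) r) (nhds (snd c x i))"
      using r(1) by (intro eventually_nhds_in_open) auto
    then show ?thesis by eventually_elim (rule r(3)[OF IntI[OF r(2) xi]])
  qed
qed

lemma coord_move_image: "(snd c x)(i := w) \<in> snd c ` (V \<inter> fst c) \<Longrightarrow>
    coord_move c i x w \<in> V \<inter> fst c \<and> snd c (coord_move c i x w) = (snd c x)(i := w)"
  unfolding coord_move_def by (auto simp: image_iff f_inv_into_f)

lemma eventually_coord_move:
  assumes "open V" "x \<in> V \<inter> fst c" "i < cdim X"
  shows "eventually (\<lambda>w. coord_move c i x w \<in> V \<inter> fst c \<and> snd c (coord_move c i x w) = (snd c x)(i := w))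
    (nhds (snd c x i))"
  using eventually_chart_update[OF assms] by (rule eventually_mono) (rule coord_move_image)

lemma field_differentiable_coord_move_cong:
  assumes "open V" "x \<in> V \<inter> fst c" "i < cdim X" "\<And>y. y \<in> V \<inter> fst c \<Longrightarrow> g y = h y"
  shows "(\<lambda>w. g (coord_move c i x w)) field_differentiable at (snd c x i) \<longleftrightarrow>
         (\<lambda>w. h (coord_move c i x w)) field_differentiable at (snd c x i)"
proof -
  have "eventually (\<lambda>w. g (coord_move c i x w) = h (coord_move c i x w)) (nhds (snd c x i))"
    using eventually_coord_move[OF assms(1-3)] by eventually_elim (use assms(4) in blast)
  then show ?thesis unfolding field_differentiable_def
    by (intro ex_cong1 DERIV_cong_ev refl)
qed

lemma coord_deriv_cong:
  assumes "open V" "x \<in> V \<inter> fst c" "i < cdim X" "\<And>y. y \<in> V \<inter> fst c \<Longrightarrow> g y = h y"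
  shows "coord_deriv c i g x = coord_deriv c i h x"
proof -
  have "eventually (\<lambda>w. g (coord_move c i x w) = h (coord_move c i x w)) (nhds (snd c x i))"
    using eventually_coord_move[OF assms(1-3)] by eventually_elim (use assms(4) in blast)
  then show ?thesis unfolding coord_deriv_coord_move by (intro deriv_cong_ev refl)
qed

lemma hol_in_chart_cong:
  assumes "open V" "\<And>y. y \<in> V \<inter> fst c \<Longrightarrow> g y = h y"
  shows "hol_in_chart (cdim X) c V g \<longleftrightarrow> hol_in_chart (cdim X) c V h"
proof -
  have "continuous_on (V \<inter> fst c) g = continuous_on (V \<inter> fst c) h"
    using assms(2) by (intro continuous_on_cong) auto
  moreover have "(\<lambda>w. g (coord_move c i x w)) field_differentiable at (snd c x i) \<longleftrightarrow>
         (\<lambda>w. h (coord_move c i x w)) field_differentiable at (snd c x i)"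
    if "x \<in> V \<inter> fst c" "i < cdim X" for x i
    using assms that by (intro field_differentiable_coord_move_cong) auto
  ultimately show ?thesis unfolding hol_in_chart_def by auto
qed

text \<open>The chart is a homeomorphism, so continuity carries over, and moving a coordinate of a
  point is what updating its coordinate vector becomes on the manifold.\<close>

lemma hol_in_chart_iff_hol_on:
  assumes V: "open V"
  shows "hol_in_chart (cdim X) c V g \<longleftrightarrow>
    hol_on (cdim X) (snd c ` (V \<inter> fst c)) (\<lambda>z. g (inv_into (fst c) (snd c) z))"
proof -
  let ?i = "inv_into (fst c) (snd c)"
  have im: "?i ` (snd c ` (V \<inter> fst c)) = V \<inter> fst c" by (force simp: image_image)
  have "continuous_on (V \<inter> fst c) g \<longleftrightarrow> continuous_on (snd c ` (V \<inter> fst c)) (\<lambda>z. g (?i z))"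
  proof
    assume "continuous_on (V \<inter> fst c) g"
    then have "continuous_on (snd c ` (V \<inter> fst c)) (g \<circ> ?i)"
      by (intro continuous_on_compose continuous_on_subset[OF chart_inv_continuous]) (auto simp: im)
    then show "continuous_on (snd c ` (V \<inter> fst c)) (\<lambda>z. g (?i z))" by (simp add: o_def)
  next
    assume "continuous_on (snd c ` (V \<inter> fst c)) (\<lambda>z. g (?i z))"
    then have "continuous_on (V \<inter> fst c) ((\<lambda>z. g (?i z)) \<circ> snd c)"
      by (intro continuous_on_compose continuous_on_subset[OF chart_continuous]) auto
    then show "continuous_on (V \<inter> fst c) g"
      by (rule continuous_on_eq) auto
  qed
  then show ?thesis by (auto simp: hol_in_chart_def hol_on_def coord_move_def)
qed

lemma hol_in_chart_const: "hol_in_chart (cdim X) c V (\<lambda>_. a)"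
  by (auto simp: hol_in_chart_def)

lemma hol_in_chart_add: "hol_in_chart (cdim X) c V g \<Longrightarrow> hol_in_chart (cdim X) c V h \<Longrightarrow>
    hol_in_chart (cdim X) c V (\<lambda>x. g x + h x)"
  by (auto simp: hol_in_chart_def intro!: continuous_intros field_differentiable_add)

lemma hol_in_chart_mult: "hol_in_chart (cdim X) c V g \<Longrightarrow> hol_in_chart (cdim X) c V h \<Longrightarrow>
    hol_in_chart (cdim X) c V (\<lambda>x. g x * h x)"
  by (auto simp: hol_in_chart_def intro!: continuous_intros field_differentiable_mult)

lemma hol_in_chart_sum: "(\<And>i. i \<in> I \<Longrightarrow> hol_in_chart (cdim X) c V (g i)) \<Longrightarrow>
    hol_in_chart (cdim X) c V (\<lambda>x. \<Sum>i\<in>I. g i x)"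
  by (induction I rule: infinite_finite_induct) (auto intro: hol_in_chart_const hol_in_chart_add)

lemma hol_in_chart_mono: "hol_in_chart (cdim X) c V g \<Longrightarrow> U \<inter> fst c \<subseteq> V \<inter> fst c \<Longrightarrow> hol_in_chart (cdim X) c U g"
  unfolding hol_in_chart_def by (meson continuous_on_subset in_mono)

lemma coord_deriv_partial_deriv:
  "coord_deriv c i g x = partial_deriv i (\<lambda>z. g (inv_into (fst c) (snd c) z)) (snd c x)"
  by (simp add: coord_deriv_def partial_deriv_def)

lemma hol_in_chart_coord_deriv:
  assumes V: "open V" and g: "hol_in_chart (cdim X) c V g" and i: "i < cdim X"
  shows "hol_in_chart (cdim X) c V (coord_deriv c i g)"
proof -
  let ?G = "snd c ` (V \<inter> fst c)"
  let ?g = "\<lambda>z. g (inv_into (fst c) (snd c) z)"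
  have h: "hol_on (cdim X) ?G (partial_deriv i ?g)"
    using g i hol_on_partial_deriv chart_image_open[OF V] hol_in_chart_iff_hol_on[OF V] by blast
  have "continuous_on (V \<inter> fst c) (partial_deriv i ?g \<circ> snd c)"
    using h by (intro continuous_on_compose continuous_on_subset[OF chart_continuous]) (auto simp: hol_on_def)
  moreover have "(\<lambda>w. coord_deriv c i g (coord_move c k x w)) field_differentiable at (snd c x k)"
    if x: "x \<in> V \<inter> fst c" and k: "k < cdim X" for x k
  proof -
    have ev: "eventually (\<lambda>w. coord_deriv c i g (coord_move c k x w) = partial_deriv i ?g ((snd c x)(k := w)))
      (nhds (snd c x k))"
      using eventually_coord_move[OF V x k] by eventually_elim (simp add: coord_deriv_partial_deriv)
    have "(\<lambda>w. partial_deriv i ?g ((snd c x)(k := w))) field_differentiable at (snd c x k)"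
      using h x k by (auto simp: hol_on_def)
    then show ?thesis unfolding field_differentiable_def DERIV_cong_ev[OF refl ev refl] .
  qed
  ultimately show ?thesis
    by (auto simp: hol_in_chart_def coord_deriv_partial_deriv[abs_def] o_def)
qed

text \<open>Stated as existence of the derivative with its value, since the derivative along the
  line has to be computed from it later.\<close>

lemma coord_deriv_commute:
  assumes V: "open V" and g: "hol_in_chart (cdim X) c V g" and i: "i < cdim X" and k: "k < cdim X"
    and ik: "i \<noteq> k" and x: "x \<in> V \<inter> fst c"
  shows "((\<lambda>w. coord_deriv c i g (coord_move c k x w)) has_field_derivative
      coord_deriv c i (coord_deriv c k g) x) (at (snd c x k))"
proof -
  let ?g = "\<lambda>z. g (inv_into (fst c) (snd c) z)"
  have ev: "eventually (\<lambda>w. coord_deriv c i g (coord_move c k x w) = partial_deriv i ?g ((snd c x)(k := w)))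
      (nhds (snd c x k))" if "k < cdim X" for i k
    using eventually_coord_move[OF V x that] by eventually_elim (simp add: coord_deriv_partial_deriv)
  have "coord_deriv c i (coord_deriv c k g) x = partial_deriv i (partial_deriv k ?g) (snd c x)"
    unfolding partial_deriv_def[of i] coord_deriv_coord_move[of c i] using ev[OF i, of k]
    by (intro deriv_cong_ev refl) simp
  moreover have "((\<lambda>w. partial_deriv i ?g ((snd c x)(k := w))) has_field_derivative
      partial_deriv i (partial_deriv k ?g) (snd c x)) (at (snd c x k))"
    by (rule partial_deriv_commute[OF _ chart_image_open[OF V] i k ik])
      (use g x hol_in_chart_iff_hol_on[OF V] in auto)
  ultimately show ?thesis using DERIV_cong_ev[OF refl ev[OF k] refl] by simp
qed

end

lemma hol_sec_iff:
  assumes X: "charted X" and V: "open V"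
  shows "g \<in> hol_sec X V \<longleftrightarrow> (\<forall>x. x \<notin> V \<longrightarrow> g x = 0) \<and> (\<forall>c\<in>atlas X. hol_in_chart (cdim X) c V g)"
  unfolding hol_sec_def using hol_in_chart_iff_hol_on[OF X _ V] by (auto simp: split_beta)

lemma hol_sec_outside: "g \<in> hol_sec X V \<Longrightarrow> x \<notin> V \<Longrightarrow> g x = 0"
  by (auto simp: hol_sec_def)

lemma charted_cover: "charted X \<Longrightarrow> \<exists>c\<in>atlas X. x \<in> fst c"
  unfolding charted_def by (metis UNIV_I UN_iff)

lemma hol_sec_continuous:
  assumes X: "charted X" and V: "open V" and g: "g \<in> hol_sec X V"
  shows "continuous_on V g"
proof -
  have "continuous_on (\<Union>c\<in>atlas X. V \<inter> fst c) g"
    using g V chart_open[OF X] unfolding hol_sec_iff[OF X V] hol_in_chart_def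
    by (intro continuous_on_open_UN) auto
  moreover have "(\<Union>c\<in>atlas X. V \<inter> fst c) = V" using charted_cover[OF X] by blast
  ultimately show ?thesis by simp
qed

lemma hol_sec_fres:
  assumes X: "charted X" and "open V" "open U" "V \<subseteq> U" and g: "g \<in> hol_sec X U"
  shows "fres V g \<in> hol_sec X V"
proof -
  have "hol_in_chart (cdim X) c V (fres V g)" if c: "c \<in> atlas X" for c
    using hol_in_chart_cong[OF X c \<open>open V\<close>, of "fres V g" g] hol_in_chart_mono[of "X" c U g V] g assms c
    by (auto simp: fres_def hol_sec_iff)
  then show ?thesis using assms by (auto simp: hol_sec_iff fres_def)
qed

text \<open>Continuity and differentiability are local, and extension by zero outside of
  \<open>U\<close> does not change the function near a point of \<open>U\<close>.\<close>

lemma hol_sec_local: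
  assumes X: "charted X" and V: "open V" and z: "\<And>x. x \<notin> V \<Longrightarrow> g x = 0"
    and loc: "\<And>x. x \<in> V \<Longrightarrow> \<exists>U. open U \<and> x \<in> U \<and> U \<subseteq> V \<and> fres U g \<in> hol_sec X U"
  shows "g \<in> hol_sec X V"
proof -
  have "hol_in_chart (cdim X) c V g" if c: "c \<in> atlas X" for c
  proof -
    obtain U where U: "\<And>x. x \<in> V \<Longrightarrow> open (U x) \<and> x \<in> U x \<and> U x \<subseteq> V \<and> fres (U x) g \<in> hol_sec X (U x)"
      using loc by metis
    have h: "hol_in_chart (cdim X) c (U x) g" if "x \<in> V" for x
      using hol_in_chart_cong[OF X c, of "U x" "fres (U x) g" g] U[OF that] c
      by (auto simp: hol_sec_iff[OF X] fres_def)
    have "continuous_on (\<Union>x\<in>V. U x \<inter> fst c) g"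
      using h U chart_open[OF X c] by (intro continuous_on_open_UN) (auto simp: hol_in_chart_def)
    moreover have "(\<Union>x\<in>V. U x \<inter> fst c) = V \<inter> fst c" using U by blast
    ultimately show ?thesis using h U by (fastforce simp: hol_in_chart_def)
  qed
  then show ?thesis using z V X by (simp add: hol_sec_iff)
qed

lemma hol_sec_const: "charted X \<Longrightarrow> open U \<Longrightarrow> fres U (\<lambda>_. a) \<in> hol_sec X U"
proof -
  assume X: "charted X" and U: "open U"
  have "hol_in_chart (cdim X) c U (fres U (\<lambda>_. a))" if c: "c \<in> atlas X" for c
    using hol_in_chart_cong[OF X c U, of "fres U (\<lambda>_. a)" "\<lambda>_. a"] hol_in_chart_const[OF X c]
    by (simp add: fres_def)
  then show ?thesis by (simp add: hol_sec_iff X U fres_def)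
qed

lemma hol_sec_zero: "charted X \<Longrightarrow> open U \<Longrightarrow> (\<lambda>x. 0) \<in> hol_sec X U"
  by (auto simp: hol_sec_iff hol_in_chart_const)

lemma hol_sec_mult:
  assumes "charted X" "open V" "open U" "V \<subseteq> U" "h \<in> hol_sec X U" "g \<in> hol_sec X V"
  shows "(\<lambda>x. h x * g x) \<in> hol_sec X V"
proof -
  have "hol_in_chart (cdim X) c V h" if "c \<in> atlas X" for c
    using assms that by (intro hol_in_chart_mono[of X c U h V]) (auto simp: hol_sec_iff)
  then show ?thesis using assms by (auto simp: hol_sec_iff intro: hol_in_chart_mult)
qed

lemma hol_sec_add: "charted X \<Longrightarrow> open V \<Longrightarrow> g \<in> hol_sec X V \<Longrightarrow> h \<in> hol_sec X V \<Longrightarrow> (\<lambda>x. g x + h x) \<in> hol_sec X V"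
  by (auto simp: hol_sec_iff intro: hol_in_chart_add)

lemma hol_sec_lin: "charted X \<Longrightarrow> open V \<Longrightarrow> g \<in> hol_sec X V \<Longrightarrow> h \<in> hol_sec X V \<Longrightarrow> (\<lambda>x. a * g x + h x) \<in> hol_sec X V"
  unfolding hol_sec_iff
  by (auto intro!: hol_in_chart_add hol_in_chart_mult hol_in_chart_const simp del: split_paired_All)

subsection \<open>The product with the line\<close>

definition chart_C :: "nat \<Rightarrow> 'a chart \<Rightarrow> ('a \<times> complex) chart" where
  "chart_C n c = (fst c \<times> UNIV, \<lambda>p. (snd c (fst p))(n := snd p))"

lemma atlas_times_C: "atlas (times_C X) = chart_C (cdim X) ` atlas X"
  by (auto simp: times_C_def chart_C_def image_iff split_beta)

lemma cdim_times_C [simp]: "cdim (times_C X) = Suc (cdim X)"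
  by (simp add: times_C_def)

lemma fst_chart_C [simp]: "fst (chart_C n c) = fst c \<times> UNIV"
  by (simp add: chart_C_def)

lemma snd_chart_C [simp]: "snd (chart_C n c) p = (snd c (fst p))(n := snd p)"
  by (simp add: chart_C_def)

lemma charted_times_C:
  assumes X: "charted X"
  shows "charted (times_C X)"
proof -
  let ?n = "cdim X"
  have "open (fst c') \<and> openin (top_of_set (cspace (Suc ?n))) (snd c' ` fst c') \<and>
        (\<exists>\<psi>. homeomorphism (fst c') (snd c' ` fst c') (snd c') \<psi>)" if "c' \<in> atlas (times_C X)" for c'
  proof -
    obtain c where c: "c \<in> atlas X" "c' = chart_C ?n c" using \<open>c' \<in> _\<close> by (auto simp: atlas_times_C)
    let ?i = "inv_into (fst c) (snd c)"
    let ?\<psi> = "\<lambda>z::nat\<Rightarrow>complex. (?i (z(?n := 0)), z ?n)"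
    have upd: "((snd c x)(?n := t))(?n := 0) = snd c x" if "x \<in> fst c" for x t
      using chart_cspace[OF X c(1) that, of ?n] by (auto simp: fun_eq_iff)
    have upd0: "(snd c x)(?n := 0) = snd c x" if "x \<in> fst c" for x
      using chart_cspace[OF X c(1) that, of ?n] by (auto simp: fun_eq_iff)
    have im: "snd c' ` fst c' = {z \<in> cspace (Suc ?n). z(?n := 0) \<in> snd c ` fst c}" (is "_ = ?R")
    proof (intro equalityI subsetI)
      fix z assume "z \<in> ?R"
      then obtain x where x: "x \<in> fst c" "z(?n := 0) = snd c x" by auto
      from x(2) have "(snd c x)(?n := z ?n) = (z(?n := 0))(?n := z ?n)" by simp
      then have "z = snd c' (x, z ?n)" unfolding c(2) by simp
      moreover have "(x, z ?n) \<in> fst c'" using x(1) by (simp add: c(2))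
      ultimately show "z \<in> snd c' ` fst c'" by (rule image_eqI)
    qed (use c(2) upd chart_cspace[OF X c(1)] in \<open>auto simp: cspace_def\<close>)
    obtain O' where O: "open O'" "snd c ` fst c = cspace ?n \<inter> O'"
      using chart_image_openin[OF X c(1)] by (auto simp: openin_open)
    have "continuous_on UNIV (\<lambda>z::nat\<Rightarrow>complex. z(?n := 0))" by (intro continuous_intros)
    then have "open ((\<lambda>z::nat\<Rightarrow>complex. z(?n := 0)) -` O')" using O(1) by (simp add: open_vimage)
    moreover have "snd c' ` fst c' = cspace (Suc ?n) \<inter> ((\<lambda>z. z(?n := 0)) -` O')"
      unfolding im O(2) by (auto simp: cspace_def)
    ultimately have op: "openin (top_of_set (cspace (Suc ?n))) (snd c' ` fst c')"
      by (auto simp: openin_open)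
    have "homeomorphism (fst c') (snd c' ` fst c') (snd c') ?\<psi>"
    proof (rule homeomorphismI)
      have "continuous_on (fst c') (snd c \<circ> fst)"
        by (intro continuous_on_compose continuous_intros continuous_on_subset[OF chart_continuous[OF X c(1)]])
          (auto simp: c(2))
      then have "continuous_on (fst c') (\<lambda>p. (snd c (fst p))(?n := snd p))"
        by (intro continuous_on_fun_upd2 continuous_on_snd continuous_on_id) (simp add: o_def)
      then show "continuous_on (fst c') (snd c')" by (simp add: c(2) chart_C_def)
      have "continuous_on (snd c' ` fst c') (?i \<circ> (\<lambda>z. z(?n := 0)))"
        by (intro continuous_on_compose continuous_intros continuous_on_subset[OF chart_inv_continuous[OF X c(1)]])
          (auto simp: c(2) upd upd0)
      then show "continuous_on (snd c' ` fst c') ?\<psi>"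
        by (intro continuous_on_Pair continuous_on_subset[OF continuous_on_product_coordinates]) (auto simp: o_def)
    qed (auto simp: c(2) upd upd0 chart_inv[OF X c(1)])
    then show ?thesis using op chart_open[OF X c(1)] by (auto simp: c(2) open_Times)
  qed
  moreover have "(\<Union>c'\<in>atlas (times_C X). fst c') = UNIV"
    using charted_cover[OF X] by (auto simp: atlas_times_C)
  ultimately show ?thesis by (auto simp: charted_def split_beta)
qed

lemma coord_move_chart_C_last:
  assumes X: "charted X" and c: "c \<in> atlas X" and x: "x \<in> fst c"
  shows "coord_move (chart_C (cdim X) c) (cdim X) (x, t) w = (x, w)"
proof -
  have "chart_C (cdim X) c \<in> atlas (times_C X)" using c by (simp add: atlas_times_C)
  from chart_inv[OF charted_times_C[OF X] this, of "(x, w)"] x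
  show ?thesis by (simp add: coord_move_def)
qed

lemma eventually_coord_move_chart_C:
  assumes X: "charted X" and c: "c \<in> atlas X" and x: "x \<in> fst c" and i: "i < cdim X"
  shows "eventually (\<lambda>w. coord_move (chart_C (cdim X) c) i (x, t) w = (coord_move c i x w, t)) (nhds (snd c x i))"
  using eventually_coord_move[OF X c open_UNIV, of x i]
proof (rule eventually_mono)
  fix w assume w: "coord_move c i x w \<in> UNIV \<inter> fst c \<and> snd c (coord_move c i x w) = (snd c x)(i := w)"
  have "chart_C (cdim X) c \<in> atlas (times_C X)" using c by (simp add: atlas_times_C)
  from chart_inv[OF charted_times_C[OF X] this, of "(coord_move c i x w, t)"] w i
  show "coord_move (chart_C (cdim X) c) i (x, t) w = (coord_move c i x w, t)"
    by (simp add: coord_move_def[of "chart_C (cdim X) c"] fun_upd_twist)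
qed (use x i in auto)

lemma coord_deriv_chart_C:
  assumes X: "charted X" and c: "c \<in> atlas X" and x: "x \<in> fst c" and i: "i < cdim X"
  shows "coord_deriv (chart_C (cdim X) c) i g (x, t) = coord_deriv c i (\<lambda>y. g (y, t)) x"
  unfolding coord_deriv_coord_move using eventually_coord_move_chart_C[OF assms, of t] i
  by (intro deriv_cong_ev) (auto elim: eventually_mono)

lemma coord_deriv_chart_C_last:
  assumes X: "charted X" and c: "c \<in> atlas X" and x: "x \<in> fst c"
  shows "coord_deriv (chart_C (cdim X) c) (cdim X) g (x, t) = deriv (\<lambda>w. g (x, w)) t"
  unfolding coord_deriv_coord_move coord_move_chart_C_last[OF assms] by simp

text \<open>Of the coordinate directions of the product, the last one varies \<open>t\<close> with
  \<open>x\<close> fixed, and the others vary \<open>x\<close> with \<open>t\<close> fixed.\<close>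

lemma hol_in_chart_C_iff:
  assumes X: "charted X" and c: "c \<in> atlas X"
  shows "hol_in_chart (Suc (cdim X)) (chart_C (cdim X) c) V g \<longleftrightarrow>
    continuous_on (V \<inter> fst c \<times> UNIV) g \<and>
    (\<forall>x t. (x, t) \<in> V \<and> x \<in> fst c \<longrightarrow> (\<lambda>w. g (x, w)) field_differentiable at t \<and>
       (\<forall>i<cdim X. (\<lambda>w. g (coord_move c i x w, t)) field_differentiable at (snd c x i)))"
proof -
  have "(\<lambda>w. g (coord_move (chart_C (cdim X) c) i (x, t) w)) field_differentiable at (snd c x i) \<longleftrightarrow>
     (\<lambda>w. g (coord_move c i x w, t)) field_differentiable at (snd c x i)"
    if "x \<in> fst c" "i < cdim X" for x t i
    unfolding field_differentiable_def using eventually_coord_move_chart_C[OF X c that, of t]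
    by (intro ex_cong1 DERIV_cong_ev refl) (auto elim: eventually_mono)
  note * = this
  have ball: "(\<forall>p\<in>V \<inter> fst c \<times> UNIV. Q p) \<longleftrightarrow> (\<forall>x t. (x, t) \<in> V \<and> x \<in> fst c \<longrightarrow> Q (x, t))" for Q
    by auto
  show ?thesis unfolding hol_in_chart_def fst_chart_C ball
    by (intro arg_cong2[where f="(\<and>)"] refl all_cong)
      (auto simp: less_Suc_eq coord_move_chart_C_last[OF X c] *)
qed

definition slice :: "('a \<times> complex) set \<Rightarrow> complex \<Rightarrow> 'a set" where
  "slice V t = {y. (y, t) \<in> V}"

lemma open_slice: "open V \<Longrightarrow> open (slice V t)"
proof -
  assume "open V"
  moreover have "slice V t = (\<lambda>y. (y, t)) -` V" by (auto simp: slice_def)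
  ultimately show ?thesis by (simp add: open_vimage continuous_intros)
qed

lemma hol_sec_slice:
  assumes X: "charted X" and V: "open V" and g: "g \<in> hol_sec (times_C X) V"
  shows "(\<lambda>y. g (y, t)) \<in> hol_sec X (slice V t)"
proof -
  have "hol_in_chart (cdim X) c (slice V t) (\<lambda>y. g (y, t))" if c: "c \<in> atlas X" for c
  proof -
    have h: "hol_in_chart (Suc (cdim X)) (chart_C (cdim X) c) V g"
      using g c by (simp add: hol_sec_iff[OF charted_times_C[OF X] V] atlas_times_C)
    have "continuous_on (slice V t \<inter> fst c) (g \<circ> (\<lambda>y. (y, t)))"
      using h unfolding hol_in_chart_C_iff[OF X c]
      by (intro continuous_on_compose continuous_intros) (auto simp: slice_def elim!: continuous_on_subset)
    then show ?thesis using h unfolding hol_in_chart_C_iff[OF X c]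
      by (auto simp: hol_in_chart_def slice_def o_def)
  qed
  moreover have "\<forall>x. x \<notin> slice V t \<longrightarrow> g (x, t) = 0"
    using hol_sec_outside[OF g] by (auto simp: slice_def)
  ultimately show ?thesis unfolding hol_sec_iff[OF X open_slice[OF V]] by blast
qed

lemma hol_sec_times_C_pullback:
  assumes X: "charted X" and V: "open V" and h: "h \<in> hol_sec X V"
  shows "(\<lambda>p. h (fst p)) \<in> hol_sec (times_C X) (V \<times> UNIV)"
proof -
  have "hol_in_chart (Suc (cdim X)) (chart_C (cdim X) c) (V \<times> UNIV) (\<lambda>p. h (fst p))"
    if c: "c \<in> atlas X" for c
  proof -
    have hc: "hol_in_chart (cdim X) c V h" using h c by (simp add: hol_sec_iff[OF X V])
    have "continuous_on (V \<times> UNIV \<inter> fst c \<times> UNIV) (h \<circ> fst)"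
      using hc by (intro continuous_on_compose continuous_intros)
        (auto simp: hol_in_chart_def elim!: continuous_on_subset)
    then show ?thesis using hc unfolding hol_in_chart_C_iff[OF X c]
      by (auto simp: hol_in_chart_def o_def)
  qed
  then show ?thesis using h V
    by (auto simp: hol_sec_iff[OF charted_times_C[OF X]] open_Times atlas_times_C hol_sec_outside)
qed

lemma hol_sec_snd:
  assumes X: "charted X" and V: "open V"
  shows "fres V snd \<in> hol_sec (times_C X) V"
proof -
  have "hol_in_chart (Suc (cdim X)) (chart_C (cdim X) c) V (fres V snd)" if c: "c \<in> atlas X" for c
  proof -
    have "chart_C (cdim X) c \<in> atlas (times_C X)" using c by (simp add: atlas_times_C)
    from hol_in_chart_cong[OF charted_times_C[OF X] this V, of "fres V snd" snd]
    have "hol_in_chart (Suc (cdim X)) (chart_C (cdim X) c) V (fres V snd) =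
       hol_in_chart (Suc (cdim X)) (chart_C (cdim X) c) V snd" by (simp add: fres_def)
    also have "\<dots>" unfolding hol_in_chart_C_iff[OF X c] by (auto intro: continuous_intros)
    finally show ?thesis by simp
  qed
  then show ?thesis using V
    by (auto simp: hol_sec_iff[OF charted_times_C[OF X]] atlas_times_C fres_def)
qed


section \<open>Differential operators and their extension to the product with the line\<close>

lemma op_dom_fres: "charted X \<Longrightarrow> op_dom X U V g \<Longrightarrow> open W \<Longrightarrow> W \<subseteq> V \<Longrightarrow> op_dom X U W (fres W g)"
  by (auto simp: op_dom_def intro: hol_sec_fres)

lemma end_sec_hol: "P \<in> end_sec X U \<Longrightarrow> op_dom X U V g \<Longrightarrow> P V g \<in> hol_sec X V"
  by (auto simp: end_sec_def)

lemma end_sec_op_dom: "P \<in> end_sec X U \<Longrightarrow> op_dom X U V g \<Longrightarrow> op_dom X U V (P V g)"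
  by (auto simp: end_sec_def op_dom_def)

lemma end_sec_fres: "P \<in> end_sec X U \<Longrightarrow> op_dom X U V g \<Longrightarrow> open W \<Longrightarrow> W \<subseteq> V \<Longrightarrow> P W (fres W g) = fres W (P V g)"
  by (auto simp: end_sec_def)

lemma end_sec_lin: "P \<in> end_sec X U \<Longrightarrow> op_dom X U V g \<Longrightarrow> op_dom X U V h \<Longrightarrow>
   P V (\<lambda>x. a * g x + h x) = (\<lambda>x. a * P V g x + P V h x)"
  by (auto simp: end_sec_def)

lemma end_sec_ndom: "P \<in> end_sec X U \<Longrightarrow> \<not> op_dom X U V g \<Longrightarrow> P V g = (\<lambda>x. 0)"
  by (auto simp: end_sec_def)

lemma end_sec_zero:
  assumes X: "charted X" and P: "P \<in> end_sec X U" and V: "open V" "V \<subseteq> U"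
  shows "P V (\<lambda>x. 0) = (\<lambda>x. 0)"
proof -
  have d: "op_dom X U V (\<lambda>x. 0)" using X V by (simp add: op_dom_def hol_sec_zero)
  from end_sec_lin[OF P d d, of "- 1"] show ?thesis by simp
qed

lemma end_sec_scale:
  assumes X: "charted X" and P: "P \<in> end_sec X U" and g: "op_dom X U V g"
  shows "P V (\<lambda>x. a * g x) = (\<lambda>x. a * P V g x)"
proof -
  have d: "op_dom X U V (\<lambda>x. 0)" and V: "open V" "V \<subseteq> U"
    using X g by (auto simp: op_dom_def hol_sec_zero)
  from end_sec_lin[OF P g d, of a] end_sec_zero[OF X P V] show ?thesis by simp
qed

lemma end_sec_eqI:
  assumes "P \<in> end_sec X U" "Q \<in> end_sec X U"
    and "\<And>V g. op_dom X U V g \<Longrightarrow> P V g = Q V g"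
  shows "P = Q"
proof (intro ext)
  fix V g x show "P V g x = Q V g x"
    using assms by (cases "op_dom X U V g") (auto simp: end_sec_ndom)
qed

lemma end_secI:
  assumes "\<And>V g. \<not> op_dom X U V g \<Longrightarrow> P V g = (\<lambda>x. 0)"
    and "\<And>V g. op_dom X U V g \<Longrightarrow> P V g \<in> hol_sec X V"
    and "\<And>V g W. op_dom X U V g \<Longrightarrow> open W \<Longrightarrow> W \<subseteq> V \<Longrightarrow> P W (fres W g) = fres W (P V g)"
    and "\<And>V g h a. op_dom X U V g \<Longrightarrow> op_dom X U V h \<Longrightarrow>
        P V (\<lambda>x. a * g x + h x) = (\<lambda>x. a * P V g x + P V h x)"
  shows "P \<in> end_sec X U"
  using assms by (simp add: end_sec_def)

lemma op_dom_lin: "charted X \<Longrightarrow> op_dom X U V g \<Longrightarrow> op_dom X U V h \<Longrightarrow> op_dom X U V (\<lambda>x. a * g x + h x)"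
  by (simp add: op_dom_def hol_sec_lin)

lemma op_add_end_sec:
  assumes "charted X" "P \<in> end_sec X U" "Q \<in> end_sec X U"
  shows "op_add P Q \<in> end_sec X U"
proof (rule end_secI)
  fix V g
  show "op_add P Q V g = (\<lambda>x. 0)" if "\<not> op_dom X U V g"
    using assms that by (simp add: op_add_def end_sec_ndom)
  assume g: "op_dom X U V g"
  show "op_add P Q V g \<in> hol_sec X V"
    unfolding op_add_def using assms g by (intro hol_sec_add end_sec_hol[of _ X U]) (auto simp: op_dom_def)
  show "op_add P Q W (fres W g) = fres W (op_add P Q V g)" if "open W" "W \<subseteq> V" for W
    using end_sec_fres[OF assms(2) g that] end_sec_fres[OF assms(3) g that]
    by (simp add: op_add_def fres_def fun_eq_iff)
  show "op_add P Q V (\<lambda>x. a * g x + h x) = (\<lambda>x. a * op_add P Q V g x + op_add P Q V h x)"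
    if h: "op_dom X U V h" for h a
    using end_sec_lin[OF assms(2) g h, of a] end_sec_lin[OF assms(3) g h, of a]
    by (simp add: op_add_def algebra_simps)
qed

lemma op_comp_end_sec:
  assumes X: "charted X" and P: "P \<in> end_sec X U" and Q: "Q \<in> end_sec X U"
  shows "op_comp P Q \<in> end_sec X U"
proof (intro end_secI)
  fix V g assume "\<not> op_dom X U V g"
  then show "op_comp P Q V g = (\<lambda>x. 0)"
    using end_sec_zero[OF X P, of V] end_sec_ndom[OF P, of V]
    by (cases "open V \<and> V \<subseteq> U") (auto simp: op_comp_def end_sec_ndom[OF Q] op_dom_def)
next
  fix V g assume g: "op_dom X U V g"
  note Qg = end_sec_op_dom[OF Q g]
  show "op_comp P Q V g \<in> hol_sec X V" unfolding op_comp_def by (rule end_sec_hol[OF P Qg])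
  show "op_comp P Q W (fres W g) = fres W (op_comp P Q V g)" if "open W" "W \<subseteq> V" for W
    using end_sec_fres[OF P Qg that] end_sec_fres[OF Q g that] by (simp add: op_comp_def)
  show "op_comp P Q V (\<lambda>x. a * g x + h x) = (\<lambda>x. a * op_comp P Q V g x + op_comp P Q V h x)"
    if h: "op_dom X U V h" for h a
    using end_sec_lin[OF P Qg end_sec_op_dom[OF Q h], of a] end_sec_lin[OF Q g h, of a]
    by (simp add: op_comp_def)
qed

lemma mul_op_end_sec:
  assumes X: "charted X" and U: "open U" and h: "h \<in> hol_sec X U"
  shows "mul_op X U h \<in> end_sec X U"
proof (intro end_secI)
  fix V g assume g: "op_dom X U V g"
  show "mul_op X U h V g \<in> hol_sec X V"
    using g hol_sec_mult[OF X _ U _ h] by (auto simp: mul_op_def op_dom_def)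
  show "mul_op X U h W (fres W g) = fres W (mul_op X U h V g)" if "open W" "W \<subseteq> V" for W
    using g op_dom_fres[OF X g that] by (auto simp: mul_op_def fres_def fun_eq_iff)
  show "mul_op X U h V (\<lambda>x. a * g x + k x) = (\<lambda>x. a * mul_op X U h V g x + mul_op X U h V k x)"
    if k: "op_dom X U V k" for k a
    using g k op_dom_lin[OF X g k, of a] by (auto simp: mul_op_def algebra_simps)
qed (simp add: mul_op_def)

lemma has_order_end_sec:
  assumes X: "charted X" and U: "open U"
  shows "has_order X U k P \<Longrightarrow> P \<in> end_sec X U"
  by (induction rule: has_order.induct)
    (auto intro: mul_op_end_sec[OF X U] op_add_end_sec[OF X] op_comp_end_sec[OF X] simp: vector_fields_def)

lemma op_res_self: 
  assumes "P \<in> end_sec X U"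
  shows "op_res U P = P"
proof (intro ext)
  fix V g x show "op_res U P V g x = P V g x"
    using end_sec_ndom[OF assms, of V g] by (auto simp: op_res_def op_dom_def)
qed

lemma has_order_D_sec:
  assumes "charted X" "open U" "has_order X U k P"
  shows "P \<in> D_sec X U"
proof -
  have P: "P \<in> end_sec X U" using assms has_order_end_sec by blast
  have "has_order X U k (op_res U P)" using assms(3) op_res_self[OF P] by simp
  with P assms(2) show ?thesis unfolding D_sec_def by (intro CollectI conjI ballI exI[of _ U] exI[of _ k]) auto
qed

lemma D_sec_end_sec: "P \<in> D_sec X U \<Longrightarrow> P \<in> end_sec X U"
  by (simp add: D_sec_def)

lemma mul_op_D_sec: "charted X \<Longrightarrow> open U \<Longrightarrow> h \<in> hol_sec X U \<Longrightarrow> mul_op X U h \<in> D_sec X U"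
  by (rule has_order_D_sec[OF _ _ has_order.mult])

lemma vector_fields_D_sec: "charted X \<Longrightarrow> open U \<Longrightarrow> \<xi> \<in> vector_fields X U \<Longrightarrow> \<xi> \<in> D_sec X U"
  by (rule has_order_D_sec[OF _ _ has_order.vf])

lemma op_res_end_sec:
  assumes P: "P \<in> end_sec X U" and V: "open V" "V \<subseteq> U"
  shows "op_res V P \<in> end_sec X V"
proof -
  have d: "op_dom X V W g \<longleftrightarrow> W \<subseteq> V \<and> op_dom X U W g" for W g using V by (auto simp: op_dom_def)
  show ?thesis
    by (rule end_secI) (use P in \<open>auto simp: op_res_def d end_sec_hol end_sec_fres end_sec_lin end_sec_ndom\<close>)
qed

lemma op_res_mul_op:
  assumes V: "V \<subseteq> U"
  shows "op_res V (mul_op X U h) = mul_op X V (fres V h)"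
proof (intro ext)
  fix W g x
  show "op_res V (mul_op X U h) W g x = mul_op X V (fres V h) W g x"
    using V hol_sec_outside[of g X W x] by (auto simp: op_res_def mul_op_def op_dom_def fres_def)
qed

lemma vector_field_coeffs:
  assumes "\<xi> \<in> vector_fields X U" "c \<in> atlas X"
  obtains a where "\<And>i. i < cdim X \<Longrightarrow> a i \<in> hol_sec X (U \<inter> fst c)"
    "\<And>V g x. op_dom X (U \<inter> fst c) V g \<Longrightarrow> x \<in> V \<Longrightarrow> \<xi> V g x = (\<Sum>i<cdim X. a i x * coord_deriv c i g x)"
proof -
  from assms have "\<exists>a. (\<forall>i<cdim X. a i \<in> hol_sec X (U \<inter> fst c)) \<and>
     (\<forall>V g. op_dom X (U \<inter> fst c) V g \<longrightarrow> (\<forall>x\<in>V. \<xi> V g x = (\<Sum>i<cdim X. a i x * coord_deriv c i g x)))"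
    by (simp add: vector_fields_def)
  then obtain a where "\<forall>i<cdim X. a i \<in> hol_sec X (U \<inter> fst c)"
     "\<forall>V g. op_dom X (U \<inter> fst c) V g \<longrightarrow> (\<forall>x\<in>V. \<xi> V g x = (\<Sum>i<cdim X. a i x * coord_deriv c i g x))"
    by (elim exE conjE)
  then show thesis by (intro that[of a]) simp_all
qed

lemma vector_fieldsI:
  assumes "\<xi> \<in> end_sec X U"
    and "\<And>c. c \<in> atlas X \<Longrightarrow> \<exists>a. (\<forall>i<cdim X. a i \<in> hol_sec X (U \<inter> fst c)) \<and>
     (\<forall>V g. op_dom X (U \<inter> fst c) V g \<longrightarrow> (\<forall>x\<in>V. \<xi> V g x = (\<Sum>i<cdim X. a i x * coord_deriv c i g x)))"
  shows "\<xi> \<in> vector_fields X U"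
  using assms by (simp add: vector_fields_def)

lemma op_res_vector_field:
  assumes X: "charted X" and U: "open U" and \<xi>: "\<xi> \<in> vector_fields X U" and V: "open V" "V \<subseteq> U"
  shows "op_res V \<xi> \<in> vector_fields X V"
proof -
  have "op_res V \<xi> \<in> end_sec X V" using \<xi> op_res_end_sec V by (auto simp: vector_fields_def)
  moreover have "\<exists>a. (\<forall>i<cdim X. a i \<in> hol_sec X (V \<inter> fst c)) \<and>
     (\<forall>W g. op_dom X (V \<inter> fst c) W g \<longrightarrow>
        (\<forall>x\<in>W. op_res V \<xi> W g x = (\<Sum>i<cdim X. a i x * coord_deriv c i g x)))"
    if c: "c \<in> atlas X" for c
  proof -
    obtain a where a: "\<And>i. i < cdim X \<Longrightarrow> a i \<in> hol_sec X (U \<inter> fst c)"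
      "\<And>W g x. op_dom X (U \<inter> fst c) W g \<Longrightarrow> x \<in> W \<Longrightarrow> \<xi> W g x = (\<Sum>i<cdim X. a i x * coord_deriv c i g x)"
      by (fact vector_field_coeffs[OF \<xi> c])
    have o: "open (V \<inter> fst c)" "open (U \<inter> fst c)" "V \<inter> fst c \<subseteq> U \<inter> fst c"
      using V U chart_open[OF X c] by auto
    show ?thesis
    proof (intro exI[of _ "\<lambda>i. fres (V \<inter> fst c) (a i)"] conjI allI impI ballI)
      fix i assume "i < cdim X"
      then show "fres (V \<inter> fst c) (a i) \<in> hol_sec X (V \<inter> fst c)" using a(1) by (intro hol_sec_fres[OF X o])
    next
      fix W g x assume W: "op_dom X (V \<inter> fst c) W g" and x: "x \<in> W"
      have "op_dom X (U \<inter> fst c) W g" "W \<subseteq> V" "x \<in> V \<inter> fst c" using W x V by (auto simp: op_dom_def)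
      then show "op_res V \<xi> W g x = (\<Sum>i<cdim X. fres (V \<inter> fst c) (a i) x * coord_deriv c i g x)"
        using a(2) x by (simp add: op_res_def fres_def)
    qed
  qed
  ultimately show ?thesis by (rule vector_fieldsI)
qed

lemma op_res_op_comp: "op_res V (op_comp P Q) = op_comp (op_res V P) (op_res V Q)"
  by (auto simp: op_res_def op_comp_def fun_eq_iff)

lemma op_res_op_add: "op_res V (op_add P Q) = op_add (op_res V P) (op_res V Q)"
  by (auto simp: op_res_def op_add_def fun_eq_iff)

text \<open>Constants as operators: through them every module of sections is a complex vector
  space.\<close>

definition scal :: "('a::topological_space) cmfd \<Rightarrow> 'a set \<Rightarrow> complex \<Rightarrow> 'a dop" where
  "scal X U a = mul_op X U (fres U (\<lambda>_. a))"

lemma scal_apply: "scal X U a V g = (if op_dom X U V g then (\<lambda>x. a * g x) else (\<lambda>x. 0))"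
proof (cases "op_dom X U V g")
  case True
  have "(\<lambda>x. fres U (\<lambda>_. a) x * g x) = (\<lambda>x. a * g x)"
    using True hol_sec_outside[of g X V] by (auto simp: fres_def op_dom_def fun_eq_iff)
  then show ?thesis using True by (simp add: scal_def mul_op_def)
qed (simp add: scal_def mul_op_def)

lemma scal_D_sec: "charted X \<Longrightarrow> open U \<Longrightarrow> scal X U a \<in> D_sec X U"
  unfolding scal_def by (intro mul_op_D_sec hol_sec_const)

lemma scal_one: "scal X U 1 = op_id X U"
  by (intro ext) (simp add: scal_apply op_id_def)

lemma scal_zero: "scal X U 0 = (\<lambda>V g x. 0)"
  by (intro ext) (simp add: scal_apply)

lemma scal_add: "op_add (scal X U a) (scal X U b) = scal X U (a + b)"
  by (intro ext) (simp add: scal_apply op_add_def algebra_simps)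

lemma op_comp_scal:
  assumes X: "charted X" and P: "P \<in> end_sec X U" and "open U"
  shows "op_comp P (scal X U a) V g = (if op_dom X U V g then (\<lambda>x. a * P V g x) else (\<lambda>x. 0))"
    and "op_comp (scal X U a) P V g = (if op_dom X U V g then (\<lambda>x. a * P V g x) else (\<lambda>x. 0))"
proof -
  have s: "scal X U a \<in> end_sec X U" using assms by (intro D_sec_end_sec scal_D_sec)
  show "op_comp P (scal X U a) V g = (if op_dom X U V g then (\<lambda>x. a * P V g x) else (\<lambda>x. 0))"
    using end_sec_ndom[OF op_comp_end_sec[OF X P s]] end_sec_scale[OF X P, of V g a]
    by (simp add: op_comp_def scal_apply)
  show "op_comp (scal X U a) P V g = (if op_dom X U V g then (\<lambda>x. a * P V g x) else (\<lambda>x. 0))"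
    using end_sec_ndom[OF op_comp_end_sec[OF X s P]] end_sec_op_dom[OF P]
    by (simp add: op_comp_def scal_apply)
qed

lemma scal_central:
  assumes "charted X" "P \<in> end_sec X U" "open U"
  shows "op_comp P (scal X U a) = op_comp (scal X U a) P"
  by (intro ext) (simp add: op_comp_scal[OF assms])

lemma scal_mult:
  assumes X: "charted X" and U: "open U"
  shows "op_comp (scal X U a) (scal X U b) = scal X U (a * b)"
  by (intro ext) (simp add: op_comp_scal(2)[OF X D_sec_end_sec[OF scal_D_sec[OF X U]] U] scal_apply)

lemma op_res_scal: "V \<subseteq> U \<Longrightarrow> op_res V (scal X U a) = scal X V a"
  unfolding scal_def by (simp add: op_res_mul_op) (rule arg_cong[where f="mul_op X V"], auto simp: fres_def fun_eq_iff)

subsection \<open>The derivation along the line\<close>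

lemma dt_op_eq:
  assumes "op_dom (times_C X) W V g" "p \<in> V"
  shows "dt_op X W V g p = deriv (\<lambda>t. g (fst p, t)) (snd p)"
  using assms by (simp add: dt_op_def fres_def)

lemma dt_op_chart:
  assumes X: "charted X" and c: "c \<in> atlas X" and g: "op_dom (times_C X) W V g" and p: "p \<in> V \<inter> fst c \<times> UNIV"
  shows "dt_op X W V g p = coord_deriv (chart_C (cdim X) c) (cdim X) g p"
  using coord_deriv_chart_C_last[OF X c, of "fst p" g "snd p"] p by (auto simp: dt_op_eq[OF g])

lemma hol_sec_times_chart:
  assumes X: "charted X" and V: "open V" and g: "g \<in> hol_sec (times_C X) V" and c: "c \<in> atlas X"
  shows "hol_in_chart (Suc (cdim X)) (chart_C (cdim X) c) V g"
  using g c by (simp add: hol_sec_iff[OF charted_times_C[OF X] V] atlas_times_C)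

lemma chart_C_atlas: "c \<in> atlas X \<Longrightarrow> chart_C (cdim X) c \<in> atlas (times_C X)"
  by (simp add: atlas_times_C)

lemma hol_sec_times_field_differentiable:
  assumes X: "charted X" and V: "open V" and g: "g \<in> hol_sec (times_C X) V" and p: "(x, t) \<in> V"
  shows "(\<lambda>w. g (x, w)) field_differentiable at t"
proof -
  obtain c where c: "c \<in> atlas X" "x \<in> fst c" using charted_cover[OF X] by blast
  show ?thesis using hol_sec_times_chart[OF X V g c(1)] c p unfolding hol_in_chart_C_iff[OF X c(1)] by blast
qed

text \<open>Operators on the product are given by formulas that depend on the chart; the local
  expression need not vanish outside of \<open>V\<close>.\<close>

lemma hol_sec_timesI:
  assumes X: "charted X" and V: "open V" and z: "\<And>p. p \<notin> V \<Longrightarrow> g p = 0"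
    and h: "\<And>c. c \<in> atlas X \<Longrightarrow> \<exists>h. hol_in_chart (Suc (cdim X)) (chart_C (cdim X) c) V h \<and>
       (\<forall>p\<in>V \<inter> fst c \<times> UNIV. g p = h p)"
  shows "g \<in> hol_sec (times_C X) V"
proof -
  have "hol_in_chart (Suc (cdim X)) (chart_C (cdim X) c) V g" if c: "c \<in> atlas X" for c
  proof -
    obtain h where h': "hol_in_chart (Suc (cdim X)) (chart_C (cdim X) c) V h"
       "\<forall>p\<in>V \<inter> fst c \<times> UNIV. g p = h p" using h[OF c] by blast
    show ?thesis using hol_in_chart_cong[OF charted_times_C[OF X] chart_C_atlas[OF c] V, of g h] h' by simp
  qed
  then show ?thesis using z V by (auto simp: hol_sec_iff[OF charted_times_C[OF X] V] atlas_times_C)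
qed

lemma dt_op_hol:
  assumes X: "charted X" and g: "op_dom (times_C X) W V g"
  shows "dt_op X W V g \<in> hol_sec (times_C X) V"
proof (rule hol_sec_timesI[OF X])
  show V: "open V" using g by (simp add: op_dom_def)
  show "dt_op X W V g p = 0" if "p \<notin> V" for p using that by (simp add: dt_op_def fres_def)
  fix c assume c: "c \<in> atlas X"
  have "hol_in_chart (Suc (cdim X)) (chart_C (cdim X) c) V (coord_deriv (chart_C (cdim X) c) (cdim X) g)"
    using hol_in_chart_coord_deriv[OF charted_times_C[OF X] chart_C_atlas[OF c] V, of g "cdim X"]
      hol_sec_times_chart[OF X V _ c, of g] g by (simp add: op_dom_def)
  then show "\<exists>h. hol_in_chart (Suc (cdim X)) (chart_C (cdim X) c) V h \<and>
       (\<forall>p\<in>V \<inter> fst c \<times> UNIV. dt_op X W V g p = h p)"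
    using dt_op_chart[OF X c g] by blast
qed

lemma dt_op_end_sec:
  assumes X: "charted X"
  shows "dt_op X W \<in> end_sec (times_C X) W"
proof (rule end_secI)
  fix V g assume g: "op_dom (times_C X) W V g"
  show "dt_op X W V g \<in> hol_sec (times_C X) V" by (rule dt_op_hol[OF X g])
  have fd: "(\<lambda>t. g (fst p, t)) field_differentiable at (snd p)" if "p \<in> V" "op_dom (times_C X) W V g" for p g
    using hol_sec_times_field_differentiable[OF X, of V g "fst p" "snd p"] that by (auto simp: op_dom_def)
  show "dt_op X W V' (fres V' g) = fres V' (dt_op X W V g)" if V': "open V'" "V' \<subseteq> V" for V'
  proof
    fix p
    have d: "op_dom (times_C X) W V' (fres V' g)" by (rule op_dom_fres[OF charted_times_C[OF X] g V'])
    show "dt_op X W V' (fres V' g) p = fres V' (dt_op X W V g) p"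
    proof (cases "p \<in> V'")
      case True
      obtain c where c: "c \<in> atlas X" "fst p \<in> fst c" using charted_cover[OF X] by blast
      have p: "p \<in> V' \<inter> fst c \<times> UNIV" "p \<in> V \<inter> fst c \<times> UNIV" using True c V' by (cases p, auto)+
      show ?thesis using True dt_op_chart[OF X c(1) d p(1)] dt_op_chart[OF X c(1) g p(2)]
          coord_deriv_cong[OF charted_times_C[OF X] chart_C_atlas[OF c(1)] V'(1), of p "cdim X" "fres V' g" g] p
        by (simp add: fres_def)
    qed (simp add: fres_def dt_op_def)
  qed
  fix h a assume h: "op_dom (times_C X) W V h"
  show "dt_op X W V (\<lambda>x. a * g x + h x) = (\<lambda>x. a * dt_op X W V g x + dt_op X W V h x)"
  proof
    fix p
    show "dt_op X W V (\<lambda>x. a * g x + h x) p = a * dt_op X W V g p + dt_op X W V h p"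
    proof (cases "p \<in> V")
      case True
      then show ?thesis
        using fd[OF True g] fd[OF True h] g h op_dom_lin[OF charted_times_C[OF X] g h, of a]
        by (simp add: dt_op_eq field_differentiable_mult field_differentiable_const)
    qed (simp add: dt_op_def fres_def)
  qed
qed (simp add: dt_op_def)

lemma dt_op_vector_field:
  assumes X: "charted X" and W: "open W"
  shows "dt_op X W \<in> vector_fields (times_C X) W"
proof (rule vector_fieldsI[OF dt_op_end_sec[OF X]])
  fix c' assume "c' \<in> atlas (times_C X)"
  then obtain c where c: "c \<in> atlas X" "c' = chart_C (cdim X) c" by (auto simp: atlas_times_C)
  let ?O = "W \<inter> fst c'"
  have o: "open ?O" using W chart_open[OF charted_times_C[OF X] \<open>c' \<in> _\<close>] by auto
  show "\<exists>a. (\<forall>i<cdim (times_C X). a i \<in> hol_sec (times_C X) ?O) \<and>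
     (\<forall>V g. op_dom (times_C X) ?O V g \<longrightarrow>
        (\<forall>x\<in>V. dt_op X W V g x = (\<Sum>i<cdim (times_C X). a i x * coord_deriv c' i g x)))"
  proof (intro exI[of _ "\<lambda>i. fres ?O (\<lambda>_. if i = cdim X then 1 else 0)"] conjI allI impI ballI)
    fix i show "fres ?O (\<lambda>_. if i = cdim X then 1 else 0) \<in> hol_sec (times_C X) ?O"
      by (rule hol_sec_const[OF charted_times_C[OF X] o])
  next
    fix V g p assume g: "op_dom (times_C X) ?O V g" and p: "p \<in> V"
    have g': "op_dom (times_C X) W V g" and p': "p \<in> V \<inter> fst c \<times> UNIV" "p \<in> ?O"
      using g p c(2) by (auto simp: op_dom_def)
    show "dt_op X W V g p = (\<Sum>i<cdim (times_C X). fres ?O (\<lambda>_. if i = cdim X then 1 else 0) p * coord_deriv c' i g p)"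
      using p' dt_op_chart[OF X c(1) g' p'(1)] c(2) by (simp add: fres_def)
  qed
qed

lemma op_res_dt_op: "V \<subseteq> W \<Longrightarrow> op_res V (dt_op X W) = dt_op X V"
  by (auto simp: op_res_def dt_op_def fun_eq_iff op_dom_def)

lemma op_res_t_op: "V \<subseteq> W \<Longrightarrow> op_res V (t_op X W) = t_op X V"
  unfolding t_op_def by (simp add: op_res_mul_op) (rule arg_cong[where f="mul_op _ V"], auto simp: fres_def fun_eq_iff)

lemma t_op_apply: "t_op X W V g = (if op_dom (times_C X) W V g then (\<lambda>p. snd p * g p) else (\<lambda>p. 0))"
proof (cases "op_dom (times_C X) W V g")
  case True
  have "(\<lambda>p. fres W snd p * g p) = (\<lambda>p. snd p * g p)"
    using True hol_sec_outside[of g _ V] by (auto simp: fres_def op_dom_def fun_eq_iff)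
  then show ?thesis using True by (simp add: t_op_def mul_op_def)
qed (simp add: t_op_def mul_op_def)

lemma t_op_D_sec: "charted X \<Longrightarrow> open W \<Longrightarrow> t_op X W \<in> D_sec (times_C X) W"
  unfolding t_op_def by (intro mul_op_D_sec charted_times_C hol_sec_snd)

lemma dt_op_D_sec: "charted X \<Longrightarrow> open W \<Longrightarrow> dt_op X W \<in> D_sec (times_C X) W"
  by (intro vector_fields_D_sec charted_times_C dt_op_vector_field)

text \<open>The Leibniz rule. Together with the action of \<open>t\<close> on \<open>m \<otimes> 1\<close> and that of \<open>\<partial>\<^sub>t\<close>, it
  determines the action of \<open>t\<close> on the direct image.\<close>

lemma dt_op_t_op:
  assumes X: "charted X" and W: "open W"
  shows "op_comp (dt_op X W) (t_op X W) = op_add (op_comp (t_op X W) (dt_op X W)) (op_id (times_C X) W)"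
proof (rule end_sec_eqI)
  note T = charted_times_C[OF X]
  have e: "t_op X W \<in> end_sec (times_C X) W" "dt_op X W \<in> end_sec (times_C X) W" "op_id (times_C X) W \<in> end_sec (times_C X) W"
    using t_op_D_sec[OF X W] dt_op_D_sec[OF X W] scal_D_sec[OF T W, of 1] by (auto simp: D_sec_end_sec scal_one)
  show "op_comp (dt_op X W) (t_op X W) \<in> end_sec (times_C X) W"
    "op_add (op_comp (t_op X W) (dt_op X W)) (op_id (times_C X) W) \<in> end_sec (times_C X) W"
    using e by (auto intro!: op_comp_end_sec op_add_end_sec T)
  fix V g assume g: "op_dom (times_C X) W V g"
  have tg: "op_dom (times_C X) W V (\<lambda>p. snd p * g p)"
    using end_sec_op_dom[OF e(1) g] g by (simp add: t_op_apply)
  have dg: "op_dom (times_C X) W V (dt_op X W V g)" by (rule end_sec_op_dom[OF e(2) g])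
  show "op_comp (dt_op X W) (t_op X W) V g = op_add (op_comp (t_op X W) (dt_op X W)) (op_id (times_C X) W) V g"
  proof
    fix p
    show "op_comp (dt_op X W) (t_op X W) V g p = op_add (op_comp (t_op X W) (dt_op X W)) (op_id (times_C X) W) V g p"
    proof (cases "p \<in> V")
      case True
      have "(\<lambda>t. g (fst p, t)) field_differentiable at (snd p)"
        using hol_sec_times_field_differentiable[OF X, of V g "fst p" "snd p"] g True by (auto simp: op_dom_def)
      then show ?thesis using True g tg dg
        by (simp add: op_comp_def op_add_def t_op_apply dt_op_eq op_id_def field_differentiable_ident algebra_simps)
    next
      case False
      then show ?thesis using g tg dg hol_sec_outside[of g "times_C X" V p]
        by (simp add: op_comp_def op_add_def t_op_apply dt_op_def fres_def op_id_def, simp add: op_dom_def)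
    qed
  qed
qed

subsection \<open>Lifting operators\<close>

lemma op_dom_slice:
  "charted X \<Longrightarrow> op_dom (times_C X) (U \<times> UNIV) V g \<Longrightarrow> op_dom X U (slice V t) (\<lambda>y. g (y, t))"
  by (auto simp: op_dom_def open_slice hol_sec_slice) (auto simp: slice_def)

lemma lift_op_apply:
  "op_dom (times_C X) (U \<times> UNIV) V g \<Longrightarrow> lift_op X U P V g p = P (slice V (snd p)) (\<lambda>y. g (y, snd p)) (fst p)"
  by (simp add: lift_op_def slice_def)

lemma lift_op_outside:
  assumes X: "charted X" and P: "P \<in> end_sec X U" and g: "op_dom (times_C X) (U \<times> UNIV) V g" and p: "p \<notin> V"
  shows "lift_op X U P V g p = 0"
  unfolding lift_op_apply[OF g]
  by (rule hol_sec_outside[OF end_sec_hol[OF P op_dom_slice[OF X g]]]) (use p in \<open>auto simp: slice_def\<close>)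

lemma lift_op_fres:
  assumes X: "charted X" and P: "P \<in> end_sec X U" and g: "op_dom (times_C X) (U \<times> UNIV) V g"
    and W: "open W" "W \<subseteq> V"
  shows "lift_op X U P W (fres W g) = fres W (lift_op X U P V g)"
proof
  fix p :: "'a \<times> complex"
  have d: "op_dom (times_C X) (U \<times> UNIV) W (fres W g)" by (rule op_dom_fres[OF charted_times_C[OF X] g W])
  have "(\<lambda>y. fres W g (y, snd p)) = fres (slice W (snd p)) (\<lambda>y. g (y, snd p))"
    by (auto simp: fres_def slice_def)
  moreover have "slice W (snd p) \<subseteq> slice V (snd p)" using W by (auto simp: slice_def)
  ultimately show "lift_op X U P W (fres W g) p = fres W (lift_op X U P V g) p"
    using end_sec_fres[OF P op_dom_slice[OF X g] open_slice[OF W(1)], of "snd p" "snd p"]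
    unfolding lift_op_apply[OF d] fres_def[of W "lift_op X U P V g"] by (auto simp: lift_op_apply[OF g] fres_def slice_def)
qed

lemma lift_op_end_sec:
  assumes X: "charted X" and P: "P \<in> end_sec X U"
    and hol: "\<And>V g. op_dom (times_C X) (U \<times> UNIV) V g \<Longrightarrow> lift_op X U P V g \<in> hol_sec (times_C X) V"
  shows "lift_op X U P \<in> end_sec (times_C X) (U \<times> UNIV)"
proof (rule end_secI)
  fix V g assume g: "op_dom (times_C X) (U \<times> UNIV) V g"
  show "lift_op X U P W (fres W g) = fres W (lift_op X U P V g)" if "open W" "W \<subseteq> V" for W
    by (rule lift_op_fres[OF X P g that])
  fix h a assume h: "op_dom (times_C X) (U \<times> UNIV) V h"
  note gh = op_dom_lin[OF charted_times_C[OF X] g h]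
  show "lift_op X U P V (\<lambda>x. a * g x + h x) = (\<lambda>x. a * lift_op X U P V g x + lift_op X U P V h x)"
    using end_sec_lin[OF P op_dom_slice[OF X g] op_dom_slice[OF X h]]
    by (simp add: lift_op_apply[OF gh] lift_op_apply[OF g] lift_op_apply[OF h] fun_eq_iff)
next
  show "lift_op X U P V g = (\<lambda>p. 0)" if "\<not> op_dom (times_C X) (U \<times> UNIV) V g" for V g
    using that by (simp add: lift_op_def)
qed (rule hol)

lemma lift_op_add: "lift_op X U (op_add P Q) = op_add (lift_op X U P) (lift_op X U Q)"
  by (auto simp: lift_op_def op_add_def fun_eq_iff)

text \<open>The lift of \<open>Q\<close> has to produce sections again: composing parameterwise
  makes sense only if the result is holomorphic in \<open>t\<close> as well.\<close>

lemma lift_op_comp: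
  assumes X: "charted X" and P: "lift_op X U P \<in> end_sec (times_C X) (U \<times> UNIV)"
    and Q: "lift_op X U Q \<in> end_sec (times_C X) (U \<times> UNIV)"
  shows "lift_op X U (op_comp P Q) = op_comp (lift_op X U P) (lift_op X U Q)"
proof (intro ext)
  fix V g p
  show "lift_op X U (op_comp P Q) V g p = op_comp (lift_op X U P) (lift_op X U Q) V g p"
  proof (cases "op_dom (times_C X) (U \<times> UNIV) V g")
    case True
    note Qg = end_sec_op_dom[OF Q True]
    have "(\<lambda>y. lift_op X U Q V g (y, snd p)) = Q (slice V (snd p)) (\<lambda>y. g (y, snd p))"
      by (simp add: lift_op_apply[OF True])
    then show ?thesis by (simp add: op_comp_def lift_op_apply[OF True] lift_op_apply[OF Qg])
  next
    case False
    then show ?thesis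
      using end_sec_ndom[OF op_comp_end_sec[OF charted_times_C[OF X] P Q] False] by (simp add: lift_op_def)
  qed
qed

lemma lift_op_mul_op:
  assumes X: "charted X"
  shows "lift_op X U (mul_op X U h) = mul_op (times_C X) (U \<times> UNIV) (\<lambda>p. h (fst p))"
proof (intro ext)
  fix V g p
  show "lift_op X U (mul_op X U h) V g p = mul_op (times_C X) (U \<times> UNIV) (\<lambda>p. h (fst p)) V g p"
    using op_dom_slice[OF X, of U V g "snd p"] 
    by (cases "op_dom (times_C X) (U \<times> UNIV) V g") (auto simp: lift_op_apply mul_op_def, simp add: lift_op_def)
qed

lemma lift_op_scal: "charted X \<Longrightarrow> lift_op X U (scal X U a) = scal (times_C X) (U \<times> UNIV) a"
  unfolding scal_def by (simp add: lift_op_mul_op) (rule arg_cong[where f="mul_op _ _"], auto simp: fres_def fun_eq_iff)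

text \<open>Derivatives in the directions of \<open>X\<close> are taken with \<open>t\<close> fixed,
  so the lifted field has the same coefficients, constant in \<open>t\<close>.\<close>

lemma lift_op_vector_field_chart:
  assumes X: "charted X" and U: "open U" and \<xi>: "\<xi> \<in> vector_fields X U" and c: "c \<in> atlas X"
  obtains a where "\<And>i. i < cdim X \<Longrightarrow> a i \<in> hol_sec X (U \<inter> fst c)"
    "\<And>V g p. op_dom (times_C X) (U \<times> UNIV) V g \<Longrightarrow> p \<in> V \<inter> fst c \<times> UNIV \<Longrightarrow> lift_op X U \<xi> V g p =
        (\<Sum>i<cdim X. a i (fst p) * coord_deriv (chart_C (cdim X) c) i g p)"
proof -
  obtain a where a: "\<And>i. i < cdim X \<Longrightarrow> a i \<in> hol_sec X (U \<inter> fst c)"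
    "\<And>W g x. op_dom X (U \<inter> fst c) W g \<Longrightarrow> x \<in> W \<Longrightarrow> \<xi> W g x = (\<Sum>i<cdim X. a i x * coord_deriv c i g x)"
    by (fact vector_field_coeffs[OF \<xi> c])
  have \<xi>e: "\<xi> \<in> end_sec X U" using \<xi> by (simp add: vector_fields_def)
  have "lift_op X U \<xi> V g p = (\<Sum>i<cdim X. a i (fst p) * coord_deriv (chart_C (cdim X) c) i g p)"
    if g: "op_dom (times_C X) (U \<times> UNIV) V g" and p: "p \<in> V \<inter> fst c \<times> UNIV" for V g p
  proof -
    obtain x t where xt: "p = (x, t)" by (cases p)
    let ?S = "slice V t" and ?gt = "\<lambda>y. g (y, t)"
    let ?S' = "?S \<inter> fst c"
    note d = op_dom_slice[OF X g, of t]
    have o: "open ?S'" "?S' \<subseteq> ?S" using d chart_open[OF X c] by (auto simp: op_dom_def)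
    have d': "op_dom X (U \<inter> fst c) ?S' (fres ?S' ?gt)"
      using op_dom_fres[OF X d o] d by (auto simp: op_dom_def)
    have x: "x \<in> ?S'" using p xt by (auto simp: slice_def)
    have "lift_op X U \<xi> V g p = \<xi> ?S ?gt x" by (simp add: lift_op_apply[OF g] xt)
    also have "\<dots> = \<xi> ?S' (fres ?S' ?gt) x" using end_sec_fres[OF \<xi>e d o] x by (simp add: fres_def)
    also have "\<dots> = (\<Sum>i<cdim X. a i x * coord_deriv c i (fres ?S' ?gt) x)" by (rule a(2)[OF d' x])
    also have "\<dots> = (\<Sum>i<cdim X. a i x * coord_deriv c i ?gt x)"
      using coord_deriv_cong[OF X c o(1), of x _ "fres ?S' ?gt" ?gt] x by (intro sum.cong) (auto simp: fres_def)
    also have "\<dots> = (\<Sum>i<cdim X. a i x * coord_deriv (chart_C (cdim X) c) i g p)"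
      unfolding xt using x by (intro sum.cong refl) (simp add: coord_deriv_chart_C[OF X c])
    finally show ?thesis by (simp add: xt)
  qed
  then show thesis using a(1) by (intro that)
qed

text \<open>By the local expression, holomorphy of the result is that of partial derivatives, and
  commutation with \<open>\<partial>\<^sub>t\<close> is that of mixed partial derivatives together
  with the independence of the coefficients from \<open>t\<close>.\<close>

lemma lift_op_vector_field:
  assumes X: "charted X" and U: "open U" and \<xi>: "\<xi> \<in> vector_fields X U"
  shows "lift_op X U \<xi> \<in> vector_fields (times_C X) (U \<times> UNIV)" (is ?vf)
    and "op_dom (times_C X) (U \<times> UNIV) V g \<Longrightarrow>
      lift_op X U \<xi> V (dt_op X (U \<times> UNIV) V g) = dt_op X (U \<times> UNIV) V (lift_op X U \<xi> V g)" (is "_ \<Longrightarrow> ?comm")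
proof -
  note T = charted_times_C[OF X]
  have \<xi>e: "\<xi> \<in> end_sec X U" using \<xi> by (simp add: vector_fields_def)
  have pull: "(\<lambda>p. h (fst p)) \<in> hol_sec (times_C X) ((U \<times> UNIV) \<inter> fst c \<times> UNIV)"
    if "h \<in> hol_sec X (U \<inter> fst c)" "c \<in> atlas X" for h c
    using hol_sec_times_C_pullback[OF X open_Int[OF U chart_open[OF X that(2)]] that(1)]
    by (simp add: Times_Int_Times)
  have oc: "open ((U \<times> UNIV) \<inter> fst c \<times> UNIV)" if "c \<in> atlas X" for c
    using U chart_open[OF X that] by (intro open_Int open_Times) auto
  have hol: "lift_op X U \<xi> V g \<in> hol_sec (times_C X) V" if g: "op_dom (times_C X) (U \<times> UNIV) V g" for V g
  proof (rule hol_sec_timesI[OF X])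
    show V: "open V" using g by (simp add: op_dom_def)
    show "lift_op X U \<xi> V g p = 0" if "p \<notin> V" for p by (rule lift_op_outside[OF X \<xi>e g that])
    fix c assume c: "c \<in> atlas X"
    let ?c = "chart_C (cdim X) c"
    obtain a where a: "\<And>i. i < cdim X \<Longrightarrow> a i \<in> hol_sec X (U \<inter> fst c)"
      "\<And>V g p. op_dom (times_C X) (U \<times> UNIV) V g \<Longrightarrow> p \<in> V \<inter> fst c \<times> UNIV \<Longrightarrow> lift_op X U \<xi> V g p =
        (\<Sum>i<cdim X. a i (fst p) * coord_deriv ?c i g p)"
      by (fact lift_op_vector_field_chart[OF X U \<xi> c])
    have "hol_in_chart (cdim (times_C X)) ?c V (\<lambda>p. \<Sum>i<cdim X. a i (fst p) * coord_deriv ?c i g p)"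
    proof (intro hol_in_chart_sum[OF T chart_C_atlas[OF c]] hol_in_chart_mult[OF T chart_C_atlas[OF c]])
      fix i assume "i \<in> {..<cdim X}"
      then have i: "i < cdim X" by simp
      have "hol_in_chart (cdim (times_C X)) ?c ((U \<times> UNIV) \<inter> fst c \<times> UNIV) (\<lambda>p. a i (fst p))"
        using pull[OF a(1)[OF i] c] hol_sec_iff[OF T oc[OF c]] chart_C_atlas[OF c] by blast
      then show "hol_in_chart (cdim (times_C X)) ?c V (\<lambda>p. a i (fst p))"
        by (rule hol_in_chart_mono[OF T chart_C_atlas[OF c]]) (use g in \<open>auto simp: op_dom_def\<close>)
      show "hol_in_chart (cdim (times_C X)) ?c V (coord_deriv ?c i g)"
        using hol_in_chart_coord_deriv[OF T chart_C_atlas[OF c] V, of g i] i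
          hol_sec_times_chart[OF X V _ c, of g] g by (simp add: op_dom_def)
    qed
    then show "\<exists>h. hol_in_chart (Suc (cdim X)) ?c V h \<and> (\<forall>p\<in>V \<inter> fst c \<times> UNIV. lift_op X U \<xi> V g p = h p)"
      using a(2)[OF g] by (intro exI[of _ "\<lambda>p. \<Sum>i<cdim X. a i (fst p) * coord_deriv ?c i g p"]) simp
  qed
  have le: "lift_op X U \<xi> \<in> end_sec (times_C X) (U \<times> UNIV)" by (rule lift_op_end_sec[OF X \<xi>e hol])
  show ?vf
  proof (rule vector_fieldsI[OF le])
    fix c' assume "c' \<in> atlas (times_C X)"
    then obtain c where c: "c \<in> atlas X" "c' = chart_C (cdim X) c" by (auto simp: atlas_times_C)
    let ?O = "(U \<times> UNIV) \<inter> fst c'"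
    have o: "open ?O" using oc[OF c(1)] c(2) by simp
    obtain a where a: "\<And>i. i < cdim X \<Longrightarrow> a i \<in> hol_sec X (U \<inter> fst c)"
      "\<And>V g p. op_dom (times_C X) (U \<times> UNIV) V g \<Longrightarrow> p \<in> V \<inter> fst c \<times> UNIV \<Longrightarrow> lift_op X U \<xi> V g p =
        (\<Sum>i<cdim X. a i (fst p) * coord_deriv c' i g p)"
      unfolding c(2) by (fact lift_op_vector_field_chart[OF X U \<xi> c(1)])
    show "\<exists>a. (\<forall>i<cdim (times_C X). a i \<in> hol_sec (times_C X) ?O) \<and>
     (\<forall>V g. op_dom (times_C X) ?O V g \<longrightarrow>
        (\<forall>x\<in>V. lift_op X U \<xi> V g x = (\<Sum>i<cdim (times_C X). a i x * coord_deriv c' i g x)))"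
    (* The coefficient in the direction of t is zero. *)
    proof (intro exI[of _ "\<lambda>i p. if i < cdim X then a i (fst p) else 0"] conjI allI impI ballI)
      fix i
      show "(\<lambda>p. if i < cdim X then a i (fst p) else 0) \<in> hol_sec (times_C X) ?O"
        using pull[OF a(1) c(1), of i] c(2) hol_sec_zero[OF T o] by (cases "i < cdim X") auto
    next
      fix V g p assume g: "op_dom (times_C X) ?O V g" and p: "p \<in> V"
      have g': "op_dom (times_C X) (U \<times> UNIV) V g" and p': "p \<in> V \<inter> fst c \<times> UNIV"
        using g p c(2) by (auto simp: op_dom_def)
      show "lift_op X U \<xi> V g p =
        (\<Sum>i<cdim (times_C X). (if i < cdim X then a i (fst p) else 0) * coord_deriv c' i g p)"
        using a(2)[OF g' p'] by simp
    qed
  qed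
  assume g: "op_dom (times_C X) (U \<times> UNIV) V g"
  have V: "open V" using g by (simp add: op_dom_def)
  note dg = end_sec_op_dom[OF dt_op_end_sec[OF X] g]
  note lg = end_sec_op_dom[OF le g]
  show ?comm
  proof
    fix p
    show "lift_op X U \<xi> V (dt_op X (U \<times> UNIV) V g) p = dt_op X (U \<times> UNIV) V (lift_op X U \<xi> V g) p"
    proof (cases "p \<in> V")
      case True
      obtain c where c: "c \<in> atlas X" "fst p \<in> fst c" using charted_cover[OF X] by blast
      let ?c = "chart_C (cdim X) c"
      note C = chart_C_atlas[OF c(1)]
      have p: "p \<in> V \<inter> fst c \<times> UNIV" "p \<in> V \<inter> fst ?c" using True c by (cases p, auto)+
      obtain a where "\<And>i. i < cdim X \<Longrightarrow> a i \<in> hol_sec X (U \<inter> fst c)"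
        and a: "\<And>V g p. op_dom (times_C X) (U \<times> UNIV) V g \<Longrightarrow> p \<in> V \<inter> fst c \<times> UNIV \<Longrightarrow> lift_op X U \<xi> V g p =
          (\<Sum>i<cdim X. a i (fst p) * coord_deriv ?c i g p)"
        by (fact lift_op_vector_field_chart[OF X U \<xi> c(1)])
      have hg: "hol_in_chart (cdim (times_C X)) ?c V g"
        using hol_sec_times_chart[OF X V _ c(1), of g] g by (simp add: op_dom_def)
      have mv: "coord_move ?c (cdim X) p w = (fst p, w)" for w
        using coord_move_chart_C_last[OF X c, of "snd p" w] by simp
      have "((\<lambda>w. coord_deriv ?c i g (fst p, w)) has_field_derivative
            coord_deriv ?c i (coord_deriv ?c (cdim X) g) p) (at (snd p))" if "i < cdim X" for i
        using coord_deriv_commute[OF T C V hg _ _ _ p(2), of i "cdim X"] that unfolding mv by simp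
      then have "((\<lambda>w. \<Sum>i<cdim X. a i (fst p) * coord_deriv ?c i g (fst p, w)) has_field_derivative
         (\<Sum>i<cdim X. a i (fst p) * coord_deriv ?c i (coord_deriv ?c (cdim X) g) p)) (at (snd p))"
        by (intro DERIV_sum DERIV_cmult) simp
      moreover have ev: "eventually (\<lambda>w. (\<Sum>i<cdim X. a i (fst p) * coord_deriv ?c i g (fst p, w)) =
          lift_op X U \<xi> V g (fst p, w)) (nhds (snd p))"
      proof -
        have "eventually (\<lambda>w. (fst p, w) \<in> V) (nhds (snd p))"
        proof -
          have "open ((\<lambda>w. (fst p, w)) -` V)" using V by (intro open_vimage) (auto intro: continuous_intros)
          from eventually_nhds_in_open[OF this] True show ?thesis by simp
        qed
        then show ?thesis by eventually_elim (use a[OF g] c in simp)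
      qed
      ultimately have "((\<lambda>w. lift_op X U \<xi> V g (fst p, w)) has_field_derivative
         (\<Sum>i<cdim X. a i (fst p) * coord_deriv ?c i (coord_deriv ?c (cdim X) g) p)) (at (snd p))"
        unfolding DERIV_cong_ev[OF refl ev refl] by blast
      then have "dt_op X (U \<times> UNIV) V (lift_op X U \<xi> V g) p =
         (\<Sum>i<cdim X. a i (fst p) * coord_deriv ?c i (coord_deriv ?c (cdim X) g) p)"
        using dt_op_eq[OF lg True] by (simp add: DERIV_imp_deriv)
      also have "\<dots> = (\<Sum>i<cdim X. a i (fst p) * coord_deriv ?c i (dt_op X (U \<times> UNIV) V g) p)"
      proof (intro sum.cong refl arg_cong2[where f="(*)"])
        fix i assume "i \<in> {..<cdim X}"
        then show "coord_deriv ?c i (coord_deriv ?c (cdim X) g) p = coord_deriv ?c i (dt_op X (U \<times> UNIV) V g) p"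
          by (intro coord_deriv_cong[OF T C V p(2)]) (auto simp: dt_op_chart[OF X c(1) g])
      qed
      also have "\<dots> = lift_op X U \<xi> V (dt_op X (U \<times> UNIV) V g) p" by (rule a[OF dg p(1), symmetric])
      finally show ?thesis by simp
    next
      case False
      then show ?thesis using lift_op_outside[OF X \<xi>e dg] by (simp add: dt_op_def fres_def)
    qed
  qed
qed


lemma dt_op_lin:
  assumes X: "charted X" and g: "op_dom (times_C X) W V g" and h: "op_dom (times_C X) W V h"
  shows "dt_op X W V (\<lambda>p. g p + h p) = (\<lambda>p. dt_op X W V g p + dt_op X W V h p)"
  using end_sec_lin[OF dt_op_end_sec[OF X] g h, of 1] by simp

lemma op_dom_tpow:
  assumes X: "charted X" and g: "op_dom (times_C X) W V g"
  shows "op_dom (times_C X) W V (\<lambda>p. snd p ^ k * g p)"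
proof (induction k)
  case 0 then show ?case using g by simp
next
  case (Suc k)
  have V: "open V" using g by (simp add: op_dom_def)
  have d: "op_dom (times_C X) V V (\<lambda>p. snd p ^ k * g p)" using Suc by (auto simp: op_dom_def)
  have "op_dom (times_C X) V V (t_op X V V (\<lambda>p. snd p ^ k * g p))"
    by (rule end_sec_op_dom[OF D_sec_end_sec[OF t_op_D_sec[OF X V]] d])
  then show ?case using d g by (auto simp: t_op_apply op_dom_def mult.assoc)
qed

lemma lift_op_tpow:
  assumes X: "charted X" and P: "P \<in> end_sec X U" and g: "op_dom (times_C X) (U \<times> UNIV) V g"
  shows "lift_op X U P V (\<lambda>p. snd p ^ k * g p) = (\<lambda>p. snd p ^ k * lift_op X U P V g p)"
proof
  fix p :: "'a \<times> complex"
  show "lift_op X U P V (\<lambda>p. snd p ^ k * g p) p = snd p ^ k * lift_op X U P V g p"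
    using end_sec_scale[OF X P op_dom_slice[OF X g], of "snd p" "snd p ^ k"]
    by (simp add: lift_op_apply[OF op_dom_tpow[OF X g]] lift_op_apply[OF g])
qed

text \<open>For an arbitrary endomorphism of the structure sheaf, applying it for each
  \<open>t\<close> could destroy holomorphy in \<open>t\<close>. For operators generated by
  functions and vector fields it does not, and commutation with \<open>\<partial>\<^sub>t\<close> is
  proved along the same induction.\<close>

lemma lift_op_has_order:
  assumes X: "charted X" and U: "open U"
  shows "has_order X U k P \<Longrightarrow> has_order (times_C X) (U \<times> UNIV) k (lift_op X U P) \<and>
    (\<forall>V g. op_dom (times_C X) (U \<times> UNIV) V g \<longrightarrow>
      lift_op X U P V (dt_op X (U \<times> UNIV) V g) = dt_op X (U \<times> UNIV) V (lift_op X U P V g))"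
proof (induction rule: has_order.induct)
  note T = charted_times_C[OF X]
  have UC: "open (U \<times> (UNIV :: complex set))" using U by (intro open_Times) auto
  note E = has_order_end_sec[OF T UC]
  { case (mult h)
    have e: "mul_op X U h \<in> end_sec X U" by (rule mul_op_end_sec[OF X U mult])
    have o: "has_order (times_C X) (U \<times> UNIV) 0 (lift_op X U (mul_op X U h))"
      unfolding lift_op_mul_op[OF X] by (rule has_order.mult[OF hol_sec_times_C_pullback[OF X U mult]])
    have la: "lift_op X U (mul_op X U h) V g = (\<lambda>p. h (fst p) * g p)" if "op_dom (times_C X) (U \<times> UNIV) V g" for V g
      using that unfolding lift_op_mul_op[OF X] by (simp add: mul_op_def)
    have "lift_op X U (mul_op X U h) V (dt_op X (U \<times> UNIV) V g) p = dt_op X (U \<times> UNIV) V (lift_op X U (mul_op X U h) V g) p"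
      if g: "op_dom (times_C X) (U \<times> UNIV) V g" for V g p
    proof (cases "p \<in> V")
      case True
      note dg = end_sec_op_dom[OF dt_op_end_sec[OF X] g] and lg = end_sec_op_dom[OF E[OF o] g]
      have "(\<lambda>t. g (fst p, t)) field_differentiable at (snd p)"
        using hol_sec_times_field_differentiable[OF X, of V g "fst p" "snd p"] g True by (auto simp: op_dom_def)
      then show ?thesis using dt_op_eq[OF lg True] dt_op_eq[OF g True]
        unfolding la[OF g] la[OF dg] by simp
    next
      case False
      then show ?thesis unfolding la[OF g] la[OF end_sec_op_dom[OF dt_op_end_sec[OF X] g]]
        by (simp add: dt_op_def fres_def)
    qed
    then show ?case using o by blast }
  { case (vf \<xi>)
    show ?case
    proof (intro conjI allI impI)
      show "has_order (times_C X) (U \<times> UNIV) 1 (lift_op X U \<xi>)"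
        by (rule has_order.vf[OF lift_op_vector_field(1)[OF X U vf]])
    qed (rule lift_op_vector_field(2)[OF X U vf]) }
  { case (add k P Q)
    have o: "has_order (times_C X) (U \<times> UNIV) k (lift_op X U P)" "has_order (times_C X) (U \<times> UNIV) k (lift_op X U Q)"
      using add by auto
    show ?case
    proof (intro conjI allI impI)
      show "has_order (times_C X) (U \<times> UNIV) k (lift_op X U (op_add P Q))"
        unfolding lift_op_add by (rule has_order.add[OF o])
      fix V g assume g: "op_dom (times_C X) (U \<times> UNIV) V g"
      show "lift_op X U (op_add P Q) V (dt_op X (U \<times> UNIV) V g) = dt_op X (U \<times> UNIV) V (lift_op X U (op_add P Q) V g)"
        using add.IH g dt_op_lin[OF X end_sec_op_dom[OF E[OF o(1)] g] end_sec_op_dom[OF E[OF o(2)] g]]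
        unfolding lift_op_add unfolding op_add_def by simp
    qed }
  { case (comp k P l Q)
    have o: "has_order (times_C X) (U \<times> UNIV) k (lift_op X U P)" "has_order (times_C X) (U \<times> UNIV) l (lift_op X U Q)"
      using comp by auto
    note lc = lift_op_comp[OF X E[OF o(1)] E[OF o(2)]]
    show ?case
    proof (intro conjI allI impI)
      show "has_order (times_C X) (U \<times> UNIV) (k + l) (lift_op X U (op_comp P Q))"
        unfolding lc by (rule has_order.comp[OF o])
      fix V g assume g: "op_dom (times_C X) (U \<times> UNIV) V g"
      show "lift_op X U (op_comp P Q) V (dt_op X (U \<times> UNIV) V g) = dt_op X (U \<times> UNIV) V (lift_op X U (op_comp P Q) V g)"
        using comp.IH g end_sec_op_dom[OF E[OF o(2)] g] unfolding lc unfolding op_comp_def by simp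
    qed }
  { case (mono k P l)
    then show ?case using has_order.mono by blast }
qed

lemma op_res_lift_op:
  fixes X :: "('a::topological_space) cmfd"
  assumes "V \<subseteq> U"
  shows "op_res (V \<times> UNIV) (lift_op X U P) = lift_op X V (op_res V P)"
proof (intro ext)
  fix W g and p :: "'a \<times> complex"
  have "op_dom (times_C X) (V \<times> UNIV) W g \<longleftrightarrow> W \<subseteq> V \<times> UNIV \<and> op_dom (times_C X) (U \<times> UNIV) W g"
    using assms by (auto simp: op_dom_def)
  moreover have "{y. (y, snd p) \<in> W} \<subseteq> V" if "W \<subseteq> V \<times> UNIV" using that by auto
  ultimately show "op_res (V \<times> UNIV) (lift_op X U P) W g p = lift_op X V (op_res V P) W g p"
    by (auto simp: op_res_def lift_op_def)
qed

lemma fres_Int_eqI: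
  assumes "\<And>p. p \<in> V \<Longrightarrow> \<exists>W. p \<in> W \<and> fres W g = fres W h" "\<And>p. p \<notin> V \<Longrightarrow> g p = h p"
  shows "g = h"
proof
  fix p show "g p = h p"
  proof (cases "p \<in> V")
    case True
    then obtain W where "p \<in> W" "fres W g = fres W h" using assms(1) by blast
    then show ?thesis by (metis fres_def)
  qed (rule assms(2))
qed

text \<open>Differential operators are generated by functions and vector fields only locally on
  \<open>X\<close>; both properties can be checked over cylinders on small open sets.\<close>

lemma lift_op_local:
  assumes X: "charted X" and U: "open U" and P: "P \<in> D_sec X U"
  shows "lift_op X U P \<in> D_sec (times_C X) (U \<times> UNIV)"
    and "op_dom (times_C X) (U \<times> UNIV) V g \<Longrightarrow>
      lift_op X U P V (dt_op X (U \<times> UNIV) V g) = dt_op X (U \<times> UNIV) V (lift_op X U P V g)"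
proof -
  note T = charted_times_C[OF X]
  have Pe: "P \<in> end_sec X U" by (rule D_sec_end_sec[OF P])
  have loc: "\<exists>V0 k. open V0 \<and> x \<in> V0 \<and> V0 \<subseteq> U \<and> has_order X V0 k (op_res V0 P)" if "x \<in> U" for x
    using P that by (simp add: D_sec_def)
  have res: "fres (V \<inter> V0 \<times> UNIV) (lift_op X U P V g) = lift_op X V0 (op_res V0 P) (V \<inter> V0 \<times> UNIV) (fres (V \<inter> V0 \<times> UNIV) g)"
    if g: "op_dom (times_C X) (U \<times> UNIV) V g" and V0: "open V0" "V0 \<subseteq> U" for V g V0
  proof -
    have o: "open (V \<inter> V0 \<times> UNIV)" "V \<inter> V0 \<times> UNIV \<subseteq> V"
      using g V0 by (auto simp: op_dom_def intro!: open_Int open_Times)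
    have "lift_op X V0 (op_res V0 P) (V \<inter> V0 \<times> UNIV) (fres (V \<inter> V0 \<times> UNIV) g) =
      lift_op X U P (V \<inter> V0 \<times> UNIV) (fres (V \<inter> V0 \<times> UNIV) g)"
      unfolding op_res_lift_op[OF V0(2), symmetric] by (simp add: op_res_def)
    then show ?thesis using lift_op_fres[OF X Pe g o] by simp
  qed
  have dres: "op_dom (times_C X) (V0 \<times> UNIV) (V \<inter> V0 \<times> UNIV) (fres (V \<inter> V0 \<times> UNIV) g)"
    if g: "op_dom (times_C X) (U \<times> UNIV) V g" and V0: "open V0" "V0 \<subseteq> U" for V g V0
  proof -
    have o: "open (V \<inter> V0 \<times> UNIV)" "V \<inter> V0 \<times> UNIV \<subseteq> V"
      using g V0 by (auto simp: op_dom_def intro!: open_Int open_Times)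
    show ?thesis using op_dom_fres[OF T g o] by (simp add: op_dom_def)
  qed
  have hol: "lift_op X U P V g \<in> hol_sec (times_C X) V" if g: "op_dom (times_C X) (U \<times> UNIV) V g" for V g
  proof (rule hol_sec_local[OF T])
    show V: "open V" using g by (simp add: op_dom_def)
    show "lift_op X U P V g p = 0" if "p \<notin> V" for p by (rule lift_op_outside[OF X Pe g that])
    fix p assume p: "p \<in> V"
    then have "fst p \<in> U" using g by (auto simp: op_dom_def)
    then obtain V0 k where V0: "open V0" "fst p \<in> V0" "V0 \<subseteq> U" "has_order X V0 k (op_res V0 P)" using loc by blast
    have oV0: "open (V0 \<times> (UNIV::complex set))" using V0(1) by (intro open_Times) auto
    have "lift_op X V0 (op_res V0 P) (V \<inter> V0 \<times> UNIV) (fres (V \<inter> V0 \<times> UNIV) g) \<in> hol_sec (times_C X) (V \<inter> V0 \<times> UNIV)"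
      by (rule end_sec_hol[OF has_order_end_sec[OF T oV0 conjunct1[OF lift_op_has_order[OF X V0(1,4)]]] dres[OF g V0(1,3)]])
    then show "\<exists>U'. open U' \<and> p \<in> U' \<and> U' \<subseteq> V \<and> fres U' (lift_op X U P V g) \<in> hol_sec (times_C X) U'"
      unfolding res[OF g V0(1,3), symmetric] using V oV0 p V0(2)
      by (intro exI[of _ "V \<inter> V0 \<times> UNIV"]) (auto simp: mem_Times_iff)
  qed
  have le: "lift_op X U P \<in> end_sec (times_C X) (U \<times> UNIV)" by (rule lift_op_end_sec[OF X Pe hol])
  have "\<exists>W k. open W \<and> p \<in> W \<and> W \<subseteq> U \<times> UNIV \<and> has_order (times_C X) W k (op_res W (lift_op X U P))"
    if p: "p \<in> U \<times> UNIV" for p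
  proof -
    have "fst p \<in> U" using p by auto
    then obtain V0 k where V0: "open V0" "fst p \<in> V0" "V0 \<subseteq> U" "has_order X V0 k (op_res V0 P)" using loc by blast
    show ?thesis
      using conjunct1[OF lift_op_has_order[OF X V0(1,4)]] V0 op_res_lift_op[OF V0(3), of X P]
      by (intro exI[of _ "V0 \<times> UNIV"] exI[of _ k]) (auto simp: mem_Times_iff intro: open_Times)
  qed
  then show "lift_op X U P \<in> D_sec (times_C X) (U \<times> UNIV)"
    using le by (simp only: D_sec_def mem_Collect_eq) blast
  assume g: "op_dom (times_C X) (U \<times> UNIV) V g"
  note dg = end_sec_op_dom[OF dt_op_end_sec[OF X] g]
  note lg = end_sec_op_dom[OF le g]
  show "lift_op X U P V (dt_op X (U \<times> UNIV) V g) = dt_op X (U \<times> UNIV) V (lift_op X U P V g)"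
  proof (rule fres_Int_eqI[of V])
    fix p assume p: "p \<in> V"
    then have "fst p \<in> U" using g by (auto simp: op_dom_def)
    then obtain V0 k where V0: "open V0" "fst p \<in> V0" "V0 \<subseteq> U" "has_order X V0 k (op_res V0 P)" using loc by blast
    let ?W = "V \<inter> V0 \<times> UNIV"
    have o: "open ?W" "?W \<subseteq> V" using g V0 by (auto simp: op_dom_def intro!: open_Int open_Times)
    have dt: "dt_op X (U \<times> UNIV) ?W h = dt_op X (V0 \<times> UNIV) ?W h" for h
      using V0(3) by (auto simp: dt_op_def op_dom_def)
    have "fres ?W (lift_op X U P V (dt_op X (U \<times> UNIV) V g)) =
      lift_op X V0 (op_res V0 P) ?W (fres ?W (dt_op X (U \<times> UNIV) V g))" by (rule res[OF dg V0(1,3)])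
    also have "\<dots> = lift_op X V0 (op_res V0 P) ?W (dt_op X (V0 \<times> UNIV) ?W (fres ?W g))"
      using end_sec_fres[OF dt_op_end_sec[OF X] g o] dt by simp
    also have "\<dots> = dt_op X (V0 \<times> UNIV) ?W (lift_op X V0 (op_res V0 P) ?W (fres ?W g))"
      using conjunct2[OF lift_op_has_order[OF X V0(1,4)]] dres[OF g V0(1,3)] by blast
    also have "\<dots> = dt_op X (U \<times> UNIV) ?W (fres ?W (lift_op X U P V g))"
      using res[OF g V0(1,3)] dt by simp
    also have "\<dots> = fres ?W (dt_op X (U \<times> UNIV) V (lift_op X U P V g))"
      by (rule end_sec_fres[OF dt_op_end_sec[OF X] lg o])
    finally show "\<exists>W. p \<in> W \<and> fres W (lift_op X U P V (dt_op X (U \<times> UNIV) V g)) =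
       fres W (dt_op X (U \<times> UNIV) V (lift_op X U P V g))"
      using p V0(2) by (intro exI[of _ ?W]) (auto simp: mem_Times_iff)
  next
    fix p assume "p \<notin> V"
    then show "lift_op X U P V (dt_op X (U \<times> UNIV) V g) p = dt_op X (U \<times> UNIV) V (lift_op X U P V g) p"
      using lift_op_outside[OF X Pe dg] by (simp add: dt_op_def fres_def)
  qed
qed

text \<open>Nonpositive powers of the ideal of \<open>t = 0\<close> are the whole structure sheaf,
  so only natural exponents have to be tested.\<close>

lemma VD_sec_zeroI:
  assumes "P \<in> D_sec (times_C X) W"
    and "\<And>V k h. op_dom (times_C X) W V h \<Longrightarrow>
      \<exists>h'\<in>hol_sec (times_C X) V. P V (\<lambda>p. snd p ^ k * h p) = (\<lambda>p. snd p ^ k * h' p)"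
  shows "P \<in> VD_sec X 0 W"
  unfolding VD_sec_def
proof (intro CollectI conjI allI impI ballI assms(1))
  fix V j g assume V: "open V \<and> V \<subseteq> W" and "g \<in> t_ideal_power X j V"
  then obtain h where h: "h \<in> hol_sec (times_C X) V" "g = (\<lambda>p. snd p ^ nat j * h p)"
    by (auto simp: t_ideal_power_def)
  then have "op_dom (times_C X) W V h" using V by (simp add: op_dom_def)
  from assms(2)[OF this, of "nat j"] h(2) show "P V g \<in> t_ideal_power X (j + 0) V"
    by (auto simp: t_ideal_power_def)
qed

text \<open>For a lifted operator \<open>t\<close> is a constant, so it commutes with
  \<open>t\<^sup>k\<close>.\<close>

lemma lift_op_VD_sec:
  assumes X: "charted X" and U: "open U" and P: "P \<in> D_sec X U"
  shows "lift_op X U P \<in> VD_sec X 0 (U \<times> UNIV)"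
proof (rule VD_sec_zeroI[OF lift_op_local(1)[OF X U P]])
  fix V k h assume h: "op_dom (times_C X) (U \<times> UNIV) V h"
  show "\<exists>h'\<in>hol_sec (times_C X) V. lift_op X U P V (\<lambda>p. snd p ^ k * h p) = (\<lambda>p. snd p ^ k * h' p)"
    using lift_op_tpow[OF X D_sec_end_sec[OF P] h] end_sec_hol[OF D_sec_end_sec[OF lift_op_local(1)[OF X U P]] h]
    by blast
qed

lemma scal_VD_sec:
  assumes X: "charted X" and W: "open W"
  shows "scal (times_C X) W a \<in> VD_sec X 0 W"
proof (rule VD_sec_zeroI[OF scal_D_sec[OF charted_times_C[OF X] W]])
  fix V k h assume h: "op_dom (times_C X) W V h"
  show "\<exists>h'\<in>hol_sec (times_C X) V. scal (times_C X) W a V (\<lambda>p. snd p ^ k * h p) = (\<lambda>p. snd p ^ k * h' p)"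
    using op_dom_tpow[OF X h, of k] h
      end_sec_hol[OF D_sec_end_sec[OF scal_D_sec[OF charted_times_C[OF X] W, of a]] h]
    by (intro bexI[of _ "\<lambda>p. a * h p"]) (auto simp: scal_apply)
qed

text \<open>With \<open>-\<partial>\<^sub>t t\<close> as a single operator, additivity, linearity and compatibility with restriction of
  the action of \<open>s\<close> are instances of the module axioms.\<close>

definition s_op :: "('a::topological_space) cmfd \<Rightarrow> ('a \<times> complex) set \<Rightarrow> ('a \<times> complex) dop" where
  "s_op X W = op_comp (scal (times_C X) W (-1)) (op_comp (dt_op X W) (t_op X W))"

lemma s_op_D_sec:
  assumes X: "charted X" and W: "open W"
  shows "s_op X W \<in> D_sec (times_C X) W"
proof (rule has_order_D_sec[OF charted_times_C[OF X] W])
  show "has_order (times_C X) W (0 + (1 + 0)) (s_op X W)"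
    unfolding s_op_def scal_def t_op_def
    by (intro has_order.comp has_order.mult has_order.vf hol_sec_const charted_times_C X W dt_op_vector_field hol_sec_snd)
qed

lemma s_op_apply:
  assumes X: "charted X" and g: "op_dom (times_C X) W V g"
  shows "s_op X W V g = (\<lambda>p. - dt_op X W V (\<lambda>p. snd p * g p) p)"
proof -
  have "op_dom (times_C X) W V (\<lambda>p. snd p * g p)" using op_dom_tpow[OF X g, of 1] by simp
  from end_sec_op_dom[OF dt_op_end_sec[OF X] this] show ?thesis
    using g by (simp add: s_op_def op_comp_def t_op_apply scal_apply)
qed

text \<open>Because \<open>-\<partial>\<^sub>t t (t\<^sup>k h) = t\<^sup>k (-(k + 1) h - t
  \<partial>\<^sub>t h)\<close>.\<close>

lemma s_op_VD_sec:
  assumes X: "charted X" and W: "open W"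
  shows "s_op X W \<in> VD_sec X 0 W"
proof (rule VD_sec_zeroI[OF s_op_D_sec[OF X W]])
  fix V k h assume h: "op_dom (times_C X) W V h"
  note T = charted_times_C[OF X]
  let ?h = "\<lambda>p. - (of_nat (Suc k) * h p + snd p * dt_op X W V h p)"
  note dh = end_sec_op_dom[OF dt_op_end_sec[OF X] h]
  have V: "open V" using h by (simp add: op_dom_def)
  have "op_dom (times_C X) W V (\<lambda>p. snd p * dt_op X W V h p)" using op_dom_tpow[OF X dh, of 1] by simp
  then have "(\<lambda>p. (-1) * (\<lambda>p. of_nat (Suc k) * h p + snd p * dt_op X W V h p) p + 0) \<in> hol_sec (times_C X) V"
    using h hol_sec_zero[OF T V] by (intro hol_sec_lin T V) (auto simp: op_dom_def)
  then have hol: "?h \<in> hol_sec (times_C X) V" by (simp add: algebra_simps)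
  have d: "op_dom (times_C X) W V (\<lambda>p. snd p * (snd p ^ k * h p))" using op_dom_tpow[OF X h, of "Suc k"] by (simp add: mult.assoc)
  have "s_op X W V (\<lambda>p. snd p ^ k * h p) p = snd p ^ k * ?h p" for p
  proof (cases "p \<in> V")
    case True
    have "(\<lambda>t. h (fst p, t)) field_differentiable at (snd p)"
      using hol_sec_times_field_differentiable[OF X, of V h "fst p" "snd p"] h True by (auto simp: op_dom_def)
    then have "((\<lambda>t. t * (t ^ k * h (fst p, t))) has_field_derivative
        (of_nat (Suc k) * snd p ^ k) * h (fst p, snd p) + snd p ^ Suc k * deriv (\<lambda>t. h (fst p, t)) (snd p)) (at (snd p))"
      unfolding mult.assoc[symmetric] power_Suc[symmetric]
      by (intro derivative_eq_intros) (auto simp: DERIV_deriv_iff_field_differentiable)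
    then have "dt_op X W V (\<lambda>p. snd p * (snd p ^ k * h p)) p =
        (of_nat (Suc k) * snd p ^ k) * h p + snd p ^ Suc k * dt_op X W V h p"
      using dt_op_eq[OF d True] dt_op_eq[OF h True] by (simp add: DERIV_imp_deriv)
    then show ?thesis using s_op_apply[OF X op_dom_tpow[OF X h, of k]] by (simp add: algebra_simps)
  next
    case False
    then have "h p = 0" using h by (auto simp: op_dom_def intro: hol_sec_outside)
    then show ?thesis using s_op_apply[OF X op_dom_tpow[OF X h, of k]] False
      by (simp add: dt_op_def fres_def)
  qed
  then show "\<exists>h'\<in>hol_sec (times_C X) V. s_op X W V (\<lambda>p. snd p ^ k * h p) = (\<lambda>p. snd p ^ k * h' p)"
    using hol by (intro bexI[of _ ?h]) auto
qed

lemma op_res_s_op: "V \<subseteq> W \<Longrightarrow> op_res V (s_op X W) = s_op X V"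
  by (simp add: s_op_def op_res_op_comp op_res_scal op_res_dt_op op_res_t_op)

text \<open>The \<open>D\<^sub>X\<close>-linearity of \<open>s\<close> on the direct image.\<close>

lemma s_op_lift_op:
  assumes X: "charted X" and U: "open U" and P: "P \<in> D_sec X U"
  shows "op_comp (s_op X (U \<times> UNIV)) (lift_op X U P) = op_comp (lift_op X U P) (s_op X (U \<times> UNIV))"
proof (rule end_sec_eqI)
  note T = charted_times_C[OF X]
  have UC: "open (U \<times> (UNIV :: complex set))" using U by (intro open_Times) auto
  have s: "s_op X (U \<times> UNIV) \<in> end_sec (times_C X) (U \<times> UNIV)" by (rule D_sec_end_sec[OF s_op_D_sec[OF X UC]])
  have l: "lift_op X U P \<in> end_sec (times_C X) (U \<times> UNIV)" by (rule D_sec_end_sec[OF lift_op_local(1)[OF X U P]])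
  show "op_comp (s_op X (U \<times> UNIV)) (lift_op X U P) \<in> end_sec (times_C X) (U \<times> UNIV)"
    "op_comp (lift_op X U P) (s_op X (U \<times> UNIV)) \<in> end_sec (times_C X) (U \<times> UNIV)"
    by (intro op_comp_end_sec T s l)+
  fix V g assume g: "op_dom (times_C X) (U \<times> UNIV) V g"
  have tg: "op_dom (times_C X) (U \<times> UNIV) V (\<lambda>p. snd p * g p)" using op_dom_tpow[OF X g, of 1] by simp
  have "lift_op X U P V (\<lambda>p. (-1) * dt_op X (U \<times> UNIV) V (\<lambda>p. snd p * g p) p) =
     (\<lambda>p. (-1) * dt_op X (U \<times> UNIV) V (\<lambda>p. snd p * lift_op X U P V g p) p)"
    unfolding end_sec_scale[OF T l end_sec_op_dom[OF dt_op_end_sec[OF X] tg]] lift_op_local(2)[OF X U P tg]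
    using lift_op_tpow[OF X D_sec_end_sec[OF P] g, of 1] by simp
  then show "op_comp (s_op X (U \<times> UNIV)) (lift_op X U P) V g = op_comp (lift_op X U P) (s_op X (U \<times> UNIV)) V g"
    by (simp add: op_comp_def s_op_apply[OF X g] s_op_apply[OF X end_sec_op_dom[OF l g]])
qed


lemma has_order_op_res:
  assumes X: "charted X" and U: "open U" and V: "open V" "V \<subseteq> U"
  shows "has_order X U k P \<Longrightarrow> has_order X V k (op_res V P)"
proof (induction rule: has_order.induct)
  case (mult h)
  then show ?case unfolding op_res_mul_op[OF V(2)] by (intro has_order.mult hol_sec_fres[OF X V(1) U V(2)])
next
  case (vf \<xi>)
  then show ?case by (intro has_order.vf op_res_vector_field[OF X U _ V])
next
  case (add k P Q)
  then show ?case unfolding op_res_op_add by (intro has_order.add)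
next
  case (comp k P l Q)
  then show ?case unfolding op_res_op_comp by (intro has_order.comp)
next
  case (mono k P l)
  show ?case by (rule has_order.mono[OF mono.IH mono.hyps(2)])
qed

lemma op_res_D_sec:
  assumes X: "charted X" and P: "P \<in> D_sec X U" and V: "open V" "V \<subseteq> U"
  shows "op_res V P \<in> D_sec X V"
proof -
  have loc: "\<exists>W k. open W \<and> x \<in> W \<and> W \<subseteq> U \<and> has_order X W k (op_res W P)" if "x \<in> U" for x
    using P that by (simp add: D_sec_def)
  have "\<exists>W k. open W \<and> x \<in> W \<and> W \<subseteq> V \<and> has_order X W k (op_res W (op_res V P))" if x: "x \<in> V" for x
  proof -
    have "x \<in> U" using x V(2) by blast
    from loc[OF this] obtain W k where W: "open W" "x \<in> W" "W \<subseteq> U" "has_order X W k (op_res W P)"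
      by (elim exE conjE)
    have o: "open (W \<inter> V)" using W V by auto
    have "has_order X (W \<inter> V) k (op_res (W \<inter> V) (op_res W P))"
      by (rule has_order_op_res[OF X W(1) o _ W(4)]) simp
    moreover have "op_res (W \<inter> V) (op_res W P) = op_res (W \<inter> V) (op_res V P)"
      by (auto simp: op_res_def fun_eq_iff)
    ultimately show ?thesis using W V x by (intro exI[of _ "W \<inter> V"] exI[of _ k]) auto
  qed
  then show ?thesis using op_res_end_sec[OF D_sec_end_sec[OF P] V] by (simp add: D_sec_def)
qed

section \<open>Sheaves of modules over the sheaf of differential operators\<close>

context left_module
begin

lemma smult_zero_right: "a \<in> carrier R \<Longrightarrow> a \<odot>\<^bsub>M\<^esub> \<zero>\<^bsub>M\<^esub> = \<zero>\<^bsub>M\<^esub>"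
  using smult_r_distr[of a "\<zero>\<^bsub>M\<^esub>" "\<zero>\<^bsub>M\<^esub>"] smult_closed[of a "\<zero>\<^bsub>M\<^esub>"]
  by (simp add: M.add.l_cancel_one')

lemma smult_zero_left: "x \<in> carrier M \<Longrightarrow> \<zero>\<^bsub>R\<^esub> \<odot>\<^bsub>M\<^esub> x = \<zero>\<^bsub>M\<^esub>"
  using smult_l_distr[of "\<zero>\<^bsub>R\<^esub>" "\<zero>\<^bsub>R\<^esub>" x] smult_closed[of "\<zero>\<^bsub>R\<^esub>" x]
  by (simp add: M.add.l_cancel_one')

end

lemma D_ring_simps [simp]:
  "carrier (D_ring X U) = D_sec X U" "mult (D_ring X U) = op_comp" "one (D_ring X U) = op_id X U"
  "zero (D_ring X U) = (\<lambda>V g x. 0)" "add (D_ring X U) = op_add"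
  by (simp_all add: D_ring_def op_ring_def)

text \<open>Pointwise premises; equality of sections is tested on a neighbourhood of each point
  instead of on a cover.\<close>

lemma module_sheafI:
  assumes left_module_sect: "\<And>U. open U \<Longrightarrow> left_module (R U) (sect E U)"
    and r1: "\<And>U V m. open U \<Longrightarrow> open V \<Longrightarrow> V \<subseteq> U \<Longrightarrow> m \<in> carrier (sect E U) \<Longrightarrow> restr E U V m \<in> carrier (sect E V)"
    and r2: "\<And>U V m m'. open U \<Longrightarrow> open V \<Longrightarrow> V \<subseteq> U \<Longrightarrow> m \<in> carrier (sect E U) \<Longrightarrow> m' \<in> carrier (sect E U) \<Longrightarrow>
      restr E U V (m \<oplus>\<^bsub>sect E U\<^esub> m') = restr E U V m \<oplus>\<^bsub>sect E V\<^esub> restr E U V m'"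
    and r3: "\<And>U V P m. open U \<Longrightarrow> open V \<Longrightarrow> V \<subseteq> U \<Longrightarrow> P \<in> carrier (R U) \<Longrightarrow> m \<in> carrier (sect E U) \<Longrightarrow>
      restr E U V (P \<odot>\<^bsub>sect E U\<^esub> m) = op_res V P \<odot>\<^bsub>sect E V\<^esub> restr E U V m"
    and r4: "\<And>U m. open U \<Longrightarrow> m \<in> carrier (sect E U) \<Longrightarrow> restr E U U m = m"
    and r5: "\<And>U V W m. open U \<Longrightarrow> open V \<Longrightarrow> open W \<Longrightarrow> W \<subseteq> V \<Longrightarrow> V \<subseteq> U \<Longrightarrow> m \<in> carrier (sect E U) \<Longrightarrow>
      restr E V W (restr E U V m) = restr E U W m"
    and sep: "\<And>U m m'. open U \<Longrightarrow> m \<in> carrier (sect E U) \<Longrightarrow> m' \<in> carrier (sect E U) \<Longrightarrow>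
      (\<And>x. x \<in> U \<Longrightarrow> \<exists>V. open V \<and> x \<in> V \<and> V \<subseteq> U \<and> restr E U V m = restr E U V m') \<Longrightarrow> m = m'"
    and glue: "\<And>\<U> \<sigma>. (\<And>V. V \<in> \<U> \<Longrightarrow> open V) \<Longrightarrow> (\<And>V. V \<in> \<U> \<Longrightarrow> \<sigma> V \<in> carrier (sect E V)) \<Longrightarrow>
      (\<And>V W. V \<in> \<U> \<Longrightarrow> W \<in> \<U> \<Longrightarrow> restr E V (V \<inter> W) (\<sigma> V) = restr E W (V \<inter> W) (\<sigma> W)) \<Longrightarrow>
      \<exists>m\<in>carrier (sect E (\<Union>\<U>)). \<forall>V\<in>\<U>. restr E (\<Union>\<U>) V m = \<sigma> V"
  shows "module_sheaf R E"
proof -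
  have sep': "m = m'" if o: "\<forall>V\<in>\<U>. open V" and m: "m \<in> carrier (sect E (\<Union>\<U>))" "m' \<in> carrier (sect E (\<Union>\<U>))"
    and eq: "\<forall>V\<in>\<U>. restr E (\<Union>\<U>) V m = restr E (\<Union>\<U>) V m'" for \<U> m m'
  proof (rule sep[OF _ m])
    show "open (\<Union>\<U>)" using o by blast
    fix x assume "x \<in> \<Union>\<U>"
    then obtain V where "V \<in> \<U>" "x \<in> V" by blast
    then show "\<exists>V. open V \<and> x \<in> V \<and> V \<subseteq> \<Union>\<U> \<and> restr E (\<Union>\<U>) V m = restr E (\<Union>\<U>) V m'"
      using o eq by (intro exI[of _ V]) auto
  qed
  have glue': "\<exists>m\<in>carrier (sect E (\<Union>\<U>)). \<forall>V\<in>\<U>. restr E (\<Union>\<U>) V m = \<sigma> V"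
    if o: "\<forall>V\<in>\<U>. open V" and s: "(\<forall>V\<in>\<U>. \<sigma> V \<in> carrier (sect E V)) \<and>
       (\<forall>V\<in>\<U>. \<forall>W\<in>\<U>. restr E V (V \<inter> W) (\<sigma> V) = restr E W (V \<inter> W) (\<sigma> W))" for \<U> \<sigma>
  proof (rule glue)
    show "open V" if "V \<in> \<U>" for V by (rule bspec[OF o that])
    show "\<sigma> V \<in> carrier (sect E V)" if "V \<in> \<U>" for V by (rule bspec[OF conjunct1[OF s] that])
    show "restr E V (V \<inter> W) (\<sigma> V) = restr E W (V \<inter> W) (\<sigma> W)" if "V \<in> \<U>" "W \<in> \<U>" for V W
      by (rule bspec[OF bspec[OF conjunct2[OF s] that(1)] that(2)])
  qed
  show ?thesis unfolding module_sheaf_def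
    apply (intro conjI allI impI ballI)
            apply (rule left_module_sect, assumption)
           apply (elim conjE, rule r1, assumption+)
          apply (elim conjE, rule r2, assumption+)
         apply (elim conjE, rule r3, assumption+)
        apply (rule r4, assumption+)
       apply (elim conjE, rule r5, assumption+)
     apply (rule sep', assumption+)
    apply (rule glue', assumption+)
    done
qed

locale D_sheaf =
  fixes Y :: "('a::topological_space) cmfd" and E :: "('a, 'm, 'z) msheaf_scheme"
  assumes charted: "charted Y" and sheaf: "module_sheaf (D_ring Y) E"
begin

lemma left_module_sect: "open U \<Longrightarrow> left_module (D_ring Y U) (sect E U)"
  using sheaf unfolding module_sheaf_def by (elim conjE) simp

lemma abelian_group_sect: "open U \<Longrightarrow> abelian_group (sect E U)"
  using left_module_sect by (simp add: left_module_def)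

lemma restr_closed [simp]:
  "open U \<Longrightarrow> open V \<Longrightarrow> V \<subseteq> U \<Longrightarrow> m \<in> carrier (sect E U) \<Longrightarrow> restr E U V m \<in> carrier (sect E V)"
  using sheaf unfolding module_sheaf_def by (elim conjE) simp

lemma restr_add:
  "open U \<Longrightarrow> open V \<Longrightarrow> V \<subseteq> U \<Longrightarrow> m \<in> carrier (sect E U) \<Longrightarrow> m' \<in> carrier (sect E U) \<Longrightarrow>
   restr E U V (m \<oplus>\<^bsub>sect E U\<^esub> m') = restr E U V m \<oplus>\<^bsub>sect E V\<^esub> restr E U V m'"
  using sheaf unfolding module_sheaf_def by (elim conjE) simp

lemma restr_smult:
  "open U \<Longrightarrow> open V \<Longrightarrow> V \<subseteq> U \<Longrightarrow> P \<in> D_sec Y U \<Longrightarrow> m \<in> carrier (sect E U) \<Longrightarrow>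
   restr E U V (P \<odot>\<^bsub>sect E U\<^esub> m) = op_res V P \<odot>\<^bsub>sect E V\<^esub> restr E U V m"
  using sheaf unfolding module_sheaf_def by (elim conjE) simp

lemma restr_id [simp]: "open U \<Longrightarrow> m \<in> carrier (sect E U) \<Longrightarrow> restr E U U m = m"
  using sheaf unfolding module_sheaf_def by (elim conjE) simp

lemma restr_restr:
  "open U \<Longrightarrow> open V \<Longrightarrow> open W \<Longrightarrow> W \<subseteq> V \<Longrightarrow> V \<subseteq> U \<Longrightarrow> m \<in> carrier (sect E U) \<Longrightarrow>
   restr E V W (restr E U V m) = restr E U W m"
  using sheaf unfolding module_sheaf_def by (elim conjE) simp

lemmas gluing_axiom = sheaf[unfolded module_sheaf_def, THEN conjunct2, THEN conjunct2, THEN conjunct2,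
  THEN conjunct2, THEN spec, THEN mp]

lemma section_eqI:
  assumes U: "open U" and m: "m \<in> carrier (sect E U)" "m' \<in> carrier (sect E U)"
    and loc: "\<And>x. x \<in> U \<Longrightarrow> \<exists>V. open V \<and> x \<in> V \<and> V \<subseteq> U \<and> restr E U V m = restr E U V m'"
  shows "m = m'"
proof -
  let ?\<U> = "{V. open V \<and> V \<subseteq> U \<and> restr E U V m = restr E U V m'}"
  have un: "\<Union>?\<U> = U" using loc by blast
  have A: "\<forall>V\<in>?\<U>. open V" by simp
  from conjunct1[OF gluing_axiom[OF A]] have "\<forall>m\<in>carrier (sect E U). \<forall>m'\<in>carrier (sect E U).
           (\<forall>V\<in>?\<U>. restr E U V m = restr E U V m') \<longrightarrow> m = m'" unfolding un .
  then show ?thesis using m by simp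
qed

text \<open>Covers come with arbitrary index sets: the section on an open set may depend on a choice
  that the open set does not determine.\<close>

lemma section_glue:
  assumes o: "\<And>i. i \<in> I \<Longrightarrow> open (V i)" and s: "\<And>i. i \<in> I \<Longrightarrow> \<sigma> i \<in> carrier (sect E (V i))"
    and c: "\<And>i j. i \<in> I \<Longrightarrow> j \<in> I \<Longrightarrow> restr E (V i) (V i \<inter> V j) (\<sigma> i) = restr E (V j) (V i \<inter> V j) (\<sigma> j)"
    and U: "U = (\<Union>i\<in>I. V i)"
  obtains m where "m \<in> carrier (sect E U)" "\<And>i. i \<in> I \<Longrightarrow> restr E U (V i) m = \<sigma> i"
proof -
  let ?\<U> = "V ` I"
  define \<tau> where "\<tau> W = \<sigma> (SOME i. i \<in> I \<and> V i = W)" for W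
  have \<tau>: "\<tau> (V i) = \<sigma> i" if i: "i \<in> I" for i
  proof -
    define j where "j = (SOME j. j \<in> I \<and> V j = V i)"
    have j: "j \<in> I \<and> V j = V i" unfolding j_def by (rule someI[of _ i]) (use i in simp)
    have "\<sigma> j = \<sigma> i" using c[OF conjunct1[OF j] i] j o[OF i] s[OF i] s[OF conjunct1[OF j]] by simp
    then show ?thesis by (simp add: \<tau>_def j_def)
  qed
  have A: "\<forall>V\<in>?\<U>. open V" using o by simp
  have B: "(\<forall>V\<in>?\<U>. \<tau> V \<in> carrier (sect E V)) \<and>
             (\<forall>V\<in>?\<U>. \<forall>W\<in>?\<U>. restr E V (V \<inter> W) (\<tau> V) = restr E W (V \<inter> W) (\<tau> W))"
  proof (intro conjI ballI)
    fix A B assume "A \<in> V ` I" "B \<in> V ` I"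
    then obtain i j where ij: "i \<in> I" "j \<in> I" "A = V i" "B = V j" by blast
    show "restr E A (A \<inter> B) (\<tau> A) = restr E B (A \<inter> B) (\<tau> B)"
      unfolding ij(3,4) \<tau>[OF ij(1)] \<tau>[OF ij(2)] by (rule c[OF ij(1,2)])
  qed (use s \<tau> in auto)
  have "\<exists>m\<in>carrier (sect E (\<Union>?\<U>)). \<forall>V\<in>?\<U>. restr E (\<Union>?\<U>) V m = \<tau> V"
    by (rule mp[OF spec[OF conjunct2[OF gluing_axiom[OF A]]] B])
  then show thesis using that \<tau> U by auto
qed

lemma restr_zero [simp]: "open U \<Longrightarrow> open V \<Longrightarrow> V \<subseteq> U \<Longrightarrow> restr E U V \<zero>\<^bsub>sect E U\<^esub> = \<zero>\<^bsub>sect E V\<^esub>"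
proof -
  assume o: "open U" "open V" "V \<subseteq> U"
  interpret A: abelian_group "sect E U" by (rule abelian_group_sect[OF o(1)])
  interpret B: abelian_group "sect E V" by (rule abelian_group_sect[OF o(2)])
  show ?thesis using restr_add[OF o, of "\<zero>\<^bsub>sect E U\<^esub>" "\<zero>\<^bsub>sect E U\<^esub>"] restr_closed[OF o A.zero_closed]
    by (simp add: B.add.l_cancel_one')
qed

definition sc :: "'a set \<Rightarrow> complex \<Rightarrow> 'm \<Rightarrow> 'm" where
  "sc U a m = scal Y U a \<odot>\<^bsub>sect E U\<^esub> m"

context
  fixes U :: "'a set" assumes U: "open U"
begin

interpretation left_module "D_ring Y U" "sect E U" by (rule left_module_sect[OF U])

lemma scal_mem: "scal Y U a \<in> D_sec Y U"
  by (rule scal_D_sec[OF charted U])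

lemma zero_mem [simp]: "\<zero>\<^bsub>sect E U\<^esub> \<in> carrier (sect E U)" by simp

lemma add_mem [simp]: "m \<in> carrier (sect E U) \<Longrightarrow> m' \<in> carrier (sect E U) \<Longrightarrow> m \<oplus>\<^bsub>sect E U\<^esub> m' \<in> carrier (sect E U)"
  by simp

lemma smult_mem [simp]: "P \<in> D_sec Y U \<Longrightarrow> m \<in> carrier (sect E U) \<Longrightarrow> P \<odot>\<^bsub>sect E U\<^esub> m \<in> carrier (sect E U)"
  using smult_closed by simp

lemma smult_add: "P \<in> D_sec Y U \<Longrightarrow> m \<in> carrier (sect E U) \<Longrightarrow> m' \<in> carrier (sect E U) \<Longrightarrow>
   P \<odot>\<^bsub>sect E U\<^esub> (m \<oplus>\<^bsub>sect E U\<^esub> m') = P \<odot>\<^bsub>sect E U\<^esub> m \<oplus>\<^bsub>sect E U\<^esub> P \<odot>\<^bsub>sect E U\<^esub> m'"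
  using smult_r_distr by simp

lemma op_add_smult: "P \<in> D_sec Y U \<Longrightarrow> Q \<in> D_sec Y U \<Longrightarrow> m \<in> carrier (sect E U) \<Longrightarrow>
   op_add P Q \<odot>\<^bsub>sect E U\<^esub> m = P \<odot>\<^bsub>sect E U\<^esub> m \<oplus>\<^bsub>sect E U\<^esub> Q \<odot>\<^bsub>sect E U\<^esub> m"
  using smult_l_distr by simp

lemma op_comp_smult: "P \<in> D_sec Y U \<Longrightarrow> Q \<in> D_sec Y U \<Longrightarrow> m \<in> carrier (sect E U) \<Longrightarrow>
   op_comp P Q \<odot>\<^bsub>sect E U\<^esub> m = P \<odot>\<^bsub>sect E U\<^esub> (Q \<odot>\<^bsub>sect E U\<^esub> m)"
  using smult_assoc by simp

lemma op_id_smult [simp]: "m \<in> carrier (sect E U) \<Longrightarrow> op_id Y U \<odot>\<^bsub>sect E U\<^esub> m = m"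
  using smult_one by simp

lemma smult_zero [simp]: "P \<in> D_sec Y U \<Longrightarrow> P \<odot>\<^bsub>sect E U\<^esub> \<zero>\<^bsub>sect E U\<^esub> = \<zero>\<^bsub>sect E U\<^esub>"
  using smult_zero_right by simp

lemma op_comp_mem: "P \<in> D_sec Y U \<Longrightarrow> Q \<in> D_sec Y U \<Longrightarrow> op_comp P Q \<in> D_sec Y U"
  using R.m_closed by simp

lemma op_add_mem: "P \<in> D_sec Y U \<Longrightarrow> Q \<in> D_sec Y U \<Longrightarrow> op_add P Q \<in> D_sec Y U"
  using R.add.m_closed by simp

lemma sc_mem [simp]: "m \<in> carrier (sect E U) \<Longrightarrow> sc U a m \<in> carrier (sect E U)"
  unfolding sc_def by (intro smult_mem scal_mem)

lemma sc_add: "m \<in> carrier (sect E U) \<Longrightarrow> m' \<in> carrier (sect E U) \<Longrightarrow>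
   sc U a (m \<oplus>\<^bsub>sect E U\<^esub> m') = sc U a m \<oplus>\<^bsub>sect E U\<^esub> sc U a m'"
  unfolding sc_def by (intro smult_add scal_mem)

lemma sc_add_scalar: "m \<in> carrier (sect E U) \<Longrightarrow> sc U (a + b) m = sc U a m \<oplus>\<^bsub>sect E U\<^esub> sc U b m"
  unfolding sc_def scal_add[symmetric] by (intro op_add_smult scal_mem)

lemma sc_one [simp]: "m \<in> carrier (sect E U) \<Longrightarrow> sc U 1 m = m"
  by (simp add: sc_def scal_one)

lemma sc_sc: "m \<in> carrier (sect E U) \<Longrightarrow> sc U a (sc U b m) = sc U (a * b) m"
  unfolding sc_def scal_mult[OF charted U, symmetric] by (simp add: op_comp_smult scal_mem)

lemma sc_zero_right [simp]: "sc U a \<zero>\<^bsub>sect E U\<^esub> = \<zero>\<^bsub>sect E U\<^esub>"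
  by (simp add: sc_def scal_mem)

lemma sc_zero [simp]: "m \<in> carrier (sect E U) \<Longrightarrow> sc U 0 m = \<zero>\<^bsub>sect E U\<^esub>"
  using smult_zero_left by (simp add: sc_def scal_zero)

lemma minus_eq_sc: "m \<in> carrier (sect E U) \<Longrightarrow> \<ominus>\<^bsub>sect E U\<^esub> m = sc U (-1) m"
proof -
  assume m: "m \<in> carrier (sect E U)"
  have "sc U (-1) m \<oplus>\<^bsub>sect E U\<^esub> m = \<zero>\<^bsub>sect E U\<^esub>"
    using sc_add_scalar[OF m, of "-1" 1] m by simp
  then show ?thesis using m by (intro M.minus_equality) simp_all
qed

lemma smult_sc: "P \<in> D_sec Y U \<Longrightarrow> m \<in> carrier (sect E U) \<Longrightarrow>
   P \<odot>\<^bsub>sect E U\<^esub> sc U a m = sc U a (P \<odot>\<^bsub>sect E U\<^esub> m)"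
  unfolding sc_def using scal_central[OF charted D_sec_end_sec U] op_comp_smult scal_mem by metis

end

lemma restr_sc: "open U \<Longrightarrow> open V \<Longrightarrow> V \<subseteq> U \<Longrightarrow> m \<in> carrier (sect E U) \<Longrightarrow>
   restr E U V (sc U a m) = sc V a (restr E U V m)"
  unfolding sc_def by (simp add: restr_smult scal_mem op_res_scal)

text \<open>The empty set is covered by the empty family, on which any two sections agree.\<close>

lemma empty_section: "m \<in> carrier (sect E {}) \<Longrightarrow> m = \<zero>\<^bsub>sect E {}\<^esub>"
  by (rule section_eqI) auto

end

section \<open>Quotients by an injective endomorphism with a normal form\<close>

text \<open>For \<open>h : L \<rightarrow> L\<close> injective, the presheaf quotient of \<open>L\<close> by \<open>h L\<close> is separated. If moreover every
  section is congruent modulo the image to a unique section in normal form, then sections of the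
  presheaf quotient can be glued by gluing normal forms.\<close>

locale normal_form_quotient = D_sheaf X L
  for X :: "('a::topological_space) cmfd" and L :: "('a, 'm) smsheaf" +
  fixes h :: "'a set \<Rightarrow> 'm \<Rightarrow> 'm" and T :: "'a set \<Rightarrow> 'm set"
  assumes s_hom: "sheaf_hom (D_ring X) L L (s_act L)"
    and h_hom: "sheaf_hom (D_ring X) L L h"
    and h_s: "open U \<Longrightarrow> m \<in> carrier (sect L U) \<Longrightarrow> h U (s_act L U m) = s_act L U (h U m)"
    and h_inj: "open U \<Longrightarrow> inj_on (h U) (carrier (sect L U))"
    and T_carrier: "open U \<Longrightarrow> T U \<subseteq> carrier (sect L U)"
    and T_restr: "open U \<Longrightarrow> open V \<Longrightarrow> V \<subseteq> U \<Longrightarrow> n \<in> T U \<Longrightarrow> restr L U V n \<in> T V"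
    and T_ex: "open U \<Longrightarrow> m \<in> carrier (sect L U) \<Longrightarrow> \<exists>n\<in>T U. \<exists>w\<in>carrier (sect L U). m = n \<oplus>\<^bsub>sect L U\<^esub> h U w"
    and T_unique: "open U \<Longrightarrow> n \<in> T U \<Longrightarrow> n' \<in> T U \<Longrightarrow> w \<in> carrier (sect L U) \<Longrightarrow>
        n = n' \<oplus>\<^bsub>sect L U\<^esub> h U w \<Longrightarrow> n = n'"
begin

lemma h_mem [simp]: "open U \<Longrightarrow> m \<in> carrier (sect L U) \<Longrightarrow> h U m \<in> carrier (sect L U)"
  using h_hom by (simp add: sheaf_hom_def)

lemma h_add: "open U \<Longrightarrow> m \<in> carrier (sect L U) \<Longrightarrow> m' \<in> carrier (sect L U) \<Longrightarrow>
   h U (m \<oplus>\<^bsub>sect L U\<^esub> m') = h U m \<oplus>\<^bsub>sect L U\<^esub> h U m'"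
  using h_hom by (simp add: sheaf_hom_def)

lemma h_smult: "open U \<Longrightarrow> P \<in> D_sec X U \<Longrightarrow> m \<in> carrier (sect L U) \<Longrightarrow>
   h U (P \<odot>\<^bsub>sect L U\<^esub> m) = P \<odot>\<^bsub>sect L U\<^esub> h U m"
  using h_hom by (simp add: sheaf_hom_def)

lemma h_restr: "open U \<Longrightarrow> open V \<Longrightarrow> V \<subseteq> U \<Longrightarrow> m \<in> carrier (sect L U) \<Longrightarrow>
   h V (restr L U V m) = restr L U V (h U m)"
  using h_hom by (simp add: sheaf_hom_def)

lemma h_sc: "open U \<Longrightarrow> m \<in> carrier (sect L U) \<Longrightarrow> h U (sc U a m) = sc U a (h U m)"
  unfolding sc_def by (simp add: h_smult scal_mem)

definition im :: "'a set \<Rightarrow> 'm set" where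
  "im U = h U ` carrier (sect L U)"

definition cl :: "'a set \<Rightarrow> 'm \<Rightarrow> 'm set" where
  "cl U m = im U +>\<^bsub>sect L U\<^esub> m"

abbreviation Q where "Q \<equiv> quotient_by L h"

lemma im_subset: "open U \<Longrightarrow> im U \<subseteq> carrier (sect L U)"
  by (auto simp: im_def)

lemma abelian_subgroup_im: "open U \<Longrightarrow> abelian_subgroup (im U) (sect L U)"
proof -
  assume U: "open U"
  interpret A: abelian_group "sect L U" by (rule abelian_group_sect[OF U])
  have "subgroup (im U) (add_monoid (sect L U))"
  proof (rule A.add.subgroupI)
    show "im U \<subseteq> carrier (sect L U)" using im_subset[OF U] by simp
    show "im U \<noteq> {}" using A.zero_closed by (auto simp: im_def)
    fix a assume "a \<in> im U"
    then obtain m where m: "m \<in> carrier (sect L U)" "a = h U m" by (auto simp: im_def)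
    then have "\<ominus>\<^bsub>sect L U\<^esub> a = h U (\<ominus>\<^bsub>sect L U\<^esub> m)" using U by (simp add: minus_eq_sc h_sc)
    then show "\<ominus>\<^bsub>sect L U\<^esub> a \<in> im U" using m U by (simp add: im_def)
  next
    fix a b assume "a \<in> im U" "b \<in> im U"
    then obtain m m' where m: "m \<in> carrier (sect L U)" "a = h U m" "m' \<in> carrier (sect L U)" "b = h U m'" by (auto simp: im_def)
    then have "a \<oplus>\<^bsub>sect L U\<^esub> b = h U (m \<oplus>\<^bsub>sect L U\<^esub> m')" using U by (simp add: h_add)
    then show "a \<oplus>\<^bsub>sect L U\<^esub> b \<in> im U" using m U by (simp add: im_def)
  qed
  then show ?thesis by (intro abelian_subgroupI3 additive_subgroupI abelian_group_sect[OF U])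
qed

lemma cl_eq_iff:
  assumes U: "open U" and m: "m \<in> carrier (sect L U)" "m' \<in> carrier (sect L U)"
  shows "cl U m = cl U m' \<longleftrightarrow> (\<exists>w\<in>carrier (sect L U). m = m' \<oplus>\<^bsub>sect L U\<^esub> h U w)"
proof -
  interpret A: abelian_subgroup "im U" "sect L U" by (rule abelian_subgroup_im[OF U])
  have "cl U m = cl U m' \<longleftrightarrow> m \<in> cl U m'"
    unfolding cl_def using A.a_repr_independence'[of m m'] A.a_repr_independenceD[of m m'] m by metis
  also have "\<dots> \<longleftrightarrow> (\<exists>w\<in>carrier (sect L U). m = h U w \<oplus>\<^bsub>sect L U\<^esub> m')"
    by (auto simp: cl_def a_r_coset_def' im_def)
  also have "\<dots> \<longleftrightarrow> (\<exists>w\<in>carrier (sect L U). m = m' \<oplus>\<^bsub>sect L U\<^esub> h U w)"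
    using m U by (intro bex_cong refl) (simp add: A.a_comm)
  finally show ?thesis .
qed

lemma cl_add:
  assumes "open U" "m \<in> carrier (sect L U)" "m' \<in> carrier (sect L U)"
  shows "cl U m <+>\<^bsub>sect L U\<^esub> cl U m' = cl U (m \<oplus>\<^bsub>sect L U\<^esub> m')"
  unfolding cl_def by (rule abelian_subgroup.a_rcos_sum[OF abelian_subgroup_im]) (use assms in auto)

text \<open>An additive map commuting with \<open>h\<close> descends to cosets; restriction, the
  scalars and \<open>s\<close> all act on the quotient in this way.\<close>

lemma cl_map:
  assumes U: "open U" and V: "open V" and m: "m \<in> carrier (sect L U)"
    and \<phi>: "\<And>x. x \<in> carrier (sect L U) \<Longrightarrow> \<phi> x \<in> carrier (sect L V)"
    and \<phi>_add: "\<And>x y. x \<in> carrier (sect L U) \<Longrightarrow> y \<in> carrier (sect L U) \<Longrightarrow>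
      \<phi> (x \<oplus>\<^bsub>sect L U\<^esub> y) = \<phi> x \<oplus>\<^bsub>sect L V\<^esub> \<phi> y"
    and \<phi>_h: "\<And>x. x \<in> carrier (sect L U) \<Longrightarrow> \<phi> (h U x) = h V (\<phi> x)"
  shows "im V <+>\<^bsub>sect L V\<^esub> \<phi> ` cl U m = cl V (\<phi> m)"
proof -
  interpret B: abelian_subgroup "im V" "sect L V" by (rule abelian_subgroup_im[OF V])
  interpret A: abelian_subgroup "im U" "sect L U" by (rule abelian_subgroup_im[OF U])
  have z: "\<zero>\<^bsub>sect L U\<^esub> \<in> im U" by simp
  have in_im: "\<phi> u \<in> im V" if "u \<in> im U" for u using that \<phi>_h \<phi> by (auto simp: im_def)
  have cl: "cl U m = (\<lambda>u. u \<oplus>\<^bsub>sect L U\<^esub> m) ` im U" by (auto simp: cl_def a_r_coset_def')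
  have c1: "v \<in> carrier (sect L V)" if "v \<in> im V" for v using that im_subset[OF V] by blast
  have c2: "u \<in> carrier (sect L U)" if "u \<in> im U" for u using that im_subset[OF U] by blast
  show ?thesis
  proof (intro equalityI subsetI)
    fix y assume "y \<in> im V <+>\<^bsub>sect L V\<^esub> \<phi> ` cl U m"
    then obtain v u where vu: "v \<in> im V" "u \<in> im U" "y = v \<oplus>\<^bsub>sect L V\<^esub> \<phi> (u \<oplus>\<^bsub>sect L U\<^esub> m)"
      by (auto simp: set_add_def' cl)
    have "y = (v \<oplus>\<^bsub>sect L V\<^esub> \<phi> u) \<oplus>\<^bsub>sect L V\<^esub> \<phi> m"
      using vu c1 c2 m \<phi> by (simp add: \<phi>_add B.a_assoc)
    moreover have "v \<oplus>\<^bsub>sect L V\<^esub> \<phi> u \<in> im V" using vu in_im B.a_closed by blast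
    ultimately show "y \<in> cl V (\<phi> m)" by (auto simp: cl_def a_r_coset_def')
  next
    fix y assume "y \<in> cl V (\<phi> m)"
    then obtain v where v: "v \<in> im V" "y = v \<oplus>\<^bsub>sect L V\<^esub> \<phi> m" by (auto simp: cl_def a_r_coset_def')
    have "m \<in> cl U m" unfolding cl using z m by (intro image_eqI[of _ _ "\<zero>\<^bsub>sect L U\<^esub>"]) auto
    then show "y \<in> im V <+>\<^bsub>sect L V\<^esub> \<phi> ` cl U m" using v by (auto simp: set_add_def')
  qed
qed

lemma Q_simps:
  "zero (sect Q U) = im U" "add (sect Q U) = (\<lambda>K K'. K <+>\<^bsub>sect L U\<^esub> K')"
  "smult (sect Q U) = (\<lambda>P K. im U <+>\<^bsub>sect L U\<^esub> (\<lambda>m. P \<odot>\<^bsub>sect L U\<^esub> m) ` K)"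
  "restr Q U V = (\<lambda>K. im V <+>\<^bsub>sect L V\<^esub> restr L U V ` K)"
  "s_act Q U = (\<lambda>K. im U <+>\<^bsub>sect L U\<^esub> s_act L U ` K)"
  by (simp_all add: quotient_by_def Let_def im_def)

lemma Q_carrier: "carrier (sect Q U) = cl U ` carrier (sect L U)"
  by (auto simp: quotient_by_def Let_def im_def cl_def A_RCOSETS_def')

lemma Q_zero: "open U \<Longrightarrow> \<zero>\<^bsub>sect Q U\<^esub> = cl U \<zero>\<^bsub>sect L U\<^esub>"
proof -
  assume U: "open U"
  interpret A: abelian_subgroup "im U" "sect L U" by (rule abelian_subgroup_im[OF U])
  have "u \<oplus>\<^bsub>sect L U\<^esub> \<zero>\<^bsub>sect L U\<^esub> = u" if "u \<in> im U" for u
    using im_subset[OF U] that by (intro A.r_zero) blast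
  then show ?thesis by (auto simp: Q_simps cl_def a_r_coset_def')
qed

lemma s_mem: "open U \<Longrightarrow> m \<in> carrier (sect L U) \<Longrightarrow> s_act L U m \<in> carrier (sect L U)"
  using s_hom by (simp add: sheaf_hom_def)

lemma Q_add: "open U \<Longrightarrow> m \<in> carrier (sect L U) \<Longrightarrow> m' \<in> carrier (sect L U) \<Longrightarrow>
   cl U m \<oplus>\<^bsub>sect Q U\<^esub> cl U m' = cl U (m \<oplus>\<^bsub>sect L U\<^esub> m')"
  by (simp add: Q_simps cl_add)

lemma Q_smult: "open U \<Longrightarrow> P \<in> D_sec X U \<Longrightarrow> m \<in> carrier (sect L U) \<Longrightarrow>
   P \<odot>\<^bsub>sect Q U\<^esub> cl U m = cl U (P \<odot>\<^bsub>sect L U\<^esub> m)"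
  unfolding Q_simps by (rule cl_map) (simp_all add: smult_add h_smult)

lemma Q_restr: "open U \<Longrightarrow> open V \<Longrightarrow> V \<subseteq> U \<Longrightarrow> m \<in> carrier (sect L U) \<Longrightarrow>
   restr Q U V (cl U m) = cl V (restr L U V m)"
  unfolding Q_simps by (rule cl_map) (simp_all add: restr_add h_restr)

lemma Q_s: "open U \<Longrightarrow> m \<in> carrier (sect L U) \<Longrightarrow> s_act Q U (cl U m) = cl U (s_act L U m)"
  unfolding Q_simps using s_hom by (intro cl_map) (simp_all add: sheaf_hom_def h_s)

lemma Q_left_module: "open U \<Longrightarrow> left_module (D_ring X U) (sect Q U)"
proof -
  assume U: "open U"
  interpret A: left_module "D_ring X U" "sect L U" by (rule left_module_sect[OF U])
  have "abelian_group (sect Q U)"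
  proof (rule abelian_groupI)
    fix x assume "x \<in> carrier (sect Q U)"
    then obtain m where m: "m \<in> carrier (sect L U)" "x = cl U m" by (auto simp: Q_carrier)
    show "\<exists>y\<in>carrier (sect Q U). y \<oplus>\<^bsub>sect Q U\<^esub> x = \<zero>\<^bsub>sect Q U\<^esub>"
      using m U by (intro bexI[of _ "cl U (\<ominus>\<^bsub>sect L U\<^esub> m)"]) (auto simp: Q_add Q_zero A.M.l_neg Q_carrier)
  qed (use U in \<open>auto simp: Q_carrier Q_add Q_zero A.M.a_ac\<close>)
  then show ?thesis
    by (intro left_module.intro left_module_axioms.intro A.R.ring_axioms)
      (use U in \<open>auto simp: Q_carrier Q_add Q_smult smult_add op_add_smult op_comp_smult op_add_mem op_comp_mem\<close>,
       use A.R.one_closed in \<open>auto simp: Q_smult\<close>)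
qed

text \<open>As \<open>h\<close> is injective, local preimages agree on overlaps and glue.\<close>

lemma im_local:
  assumes U: "open U" and m: "m \<in> carrier (sect L U)"
    and loc: "\<And>x. x \<in> U \<Longrightarrow> \<exists>V. open V \<and> x \<in> V \<and> V \<subseteq> U \<and> restr L U V m \<in> im V"
  shows "m \<in> im U"
proof -
  have "\<forall>x\<in>U. \<exists>V w. open V \<and> x \<in> V \<and> V \<subseteq> U \<and> w \<in> carrier (sect L V) \<and> restr L U V m = h V w"
    using loc unfolding im_def by (metis imageE)
  then obtain V w where V: "\<And>x. x \<in> U \<Longrightarrow> open (V x) \<and> x \<in> V x \<and> V x \<subseteq> U \<and> w x \<in> carrier (sect L (V x)) \<and>
      restr L U (V x) m = h (V x) (w x)" by metis
  have c: "restr L (V x) (V x \<inter> V y) (w x) = restr L (V y) (V x \<inter> V y) (w y)" if x: "x \<in> U" and y: "y \<in> U" for x y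
  proof -
    have o: "open (V x \<inter> V y)" using V[OF x] V[OF y] by auto
    have "h (V x \<inter> V y) (restr L (V x) (V x \<inter> V y) (w x)) = restr L U (V x \<inter> V y) m"
      using V[OF x] o U m h_restr[of "V x" "V x \<inter> V y" "w x"] restr_restr[OF U _ o _ _ m, of "V x"] by simp
    moreover have "h (V x \<inter> V y) (restr L (V y) (V x \<inter> V y) (w y)) = restr L U (V x \<inter> V y) m"
      using V[OF y] o U m h_restr[of "V y" "V x \<inter> V y" "w y"] restr_restr[OF U _ o _ _ m, of "V y"] by simp
    ultimately have "h (V x \<inter> V y) (restr L (V x) (V x \<inter> V y) (w x)) = h (V x \<inter> V y) (restr L (V y) (V x \<inter> V y) (w y))"
      by (rule trans[OF _ sym])
    then show ?thesis
      by (rule inj_onD[OF h_inj[OF o]]) (use V[OF x] V[OF y] o in simp_all)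
  qed
  have UU: "U = (\<Union>x\<in>U. V x)" using V by blast
  obtain n where n: "n \<in> carrier (sect L U)" "\<And>x. x \<in> U \<Longrightarrow> restr L U (V x) n = w x"
    using section_glue[of U V w U, OF _ _ c UU] V by blast
  have "m = h U n"
  proof (rule section_eqI[OF U m])
    show "h U n \<in> carrier (sect L U)" using U n by simp
    fix x assume x: "x \<in> U"
    show "\<exists>V. open V \<and> x \<in> V \<and> V \<subseteq> U \<and> restr L U V m = restr L U V (h U n)"
      using V[OF x] n(2)[OF x] h_restr[OF U _ _ n(1), of "V x"] by (intro exI[of _ "V x"]) simp
  qed
  then show ?thesis using n by (simp add: im_def)
qed

lemma cl_eq_diff:
  assumes U: "open U" and m: "m \<in> carrier (sect L U)" "m' \<in> carrier (sect L U)"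
  shows "cl U m = cl U m' \<longleftrightarrow> m \<oplus>\<^bsub>sect L U\<^esub> sc U (-1) m' \<in> im U"
proof -
  interpret A: abelian_group "sect L U" by (rule abelian_group_sect[OF U])
  have m1: "sc U (-1) m' = \<ominus>\<^bsub>sect L U\<^esub> m'" using m U by (simp add: minus_eq_sc)
  have "m = m' \<oplus>\<^bsub>sect L U\<^esub> w \<longleftrightarrow> m \<oplus>\<^bsub>sect L U\<^esub> \<ominus>\<^bsub>sect L U\<^esub> m' = w" if "w \<in> carrier (sect L U)" for w
    using m that by (metis A.add.inv_solve_right A.a_comm A.a_inv_closed A.add.m_closed A.minus_minus)
  then show ?thesis unfolding cl_eq_iff[OF assms] m1 im_def image_iff using U by (intro bex_cong refl) simp
qed

lemma Q_separated:
  assumes U: "open U" and K: "K \<in> carrier (sect Q U)" "K' \<in> carrier (sect Q U)"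
    and loc: "\<And>x. x \<in> U \<Longrightarrow> \<exists>V. open V \<and> x \<in> V \<and> V \<subseteq> U \<and> restr Q U V K = restr Q U V K'"
  shows "K = K'"
proof -
  obtain m m' where m: "m \<in> carrier (sect L U)" "K = cl U m" "m' \<in> carrier (sect L U)" "K' = cl U m'"
    using K by (auto simp: Q_carrier)
  have "m \<oplus>\<^bsub>sect L U\<^esub> sc U (-1) m' \<in> im U"
  proof (rule im_local[OF U])
    show "m \<oplus>\<^bsub>sect L U\<^esub> sc U (-1) m' \<in> carrier (sect L U)" using m U by simp
    fix x assume "x \<in> U"
    from loc[OF this] obtain V where V: "open V" "x \<in> V" "V \<subseteq> U" "cl V (restr L U V m) = cl V (restr L U V m')"
      using m U by (auto simp: Q_restr)
    then show "\<exists>V. open V \<and> x \<in> V \<and> V \<subseteq> U \<and> restr L U V (m \<oplus>\<^bsub>sect L U\<^esub> sc U (-1) m') \<in> im V"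
      using m U cl_eq_diff[OF V(1), of "restr L U V m" "restr L U V m'"]
      by (intro exI[of _ V]) (simp add: restr_add restr_sc)
  qed
  then show ?thesis unfolding m(2,4) cl_eq_diff[OF U m(1,3)] .
qed

lemma Q_normal_form:
  assumes "open U" "K \<in> carrier (sect Q U)"
  shows "\<exists>n. n \<in> T U \<and> K = cl U n"
proof -
  obtain m where m: "m \<in> carrier (sect L U)" "K = cl U m" using assms by (auto simp: Q_carrier)
  obtain n w where "n \<in> T U" "w \<in> carrier (sect L U)" "m = n \<oplus>\<^bsub>sect L U\<^esub> h U w"
    using T_ex[OF assms(1) m(1)] by blast
  then show ?thesis using m cl_eq_iff[OF assms(1) m(1), of n] T_carrier[OF assms(1)] by blast
qed

lemma normal_form_unique: "open U \<Longrightarrow> n \<in> T U \<Longrightarrow> n' \<in> T U \<Longrightarrow> cl U n = cl U n' \<Longrightarrow> n = n'"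
  using cl_eq_iff[of U n n'] T_unique[of U n n'] T_carrier[of U] by blast

text \<open>Normal forms of the given classes agree on overlaps by uniqueness. They are glued in
  \<open>L\<close>, and the class of the result is the class sought.\<close>

lemma Q_glue:
  assumes o: "\<And>V. V \<in> \<U> \<Longrightarrow> open V" and s: "\<And>V. V \<in> \<U> \<Longrightarrow> \<sigma> V \<in> carrier (sect Q V)"
    and c: "\<And>V W. V \<in> \<U> \<Longrightarrow> W \<in> \<U> \<Longrightarrow> restr Q V (V \<inter> W) (\<sigma> V) = restr Q W (V \<inter> W) (\<sigma> W)"
  shows "\<exists>K\<in>carrier (sect Q (\<Union>\<U>)). \<forall>V\<in>\<U>. restr Q (\<Union>\<U>) V K = \<sigma> V"
proof -
  have "\<forall>V\<in>\<U>. \<exists>n. n \<in> T V \<and> \<sigma> V = cl V n" using Q_normal_form o s by blast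
  then obtain n where n: "\<And>V. V \<in> \<U> \<Longrightarrow> n V \<in> T V \<and> \<sigma> V = cl V (n V)" by metis
  have nc: "n V \<in> carrier (sect L V)" if "V \<in> \<U>" for V using n[OF that] T_carrier o that by blast
  have "restr L V (V \<inter> W) (n V) = restr L W (V \<inter> W) (n W)" if V: "V \<in> \<U>" and W: "W \<in> \<U>" for V W
  proof (rule normal_form_unique)
    show oo: "open (V \<inter> W)" using o V W by blast
    show "restr L V (V \<inter> W) (n V) \<in> T (V \<inter> W)" using T_restr[OF o[OF V] oo] n V by blast
    show "restr L W (V \<inter> W) (n W) \<in> T (V \<inter> W)" using T_restr[OF o[OF W] oo] n W by blast
    show "cl (V \<inter> W) (restr L V (V \<inter> W) (n V)) = cl (V \<inter> W) (restr L W (V \<inter> W) (n W))"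
      using c[OF V W] n[OF V] n[OF W] o[OF V] o[OF W] nc[OF V] nc[OF W] oo by (simp add: Q_restr)
  qed
  then obtain m where m: "m \<in> carrier (sect L (\<Union>\<U>))" "\<And>V. V \<in> \<U> \<Longrightarrow> restr L (\<Union>\<U>) V m = n V"
    using section_glue[of \<U> "\<lambda>V. V" n "\<Union>\<U>"] o nc by auto
  have "open (\<Union>\<U>)" using o by blast
  then show ?thesis using m o n
    by (intro bexI[of _ "cl (\<Union>\<U>) m"]) (auto simp: Q_carrier Q_restr Union_upper)
qed

theorem Q_module_sheaf: "module_sheaf (D_ring X) Q"
proof (rule module_sheafI)
  show "left_module (D_ring X U) (sect Q U)" if "open U" for U by (rule Q_left_module[OF that])
  fix U V :: "'a set" assume o: "open U" "open V" "V \<subseteq> U"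
  show "restr Q U V m \<in> carrier (sect Q V)" if "m \<in> carrier (sect Q U)" for m
    using that o by (auto simp: Q_carrier Q_restr)
  show "restr Q U V (m \<oplus>\<^bsub>sect Q U\<^esub> m') = restr Q U V m \<oplus>\<^bsub>sect Q V\<^esub> restr Q U V m'"
    if "m \<in> carrier (sect Q U)" "m' \<in> carrier (sect Q U)" for m m'
    using that o by (auto simp: Q_carrier Q_restr Q_add restr_add)
  show "restr Q U V (P \<odot>\<^bsub>sect Q U\<^esub> m) = op_res V P \<odot>\<^bsub>sect Q V\<^esub> restr Q U V m"
    if "P \<in> carrier (D_ring X U)" "m \<in> carrier (sect Q U)" for P m
    using that o op_res_D_sec[OF charted _ o(2,3)] by (auto simp: Q_carrier Q_restr Q_smult restr_smult)
next
  show "restr Q U U m = m" if "open U" "m \<in> carrier (sect Q U)" for U :: "'a set" and m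
    using that by (auto simp: Q_carrier Q_restr)
  show "restr Q V W (restr Q U V m) = restr Q U W m"
    if "open U" "open V" "open W" "W \<subseteq> V" "V \<subseteq> U" "m \<in> carrier (sect Q U)" for U V W :: "'a set" and m
  proof -
    have "W \<subseteq> U" using that by blast
    then show ?thesis using that by (auto simp: Q_carrier Q_restr restr_restr)
  qed
qed (fact Q_separated Q_glue)+

lemma Q_Ds_module_sheaf: "Ds_module_sheaf X Q"
proof -
  have s: "s_act L U (m \<oplus>\<^bsub>sect L U\<^esub> m') = s_act L U m \<oplus>\<^bsub>sect L U\<^esub> s_act L U m'"
    "P \<in> D_sec X U \<Longrightarrow> s_act L U (P \<odot>\<^bsub>sect L U\<^esub> m) = P \<odot>\<^bsub>sect L U\<^esub> s_act L U m"
    if "open U" "m \<in> carrier (sect L U)" "m' \<in> carrier (sect L U)" for U :: "'a set" and m m' P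
    using s_hom that by (simp_all add: sheaf_hom_def)
  have sr: "s_act L V (restr L U V m) = restr L U V (s_act L U m)"
    if "open U" "open V" "V \<subseteq> U" "m \<in> carrier (sect L U)" for U V :: "'a set" and m
    using s_hom that by (simp add: sheaf_hom_def)
  have "sheaf_hom (D_ring X) Q Q (s_act Q)"
    unfolding sheaf_hom_def
    by (auto simp: Q_carrier Q_s s_mem Q_add s Q_smult Q_restr sr)
  then show ?thesis using Q_module_sheaf by (simp add: Ds_module_sheaf_def)
qed

end


section \<open>The graph direct image in coordinates\<close>

locale graph_setting =
  fixes X :: "('a::topological_space) cmfd"
    and M :: "('a, 'm) msheaf"
    and f :: "'a \<Rightarrow> complex"
    and L :: "('a, nat \<Rightarrow> 'm) smsheaf"
    and N :: "('a \<times> complex, nat \<Rightarrow> 'm) msheaf"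
  assumes X: "charted X"
    and f: "f \<in> hol_sec X UNIV"
    and M_sheaf: "module_sheaf (D_ring X) M"
    and f_bij: "acts_bijectively X M f"
    and L_Ms: "is_Ms_fs X M f L"
    and N_di: "is_graph_direct_image X M f N"

sublocale graph_setting \<subseteq> M: D_sheaf X M
  by unfold_locales (rule X, rule M_sheaf)

sublocale graph_setting \<subseteq> L: D_sheaf X L
  using L_Ms by unfold_locales (auto simp: X is_Ms_fs_def)

sublocale graph_setting \<subseteq> N: D_sheaf "times_C X" N
  using N_di by unfold_locales (auto simp: X charted_times_C is_graph_direct_image_def)

context graph_setting
begin

abbreviation pre :: "('a \<times> complex) set \<Rightarrow> 'a set" where "pre W \<equiv> graph_pre f W"
abbreviation z0 :: "'a set \<Rightarrow> 'm" where "z0 U \<equiv> \<zero>\<^bsub>sect M U\<^esub>"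
abbreviation cyl :: "'a set \<Rightarrow> ('a \<times> complex) set" where "cyl U \<equiv> U \<times> UNIV"

lemma f_continuous: "continuous_on UNIV f"
  by (rule hol_sec_continuous[OF X open_UNIV f])

lemma open_pre [simp]: "open W \<Longrightarrow> open (pre W)"
proof -
  assume "open W"
  moreover have "pre W = (\<lambda>x. (x, f x)) -` W" by (auto simp: graph_pre_def)
  ultimately show ?thesis using f_continuous by (simp add: open_vimage continuous_intros)
qed

lemma pre_cyl [simp]: "pre (cyl U) = U"
  by (auto simp: graph_pre_def)

lemma open_cyl [simp]: "open U \<Longrightarrow> open (cyl U)"
  by (intro open_Times) auto

lemma L_facts:
  assumes "open U"
  shows "seq_group M U (sect L U)"
    and "open V \<Longrightarrow> V \<subseteq> U \<Longrightarrow> m \<in> seq_sec M U \<Longrightarrow> restr L U V m = (\<lambda>j. restr M U V (m j))"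
    and "h \<in> hol_sec X U \<Longrightarrow> m \<in> seq_sec M U \<Longrightarrow> mul_op X U h \<odot>\<^bsub>sect L U\<^esub> m = (\<lambda>j. mul_op X U h \<odot>\<^bsub>sect M U\<^esub> m j)"
    and "\<xi> \<in> vector_fields X U \<Longrightarrow> m \<in> seq_sec M U \<Longrightarrow> \<xi> \<odot>\<^bsub>sect L U\<^esub> m =
             (\<lambda>j. \<xi> \<odot>\<^bsub>sect M U\<^esub> m j \<oplus>\<^bsub>sect M U\<^esub>
                shift (z0 U) (\<lambda>i. div_by X M f U (mul_op X U (\<xi> U (fres U f)) \<odot>\<^bsub>sect M U\<^esub> m i)) j)"
    and "m \<in> seq_sec M U \<Longrightarrow> s_act L U m = shift (z0 U) m"
  using L_Ms assms unfolding is_Ms_fs_def by simp_all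

lemma N_facts:
  assumes "open W"
  shows "seq_group M (pre W) (sect N W)"
    and "open V \<Longrightarrow> V \<subseteq> W \<Longrightarrow> m \<in> seq_sec M (pre W) \<Longrightarrow> restr N W V m = (\<lambda>j. restr M (pre W) (pre V) (m j))"
    and "h \<in> hol_sec (times_C X) W \<Longrightarrow> m0 \<in> carrier (sect M (pre W)) \<Longrightarrow>
           mul_op (times_C X) W h \<odot>\<^bsub>sect N W\<^esub> delta (z0 (pre W)) m0 =
             delta (z0 (pre W)) (mul_op X (pre W) (\<lambda>x. h (x, f x)) \<odot>\<^bsub>sect M (pre W)\<^esub> m0)"
    and "m \<in> seq_sec M (pre W) \<Longrightarrow> dt_op X W \<odot>\<^bsub>sect N W\<^esub> m = shift (z0 (pre W)) m"
  using N_di assms unfolding is_graph_direct_image_def by simp_all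

lemma N_vf:
  assumes "open U" "\<xi> \<in> vector_fields X U" "m0 \<in> carrier (sect M U)"
  shows "lift_op X U \<xi> \<odot>\<^bsub>sect N (cyl U)\<^esub> delta (z0 U) m0 =
          (\<lambda>j. if j = 0 then \<xi> \<odot>\<^bsub>sect M U\<^esub> m0
               else if j = 1 then \<ominus>\<^bsub>sect M U\<^esub> (mul_op X U (\<xi> U (fres U f)) \<odot>\<^bsub>sect M U\<^esub> m0)
               else z0 U)"
  using N_di assms unfolding is_graph_direct_image_def by simp

lemma L_carrier [simp]: "open U \<Longrightarrow> carrier (sect L U) = seq_sec M U"
  and L_zero: "open U \<Longrightarrow> \<zero>\<^bsub>sect L U\<^esub> = (\<lambda>j. z0 U)"
  and L_add: "open U \<Longrightarrow> m \<in> seq_sec M U \<Longrightarrow> m' \<in> seq_sec M U \<Longrightarrow> m \<oplus>\<^bsub>sect L U\<^esub> m' = (\<lambda>j. m j \<oplus>\<^bsub>sect M U\<^esub> m' j)"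
  using L_facts(1) by (simp_all add: seq_group_def)

lemma N_carrier [simp]: "open W \<Longrightarrow> carrier (sect N W) = seq_sec M (pre W)"
  and N_zero: "open W \<Longrightarrow> \<zero>\<^bsub>sect N W\<^esub> = (\<lambda>j. z0 (pre W))"
  and N_add: "open W \<Longrightarrow> m \<in> seq_sec M (pre W) \<Longrightarrow> m' \<in> seq_sec M (pre W) \<Longrightarrow> m \<oplus>\<^bsub>sect N W\<^esub> m' = (\<lambda>j. m j \<oplus>\<^bsub>sect M (pre W)\<^esub> m' j)"
  using N_facts(1) by (simp_all add: seq_group_def)

lemma seq_sec_comp: "m \<in> seq_sec M U \<Longrightarrow> m j \<in> carrier (sect M U)"
  by (simp add: seq_sec_def)

text \<open>Sections of bounded degree, in \<open>s\<close> or in \<open>\<partial>\<^sub>t\<close>.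
  Elements of the direct sum sheaves are only locally of this kind, so inductions on the degree run
  on small open sets.\<close>

definition deg_lt :: "'a set \<Rightarrow> nat \<Rightarrow> (nat \<Rightarrow> 'm) set" where
  "deg_lt U d = {m. (\<forall>j. m j \<in> carrier (sect M U)) \<and> (\<forall>j\<ge>d. m j = z0 U)}"

lemma deg_lt_seq_sec: "open U \<Longrightarrow> m \<in> deg_lt U d \<Longrightarrow> m \<in> seq_sec M U"
  unfolding seq_sec_def deg_lt_def by (auto intro!: exI[of _ U] exI[of _ d])

lemma deg_lt_mono: "m \<in> deg_lt U d \<Longrightarrow> d \<le> e \<Longrightarrow> m \<in> deg_lt U e"
  by (auto simp: deg_lt_def)

lemma seq_sec_local:
  assumes "m \<in> seq_sec M U" "open U" "x \<in> U"
  obtains V d where "open V" "x \<in> V" "V \<subseteq> U" "(\<lambda>j. restr M U V (m j)) \<in> deg_lt V d"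
proof -
  from assms have "\<exists>V d. open V \<and> x \<in> V \<and> V \<subseteq> U \<and> (\<forall>j\<ge>d. restr M U V (m j) = z0 V)"
    by (simp add: seq_sec_def)
  then obtain V d where V: "open V" "x \<in> V" "V \<subseteq> U" "\<forall>j\<ge>d. restr M U V (m j) = z0 V" by (elim exE conjE)
  then show thesis using assms by (intro that[of V d]) (auto simp: deg_lt_def seq_sec_comp)
qed

lemma deg_lt_restr: "open U \<Longrightarrow> open V \<Longrightarrow> V \<subseteq> U \<Longrightarrow> m \<in> deg_lt U d \<Longrightarrow> (\<lambda>j. restr M U V (m j)) \<in> deg_lt V d"
  by (auto simp: deg_lt_def)

lemma deg_lt_zero: "open U \<Longrightarrow> (\<lambda>j. z0 U) \<in> deg_lt U d"
  by (simp add: deg_lt_def)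

lemma deg_lt_0: "m \<in> deg_lt U 0 \<Longrightarrow> m = (\<lambda>j. z0 U)"
  by (auto simp: deg_lt_def)

lemma deg_lt_add: "open U \<Longrightarrow> m \<in> deg_lt U d \<Longrightarrow> m' \<in> deg_lt U d \<Longrightarrow> (\<lambda>j. m j \<oplus>\<^bsub>sect M U\<^esub> m' j) \<in> deg_lt U d"
proof -
  assume U: "open U" and m: "m \<in> deg_lt U d" "m' \<in> deg_lt U d"
  interpret abelian_group "sect M U" by (rule M.abelian_group_sect[OF U])
  show ?thesis using m by (auto simp: deg_lt_def)
qed

lemma deg_lt_minus: "open U \<Longrightarrow> m \<in> deg_lt U d \<Longrightarrow> (\<lambda>j. \<ominus>\<^bsub>sect M U\<^esub> m j) \<in> deg_lt U d"
proof -
  assume U: "open U" and m: "m \<in> deg_lt U d"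
  interpret abelian_group "sect M U" by (rule M.abelian_group_sect[OF U])
  show ?thesis using m by (auto simp: deg_lt_def)
qed

lemma shift_simps [simp]: "shift z m 0 = z" "shift z m (Suc j) = m j"
  by (simp_all add: shift_def)

lemma deg_lt_shift: "open U \<Longrightarrow> m \<in> deg_lt U d \<Longrightarrow> shift (z0 U) m \<in> deg_lt U (Suc d)"
  by (auto simp: deg_lt_def shift_def split: nat.splits)

lemma deg_lt_delta: "open U \<Longrightarrow> m0 \<in> carrier (sect M U) \<Longrightarrow> delta (z0 U) m0 \<in> deg_lt U (Suc d)"
  by (auto simp: deg_lt_def delta_def)

lemma deg_lt_tail: "m \<in> deg_lt U (Suc d) \<Longrightarrow> (\<lambda>j. m (Suc j)) \<in> deg_lt U d"
  by (auto simp: deg_lt_def)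

lemma seq_sec_shift: "open U \<Longrightarrow> m \<in> seq_sec M U \<Longrightarrow> shift (z0 U) m \<in> seq_sec M U"
  using N.smult_mem[of "cyl U" "dt_op X (cyl U)" m] N_facts(4)[of "cyl U" m] dt_op_D_sec[OF X, of "cyl U"]
  by simp

lemma deg_lt_drop:
  assumes "m \<in> deg_lt U (Suc d)" "m d = z0 U"
  shows "m \<in> deg_lt U d"
proof -
  have "m j = z0 U" if "j \<ge> d" for j
    using assms that by (cases "j = d") (auto simp: deg_lt_def)
  then show ?thesis using assms(1) by (simp add: deg_lt_def)
qed

lemma split_first:
  assumes U: "open U" and m: "\<And>j. m j \<in> carrier (sect M U)"
  shows "m = (\<lambda>j. delta (z0 U) (m 0) j \<oplus>\<^bsub>sect M U\<^esub> shift (z0 U) (\<lambda>j. m (Suc j)) j)"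
proof
  interpret abelian_group "sect M U" by (rule M.abelian_group_sect[OF U])
  fix j show "m j = delta (z0 U) (m 0) j \<oplus>\<^bsub>sect M U\<^esub> shift (z0 U) (\<lambda>j. m (Suc j)) j"
    using m by (cases j) (simp_all add: delta_def)
qed

lemma N_minus:
  assumes W: "open W" and u: "u \<in> seq_sec M (pre W)"
  shows "\<ominus>\<^bsub>sect N W\<^esub> u = (\<lambda>j. \<ominus>\<^bsub>sect M (pre W)\<^esub> u j)"
proof
  fix j
  interpret A: abelian_group "sect N W" by (rule N.abelian_group_sect[OF W])
  interpret B: abelian_group "sect M (pre W)" by (rule M.abelian_group_sect[OF open_pre[OF W]])
  have c: "\<ominus>\<^bsub>sect N W\<^esub> u \<in> seq_sec M (pre W)" using A.a_inv_closed[of u] u W by simp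
  have "(\<ominus>\<^bsub>sect N W\<^esub> u) \<oplus>\<^bsub>sect N W\<^esub> u = \<zero>\<^bsub>sect N W\<^esub>" using A.l_neg u W by simp
  then have "(\<ominus>\<^bsub>sect N W\<^esub> u) j \<oplus>\<^bsub>sect M (pre W)\<^esub> u j = z0 (pre W)"
    unfolding N_add[OF W c u] N_zero[OF W] by (rule fun_cong)
  then show "(\<ominus>\<^bsub>sect N W\<^esub> u) j = \<ominus>\<^bsub>sect M (pre W)\<^esub> u j"
    using seq_sec_comp[OF u] seq_sec_comp[OF c] by (intro B.minus_equality[symmetric]) auto
qed

abbreviation f_act :: "'a set \<Rightarrow> 'm \<Rightarrow> 'm" where
  "f_act U m0 \<equiv> mul_op X U (fres U f) \<odot>\<^bsub>sect M U\<^esub> m0"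

lemma f_op: "open U \<Longrightarrow> mul_op X U (fres U f) \<in> D_sec X U"
  by (intro mul_op_D_sec X hol_sec_fres[OF X _ open_UNIV _ f]) auto

lemma f_act_bij: "open U \<Longrightarrow> bij_betw (f_act U) (carrier (sect M U)) (carrier (sect M U))"
  using f_bij by (simp add: acts_bijectively_def)

lemma t_op_delta:
  assumes W: "open W" and m: "m0 \<in> carrier (sect M (pre W))"
  shows "t_op X W \<odot>\<^bsub>sect N W\<^esub> delta (z0 (pre W)) m0 = delta (z0 (pre W)) (f_act (pre W) m0)"
proof -
  have "(\<lambda>x. fres W snd (x, f x)) = fres (pre W) f" by (auto simp: fres_def graph_pre_def)
  then show ?thesis unfolding t_op_def using N_facts(3)[OF W hol_sec_snd[OF X W] m] by simp
qed

text \<open>The Leibniz rule, read as a recursion for the action of \<open>t\<close> on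
  \<open>\<partial>\<^sub>t u\<close>.\<close>

lemma t_op_shift:
  assumes W: "open W" and u: "u \<in> seq_sec M (pre W)"
  shows "t_op X W \<odot>\<^bsub>sect N W\<^esub> shift (z0 (pre W)) u =
     shift (z0 (pre W)) (t_op X W \<odot>\<^bsub>sect N W\<^esub> u) \<oplus>\<^bsub>sect N W\<^esub> \<ominus>\<^bsub>sect N W\<^esub> u"
proof -
  interpret A: abelian_group "sect N W" by (rule N.abelian_group_sect[OF W])
  note D = t_op_D_sec[OF X W] dt_op_D_sec[OF X W]
  have I: "op_id (times_C X) W \<in> D_sec (times_C X) W" using N.scal_mem[OF W, of 1] by (simp add: scal_one)
  have u': "u \<in> carrier (sect N W)" using u W by simp
  have tu: "t_op X W \<odot>\<^bsub>sect N W\<^esub> u \<in> seq_sec M (pre W)" using N.smult_mem[OF W D(1) u'] W by simp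
  have "shift (z0 (pre W)) (t_op X W \<odot>\<^bsub>sect N W\<^esub> u) = op_comp (dt_op X W) (t_op X W) \<odot>\<^bsub>sect N W\<^esub> u"
    using N_facts(4)[OF W tu] N.op_comp_smult[OF W D(2,1) u'] by simp
  also have "\<dots> = t_op X W \<odot>\<^bsub>sect N W\<^esub> shift (z0 (pre W)) u \<oplus>\<^bsub>sect N W\<^esub> u"
    unfolding dt_op_t_op[OF X W] using N.op_add_smult[OF W N.op_comp_mem[OF W D] I u']
      N.op_comp_smult[OF W D u'] N_facts(4)[OF W u] N.op_id_smult[OF W u'] by simp
  finally have e: "shift (z0 (pre W)) (t_op X W \<odot>\<^bsub>sect N W\<^esub> u) = t_op X W \<odot>\<^bsub>sect N W\<^esub> shift (z0 (pre W)) u \<oplus>\<^bsub>sect N W\<^esub> u" .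
  have "t_op X W \<odot>\<^bsub>sect N W\<^esub> shift (z0 (pre W)) u \<in> carrier (sect N W)"
    using N.smult_mem[OF W D(1)] seq_sec_shift[OF open_pre[OF W] u] W by simp
  then show ?thesis unfolding e using u' by (simp add: A.a_assoc A.r_neg)
qed

text \<open>Since \<open>t \<partial>\<^sub>t\<^sup>j = \<partial>\<^sub>t\<^sup>j t - j \<partial>\<^sub>t\<^sup>(\<^sup>j\<^sup>-\<^sup>1\<^sup>)\<close>, the operator \<open>t\<close> changes the top coefficient only
  through its action on \<open>m \<otimes> 1\<close>, which is multiplication by \<open>f\<close>. The induction splits off the
  constant term \<open>m\<^sub>0 \<otimes> 1\<close>.\<close>

lemma t_op_deg_lt:
  assumes W: "open W"
  shows "u \<in> deg_lt (pre W) d \<Longrightarrow> t_op X W \<odot>\<^bsub>sect N W\<^esub> u \<in> deg_lt (pre W) d \<and>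
    (\<forall>e. d = Suc e \<longrightarrow> (t_op X W \<odot>\<^bsub>sect N W\<^esub> u) e = f_act (pre W) (u e))"
proof (induction d arbitrary: u)
  case 0
  note G = open_pre[OF W]
  have "u = \<zero>\<^bsub>sect N W\<^esub>" using deg_lt_0[OF 0] N_zero[OF W] by simp
  then have "t_op X W \<odot>\<^bsub>sect N W\<^esub> u = (\<lambda>j. z0 (pre W))"
    using N.smult_zero[OF W t_op_D_sec[OF X W]] N_zero[OF W] by simp
  then show ?case using deg_lt_zero[OF G] by simp
next
  case (Suc d)
  note G = open_pre[OF W]
  let ?G = "pre W"
  interpret B: abelian_group "sect M ?G" by (rule M.abelian_group_sect[OF G])
  let ?u = "\<lambda>j. u (Suc j)" and ?t = "\<lambda>u. t_op X W \<odot>\<^bsub>sect N W\<^esub> u"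
  have uc: "u j \<in> carrier (sect M ?G)" for j using Suc.prems by (simp add: deg_lt_def)
  have u': "?u \<in> deg_lt ?G d" by (rule deg_lt_tail[OF Suc.prems])
  have us: "?u \<in> seq_sec M ?G" by (rule deg_lt_seq_sec[OF G u'])
  note IH = Suc.IH[OF u']
  have tu: "?t ?u \<in> deg_lt ?G d" using IH by simp
  have ds: "delta (z0 ?G) (u 0) \<in> seq_sec M ?G" by (rule deg_lt_seq_sec[OF G deg_lt_delta[OF G uc]])
  have ss: "shift (z0 ?G) ?u \<in> seq_sec M ?G" by (rule seq_sec_shift[OF G us])
  have f0: "f_act ?G (u 0) \<in> carrier (sect M ?G)" by (rule M.smult_mem[OF G f_op[OF G] uc])
  have m: "\<ominus>\<^bsub>sect N W\<^esub> ?u = (\<lambda>j. \<ominus>\<^bsub>sect M ?G\<^esub> ?u j)" by (rule N_minus[OF W us])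
  have ms: "(\<lambda>j. \<ominus>\<^bsub>sect M ?G\<^esub> ?u j) \<in> deg_lt ?G d" by (rule deg_lt_minus[OF G u'])
  have sts: "shift (z0 ?G) (?t ?u) \<in> deg_lt ?G (Suc d)" by (rule deg_lt_shift[OF G tu])
  have "u = delta (z0 ?G) (u 0) \<oplus>\<^bsub>sect N W\<^esub> shift (z0 ?G) ?u"
    unfolding N_add[OF W ds ss] by (rule split_first[OF G uc])
  then have "?t u = ?t (delta (z0 ?G) (u 0) \<oplus>\<^bsub>sect N W\<^esub> shift (z0 ?G) ?u)" by (rule arg_cong)
  also have "\<dots> = ?t (delta (z0 ?G) (u 0)) \<oplus>\<^bsub>sect N W\<^esub> ?t (shift (z0 ?G) ?u)"
    by (rule N.smult_add[OF W t_op_D_sec[OF X W]]) (simp_all add: ds ss W)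
  also have "\<dots> = delta (z0 ?G) (f_act ?G (u 0)) \<oplus>\<^bsub>sect N W\<^esub>
      (shift (z0 ?G) (?t ?u) \<oplus>\<^bsub>sect N W\<^esub> (\<lambda>j. \<ominus>\<^bsub>sect M ?G\<^esub> ?u j))"
    by (simp only: t_op_delta[OF W uc] t_op_shift[OF W us] m)
  also have "shift (z0 ?G) (?t ?u) \<oplus>\<^bsub>sect N W\<^esub> (\<lambda>j. \<ominus>\<^bsub>sect M ?G\<^esub> ?u j) =
     (\<lambda>j. shift (z0 ?G) (?t ?u) j \<oplus>\<^bsub>sect M ?G\<^esub> \<ominus>\<^bsub>sect M ?G\<^esub> ?u j)" (is "_ = ?v")
    by (rule N_add[OF W deg_lt_seq_sec[OF G sts] deg_lt_seq_sec[OF G ms]])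
  also have "delta (z0 ?G) (f_act ?G (u 0)) \<oplus>\<^bsub>sect N W\<^esub> ?v =
     (\<lambda>j. delta (z0 ?G) (f_act ?G (u 0)) j \<oplus>\<^bsub>sect M ?G\<^esub> ?v j)"
    by (rule N_add[OF W deg_lt_seq_sec[OF G deg_lt_delta[OF G f0]]
      deg_lt_seq_sec[OF G deg_lt_add[OF G sts deg_lt_mono[OF ms le_SucI[OF order.refl]]]]])
  finally have e: "?t u = (\<lambda>j. delta (z0 ?G) (f_act ?G (u 0)) j \<oplus>\<^bsub>sect M ?G\<^esub> ?v j)" .
  have "?t u \<in> deg_lt ?G (Suc d)" unfolding e
    by (intro deg_lt_add G deg_lt_delta f0 sts deg_lt_mono[OF ms le_SucI[OF order.refl]])
  moreover have "?t u d = f_act ?G (u d)"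
  proof (cases d)
    case 0
    then show ?thesis unfolding e using f0 u' by (simp add: delta_def deg_lt_def)
  next
    case (Suc e')
    then have "u (Suc d) = z0 ?G" using u' by (simp add: deg_lt_def)
    moreover have "?t ?u e' = f_act ?G (u d)" using IH Suc by simp
    moreover have "f_act ?G (u d) \<in> carrier (sect M ?G)" by (rule M.smult_mem[OF G f_op[OF G] uc])
    ultimately show ?thesis unfolding e using Suc by (simp add: delta_def)
  qed
  ultimately show ?case by simp
qed

subsection \<open>The action of \<open>s\<close>\<close>

abbreviation sN :: "('a \<times> complex) set \<Rightarrow> (nat \<Rightarrow> 'm) \<Rightarrow> nat \<Rightarrow> 'm" where
  "sN \<equiv> minus_dt_t X N"

lemma sN_eq:
  assumes W: "open W" and u: "u \<in> carrier (sect N W)"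
  shows "sN W u = s_op X W \<odot>\<^bsub>sect N W\<^esub> u"
proof -
  note D = t_op_D_sec[OF X W] dt_op_D_sec[OF X W]
  show ?thesis unfolding minus_dt_t_def s_op_def
    by (simp add: N.op_comp_smult W D u N.op_comp_mem N.scal_mem N.minus_eq_sc N.sc_def N.smult_mem del: N_carrier)
qed

lemma sN_mem: "open W \<Longrightarrow> u \<in> carrier (sect N W) \<Longrightarrow> sN W u \<in> carrier (sect N W)"
  using sN_eq N.smult_mem s_op_D_sec[OF X] by metis

lemma sN_add: "open W \<Longrightarrow> u \<in> carrier (sect N W) \<Longrightarrow> v \<in> carrier (sect N W) \<Longrightarrow>
   sN W (u \<oplus>\<^bsub>sect N W\<^esub> v) = sN W u \<oplus>\<^bsub>sect N W\<^esub> sN W v"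
  by (simp add: sN_eq N.add_mem N.smult_add s_op_D_sec[OF X] del: N_carrier)

lemma sN_zero: "open W \<Longrightarrow> sN W \<zero>\<^bsub>sect N W\<^esub> = \<zero>\<^bsub>sect N W\<^esub>"
  by (simp add: sN_eq s_op_D_sec[OF X] del: N_carrier)

lemma sN_sc: "open W \<Longrightarrow> u \<in> carrier (sect N W) \<Longrightarrow> sN W (N.sc W a u) = N.sc W a (sN W u)"
  by (simp add: sN_eq N.sc_mem N.smult_sc s_op_D_sec[OF X] del: N_carrier)

lemma sN_restr: "open W \<Longrightarrow> open V \<Longrightarrow> V \<subseteq> W \<Longrightarrow> u \<in> carrier (sect N W) \<Longrightarrow>
   restr N W V (sN W u) = sN V (restr N W V u)"
  by (simp add: sN_eq N.restr_closed N.restr_smult s_op_D_sec[OF X] op_res_s_op del: N_carrier)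

lemma sN_lift: "open U \<Longrightarrow> P \<in> D_sec X U \<Longrightarrow> u \<in> carrier (sect N (cyl U)) \<Longrightarrow>
   sN (cyl U) (lift_op X U P \<odot>\<^bsub>sect N (cyl U)\<^esub> u) = lift_op X U P \<odot>\<^bsub>sect N (cyl U)\<^esub> sN (cyl U) u"
  by (simp add: sN_eq N.smult_mem lift_op_local(1)[OF X] N.op_comp_smult[symmetric] s_op_D_sec[OF X]
      s_op_lift_op[OF X] del: N_carrier)

lemma sN_deg_lt:
  assumes W: "open W" and u: "u \<in> deg_lt (pre W) d"
  shows "sN W u \<in> deg_lt (pre W) (Suc d)"
    and "d = Suc e \<Longrightarrow> sN W u d = \<ominus>\<^bsub>sect M (pre W)\<^esub> f_act (pre W) (u e)"
proof -
  note G = open_pre[OF W]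
  have t: "t_op X W \<odot>\<^bsub>sect N W\<^esub> u \<in> deg_lt (pre W) d" using t_op_deg_lt[OF W u] by simp
  note st = seq_sec_shift[OF G deg_lt_seq_sec[OF G t]]
  have e: "sN W u = (\<lambda>j. \<ominus>\<^bsub>sect M (pre W)\<^esub> shift (z0 (pre W)) (t_op X W \<odot>\<^bsub>sect N W\<^esub> u) j)"
    unfolding minus_dt_t_def N_facts(4)[OF W deg_lt_seq_sec[OF G t]] by (rule N_minus[OF W st])
  show "sN W u \<in> deg_lt (pre W) (Suc d)" unfolding e by (intro deg_lt_minus deg_lt_shift G t)
  show "sN W u d = \<ominus>\<^bsub>sect M (pre W)\<^esub> f_act (pre W) (u e)" if "d = Suc e"
    unfolding e using t_op_deg_lt[OF W u] that by simp
qed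

text \<open>Choosing \<open>v\<close> with a single coefficient, whose product with \<open>-f\<close> is the top coefficient of \<open>u\<close>,
  makes \<open>u - s v\<close> of lower degree.\<close>

lemma horner_exists:
  assumes W: "open W"
  shows "u \<in> deg_lt (pre W) (Suc d) \<Longrightarrow> \<exists>m0\<in>carrier (sect M (pre W)). \<exists>v\<in>deg_lt (pre W) d.
    u = delta (z0 (pre W)) m0 \<oplus>\<^bsub>sect N W\<^esub> sN W v"
proof (induction d arbitrary: u)
  case 0
  note G = open_pre[OF W]
  interpret A: abelian_group "sect N W" by (rule N.abelian_group_sect[OF W])
  have u: "u = delta (z0 (pre W)) (u 0)" and u0: "u 0 \<in> carrier (sect M (pre W))"
    using 0 by (auto simp: deg_lt_def delta_def fun_eq_iff)
  have "delta (z0 (pre W)) (u 0) \<in> carrier (sect N W)" using deg_lt_seq_sec[OF G deg_lt_delta[OF G u0]] W by simp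
  then have "delta (z0 (pre W)) (u 0) \<oplus>\<^bsub>sect N W\<^esub> sN W \<zero>\<^bsub>sect N W\<^esub> = delta (z0 (pre W)) (u 0)"
    unfolding sN_zero[OF W] by (rule A.r_zero)
  then have "u = delta (z0 (pre W)) (u 0) \<oplus>\<^bsub>sect N W\<^esub> sN W \<zero>\<^bsub>sect N W\<^esub>"
    by (rule trans[OF u sym])
  moreover have "\<zero>\<^bsub>sect N W\<^esub> \<in> deg_lt (pre W) 0" using deg_lt_zero[OF G] N_zero[OF W] by simp
  ultimately show ?case using u0 by blast
next
  case (Suc d)
  note G = open_pre[OF W]
  interpret A: abelian_group "sect N W" by (rule N.abelian_group_sect[OF W])
  interpret B: abelian_group "sect M (pre W)" by (rule M.abelian_group_sect[OF G])
  have uc: "u j \<in> carrier (sect M (pre W))" for j using Suc.prems by (simp add: deg_lt_def)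
  have "\<ominus>\<^bsub>sect M (pre W)\<^esub> u (Suc d) \<in> f_act (pre W) ` carrier (sect M (pre W))"
    unfolding bij_betw_imp_surj_on[OF f_act_bij[OF G]] by (rule B.a_inv_closed[OF uc])
  then obtain g where g: "g \<in> carrier (sect M (pre W))" "f_act (pre W) g = \<ominus>\<^bsub>sect M (pre W)\<^esub> u (Suc d)"
    by (elim imageE) simp
  define v where "v = (\<lambda>j. if j = d then g else z0 (pre W))"
  have v: "v \<in> deg_lt (pre W) (Suc d)" using g by (auto simp: v_def deg_lt_def)
  have sv: "sN W v \<in> deg_lt (pre W) (Suc (Suc d))" "sN W v (Suc d) = u (Suc d)"
    using sN_deg_lt[OF W v] g uc by (simp_all add: v_def)
  have c: "u \<in> seq_sec M (pre W)" "sN W v \<in> seq_sec M (pre W)" "v \<in> seq_sec M (pre W)"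
    by (rule deg_lt_seq_sec[OF G], fact)+
  define w where "w = u \<oplus>\<^bsub>sect N W\<^esub> \<ominus>\<^bsub>sect N W\<^esub> sN W v"
  have w: "w = (\<lambda>j. u j \<oplus>\<^bsub>sect M (pre W)\<^esub> \<ominus>\<^bsub>sect M (pre W)\<^esub> sN W v j)"
    unfolding w_def N_minus[OF W c(2)]
    by (rule N_add[OF W c(1) deg_lt_seq_sec[OF G deg_lt_minus[OF G sv(1)]]])
  have wS: "w \<in> deg_lt (pre W) (Suc (Suc d))" unfolding w by (intro deg_lt_add deg_lt_minus G Suc.prems sv)
  moreover have "w (Suc d) = z0 (pre W)" unfolding w sv(2) using uc by (simp add: B.r_neg)
  ultimately have "w \<in> deg_lt (pre W) (Suc d)"
    by (rule deg_lt_drop)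
  from Suc.IH[OF this] obtain m0 v' where m0: "m0 \<in> carrier (sect M (pre W))" "v' \<in> deg_lt (pre W) d"
    "w = delta (z0 (pre W)) m0 \<oplus>\<^bsub>sect N W\<^esub> sN W v'" by blast
  have c': "delta (z0 (pre W)) m0 \<in> carrier (sect N W)" "v' \<in> carrier (sect N W)" "v \<in> carrier (sect N W)"
    "u \<in> carrier (sect N W)"
    using deg_lt_seq_sec[OF G deg_lt_delta[OF G m0(1)]] deg_lt_seq_sec[OF G m0(2)] c W by simp_all
  have "u = w \<oplus>\<^bsub>sect N W\<^esub> sN W v"
    unfolding w_def using c' sN_mem[OF W c'(3)] by (simp add: A.a_assoc A.l_neg)
  also have "\<dots> = delta (z0 (pre W)) m0 \<oplus>\<^bsub>sect N W\<^esub> sN W (v' \<oplus>\<^bsub>sect N W\<^esub> v)"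
    unfolding m0(3) sN_add[OF W c'(2,3)] using c' sN_mem[OF W] by (simp add: A.a_assoc)
  finally have "u = delta (z0 (pre W)) m0 \<oplus>\<^bsub>sect N W\<^esub> sN W (v' \<oplus>\<^bsub>sect N W\<^esub> v)" .
  moreover have "v' \<oplus>\<^bsub>sect N W\<^esub> v \<in> deg_lt (pre W) (Suc d)"
    using N_add[OF W, of v' v] deg_lt_add[OF G deg_lt_mono[OF m0(2)] v] c' W by simp
  ultimately show ?case using m0(1) by blast
qed

text \<open>The top coefficient of \<open>s v\<close> is that of \<open>v\<close> times
  \<open>-f\<close> and cannot be cancelled by \<open>m\<^sub>0 \<otimes> 1\<close>; injectivity of
  \<open>f\<close> lowers the degree of \<open>v\<close> until nothing is left.\<close>

lemma horner_unique:
  assumes W: "open W" and m0: "m0 \<in> carrier (sect M (pre W))"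
  shows "v \<in> deg_lt (pre W) d \<Longrightarrow> delta (z0 (pre W)) m0 \<oplus>\<^bsub>sect N W\<^esub> sN W v = \<zero>\<^bsub>sect N W\<^esub> \<Longrightarrow>
    m0 = z0 (pre W) \<and> v = \<zero>\<^bsub>sect N W\<^esub>"
proof (induction d arbitrary: v)
  case 0
  note G = open_pre[OF W]
  interpret A: abelian_group "sect N W" by (rule N.abelian_group_sect[OF W])
  have v: "v = \<zero>\<^bsub>sect N W\<^esub>" using deg_lt_0[OF 0(1)] N_zero[OF W] by simp
  have "delta (z0 (pre W)) m0 \<in> carrier (sect N W)" using deg_lt_seq_sec[OF G deg_lt_delta[OF G m0]] W by simp
  then have "delta (z0 (pre W)) m0 = \<zero>\<^bsub>sect N W\<^esub>"
    using 0(2) unfolding v sN_zero[OF W] by simp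
  then have "delta (z0 (pre W)) m0 = (\<lambda>j. z0 (pre W))" unfolding N_zero[OF W] .
  then have "delta (z0 (pre W)) m0 0 = z0 (pre W)" by simp
  then show ?case using v by (simp add: delta_def)
next
  case (Suc d)
  note G = open_pre[OF W]
  interpret B: abelian_group "sect M (pre W)" by (rule M.abelian_group_sect[OF G])
  have vc: "v j \<in> carrier (sect M (pre W))" for j using Suc.prems(1) by (simp add: deg_lt_def)
  note sv = sN_deg_lt[OF W Suc.prems(1)]
  have "delta (z0 (pre W)) m0 \<oplus>\<^bsub>sect N W\<^esub> sN W v = (\<lambda>j. delta (z0 (pre W)) m0 j \<oplus>\<^bsub>sect M (pre W)\<^esub> sN W v j)"
    by (rule N_add[OF W deg_lt_seq_sec[OF G deg_lt_delta[OF G m0]] deg_lt_seq_sec[OF G sv(1)]])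
  then have "(\<lambda>j. delta (z0 (pre W)) m0 j \<oplus>\<^bsub>sect M (pre W)\<^esub> sN W v j) = (\<lambda>j. z0 (pre W))"
    using Suc.prems(2) N_zero[OF W] by simp
  then have "delta (z0 (pre W)) m0 (Suc d) \<oplus>\<^bsub>sect M (pre W)\<^esub> sN W v (Suc d) = z0 (pre W)" by (rule fun_cong)
  moreover have fv: "f_act (pre W) (v d) \<in> carrier (sect M (pre W))" by (rule M.smult_mem[OF G f_op[OF G] vc])
  ultimately have "\<ominus>\<^bsub>sect M (pre W)\<^esub> f_act (pre W) (v d) = z0 (pre W)"
    using sv(2)[of d] by (simp add: delta_def)
  then have "f_act (pre W) (v d) = f_act (pre W) (z0 (pre W))"
    using fv M.smult_zero[OF G f_op[OF G]] B.minus_minus[OF fv] by simp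
  then have "v d = z0 (pre W)"
    using bij_betw_imp_inj_on[OF f_act_bij[OF G]] vc by (auto dest: inj_onD)
  then have "v \<in> deg_lt (pre W) d" by (rule deg_lt_drop[OF Suc.prems(1)])
  then show ?case by (rule Suc.IH[OF _ Suc.prems(2)])
qed

end


section \<open>The identification of \<open>M[s] f^s\<close> with the graph direct image\<close>

context graph_setting
begin

text \<open>Horner's scheme for \<open>\<Sum>j<d. s^j (m\<^sub>j \<otimes> 1)\<close>.\<close>

primrec horner :: "'a set \<Rightarrow> nat \<Rightarrow> (nat \<Rightarrow> 'm) \<Rightarrow> nat \<Rightarrow> 'm" where
  "horner U 0 m = \<zero>\<^bsub>sect N (cyl U)\<^esub>"
| "horner U (Suc d) m = delta (z0 U) (m 0) \<oplus>\<^bsub>sect N (cyl U)\<^esub> sN (cyl U) (horner U d (\<lambda>j. m (Suc j)))"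

lemma N_cyl_carrier [simp]: "open U \<Longrightarrow> carrier (sect N (cyl U)) = seq_sec M U"
  by simp

lemma delta_mem: "open U \<Longrightarrow> m0 \<in> carrier (sect M U) \<Longrightarrow> delta (z0 U) m0 \<in> carrier (sect N (cyl U))"
  using deg_lt_seq_sec[OF _ deg_lt_delta] by simp

lemma horner_deg_lt:
  assumes U: "open U"
  shows "(\<And>j. m j \<in> carrier (sect M U)) \<Longrightarrow> horner U d m \<in> deg_lt U d"
proof (induction d arbitrary: m)
  case 0 show ?case using deg_lt_zero[OF U] N_zero[OF open_cyl[OF U]] by simp
next
  case (Suc d)
  let ?h = "horner U d (\<lambda>j. m (Suc j))"
  have h: "?h \<in> deg_lt U d" using Suc by simp
  have s: "sN (cyl U) ?h \<in> deg_lt U (Suc d)" using sN_deg_lt(1)[OF open_cyl[OF U], of ?h d] h by simp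
  note d = deg_lt_delta[OF U Suc.prems]
  have "horner U (Suc d) m = (\<lambda>j. delta (z0 U) (m 0) j \<oplus>\<^bsub>sect M U\<^esub> sN (cyl U) ?h j)"
    using N_add[OF open_cyl[OF U], of "delta (z0 U) (m 0)" "sN (cyl U) ?h"] deg_lt_seq_sec[OF U d] deg_lt_seq_sec[OF U s] by simp
  then show ?case using deg_lt_add[OF U d s] by simp
qed

lemma horner_mem: "open U \<Longrightarrow> (\<And>j. m j \<in> carrier (sect M U)) \<Longrightarrow> horner U d m \<in> carrier (sect N (cyl U))"
  using deg_lt_seq_sec[OF _ horner_deg_lt] by simp

lemma horner_zero: "open U \<Longrightarrow> horner U d (\<lambda>j. z0 U) = \<zero>\<^bsub>sect N (cyl U)\<^esub>"
proof (induction d)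
  case (Suc d)
  interpret A: abelian_group "sect N (cyl U)" by (rule N.abelian_group_sect[OF open_cyl[OF Suc.prems]])
  have "delta (z0 U) (z0 U) = \<zero>\<^bsub>sect N (cyl U)\<^esub>"
    using N_zero[OF open_cyl[OF Suc.prems]] by (auto simp: delta_def)
  then show ?case using Suc sN_zero[OF open_cyl[OF Suc.prems]] by (simp del: N_carrier N_cyl_carrier)
qed simp

lemma horner_extend: "open U \<Longrightarrow> m \<in> deg_lt U d \<Longrightarrow> d \<le> e \<Longrightarrow> horner U e m = horner U d m"
proof (induction d arbitrary: m e)
  case 0
  then show ?case using deg_lt_0[OF 0(2)] horner_zero by simp
next
  case (Suc d)
  obtain e' where e: "e = Suc e'" using Suc.prems by (cases e) auto
  then show ?case using Suc.IH[OF Suc.prems(1) deg_lt_tail[OF Suc.prems(2)], of e'] Suc.prems by simp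
qed

lemma horner_add:
  assumes U: "open U"
  shows "(\<And>j. m j \<in> carrier (sect M U)) \<Longrightarrow> (\<And>j. m' j \<in> carrier (sect M U)) \<Longrightarrow>
    horner U d (\<lambda>j. m j \<oplus>\<^bsub>sect M U\<^esub> m' j) = horner U d m \<oplus>\<^bsub>sect N (cyl U)\<^esub> horner U d m'"
proof (induction d arbitrary: m m')
  case 0
  interpret A: abelian_group "sect N (cyl U)" by (rule N.abelian_group_sect[OF open_cyl[OF U]])
  show ?case by simp
next
  case (Suc d)
  interpret A: abelian_group "sect N (cyl U)" by (rule N.abelian_group_sect[OF open_cyl[OF U]])
  interpret B: abelian_group "sect M U" by (rule M.abelian_group_sect[OF U])
  let ?t = "\<lambda>m j. m (Suc j)"
  have "delta (z0 U) (m 0 \<oplus>\<^bsub>sect M U\<^esub> m' 0) = (\<lambda>j. delta (z0 U) (m 0) j \<oplus>\<^bsub>sect M U\<^esub> delta (z0 U) (m' 0) j)"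
    by (auto simp: delta_def)
  also have "\<dots> = delta (z0 U) (m 0) \<oplus>\<^bsub>sect N (cyl U)\<^esub> delta (z0 U) (m' 0)"
    using N_add[OF open_cyl[OF U], of "delta (z0 U) (m 0)" "delta (z0 U) (m' 0)"] delta_mem[OF U] Suc.prems U by simp
  finally have d: "delta (z0 U) (m 0 \<oplus>\<^bsub>sect M U\<^esub> m' 0) = delta (z0 U) (m 0) \<oplus>\<^bsub>sect N (cyl U)\<^esub> delta (z0 U) (m' 0)" .
  have h: "horner U d (?t m) \<in> carrier (sect N (cyl U))" "horner U d (?t m') \<in> carrier (sect N (cyl U))"
    by (intro horner_mem U Suc.prems)+
  have dm: "delta (z0 U) (m 0) \<in> carrier (sect N (cyl U))" "delta (z0 U) (m' 0) \<in> carrier (sect N (cyl U))"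
    by (intro delta_mem U Suc.prems)+
  note s = sN_mem[OF open_cyl[OF U]]
  have IH: "horner U d (\<lambda>j. m (Suc j) \<oplus>\<^bsub>sect M U\<^esub> m' (Suc j)) = horner U d (?t m) \<oplus>\<^bsub>sect N (cyl U)\<^esub> horner U d (?t m')"
    by (rule Suc.IH) (rule Suc.prems)+
  show ?case unfolding horner.simps d IH sN_add[OF open_cyl[OF U] h]
    using s[OF h(1)] s[OF h(2)] dm by (simp add: A.a_ac del: N_carrier N_cyl_carrier)
qed

lemma restr_delta:
  assumes U: "open U" and V: "open V" "V \<subseteq> U" and m: "m0 \<in> carrier (sect M U)"
  shows "restr N (cyl U) (cyl V) (delta (z0 U) m0) = delta (z0 V) (restr M U V m0)"
proof -
  have "cyl V \<subseteq> cyl U" using V by auto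
  then show ?thesis
    using N_facts(2)[OF open_cyl[OF U] open_cyl[OF V(1)], of "delta (z0 U) m0"] deg_lt_seq_sec[OF U deg_lt_delta[OF U m]] U V
    by (auto simp: delta_def fun_eq_iff)
qed

lemma horner_restr:
  assumes U: "open U" and V: "open V" "V \<subseteq> U"
  shows "(\<And>j. m j \<in> carrier (sect M U)) \<Longrightarrow>
    restr N (cyl U) (cyl V) (horner U d m) = horner V d (\<lambda>j. restr M U V (m j))"
proof (induction d arbitrary: m)
  case 0
  show ?case using U V by (simp add: Sigma_mono)
next
  case (Suc d)
  have c: "cyl V \<subseteq> cyl U" using V by auto
  let ?h = "horner U d (\<lambda>j. m (Suc j))"
  have h: "?h \<in> carrier (sect N (cyl U))" by (intro horner_mem U Suc.prems)
  have IH: "restr N (cyl U) (cyl V) ?h = horner V d (\<lambda>j. restr M U V (m (Suc j)))"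
    by (rule Suc.IH) (rule Suc.prems)
  show ?case unfolding horner.simps
    by (simp only: N.restr_add[OF open_cyl[OF U] open_cyl[OF V(1)] c delta_mem[OF U Suc.prems] sN_mem[OF open_cyl[OF U] h]]
      restr_delta[OF U V Suc.prems] sN_restr[OF open_cyl[OF U] open_cyl[OF V(1)] c h] IH)
qed

lemma horner_shift: "open U \<Longrightarrow> (\<And>j. m j \<in> carrier (sect M U)) \<Longrightarrow> horner U (Suc d) (shift (z0 U) m) = sN (cyl U) (horner U d m)"
proof -
  assume U: "open U" and m: "\<And>j. m j \<in> carrier (sect M U)"
  interpret A: abelian_group "sect N (cyl U)" by (rule N.abelian_group_sect[OF open_cyl[OF U]])
  have "delta (z0 U) (z0 U) = \<zero>\<^bsub>sect N (cyl U)\<^esub>"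
    using N_zero[OF open_cyl[OF U]] by (auto simp: delta_def)
  then show ?thesis using sN_mem[OF open_cyl[OF U] horner_mem[OF U m]] by (simp del: N_carrier N_cyl_carrier)
qed

lemma horner_inj: "open U \<Longrightarrow> m \<in> deg_lt U d \<Longrightarrow> horner U d m = \<zero>\<^bsub>sect N (cyl U)\<^esub> \<Longrightarrow> m = (\<lambda>j. z0 U)"
proof (induction d arbitrary: m)
  case 0
  then show ?case using deg_lt_0 by simp
next
  case (Suc d)
  have mc: "m j \<in> carrier (sect M U)" for j using Suc.prems by (simp add: deg_lt_def)
  have h: "horner U d (\<lambda>j. m (Suc j)) \<in> deg_lt (pre (cyl U)) d" using horner_deg_lt[OF Suc.prems(1), of "\<lambda>j. m (Suc j)" d] mc by simp
  have "m 0 = z0 (pre (cyl U)) \<and> horner U d (\<lambda>j. m (Suc j)) = \<zero>\<^bsub>sect N (cyl U)\<^esub>"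
    by (rule horner_unique[OF open_cyl[OF Suc.prems(1)] _ h]) (use mc Suc.prems in simp_all)
  then have "m 0 = z0 U" "(\<lambda>j. m (Suc j)) = (\<lambda>j. z0 U)"
    using Suc.IH[OF Suc.prems(1) deg_lt_tail[OF Suc.prems(2)]] by simp_all
  then have "m j = z0 U" for j by (cases j) (auto dest: fun_cong)
  then show ?case by blast
qed

lemma horner_surj: "open U \<Longrightarrow> u \<in> deg_lt U d \<Longrightarrow> \<exists>m\<in>deg_lt U d. u = horner U d m"
proof (induction d arbitrary: u)
  case 0
  then show ?case using deg_lt_0[OF 0(2)] N_zero[OF open_cyl[OF 0(1)]] deg_lt_zero by auto
next
  case (Suc d)
  have "u \<in> deg_lt (pre (cyl U)) (Suc d)" using Suc.prems by simp
  from horner_exists[OF open_cyl[OF Suc.prems(1)] this] obtain m0 v where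
    v: "m0 \<in> carrier (sect M U)" "v \<in> deg_lt U d" "u = delta (z0 U) m0 \<oplus>\<^bsub>sect N (cyl U)\<^esub> sN (cyl U) v" by auto
  obtain m where m: "m \<in> deg_lt U d" "v = horner U d m" using Suc.IH[OF Suc.prems(1) v(2)] by blast
  define m' where "m' = (\<lambda>j. case j of 0 \<Rightarrow> m0 | Suc i \<Rightarrow> m i)"
  have "m' \<in> deg_lt U (Suc d)" using m(1) v(1) by (auto simp: m'_def deg_lt_def split: nat.splits)
  moreover have "u = horner U (Suc d) m'" using v(3) m(2) by (simp add: m'_def)
  ultimately show ?case by blast
qed

lemma sN_pow_mem: "open W \<Longrightarrow> u \<in> carrier (sect N W) \<Longrightarrow> (sN W ^^ j) u \<in> carrier (sect N W)"
  by (induction j) (auto intro: sN_mem simp del: N_carrier)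

lemma sN_finsum:
  assumes W: "open W" and u: "\<And>i. i \<in> {..<(d::nat)} \<Longrightarrow> u i \<in> carrier (sect N W)"
  shows "sN W (\<Oplus>\<^bsub>sect N W\<^esub>i\<in>{..<d}. u i) = (\<Oplus>\<^bsub>sect N W\<^esub>i\<in>{..<d}. sN W (u i))"
proof -
  interpret A: abelian_group "sect N W" by (rule N.abelian_group_sect[OF W])
  show ?thesis using u
  proof (induction d)
    case 0 show ?case using sN_zero[OF W] by simp
  next
    case (Suc d)
    have p: "u \<in> {..<d} \<rightarrow> carrier (sect N W)" "(\<lambda>i. sN W (u i)) \<in> {..<d} \<rightarrow> carrier (sect N W)"
      and ud: "u d \<in> carrier (sect N W)"
      using Suc.prems sN_mem[OF W] by auto
    show ?case unfolding lessThan_Suc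
      using A.finsum_insert[OF _ _ p(1) ud] A.finsum_insert[OF _ _ p(2) sN_mem[OF W ud]]
        sN_add[OF W ud A.finsum_closed[OF p(1)]] Suc by simp
  qed
qed

lemma horner_eq_finsum:
  assumes U: "open U"
  shows "(\<And>j. m j \<in> carrier (sect M U)) \<Longrightarrow>
    horner U d m = (\<Oplus>\<^bsub>sect N (cyl U)\<^esub>j\<in>{..<d}. (sN (cyl U) ^^ j) (delta (z0 U) (m j)))"
proof (induction d arbitrary: m)
  case 0
  interpret A: abelian_group "sect N (cyl U)" by (rule N.abelian_group_sect[OF open_cyl[OF U]])
  show ?case by simp
next
  case (Suc d)
  interpret A: abelian_group "sect N (cyl U)" by (rule N.abelian_group_sect[OF open_cyl[OF U]])
  let ?g = "\<lambda>m j. (sN (cyl U) ^^ j) (delta (z0 U) (m j))"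
  have g: "?g m j \<in> carrier (sect N (cyl U))" if "\<And>j. m j \<in> carrier (sect M U)" for m j
    by (intro sN_pow_mem open_cyl U delta_mem that)
  have gm: "?g m j \<in> carrier (sect N (cyl U))" for j by (rule g) (rule Suc.prems)
  have IH: "horner U d (\<lambda>j. m (Suc j)) = (\<Oplus>\<^bsub>sect N (cyl U)\<^esub>j\<in>{..<d}. ?g (\<lambda>j. m (Suc j)) j)"
    by (rule Suc.IH) (rule Suc.prems)
  have "sN (cyl U) (horner U d (\<lambda>j. m (Suc j))) =
     (\<Oplus>\<^bsub>sect N (cyl U)\<^esub>j\<in>{..<d}. sN (cyl U) (?g (\<lambda>j. m (Suc j)) j))"
    unfolding IH by (rule sN_finsum[OF open_cyl[OF U]]) (rule g, rule Suc.prems)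
  also have "\<dots> = (\<Oplus>\<^bsub>sect N (cyl U)\<^esub>j\<in>{..<d}. ?g m (Suc j))" by simp
  also have "\<dots> = (\<Oplus>\<^bsub>sect N (cyl U)\<^esub>j\<in>Suc ` {..<d}. ?g m j)"
    by (rule A.finsum_reindex[symmetric]) (rule Pi_I, rule gm, simp)
  finally have e: "sN (cyl U) (horner U d (\<lambda>j. m (Suc j))) = (\<Oplus>\<^bsub>sect N (cyl U)\<^esub>j\<in>Suc ` {..<d}. ?g m j)" .
  have "(\<Oplus>\<^bsub>sect N (cyl U)\<^esub>j\<in>insert 0 (Suc ` {..<d}). ?g m j) = ?g m 0 \<oplus>\<^bsub>sect N (cyl U)\<^esub> (\<Oplus>\<^bsub>sect N (cyl U)\<^esub>j\<in>Suc ` {..<d}. ?g m j)"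
    by (rule A.finsum_insert) (simp, simp, rule Pi_I, rule gm, rule gm)
  moreover have "insert 0 (Suc ` {..<d}) = {..<Suc d}" by (simp add: lessThan_Suc_eq_insert_0)
  ultimately show ?case by (simp add: e)
qed

subsection \<open>Existence and uniqueness of the identification\<close>

abbreviation rs :: "'a set \<Rightarrow> 'a set \<Rightarrow> (nat \<Rightarrow> 'm) \<Rightarrow> nat \<Rightarrow> 'm" where
  "rs U V m \<equiv> (\<lambda>j. restr M U V (m j))"

abbreviation rN :: "'a set \<Rightarrow> 'a set \<Rightarrow> (nat \<Rightarrow> 'm) \<Rightarrow> nat \<Rightarrow> 'm" where
  "rN U V \<equiv> restr N (cyl U) (cyl V)"

abbreviation \<Phi> :: "'a set \<Rightarrow> (nat \<Rightarrow> 'm) \<Rightarrow> nat \<Rightarrow> 'm" where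
  "\<Phi> \<equiv> graph_ident X M N"

lemma cyl_mono: "V \<subseteq> U \<Longrightarrow> cyl V \<subseteq> cyl U" by auto

lemma cyl_Int: "cyl U \<inter> cyl V = cyl (U \<inter> V)" by auto

lemma rN_mem: "open U \<Longrightarrow> open V \<Longrightarrow> V \<subseteq> U \<Longrightarrow> u \<in> carrier (sect N (cyl U)) \<Longrightarrow> rN U V u \<in> carrier (sect N (cyl V))"
  by (rule N.restr_closed[OF open_cyl open_cyl cyl_mono])

lemma rN_rN: "open U \<Longrightarrow> open V \<Longrightarrow> open W \<Longrightarrow> W \<subseteq> V \<Longrightarrow> V \<subseteq> U \<Longrightarrow> u \<in> carrier (sect N (cyl U)) \<Longrightarrow>
   rN V W (rN U V u) = rN U W u"
  by (rule N.restr_restr[OF open_cyl open_cyl open_cyl cyl_mono cyl_mono])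

lemma rs_eq_restr_L: "open U \<Longrightarrow> open V \<Longrightarrow> V \<subseteq> U \<Longrightarrow> m \<in> seq_sec M U \<Longrightarrow> restr L U V m = rs U V m"
  by (rule L_facts(2))

lemma rs_mem: "open U \<Longrightarrow> open V \<Longrightarrow> V \<subseteq> U \<Longrightarrow> m \<in> seq_sec M U \<Longrightarrow> rs U V m \<in> seq_sec M V"
  using L.restr_closed[of U V m] rs_eq_restr_L[of U V m] by simp

lemma rs_rs: "open U \<Longrightarrow> open V \<Longrightarrow> open W \<Longrightarrow> W \<subseteq> V \<Longrightarrow> V \<subseteq> U \<Longrightarrow> m \<in> seq_sec M U \<Longrightarrow>
   rs V W (rs U V m) = rs U W m"
  by (simp add: M.restr_restr seq_sec_comp)

lemma rs_id: "open U \<Longrightarrow> m \<in> seq_sec M U \<Longrightarrow> rs U U m = m"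
  by (simp add: seq_sec_comp)

lemma N_cyl_eqI:
  assumes U: "open U" and u: "u \<in> carrier (sect N (cyl U))" "v \<in> carrier (sect N (cyl U))"
    and loc: "\<And>x. x \<in> U \<Longrightarrow> \<exists>V. open V \<and> x \<in> V \<and> V \<subseteq> U \<and> rN U V u = rN U V v"
  shows "u = v"
proof (rule N.section_eqI[OF open_cyl[OF U] u])
  fix p :: "'a \<times> complex" assume "p \<in> cyl U"
  then have "fst p \<in> U" by auto
  from loc[OF this] obtain V where V: "open V" "fst p \<in> V" "V \<subseteq> U" "rN U V u = rN U V v" by (elim exE conjE)
  then show "\<exists>W. open W \<and> p \<in> W \<and> W \<subseteq> cyl U \<and> restr N (cyl U) W u = restr N (cyl U) W v"
    by (intro exI[of _ "cyl V"]) (auto simp: mem_Times_iff intro: open_Times)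
qed

text \<open>A locally finite sequence is finite on small open sets, so equality of sections attached
  to it need be tested only there.\<close>

lemma local_check:
  assumes U: "open U" and u: "u \<in> carrier (sect N (cyl U))" "v \<in> carrier (sect N (cyl U))" and m: "m \<in> seq_sec M U"
    and loc: "\<And>V d. open V \<Longrightarrow> V \<subseteq> U \<Longrightarrow> rs U V m \<in> deg_lt V d \<Longrightarrow> rN U V u = rN U V v"
  shows "u = v"
proof (rule N_cyl_eqI[OF U u])
  fix x assume "x \<in> U"
  from seq_sec_local[OF m U this] obtain V d where V: "open V" "x \<in> V" "V \<subseteq> U" "rs U V m \<in> deg_lt V d" .
  then show "\<exists>V. open V \<and> x \<in> V \<and> V \<subseteq> U \<and> rN U V u = rN U V v"
    using loc by (intro exI[of _ V]) simp
qed

lemma ident_iff: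
  assumes U: "open U" and m: "m \<in> seq_sec M U" and V: "open V" "V \<subseteq> U" "\<forall>j\<ge>d. restr M U V (m j) = z0 V"
  shows "horner V d (rs U V m) = (\<Oplus>\<^bsub>sect N (cyl V)\<^esub>j\<in>{..<d}. (sN (cyl V) ^^ j) (delta (z0 V) (restr M U V (m j))))"
  by (rule horner_eq_finsum[OF V(1)]) (use U V m in \<open>auto simp: seq_sec_comp\<close>)

lemma rs_deg_lt_iff:
  assumes "open U" "m \<in> seq_sec M U" "open V" "V \<subseteq> U"
  shows "(\<forall>j\<ge>d. restr M U V (m j) = z0 V) \<longleftrightarrow> rs U V m \<in> deg_lt V d"
  using assms by (auto simp: deg_lt_def seq_sec_comp)

text \<open>Where \<open>m\<close> is finite the value is the Horner sum, which does not depend on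
  the bound for the degree and is compatible with restriction; so the local values glue.\<close>

lemma ident_exists:
  assumes U: "open U" and m: "m \<in> seq_sec M U"
  shows "\<exists>u. u \<in> carrier (sect N (cyl U)) \<and>
    (\<forall>V d. open V \<and> V \<subseteq> U \<and> rs U V m \<in> deg_lt V d \<longrightarrow> rN U V u = horner V d (rs U V m))"
proof -
  (* The degree bound is part of the index: the value must be the Horner sum for every admissible
     bound. *)
  define I where "I = {(V, d). open V \<and> V \<subseteq> U \<and> rs U V m \<in> deg_lt V d}"
  have I: "open (fst i)" "fst i \<subseteq> U" "rs U (fst i) m \<in> deg_lt (fst i) (snd i)" if "i \<in> I" for i
    using that by (auto simp: I_def)
  have mc: "restr M U V (m j) \<in> carrier (sect M V)" if "open V" "V \<subseteq> U" for V j
    using that U m by (simp add: seq_sec_comp)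
  let ?\<sigma> = "\<lambda>i. horner (fst i) (snd i) (rs U (fst i) m)"
  have res: "restr N (cyl V) (cyl (V \<inter> V')) (horner V d (rs U V m)) = horner (V \<inter> V') e (rs U (V \<inter> V') m)"
    if V: "open V" "V \<subseteq> U" "rs U V m \<in> deg_lt V d" and V': "open V'" "V' \<subseteq> U" and e: "d \<le> e" for V V' d e
  proof -
    have o: "open (V \<inter> V')" "V \<inter> V' \<subseteq> V" "V \<inter> V' \<subseteq> U" using V V' by auto
    have "restr N (cyl V) (cyl (V \<inter> V')) (horner V d (rs U V m)) = horner (V \<inter> V') d (rs V (V \<inter> V') (rs U V m))"
      by (rule horner_restr[OF V(1) o(1,2)]) (rule mc[OF V(1,2)])
    also have "rs V (V \<inter> V') (rs U V m) = rs U (V \<inter> V') m" by (rule rs_rs[OF U V(1) o(1,2) V(2) m])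
    also have "horner (V \<inter> V') d (rs U (V \<inter> V') m) = horner (V \<inter> V') e (rs U (V \<inter> V') m)"
      using horner_extend[OF o(1) _ e, of "rs U (V \<inter> V') m"] deg_lt_restr[OF V(1) o(1,2) V(3)]
        rs_rs[OF U V(1) o(1,2) V(2) m] by simp
    finally show ?thesis .
  qed
  have un: "cyl U = (\<Union>i\<in>I. cyl (fst i))"
  proof (intro equalityI subsetI)
    fix p :: "'a \<times> complex" assume "p \<in> cyl U"
    then have "fst p \<in> U" by auto
    from seq_sec_local[OF m U this] obtain V d where V: "open V" "fst p \<in> V" "V \<subseteq> U" "rs U V m \<in> deg_lt V d" .
    then show "p \<in> (\<Union>i\<in>I. cyl (fst i))" by (intro UN_I[of "(V, d)"]) (auto simp: I_def mem_Times_iff)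
  next
    fix p :: "'a \<times> complex" assume "p \<in> (\<Union>i\<in>I. cyl (fst i))"
    then obtain i where i: "i \<in> I" "p \<in> cyl (fst i)" by (rule UN_E)
    show "p \<in> cyl U" using cyl_mono[OF I(2)[OF i(1)]] i(2) by (rule subsetD)
  qed
  obtain u where u: "u \<in> carrier (sect N (cyl U))" "\<And>i. i \<in> I \<Longrightarrow> restr N (cyl U) (cyl (fst i)) u = ?\<sigma> i"
  proof (rule N.section_glue[of I "\<lambda>i. cyl (fst i)" ?\<sigma> "cyl U"])
    show "open (cyl (fst i))" if "i \<in> I" for i using I[OF that] by simp
    show "?\<sigma> i \<in> carrier (sect N (cyl (fst i)))" if "i \<in> I" for i
      by (intro horner_mem mc I[OF that])
    show "restr N (cyl (fst i)) (cyl (fst i) \<inter> cyl (fst j)) (?\<sigma> i) = restr N (cyl (fst j)) (cyl (fst i) \<inter> cyl (fst j)) (?\<sigma> j)"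
      if i: "i \<in> I" and j: "j \<in> I" for i j
      unfolding cyl_Int using res[OF I[OF i] I(1,2)[OF j], of "max (snd i) (snd j)"]
        res[OF I[OF j] I(1,2)[OF i], of "max (snd i) (snd j)"] by (simp add: Int_commute)
  qed (use un in auto)
  show ?thesis
  proof (intro exI conjI allI impI)
    show "u \<in> carrier (sect N (cyl U))" by (rule u)
    fix V d assume "open V \<and> V \<subseteq> U \<and> rs U V m \<in> deg_lt V d"
    then have "(V, d) \<in> I" by (simp add: I_def)
    from u(2)[OF this] show "rN U V u = horner V d (rs U V m)" by simp
  qed
qed

text \<open>The identification is defined by a definite description, so this is the only way to
  compute it.\<close>

lemma ident_eqI:
  assumes U: "open U" and m: "m \<in> seq_sec M U" and u: "u \<in> carrier (sect N (cyl U))"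
    and loc: "\<And>V d. open V \<Longrightarrow> V \<subseteq> U \<Longrightarrow> rs U V m \<in> deg_lt V d \<Longrightarrow> rN U V u = horner V d (rs U V m)"
  shows "\<Phi> U m = u"
proof -
  have iff: "(\<forall>V d. open V \<and> V \<subseteq> U \<and> (\<forall>j\<ge>d. restr M U V (m j) = z0 V) \<longrightarrow>
        rN U V u = (\<Oplus>\<^bsub>sect N (cyl V)\<^esub>j\<in>{..<d}. (sN (cyl V) ^^ j) (delta (z0 V) (restr M U V (m j))))) \<longleftrightarrow>
     (\<forall>V d. open V \<and> V \<subseteq> U \<and> rs U V m \<in> deg_lt V d \<longrightarrow> rN U V u = horner V d (rs U V m))" for u
  proof (intro all_cong1 imp_cong conj_cong refl)
    fix V and d :: nat assume V: "open V" "V \<subseteq> U"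
    show "(\<forall>j\<ge>d. restr M U V (m j) = z0 V) \<longleftrightarrow> rs U V m \<in> deg_lt V d" by (rule rs_deg_lt_iff[OF U m V])
  next
    fix V and d :: nat assume "open V \<and> V \<subseteq> U \<and> rs U V m \<in> deg_lt V d"
    then have V: "open V" "V \<subseteq> U" "\<forall>j\<ge>d. restr M U V (m j) = z0 V" using rs_deg_lt_iff[OF U m] by blast+
    show "(rN U V u = (\<Oplus>\<^bsub>sect N (cyl V)\<^esub>j\<in>{..<d}. (sN (cyl V) ^^ j) (delta (z0 V) (restr M U V (m j))))) =
      (rN U V u = horner V d (rs U V m))" unfolding ident_iff[OF U m V] by (rule refl)
  qed
  show ?thesis unfolding graph_ident_def iff
  proof (rule the_equality)
    show "u \<in> carrier (sect N (cyl U)) \<and>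
      (\<forall>V d. open V \<and> V \<subseteq> U \<and> rs U V m \<in> deg_lt V d \<longrightarrow> rN U V u = horner V d (rs U V m))" using u loc by blast
    fix v assume v: "v \<in> carrier (sect N (cyl U)) \<and>
      (\<forall>V d. open V \<and> V \<subseteq> U \<and> rs U V m \<in> deg_lt V d \<longrightarrow> rN U V v = horner V d (rs U V m))"
    show "v = u"
    proof (rule local_check[OF U conjunct1[OF v] u m])
      fix V d assume V: "open V" "V \<subseteq> U" "rs U V m \<in> deg_lt V d"
      have "rN U V v = horner V d (rs U V m)" using v V by blast
      then show "rN U V v = rN U V u" using loc[OF V] by simp
    qed
  qed
qed

lemma ident_mem: "open U \<Longrightarrow> m \<in> seq_sec M U \<Longrightarrow> \<Phi> U m \<in> carrier (sect N (cyl U))"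
  and ident_restr_deg_lt: "open U \<Longrightarrow> m \<in> seq_sec M U \<Longrightarrow> open V \<Longrightarrow> V \<subseteq> U \<Longrightarrow> rs U V m \<in> deg_lt V d \<Longrightarrow>
    rN U V (\<Phi> U m) = horner V d (rs U V m)"
proof -
  have *: "\<Phi> U m \<in> carrier (sect N (cyl U)) \<and>
    (\<forall>V d. open V \<and> V \<subseteq> U \<and> rs U V m \<in> deg_lt V d \<longrightarrow> rN U V (\<Phi> U m) = horner V d (rs U V m))"
    if U: "open U" and m: "m \<in> seq_sec M U" for U m
  proof -
    from ident_exists[OF U m] obtain u where u: "u \<in> carrier (sect N (cyl U))"
      "\<forall>V d. open V \<and> V \<subseteq> U \<and> rs U V m \<in> deg_lt V d \<longrightarrow> rN U V u = horner V d (rs U V m)" by (elim exE conjE)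
    have "\<Phi> U m = u" by (rule ident_eqI[OF U m u(1)]) (use u(2) in simp)
    then show ?thesis using u by simp
  qed
  show "open U \<Longrightarrow> m \<in> seq_sec M U \<Longrightarrow> \<Phi> U m \<in> carrier (sect N (cyl U))"
    by (rule conjunct1[OF *])
  show "open U \<Longrightarrow> m \<in> seq_sec M U \<Longrightarrow> open V \<Longrightarrow> V \<subseteq> U \<Longrightarrow> rs U V m \<in> deg_lt V d \<Longrightarrow>
    rN U V (\<Phi> U m) = horner V d (rs U V m)"
    using conjunct2[OF *] by simp
qed

lemma ident_deg_lt: "open U \<Longrightarrow> m \<in> deg_lt U d \<Longrightarrow> \<Phi> U m = horner U d m"
  using ident_restr_deg_lt[of U m U d] ident_mem[of U m] deg_lt_seq_sec[of U m d] rs_id[of U m]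
  by (simp del: N_carrier N_cyl_carrier)

lemma ident_restr:
  assumes U: "open U" and m: "m \<in> seq_sec M U" and V: "open V" "V \<subseteq> U"
  shows "rN U V (\<Phi> U m) = \<Phi> V (rs U V m)"
proof (rule ident_eqI[OF V(1) rs_mem[OF U V m] rN_mem[OF U V ident_mem[OF U m]], symmetric])
  fix W d assume W: "open W" "W \<subseteq> V" "rs V W (rs U V m) \<in> deg_lt W d"
  have WU: "W \<subseteq> U" using W V by blast
  have e: "rs V W (rs U V m) = rs U W m" by (rule rs_rs[OF U V(1) W(1,2) V(2) m])
  have "rN V W (rN U V (\<Phi> U m)) = rN U W (\<Phi> U m)" by (rule rN_rN[OF U V(1) W(1,2) V(2) ident_mem[OF U m]])
  also have "\<dots> = horner W d (rs U W m)" using ident_restr_deg_lt[OF U m W(1) WU] W(3) e by simp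
  finally show "rN V W (rN U V (\<Phi> U m)) = horner W d (rs V W (rs U V m))" using e by simp
qed

lemma seq_sec_add: "open U \<Longrightarrow> m \<in> seq_sec M U \<Longrightarrow> m' \<in> seq_sec M U \<Longrightarrow> m \<oplus>\<^bsub>sect L U\<^esub> m' \<in> seq_sec M U"
  using L.add_mem[of U m m'] by simp

lemma ident_add:
  assumes U: "open U" and m: "m \<in> seq_sec M U" "m' \<in> seq_sec M U"
  shows "\<Phi> U (m \<oplus>\<^bsub>sect L U\<^esub> m') = \<Phi> U m \<oplus>\<^bsub>sect N (cyl U)\<^esub> \<Phi> U m'"
proof (rule N_cyl_eqI[OF U])
  note mm = seq_sec_add[OF U m]
  show "\<Phi> U (m \<oplus>\<^bsub>sect L U\<^esub> m') \<in> carrier (sect N (cyl U))" by (rule ident_mem[OF U mm])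
  show "\<Phi> U m \<oplus>\<^bsub>sect N (cyl U)\<^esub> \<Phi> U m' \<in> carrier (sect N (cyl U))"
    by (intro N.add_mem open_cyl U ident_mem m)
  fix x assume x: "x \<in> U"
  from seq_sec_local[OF m(1) U x] obtain V d where V: "open V" "x \<in> V" "V \<subseteq> U" "rs U V m \<in> deg_lt V d" .
  have "x \<in> V" by (rule V)
  from seq_sec_local[OF rs_mem[OF U V(1,3) m(2)] V(1) this]
  obtain W e where W: "open W" "x \<in> W" "W \<subseteq> V" "rs V W (rs U V m') \<in> deg_lt W e" .
  have WU: "W \<subseteq> U" using W V by blast
  have f1: "rs U W m \<in> deg_lt W (max d e)"
    using deg_lt_mono[OF deg_lt_restr[OF V(1) W(1,3) V(4)], of "max d e"] rs_rs[OF U V(1) W(1,3) V(3) m(1)] by simp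
  have f2: "rs U W m' \<in> deg_lt W (max d e)"
    using deg_lt_mono[OF W(4), of "max d e"] rs_rs[OF U V(1) W(1,3) V(3) m(2)] by simp
  have c: "restr M U W (m j) \<in> carrier (sect M W)" "restr M U W (m' j) \<in> carrier (sect M W)" for j
    using m U W(1) WU by (simp_all add: seq_sec_comp)
  have e: "rs U W (m \<oplus>\<^bsub>sect L U\<^esub> m') = (\<lambda>j. restr M U W (m j) \<oplus>\<^bsub>sect M W\<^esub> restr M U W (m' j))"
    using m U W(1) WU by (simp add: L_add M.restr_add seq_sec_comp)
  have f3: "rs U W (m \<oplus>\<^bsub>sect L U\<^esub> m') \<in> deg_lt W (max d e)" unfolding e by (rule deg_lt_add[OF W(1) f1 f2])
  have "rN U W (\<Phi> U (m \<oplus>\<^bsub>sect L U\<^esub> m')) = horner W (max d e) (rs U W m) \<oplus>\<^bsub>sect N (cyl W)\<^esub> horner W (max d e) (rs U W m')"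
    unfolding ident_restr_deg_lt[OF U mm W(1) WU f3] e by (rule horner_add[OF W(1)]) (rule c)+
  also have "\<dots> = rN U W (\<Phi> U m \<oplus>\<^bsub>sect N (cyl U)\<^esub> \<Phi> U m')"
    using N.restr_add[OF open_cyl[OF U] open_cyl[OF W(1)] cyl_mono[OF WU] ident_mem[OF U m(1)] ident_mem[OF U m(2)]]
      ident_restr_deg_lt[OF U m(1) W(1) WU f1] ident_restr_deg_lt[OF U m(2) W(1) WU f2] by simp
  finally show "\<exists>V. open V \<and> x \<in> V \<and> V \<subseteq> U \<and> rN U V (\<Phi> U (m \<oplus>\<^bsub>sect L U\<^esub> m')) = rN U V (\<Phi> U m \<oplus>\<^bsub>sect N (cyl U)\<^esub> \<Phi> U m')"
    using W WU by (intro exI[of _ W]) simp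
qed

lemma rs_shift:
  assumes "open U" "open V" "V \<subseteq> U"
  shows "rs U V (shift (z0 U) m) = shift (z0 V) (rs U V m)"
  using assms by (auto simp: shift_def fun_eq_iff split: nat.splits)

lemma ident_shift:
  assumes U: "open U" and m: "m \<in> seq_sec M U"
  shows "\<Phi> U (shift (z0 U) m) = sN (cyl U) (\<Phi> U m)"
proof (rule local_check[OF U _ _ m])
  note sm = seq_sec_shift[OF U m]
  show "\<Phi> U (shift (z0 U) m) \<in> carrier (sect N (cyl U))" by (rule ident_mem[OF U sm])
  show "sN (cyl U) (\<Phi> U m) \<in> carrier (sect N (cyl U))" by (intro sN_mem open_cyl U ident_mem m)
  fix V d assume V: "open V" "V \<subseteq> U" "rs U V m \<in> deg_lt V d"
  have f: "rs U V (shift (z0 U) m) \<in> deg_lt V (Suc d)" unfolding rs_shift[OF U V(1,2)] by (rule deg_lt_shift[OF V(1,3)])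
  have c: "restr M U V (m j) \<in> carrier (sect M V)" for j using m U V by (simp add: seq_sec_comp)
  have "rN U V (\<Phi> U (shift (z0 U) m)) = horner V (Suc d) (shift (z0 V) (rs U V m))"
    unfolding ident_restr_deg_lt[OF U sm V(1,2) f] rs_shift[OF U V(1,2)] by (rule refl)
  also have "\<dots> = sN (cyl V) (horner V d (rs U V m))" by (rule horner_shift[OF V(1)]) (rule c)
  also have "\<dots> = rN U V (sN (cyl U) (\<Phi> U m))"
    unfolding ident_restr_deg_lt[OF U m V, symmetric]
    by (rule sN_restr[OF open_cyl[OF U] open_cyl[OF V(1)] cyl_mono[OF V(2)] ident_mem[OF U m], symmetric])
  finally show "rN U V (\<Phi> U (shift (z0 U) m)) = rN U V (sN (cyl U) (\<Phi> U m))" .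
qed

lemma ident_delta: "open U \<Longrightarrow> m0 \<in> carrier (sect M U) \<Longrightarrow> \<Phi> U (delta (z0 U) m0) = delta (z0 U) m0"
proof -
  assume U: "open U" and m0: "m0 \<in> carrier (sect M U)"
  interpret A: abelian_group "sect N (cyl U)" by (rule N.abelian_group_sect[OF open_cyl[OF U]])
  show ?thesis using ident_deg_lt[OF U deg_lt_delta[OF U m0, of 0]] sN_zero[OF open_cyl[OF U]] delta_mem[OF U m0]
    by (simp add: delta_def del: N_carrier N_cyl_carrier)
qed

lemma L_eqI:
  assumes U: "open U" and m: "m \<in> seq_sec M U" "m' \<in> seq_sec M U"
    and loc: "\<And>x. x \<in> U \<Longrightarrow> \<exists>V. open V \<and> x \<in> V \<and> V \<subseteq> U \<and> rs U V m = rs U V m'"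
  shows "m = m'"
proof (rule L.section_eqI[OF U])
  show "m \<in> carrier (sect L U)" "m' \<in> carrier (sect L U)" using m U by simp_all
  fix x assume "x \<in> U"
  from loc[OF this] obtain V where V: "open V" "x \<in> V" "V \<subseteq> U" "rs U V m = rs U V m'" by (elim exE conjE)
  then show "\<exists>V. open V \<and> x \<in> V \<and> V \<subseteq> U \<and> restr L U V m = restr L U V m'"
    using U m by (intro exI[of _ V]) (simp add: rs_eq_restr_L)
qed

lemma ident_zero_imp:
  assumes U: "open U" and m: "m \<in> seq_sec M U" and z: "\<Phi> U m = \<zero>\<^bsub>sect N (cyl U)\<^esub>"
  shows "m = (\<lambda>j. z0 U)"
proof (rule L_eqI[OF U m deg_lt_seq_sec[OF U deg_lt_zero[OF U]]])
  fix x assume "x \<in> U"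
  from seq_sec_local[OF m U this] obtain V d where V: "open V" "x \<in> V" "V \<subseteq> U" "rs U V m \<in> deg_lt V d" .
  have "horner V d (rs U V m) = \<zero>\<^bsub>sect N (cyl V)\<^esub>"
    using ident_restr_deg_lt[OF U m V(1,3,4)] z N.restr_zero[OF open_cyl[OF U] open_cyl[OF V(1)] cyl_mono[OF V(3)]] by simp
  then have "rs U V m = (\<lambda>j. z0 V)" by (rule horner_inj[OF V(1,4)])
  also have "\<dots> = rs U V (\<lambda>j. z0 U)" using U V by simp
  finally show "\<exists>V. open V \<and> x \<in> V \<and> V \<subseteq> U \<and> rs U V m = rs U V (\<lambda>j. z0 U)" using V by (intro exI[of _ V]) simp
qed

lemma ident_inj: "open U \<Longrightarrow> inj_on (\<Phi> U) (seq_sec M U)"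
proof (rule inj_onI)
  fix m m' assume U: "open U" and m: "m \<in> seq_sec M U" "m' \<in> seq_sec M U" and eq: "\<Phi> U m = \<Phi> U m'"
  interpret A: abelian_group "sect N (cyl U)" by (rule N.abelian_group_sect[OF open_cyl[OF U]])
  interpret B: abelian_group "sect L U" by (rule L.abelian_group_sect[OF U])
  let ?n = "\<ominus>\<^bsub>sect L U\<^esub> m'"
  have n: "?n \<in> seq_sec M U" using B.a_inv_closed[of m'] m U by simp
  have z: "\<Phi> U (\<lambda>j. z0 U) = \<zero>\<^bsub>sect N (cyl U)\<^esub>"
    using ident_deg_lt[OF U deg_lt_zero[OF U], of 0] by simp
  have r: "m' \<oplus>\<^bsub>sect L U\<^esub> ?n = (\<lambda>j. z0 U)" using B.r_neg[of m'] m U L_zero[OF U] by simp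
  have "\<Phi> U (m \<oplus>\<^bsub>sect L U\<^esub> ?n) = \<Phi> U (m' \<oplus>\<^bsub>sect L U\<^esub> ?n)"
    unfolding ident_add[OF U m(1) n] ident_add[OF U m(2) n] eq by (rule refl)
  then have "\<Phi> U (m \<oplus>\<^bsub>sect L U\<^esub> ?n) = \<zero>\<^bsub>sect N (cyl U)\<^esub>" unfolding r z .
  then have "m \<oplus>\<^bsub>sect L U\<^esub> ?n = \<zero>\<^bsub>sect L U\<^esub>"
    using ident_zero_imp[OF U seq_sec_add[OF U m(1) n]] L_zero[OF U] by simp
  then have "m = \<ominus>\<^bsub>sect L U\<^esub> ?n" using B.minus_equality[of m ?n] m n U by simp
  then show "m = m'" using B.minus_minus[of m'] m U by simp
qed

text \<open>Horner's scheme gives local preimages, which agree on overlaps by injectivity and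
  therefore glue.\<close>

lemma ident_surj:
  assumes U: "open U" and u: "u \<in> carrier (sect N (cyl U))"
  shows "\<exists>m\<in>seq_sec M U. \<Phi> U m = u"
proof -
  have us: "u \<in> seq_sec M U" using u U by simp
  have ru: "rN U V u = rs U V u" if "open V" "V \<subseteq> U" for V
    using N_facts(2)[OF open_cyl[OF U] open_cyl[OF that(1)] cyl_mono[OF that(2)]] us by simp
  define I where "I = {V. open V \<and> V \<subseteq> U \<and> (\<exists>m\<in>seq_sec M V. \<Phi> V m = rN U V u)}"
  have "\<exists>m. m \<in> seq_sec M V \<and> \<Phi> V m = rN U V u" if "V \<in> I" for V using that by (auto simp: I_def)
  then obtain n where n: "\<And>V. V \<in> I \<Longrightarrow> n V \<in> seq_sec M V \<and> \<Phi> V (n V) = rN U V u" by metis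
  have I: "open V" "V \<subseteq> U" if "V \<in> I" for V using that by (auto simp: I_def)
  have un: "U = (\<Union>V\<in>I. V)"
  proof (intro equalityI subsetI)
    fix x assume x: "x \<in> U"
    from seq_sec_local[OF us U x] obtain V d where V: "open V" "x \<in> V" "V \<subseteq> U" "rs U V u \<in> deg_lt V d" .
    obtain m where m: "m \<in> deg_lt V d" "rs U V u = horner V d m" using horner_surj[OF V(1,4)] by blast
    have "V \<in> I" unfolding I_def using V m ident_deg_lt[OF V(1) m(1)] deg_lt_seq_sec[OF V(1) m(1)] ru[OF V(1,3)] by auto
    then show "x \<in> (\<Union>V\<in>I. V)" using V by blast
  qed (use I in auto)
  have comp: "restr L V (V \<inter> W) (n V) = restr L W (V \<inter> W) (n W)" if V: "V \<in> I" and W: "W \<in> I" for V W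
  proof -
    have o: "open (V \<inter> W)" "V \<inter> W \<subseteq> V" "V \<inter> W \<subseteq> W" using I V W by auto
    have a: "\<Phi> (V \<inter> W) (rs V (V \<inter> W) (n V)) = rN U (V \<inter> W) u"
      using ident_restr[OF I(1)[OF V] _ o(1,2), of "n V"] n[OF V] rN_rN[OF U I(1)[OF V] o(1,2) I(2)[OF V] u] by simp
    have b: "\<Phi> (V \<inter> W) (rs W (V \<inter> W) (n W)) = rN U (V \<inter> W) u"
      using ident_restr[OF I(1)[OF W] _ o(1,3), of "n W"] n[OF W] rN_rN[OF U I(1)[OF W] o(1,3) I(2)[OF W] u] by simp
    have "rs V (V \<inter> W) (n V) = rs W (V \<inter> W) (n W)"
      by (rule inj_onD[OF ident_inj[OF o(1)]])
        (use a b rs_mem[OF I(1)[OF V] o(1,2)] rs_mem[OF I(1)[OF W] o(1,3)] n[OF V] n[OF W] in simp_all)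
    then show ?thesis using rs_eq_restr_L[OF I(1)[OF V] o(1,2)] rs_eq_restr_L[OF I(1)[OF W] o(1,3)] n[OF V] n[OF W] by simp
  qed
  obtain m where m: "m \<in> carrier (sect L U)" "\<And>V. V \<in> I \<Longrightarrow> restr L U V m = n V"
    by (rule L.section_glue[of I "\<lambda>V. V" n U, OF _ _ comp un]) (use I n in auto)
  have ms: "m \<in> seq_sec M U" using m U by simp
  have "\<Phi> U m = u"
  proof (rule N_cyl_eqI[OF U ident_mem[OF U ms] u])
    fix x assume "x \<in> U"
    then obtain V where V: "V \<in> I" "x \<in> V" using un by blast
    have "rN U V (\<Phi> U m) = \<Phi> V (restr L U V m)"
      using ident_restr[OF U ms I[OF V(1)]] rs_eq_restr_L[OF U I[OF V(1)] ms] by simp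
    also have "\<dots> = rN U V u" using m(2)[OF V(1)] n[OF V(1)] by simp
    finally show "\<exists>V. open V \<and> x \<in> V \<and> V \<subseteq> U \<and> rN U V (\<Phi> U m) = rN U V u"
      using V I[OF V(1)] by (intro exI[of _ V]) simp
  qed
  then show ?thesis using ms by blast
qed

lemma ident_bij: "open U \<Longrightarrow> bij_betw (\<Phi> U) (seq_sec M U) (carrier (sect N (cyl U)))"
  unfolding bij_betw_def using ident_inj[of U] ident_mem[of U] ident_surj[of U] by blast

end


context graph_setting
begin

subsection \<open>Linearity of the identification\<close>

lemma seq_sec_smult: "open U \<Longrightarrow> P \<in> D_sec X U \<Longrightarrow> m \<in> seq_sec M U \<Longrightarrow> P \<odot>\<^bsub>sect L U\<^esub> m \<in> seq_sec M U"
  using L.smult_mem[of U P m] by simp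

lemma lift_mem: "open U \<Longrightarrow> P \<in> D_sec X U \<Longrightarrow> lift_op X U P \<in> D_sec (times_C X) (cyl U)"
  by (rule lift_op_local(1)[OF X])

lemma rN_lift:
  assumes U: "open U" and V: "open V" "V \<subseteq> U" and P: "P \<in> D_sec X U" and u: "u \<in> carrier (sect N (cyl U))"
  shows "rN U V (lift_op X U P \<odot>\<^bsub>sect N (cyl U)\<^esub> u) = lift_op X V (op_res V P) \<odot>\<^bsub>sect N (cyl V)\<^esub> rN U V u"
  using N.restr_smult[OF open_cyl[OF U] open_cyl[OF V(1)] cyl_mono[OF V(2)] lift_mem[OF U P] u]
    op_res_lift_op[OF V(2), of X P] by simp

lemma ident_smult_local:
  assumes U: "open U" and P: "P \<in> D_sec X U" and m: "m \<in> seq_sec M U"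
    and loc: "\<And>x. x \<in> U \<Longrightarrow> \<exists>V. open V \<and> x \<in> V \<and> V \<subseteq> U \<and>
      \<Phi> V (op_res V P \<odot>\<^bsub>sect L V\<^esub> rs U V m) = lift_op X V (op_res V P) \<odot>\<^bsub>sect N (cyl V)\<^esub> \<Phi> V (rs U V m)"
  shows "\<Phi> U (P \<odot>\<^bsub>sect L U\<^esub> m) = lift_op X U P \<odot>\<^bsub>sect N (cyl U)\<^esub> \<Phi> U m"
proof (rule N_cyl_eqI[OF U])
  note Pm = seq_sec_smult[OF U P m]
  show "\<Phi> U (P \<odot>\<^bsub>sect L U\<^esub> m) \<in> carrier (sect N (cyl U))" by (rule ident_mem[OF U Pm])
  show "lift_op X U P \<odot>\<^bsub>sect N (cyl U)\<^esub> \<Phi> U m \<in> carrier (sect N (cyl U))"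
    by (intro N.smult_mem open_cyl U lift_mem P ident_mem m)
  fix x assume "x \<in> U"
  from loc[OF this] obtain V where V: "open V" "x \<in> V" "V \<subseteq> U"
    "\<Phi> V (op_res V P \<odot>\<^bsub>sect L V\<^esub> rs U V m) = lift_op X V (op_res V P) \<odot>\<^bsub>sect N (cyl V)\<^esub> \<Phi> V (rs U V m)"
    by (elim exE conjE)
  have "rN U V (\<Phi> U (P \<odot>\<^bsub>sect L U\<^esub> m)) = \<Phi> V (restr L U V (P \<odot>\<^bsub>sect L U\<^esub> m))"
    using ident_restr[OF U Pm V(1,3)] rs_eq_restr_L[OF U V(1,3) Pm] by simp
  also have "restr L U V (P \<odot>\<^bsub>sect L U\<^esub> m) = op_res V P \<odot>\<^bsub>sect L V\<^esub> rs U V m"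
    using L.restr_smult[OF U V(1,3) P, of m] m U rs_eq_restr_L[OF U V(1,3) m] by simp
  also have "\<Phi> V \<dots> = rN U V (lift_op X U P \<odot>\<^bsub>sect N (cyl U)\<^esub> \<Phi> U m)"
    using V(4) rN_lift[OF U V(1,3) P ident_mem[OF U m]] ident_restr[OF U m V(1,3)] by simp
  finally show "\<exists>V. open V \<and> x \<in> V \<and> V \<subseteq> U \<and> rN U V (\<Phi> U (P \<odot>\<^bsub>sect L U\<^esub> m)) =
      rN U V (lift_op X U P \<odot>\<^bsub>sect N (cyl U)\<^esub> \<Phi> U m)"
    using V by (intro exI[of _ V]) simp
qed

lemma L_split_first:
  assumes U: "open U" and m: "m \<in> deg_lt U (Suc d)"
  shows "m = delta (z0 U) (m 0) \<oplus>\<^bsub>sect L U\<^esub> shift (z0 U) (\<lambda>j. m (Suc j))"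
proof -
  have mc: "m j \<in> carrier (sect M U)" for j using m by (simp add: deg_lt_def)
  show ?thesis
    unfolding L_add[OF U deg_lt_seq_sec[OF U deg_lt_delta[OF U mc]] deg_lt_seq_sec[OF U deg_lt_shift[OF U deg_lt_tail[OF m]]]]
    by (rule split_first[OF U mc])
qed

text \<open>If \<open>P\<close> commutes with \<open>s\<close> on \<open>M[s] f\<^sup>s\<close>, as
  its lift does on the direct image, then Horner's scheme reduces the claim to degree 0.\<close>

lemma ident_smult_deg_lt:
  assumes U: "open U" and P: "P \<in> D_sec X U"
    and a: "\<And>m. m \<in> seq_sec M U \<Longrightarrow> P \<odot>\<^bsub>sect L U\<^esub> shift (z0 U) m = shift (z0 U) (P \<odot>\<^bsub>sect L U\<^esub> m)"
    and b: "\<And>m0. m0 \<in> carrier (sect M U) \<Longrightarrow>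
      \<Phi> U (P \<odot>\<^bsub>sect L U\<^esub> delta (z0 U) m0) = lift_op X U P \<odot>\<^bsub>sect N (cyl U)\<^esub> delta (z0 U) m0"
  shows "m \<in> deg_lt U d \<Longrightarrow> \<Phi> U (P \<odot>\<^bsub>sect L U\<^esub> m) = lift_op X U P \<odot>\<^bsub>sect N (cyl U)\<^esub> \<Phi> U m"
proof (induction d arbitrary: m)
  case 0
  have m: "m = \<zero>\<^bsub>sect L U\<^esub>" using deg_lt_0[OF 0] L_zero[OF U] by simp
  have "\<Phi> U \<zero>\<^bsub>sect L U\<^esub> = \<zero>\<^bsub>sect N (cyl U)\<^esub>"
    using ident_deg_lt[OF U deg_lt_zero[OF U], of 0] L_zero[OF U] by simp
  then show ?case unfolding m L.smult_zero[OF U P] by (simp add: N.smult_zero[OF open_cyl[OF U] lift_mem[OF U P]])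
next
  case (Suc d)
  let ?t = "\<lambda>j. m (Suc j)" and ?l = "lift_op X U P" and ?N = "sect N (cyl U)"
  have mc: "m j \<in> carrier (sect M U)" for j using Suc.prems by (simp add: deg_lt_def)
  note D = deg_lt_seq_sec[OF U deg_lt_delta[OF U mc]]
  note T = deg_lt_seq_sec[OF U deg_lt_tail[OF Suc.prems]]
  note S = seq_sec_shift[OF U T]
  note PT = seq_sec_smult[OF U P T]
  have "\<Phi> U (P \<odot>\<^bsub>sect L U\<^esub> m) = \<Phi> U (P \<odot>\<^bsub>sect L U\<^esub> (delta (z0 U) (m 0) \<oplus>\<^bsub>sect L U\<^esub> shift (z0 U) ?t))"
    by (rule arg_cong[OF L_split_first[OF U Suc.prems], of "\<lambda>m. \<Phi> U (P \<odot>\<^bsub>sect L U\<^esub> m)"])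
  also have "P \<odot>\<^bsub>sect L U\<^esub> (delta (z0 U) (m 0) \<oplus>\<^bsub>sect L U\<^esub> shift (z0 U) ?t) =
     P \<odot>\<^bsub>sect L U\<^esub> delta (z0 U) (m 0) \<oplus>\<^bsub>sect L U\<^esub> shift (z0 U) (P \<odot>\<^bsub>sect L U\<^esub> ?t)"
    unfolding a[OF T, symmetric] by (rule L.smult_add[OF U P]) (simp_all add: U D S)
  also have "\<Phi> U \<dots> = ?l \<odot>\<^bsub>?N\<^esub> delta (z0 U) (m 0) \<oplus>\<^bsub>?N\<^esub> sN (cyl U) (?l \<odot>\<^bsub>?N\<^esub> \<Phi> U ?t)"
    unfolding ident_add[OF U seq_sec_smult[OF U P D] seq_sec_shift[OF U PT]] b[OF mc] ident_shift[OF U PT]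
      Suc.IH[OF deg_lt_tail[OF Suc.prems]] by (rule refl)
  also have "\<dots> = ?l \<odot>\<^bsub>?N\<^esub> (delta (z0 U) (m 0) \<oplus>\<^bsub>?N\<^esub> sN (cyl U) (\<Phi> U ?t))"
    unfolding sN_lift[OF U P ident_mem[OF U T]]
    by (rule N.smult_add[OF open_cyl[OF U] lift_mem[OF U P] delta_mem[OF U mc] sN_mem[OF open_cyl[OF U] ident_mem[OF U T]], symmetric])
  also have "delta (z0 U) (m 0) \<oplus>\<^bsub>?N\<^esub> sN (cyl U) (\<Phi> U ?t) = \<Phi> U (delta (z0 U) (m 0) \<oplus>\<^bsub>sect L U\<^esub> shift (z0 U) ?t)"
    unfolding ident_add[OF U D S] ident_delta[OF U mc] ident_shift[OF U T] by (rule refl)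
  also have "\<dots> = \<Phi> U m" by (rule arg_cong[OF L_split_first[OF U Suc.prems, symmetric]])
  finally show ?case .
qed

lemma ident_mul_deg_lt:
  assumes U: "open U" and h: "h \<in> hol_sec X U" and m: "m \<in> deg_lt U d"
  shows "\<Phi> U (mul_op X U h \<odot>\<^bsub>sect L U\<^esub> m) = lift_op X U (mul_op X U h) \<odot>\<^bsub>sect N (cyl U)\<^esub> \<Phi> U m"
proof (rule ident_smult_deg_lt[OF U mul_op_D_sec[OF X U h] _ _ m])
  note P = mul_op_D_sec[OF X U h]
  have z: "mul_op X U h \<odot>\<^bsub>sect M U\<^esub> z0 U = z0 U" by (rule M.smult_zero[OF U P])
  show "mul_op X U h \<odot>\<^bsub>sect L U\<^esub> shift (z0 U) m = shift (z0 U) (mul_op X U h \<odot>\<^bsub>sect L U\<^esub> m)"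
    if m: "m \<in> seq_sec M U" for m
    unfolding L_facts(3)[OF U h m] L_facts(3)[OF U h seq_sec_shift[OF U m]]
    by (auto simp: fun_eq_iff shift_def z split: nat.splits)
  show "\<Phi> U (mul_op X U h \<odot>\<^bsub>sect L U\<^esub> delta (z0 U) m0) = lift_op X U (mul_op X U h) \<odot>\<^bsub>sect N (cyl U)\<^esub> delta (z0 U) m0"
    if m0: "m0 \<in> carrier (sect M U)" for m0
  proof -
    have "mul_op X U h \<odot>\<^bsub>sect L U\<^esub> delta (z0 U) m0 = delta (z0 U) (mul_op X U h \<odot>\<^bsub>sect M U\<^esub> m0)"
      unfolding L_facts(3)[OF U h deg_lt_seq_sec[OF U deg_lt_delta[OF U m0]]] by (auto simp: fun_eq_iff delta_def z)
    then have "\<Phi> U (mul_op X U h \<odot>\<^bsub>sect L U\<^esub> delta (z0 U) m0) = delta (z0 U) (mul_op X U h \<odot>\<^bsub>sect M U\<^esub> m0)"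
      using ident_delta[OF U M.smult_mem[OF U P m0]] by simp
    also have "\<dots> = lift_op X U (mul_op X U h) \<odot>\<^bsub>sect N (cyl U)\<^esub> delta (z0 U) m0"
      unfolding lift_op_mul_op[OF X]
      using N_facts(3)[OF open_cyl[OF U] hol_sec_times_C_pullback[OF X U h], of m0] m0 by simp
    finally show ?thesis .
  qed
qed

lemma div_by_f:
  assumes U: "open U" and m0: "m0 \<in> carrier (sect M U)"
  shows "div_by X M f U m0 \<in> carrier (sect M U)" "f_act U (div_by X M f U m0) = m0"
proof -
  have im: "m0 \<in> f_act U ` carrier (sect M U)" using f_act_bij[OF U] m0 by (simp add: bij_betw_def)
  show "div_by X M f U m0 \<in> carrier (sect M U)" unfolding div_by_def by (rule inv_into_into[OF im])
  show "f_act U (div_by X M f U m0) = m0" unfolding div_by_def by (rule f_inv_into_f[OF im])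
qed

lemma div_by_zero: "open U \<Longrightarrow> div_by X M f U (z0 U) = z0 U"
proof -
  assume U: "open U"
  have z: "z0 U \<in> carrier (sect M U)" by (rule M.zero_mem[OF U])
  have "f_act U (div_by X M f U (z0 U)) = f_act U (z0 U)"
    using div_by_f(2)[OF U z] M.smult_zero[OF U f_op[OF U]] by simp
  then show ?thesis using bij_betw_imp_inj_on[OF f_act_bij[OF U]] div_by_f(1)[OF U z] z by (auto dest: inj_onD)
qed

lemma sN_delta:
  assumes U: "open U" and m0: "m0 \<in> carrier (sect M U)"
  shows "sN (cyl U) (delta (z0 U) m0) = (\<lambda>j. if j = 1 then \<ominus>\<^bsub>sect M U\<^esub> f_act U m0 else z0 U)"
proof -
  interpret B: abelian_group "sect M U" by (rule M.abelian_group_sect[OF U])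
  have fm: "f_act U m0 \<in> carrier (sect M U)" by (rule M.smult_mem[OF U f_op[OF U] m0])
  have s: "delta (z0 U) (f_act U m0) \<in> seq_sec M U" by (rule deg_lt_seq_sec[OF U deg_lt_delta[OF U fm]])
  have "sN (cyl U) (delta (z0 U) m0) = \<ominus>\<^bsub>sect N (cyl U)\<^esub> shift (z0 U) (delta (z0 U) (f_act U m0))"
    unfolding minus_dt_t_def using t_op_delta[OF open_cyl[OF U], of m0] N_facts(4)[OF open_cyl[OF U], of "delta (z0 U) (f_act U m0)"] m0 s by simp
  also have "\<dots> = (\<lambda>j. \<ominus>\<^bsub>sect M U\<^esub> shift (z0 U) (delta (z0 U) (f_act U m0)) j)"
    using N_minus[OF open_cyl[OF U], of "shift (z0 U) (delta (z0 U) (f_act U m0))"] seq_sec_shift[OF U s] by simp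
  also have "\<dots> = (\<lambda>j. if j = 1 then \<ominus>\<^bsub>sect M U\<^esub> f_act U m0 else z0 U)"
    by (auto simp: fun_eq_iff shift_def delta_def split: nat.splits)
  finally show ?thesis .
qed

text \<open>Because \<open>s (m \<otimes> 1) = -f m \<otimes> \<partial>\<^sub>t\<close>, the term
  \<open>(\<xi>(f) / f) m s\<close> of the action on \<open>M[s] f\<^sup>s\<close> corresponds to
  the term \<open>-\<xi>(f) m \<otimes> \<partial>\<^sub>t\<close> of the action on the direct
  image.\<close>

lemma ident_vf_deg_lt:
  assumes U: "open U" and \<xi>: "\<xi> \<in> vector_fields X U" and m: "m \<in> deg_lt U d"
  shows "\<Phi> U (\<xi> \<odot>\<^bsub>sect L U\<^esub> m) = lift_op X U \<xi> \<odot>\<^bsub>sect N (cyl U)\<^esub> \<Phi> U m"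
proof (rule ident_smult_deg_lt[OF U vector_fields_D_sec[OF X U \<xi>] _ _ m])
  note P = vector_fields_D_sec[OF X U \<xi>]
  interpret B: abelian_group "sect M U" by (rule M.abelian_group_sect[OF U])
  have z: "\<xi> \<odot>\<^bsub>sect M U\<^esub> z0 U = z0 U" by (rule M.smult_zero[OF U P])
  define \<mu> where "\<mu> = mul_op X U (\<xi> U (fres U f))"
  have "op_dom X U U (fres U f)" using U hol_sec_fres[OF X U open_UNIV _ f] by (simp add: op_dom_def)
  then have "\<xi> U (fres U f) \<in> hol_sec X U" by (rule end_sec_hol[OF D_sec_end_sec[OF P]])
  then have \<mu>: "\<mu> \<in> D_sec X U" unfolding \<mu>_def by (rule mul_op_D_sec[OF X U])
  have \<mu>z: "\<mu> \<odot>\<^bsub>sect M U\<^esub> z0 U = z0 U" by (rule M.smult_zero[OF U \<mu>])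
  let ?g = "\<lambda>m0. div_by X M f U (\<mu> \<odot>\<^bsub>sect M U\<^esub> m0)"
  have g: "?g m0 \<in> carrier (sect M U)" "f_act U (?g m0) = \<mu> \<odot>\<^bsub>sect M U\<^esub> m0" if "m0 \<in> carrier (sect M U)" for m0
    using div_by_f[OF U M.smult_mem[OF U \<mu> that]] .
  have gz: "?g (z0 U) = z0 U" by (simp add: \<mu>z div_by_zero[OF U])
  note vf = L_facts(4)[OF U \<xi>, folded \<mu>_def]
  show "\<xi> \<odot>\<^bsub>sect L U\<^esub> shift (z0 U) m = shift (z0 U) (\<xi> \<odot>\<^bsub>sect L U\<^esub> m)" if m: "m \<in> seq_sec M U" for m
    unfolding vf[OF m] vf[OF seq_sec_shift[OF U m]]
    by (auto simp: fun_eq_iff shift_def z gz split: nat.splits)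
  show "\<Phi> U (\<xi> \<odot>\<^bsub>sect L U\<^esub> delta (z0 U) m0) = lift_op X U \<xi> \<odot>\<^bsub>sect N (cyl U)\<^esub> delta (z0 U) m0"
    if m0: "m0 \<in> carrier (sect M U)" for m0
  proof -
    have xm: "\<xi> \<odot>\<^bsub>sect M U\<^esub> m0 \<in> carrier (sect M U)" by (rule M.smult_mem[OF U P m0])
    have \<mu>m: "\<mu> \<odot>\<^bsub>sect M U\<^esub> m0 \<in> carrier (sect M U)" by (rule M.smult_mem[OF U \<mu> m0])
    note D = deg_lt_seq_sec[OF U deg_lt_delta[OF U m0]]
    note D1 = deg_lt_seq_sec[OF U deg_lt_delta[OF U xm]]
    note D2 = deg_lt_seq_sec[OF U deg_lt_delta[OF U g(1)[OF m0]]]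
    have "\<xi> \<odot>\<^bsub>sect L U\<^esub> delta (z0 U) m0 = delta (z0 U) (\<xi> \<odot>\<^bsub>sect M U\<^esub> m0) \<oplus>\<^bsub>sect L U\<^esub> shift (z0 U) (delta (z0 U) (?g m0))"
      unfolding vf[OF D] L_add[OF U D1 seq_sec_shift[OF U D2]] using xm g(1)[OF m0]
      by (auto simp: fun_eq_iff shift_def delta_def z gz split: nat.splits)
    then have "\<Phi> U (\<xi> \<odot>\<^bsub>sect L U\<^esub> delta (z0 U) m0) =
        delta (z0 U) (\<xi> \<odot>\<^bsub>sect M U\<^esub> m0) \<oplus>\<^bsub>sect N (cyl U)\<^esub> sN (cyl U) (delta (z0 U) (?g m0))"
      using ident_add[OF U D1 seq_sec_shift[OF U D2]] ident_delta[OF U xm] ident_shift[OF U D2] ident_delta[OF U g(1)[OF m0]] by simp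
    also have "\<dots> = (\<lambda>j. delta (z0 U) (\<xi> \<odot>\<^bsub>sect M U\<^esub> m0) j \<oplus>\<^bsub>sect M U\<^esub> sN (cyl U) (delta (z0 U) (?g m0)) j)"
      using N_add[OF open_cyl[OF U], of "delta (z0 U) (\<xi> \<odot>\<^bsub>sect M U\<^esub> m0)" "sN (cyl U) (delta (z0 U) (?g m0))"]
        D1 sN_mem[OF open_cyl[OF U], of "delta (z0 U) (?g m0)"] D2 U by simp
    also have "\<dots> = (\<lambda>j. if j = 0 then \<xi> \<odot>\<^bsub>sect M U\<^esub> m0
               else if j = 1 then \<ominus>\<^bsub>sect M U\<^esub> (\<mu> \<odot>\<^bsub>sect M U\<^esub> m0) else z0 U)"
      unfolding sN_delta[OF U g(1)[OF m0]] g(2)[OF m0] using xm \<mu>m by (auto simp: fun_eq_iff delta_def)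
    also have "\<dots> = lift_op X U \<xi> \<odot>\<^bsub>sect N (cyl U)\<^esub> delta (z0 U) m0"
      unfolding \<mu>_def by (rule N_vf[OF U \<xi> m0, symmetric])
    finally show ?thesis .
  qed
qed

lemma ident_smult_has_order:
  assumes U: "open U"
  shows "has_order X U k P \<Longrightarrow> \<forall>m\<in>seq_sec M U. \<Phi> U (P \<odot>\<^bsub>sect L U\<^esub> m) = lift_op X U P \<odot>\<^bsub>sect N (cyl U)\<^esub> \<Phi> U m"
proof (induction rule: has_order.induct)
  case (mult h)
  show ?case
  proof
    fix m assume m: "m \<in> seq_sec M U"
    show "\<Phi> U (mul_op X U h \<odot>\<^bsub>sect L U\<^esub> m) = lift_op X U (mul_op X U h) \<odot>\<^bsub>sect N (cyl U)\<^esub> \<Phi> U m"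
    proof (rule ident_smult_local[OF U mul_op_D_sec[OF X U mult] m])
      fix x assume "x \<in> U"
      from seq_sec_local[OF m U this] obtain V d where V: "open V" "x \<in> V" "V \<subseteq> U" "rs U V m \<in> deg_lt V d" .
      then show "\<exists>V. open V \<and> x \<in> V \<and> V \<subseteq> U \<and> \<Phi> V (op_res V (mul_op X U h) \<odot>\<^bsub>sect L V\<^esub> rs U V m) =
         lift_op X V (op_res V (mul_op X U h)) \<odot>\<^bsub>sect N (cyl V)\<^esub> \<Phi> V (rs U V m)"
        using ident_mul_deg_lt[OF V(1) hol_sec_fres[OF X V(1) U V(3) mult] V(4)]
        by (intro exI[of _ V]) (simp add: op_res_mul_op)
    qed
  qed
next
  case (vf \<xi>)
  show ?case
  proof
    fix m assume m: "m \<in> seq_sec M U"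
    show "\<Phi> U (\<xi> \<odot>\<^bsub>sect L U\<^esub> m) = lift_op X U \<xi> \<odot>\<^bsub>sect N (cyl U)\<^esub> \<Phi> U m"
    proof (rule ident_smult_local[OF U vector_fields_D_sec[OF X U vf] m])
      fix x assume "x \<in> U"
      from seq_sec_local[OF m U this] obtain V d where V: "open V" "x \<in> V" "V \<subseteq> U" "rs U V m \<in> deg_lt V d" .
      then show "\<exists>V. open V \<and> x \<in> V \<and> V \<subseteq> U \<and> \<Phi> V (op_res V \<xi> \<odot>\<^bsub>sect L V\<^esub> rs U V m) =
         lift_op X V (op_res V \<xi>) \<odot>\<^bsub>sect N (cyl V)\<^esub> \<Phi> V (rs U V m)"
        using ident_vf_deg_lt[OF V(1) op_res_vector_field[OF X U vf V(1,3)] V(4)]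
        by (intro exI[of _ V]) simp
    qed
  qed
next
  case (add k P Q)
  note D = has_order_D_sec[OF X U add.hyps(1)] has_order_D_sec[OF X U add.hyps(2)]
  show ?case
  proof
    fix m assume m: "m \<in> seq_sec M U"
    have m': "m \<in> carrier (sect L U)" using m U by simp
    show "\<Phi> U (op_add P Q \<odot>\<^bsub>sect L U\<^esub> m) = lift_op X U (op_add P Q) \<odot>\<^bsub>sect N (cyl U)\<^esub> \<Phi> U m"
      unfolding lift_op_add L.op_add_smult[OF U D m'] ident_add[OF U seq_sec_smult[OF U D(1) m] seq_sec_smult[OF U D(2) m]]
        N.op_add_smult[OF open_cyl[OF U] lift_mem[OF U D(1)] lift_mem[OF U D(2)] ident_mem[OF U m]]
      using add.IH m by simp
  qed
next
  case (comp k P l Q)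
  note D = has_order_D_sec[OF X U comp.hyps(1)] has_order_D_sec[OF X U comp.hyps(2)]
  show ?case
  proof
    fix m assume m: "m \<in> seq_sec M U"
    have m': "m \<in> carrier (sect L U)" using m U by simp
    show "\<Phi> U (op_comp P Q \<odot>\<^bsub>sect L U\<^esub> m) = lift_op X U (op_comp P Q) \<odot>\<^bsub>sect N (cyl U)\<^esub> \<Phi> U m"
      unfolding lift_op_comp[OF X D_sec_end_sec[OF lift_mem[OF U D(1)]] D_sec_end_sec[OF lift_mem[OF U D(2)]]]
        L.op_comp_smult[OF U D m']
        N.op_comp_smult[OF open_cyl[OF U] lift_mem[OF U D(1)] lift_mem[OF U D(2)] ident_mem[OF U m]]
      using comp.IH m seq_sec_smult[OF U D(2) m] by simp
  qed
next
  case (mono k P l)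
  show ?case by (rule mono.IH)
qed

lemma ident_smult:
  assumes U: "open U" and P: "P \<in> D_sec X U" and m: "m \<in> seq_sec M U"
  shows "\<Phi> U (P \<odot>\<^bsub>sect L U\<^esub> m) = lift_op X U P \<odot>\<^bsub>sect N (cyl U)\<^esub> \<Phi> U m"
proof (rule ident_smult_local[OF U P m])
  fix x assume x: "x \<in> U"
  have "\<exists>V k. open V \<and> x \<in> V \<and> V \<subseteq> U \<and> has_order X V k (op_res V P)"
    using P x by (simp add: D_sec_def)
  then obtain V k where V: "open V" "x \<in> V" "V \<subseteq> U" "has_order X V k (op_res V P)" by (elim exE conjE)
  then show "\<exists>V. open V \<and> x \<in> V \<and> V \<subseteq> U \<and> \<Phi> V (op_res V P \<odot>\<^bsub>sect L V\<^esub> rs U V m) =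
      lift_op X V (op_res V P) \<odot>\<^bsub>sect N (cyl V)\<^esub> \<Phi> V (rs U V m)"
    using bspec[OF ident_smult_has_order[OF V(1,4)] rs_mem[OF U V(1,3) m]] by (intro exI[of _ V]) simp
qed

text \<open>Centrality of \<open>s\<close>, carried over from the direct image by injectivity of the
  identification.\<close>

lemma smult_shift:
  assumes U: "open U" and P: "P \<in> D_sec X U" and m: "m \<in> seq_sec M U"
  shows "P \<odot>\<^bsub>sect L U\<^esub> shift (z0 U) m = shift (z0 U) (P \<odot>\<^bsub>sect L U\<^esub> m)"
proof (rule inj_onD[OF ident_inj[OF U]])
  note sm = seq_sec_shift[OF U m] and Pm = seq_sec_smult[OF U P m]
  show "P \<odot>\<^bsub>sect L U\<^esub> shift (z0 U) m \<in> seq_sec M U" by (rule seq_sec_smult[OF U P sm])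
  show "shift (z0 U) (P \<odot>\<^bsub>sect L U\<^esub> m) \<in> seq_sec M U" by (rule seq_sec_shift[OF U Pm])
  show "\<Phi> U (P \<odot>\<^bsub>sect L U\<^esub> shift (z0 U) m) = \<Phi> U (shift (z0 U) (P \<odot>\<^bsub>sect L U\<^esub> m))"
    unfolding ident_smult[OF U P sm] ident_shift[OF U m] ident_shift[OF U Pm] ident_smult[OF U P m]
    by (rule sN_lift[OF U P ident_mem[OF U m], symmetric])
qed

subsection \<open>The endomorphism \<open>s + \<alpha>\<close> and its cokernel\<close>

abbreviation hL :: "complex \<Rightarrow> 'a set \<Rightarrow> (nat \<Rightarrow> 'm) \<Rightarrow> nat \<Rightarrow> 'm" where
  "hL \<alpha> \<equiv> s_plus X \<alpha> L"

lemma hL_eq: "open U \<Longrightarrow> m \<in> seq_sec M U \<Longrightarrow> hL \<alpha> U m = shift (z0 U) m \<oplus>\<^bsub>sect L U\<^esub> L.sc U \<alpha> m"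
  by (simp add: s_plus_def L_facts(5) L.sc_def scal_def)

lemma L_sc_comp: "open U \<Longrightarrow> m \<in> seq_sec M U \<Longrightarrow> L.sc U \<alpha> m = (\<lambda>j. M.sc U \<alpha> (m j))"
  unfolding L.sc_def M.sc_def scal_def by (rule L_facts(3)[OF _ hol_sec_const[OF X]])

lemma L_sc_mem: "open U \<Longrightarrow> m \<in> seq_sec M U \<Longrightarrow> L.sc U \<alpha> m \<in> seq_sec M U"
  using L.sc_mem[of U m] by simp

lemma hL_mem: "open U \<Longrightarrow> m \<in> seq_sec M U \<Longrightarrow> hL \<alpha> U m \<in> seq_sec M U"
  unfolding hL_eq by (intro seq_sec_add seq_sec_shift L_sc_mem)

lemma hL_Suc: "open U \<Longrightarrow> m \<in> seq_sec M U \<Longrightarrow> hL \<alpha> U m (Suc j) = m j \<oplus>\<^bsub>sect M U\<^esub> M.sc U \<alpha> (m (Suc j))"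
proof -
  assume U: "open U" and m: "m \<in> seq_sec M U"
  show ?thesis
    unfolding hL_eq[OF U m] L_add[OF U seq_sec_shift[OF U m] L_sc_mem[OF U m]] by (simp add: L_sc_comp[OF U m])
qed

lemma shift_add:
  assumes U: "open U" and m: "m \<in> seq_sec M U" "m' \<in> seq_sec M U"
  shows "shift (z0 U) (m \<oplus>\<^bsub>sect L U\<^esub> m') = shift (z0 U) m \<oplus>\<^bsub>sect L U\<^esub> shift (z0 U) m'"
proof -
  interpret B: abelian_group "sect M U" by (rule M.abelian_group_sect[OF U])
  show ?thesis unfolding L_add[OF U m] L_add[OF U seq_sec_shift[OF U m(1)] seq_sec_shift[OF U m(2)]]
    by (auto simp: fun_eq_iff shift_def split: nat.splits)
qed

lemma L_s_hom: "sheaf_hom (D_ring X) L L (s_act L)"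
  unfolding sheaf_hom_def
proof (intro allI impI conjI ballI)
  fix U :: "'a set" and m assume U: "open U" and "m \<in> carrier (sect L U)"
  then have m: "m \<in> seq_sec M U" by simp
  show "s_act L U m \<in> carrier (sect L U)" using seq_sec_shift[OF U m] L_facts(5)[OF U m] U by simp
  show "s_act L U (m \<oplus>\<^bsub>sect L U\<^esub> m') = s_act L U m \<oplus>\<^bsub>sect L U\<^esub> s_act L U m'" if "m' \<in> carrier (sect L U)" for m'
    using that U m shift_add[OF U m, of m'] by (simp add: L_facts(5) seq_sec_add)
  show "s_act L U (P \<odot>\<^bsub>sect L U\<^esub> m) = P \<odot>\<^bsub>sect L U\<^esub> s_act L U m" if "P \<in> carrier (D_ring X U)" for P
    using that U m smult_shift[OF U _ m, of P] by (simp add: L_facts(5) seq_sec_smult)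
  show "s_act L V (restr L U V m) = restr L U V (s_act L U m)" if "open V \<and> V \<subseteq> U" for V
    using that U m rs_shift[OF U, of V m] by (simp add: L_facts(5) rs_eq_restr_L rs_mem seq_sec_shift)
qed

lemma hL_hom: "sheaf_hom (D_ring X) L L (hL \<alpha>)"
  unfolding sheaf_hom_def
proof (intro allI impI conjI ballI)
  fix U :: "'a set" and m assume U: "open U" and mc: "m \<in> carrier (sect L U)"
  then have m: "m \<in> seq_sec M U" by simp
  note sm = seq_sec_shift[OF U m] and cm = L_sc_mem[OF U m, of \<alpha>]
  interpret B: abelian_group "sect L U" by (rule L.abelian_group_sect[OF U])
  show "hL \<alpha> U m \<in> carrier (sect L U)" using hL_mem[OF U m] U by simp
  show "hL \<alpha> U (m \<oplus>\<^bsub>sect L U\<^esub> m') = hL \<alpha> U m \<oplus>\<^bsub>sect L U\<^esub> hL \<alpha> U m'" if mc': "m' \<in> carrier (sect L U)" for m'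
  proof -
    have m': "m' \<in> seq_sec M U" using mc' U by simp
    have c: "shift (z0 U) m' \<in> carrier (sect L U)" "L.sc U \<alpha> m' \<in> carrier (sect L U)"
      "shift (z0 U) m \<in> carrier (sect L U)" "L.sc U \<alpha> m \<in> carrier (sect L U)"
      using seq_sec_shift[OF U m'] L_sc_mem[OF U m', of \<alpha>] sm cm U by simp_all
    show ?thesis
      unfolding hL_eq[OF U m] hL_eq[OF U m'] hL_eq[OF U seq_sec_add[OF U m m']] shift_add[OF U m m']
        L.sc_add[OF U mc mc'] using c by (simp add: B.a_ac del: L_carrier)
  qed
  show "hL \<alpha> U (P \<odot>\<^bsub>sect L U\<^esub> m) = P \<odot>\<^bsub>sect L U\<^esub> hL \<alpha> U m" if "P \<in> carrier (D_ring X U)" for P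
  proof -
    have P: "P \<in> D_sec X U" using that by simp
    have c: "shift (z0 U) m \<in> carrier (sect L U)" "L.sc U \<alpha> m \<in> carrier (sect L U)" using sm cm U by simp_all
    show ?thesis unfolding hL_eq[OF U m] hL_eq[OF U seq_sec_smult[OF U P m]] L.smult_add[OF U P c]
        smult_shift[OF U P m] L.smult_sc[OF U P mc] by (rule refl)
  qed
  show "hL \<alpha> V (restr L U V m) = restr L U V (hL \<alpha> U m)" if V: "open V \<and> V \<subseteq> U" for V
  proof -
    have c: "shift (z0 U) m \<in> carrier (sect L U)" "L.sc U \<alpha> m \<in> carrier (sect L U)" using sm cm U by simp_all
    have V': "open V" "V \<subseteq> U" using V by auto
    have r: "restr L U V (shift (z0 U) m) = shift (z0 V) (restr L U V m)"
      using rs_eq_restr_L[OF U V' sm] rs_eq_restr_L[OF U V' m] rs_shift[OF U V', of m] by simp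
    have rm: "restr L U V m \<in> seq_sec M V" using rs_eq_restr_L[OF U V' m] rs_mem[OF U V' m] by simp
    show ?thesis unfolding hL_eq[OF U m] hL_eq[OF V'(1) rm] L.restr_add[OF U V' c] r L.restr_sc[OF U V' mc] by (rule refl)
  qed
qed

lemma hL_add: "open U \<Longrightarrow> m \<in> seq_sec M U \<Longrightarrow> m' \<in> seq_sec M U \<Longrightarrow>
    hL \<alpha> U (m \<oplus>\<^bsub>sect L U\<^esub> m') = hL \<alpha> U m \<oplus>\<^bsub>sect L U\<^esub> hL \<alpha> U m'"
  and hL_smult: "open U \<Longrightarrow> P \<in> D_sec X U \<Longrightarrow> m \<in> seq_sec M U \<Longrightarrow> hL \<alpha> U (P \<odot>\<^bsub>sect L U\<^esub> m) = P \<odot>\<^bsub>sect L U\<^esub> hL \<alpha> U m"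
  and hL_restr: "open U \<Longrightarrow> open V \<Longrightarrow> V \<subseteq> U \<Longrightarrow> m \<in> seq_sec M U \<Longrightarrow> hL \<alpha> V (restr L U V m) = restr L U V (hL \<alpha> U m)"
  using hL_hom[of \<alpha>] unfolding sheaf_hom_def by simp_all

lemma hL_sc: "open U \<Longrightarrow> m \<in> seq_sec M U \<Longrightarrow> hL \<alpha> U (L.sc U b m) = L.sc U b (hL \<alpha> U m)"
  unfolding L.sc_def by (rule hL_smult[OF _ L.scal_mem])

text \<open>The coefficient of \<open>s\<^sup>(\<^sup>j\<^sup>+\<^sup>1\<^sup>)\<close> in \<open>(s + \<alpha>) w\<close> is \<open>w\<^sub>j + \<alpha> w\<^sub>j\<^sub>+\<^sub>1\<close>. Where \<open>w\<close> is finite, the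
  coefficients therefore vanish one after the other, from the top down.\<close>

lemma hL_tail_zero:
  assumes U: "open U" and w: "w \<in> seq_sec M U" and z: "\<And>j. hL \<alpha> U w (Suc j) = z0 U"
  shows "w = \<zero>\<^bsub>sect L U\<^esub>"
  unfolding L_zero[OF U]
proof (rule L_eqI[OF U w deg_lt_seq_sec[OF U deg_lt_zero[OF U]]])
  fix x assume "x \<in> U"
  from seq_sec_local[OF w U this] obtain V d where V: "open V" "x \<in> V" "V \<subseteq> U" "rs U V w \<in> deg_lt V d" .
  interpret B: abelian_group "sect M V" by (rule M.abelian_group_sect[OF V(1)])
  let ?w = "rs U V w"
  have eq: "?w j \<oplus>\<^bsub>sect M V\<^esub> M.sc V \<alpha> (?w (Suc j)) = z0 V" for j
  proof -
    have c: "w j \<in> carrier (sect M U)" "w (Suc j) \<in> carrier (sect M U)" using seq_sec_comp[OF w] by auto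
    have "restr M U V (hL \<alpha> U w (Suc j)) = ?w j \<oplus>\<^bsub>sect M V\<^esub> M.sc V \<alpha> (?w (Suc j))"
      unfolding hL_Suc[OF U w] using M.restr_add[OF U V(1,3) c(1) M.sc_mem[OF U c(2)]] M.restr_sc[OF U V(1,3) c(2)] by simp
    then show ?thesis using z U V by simp
  qed
  have wc: "?w j \<in> carrier (sect M V)" for j using V(4) by (simp add: deg_lt_def)
  have "v \<in> deg_lt V d \<Longrightarrow> (\<And>j. v j \<oplus>\<^bsub>sect M V\<^esub> M.sc V \<alpha> (v (Suc j)) = z0 V) \<Longrightarrow> v \<in> deg_lt V 0" for v d
  proof (induction d)
    case (Suc d)
    have "v d \<in> carrier (sect M V)" "v (Suc d) = z0 V" using Suc.prems(1) by (auto simp: deg_lt_def)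
    then have "v d = z0 V" using Suc.prems(2)[of d] M.sc_zero_right[OF V(1)] by simp
    then show ?case by (intro Suc.IH deg_lt_drop[OF Suc.prems(1)] Suc.prems(2))
  qed
  from deg_lt_0[OF this[OF V(4) eq]] have "?w = (\<lambda>j. z0 V)" .
  then show "\<exists>V. open V \<and> x \<in> V \<and> V \<subseteq> U \<and> rs U V w = rs U V (\<lambda>j. z0 U)"
    using V U by (intro exI[of _ V]) simp
qed

text \<open>Uniqueness of quotient and remainder: the difference of the quotients satisfies the
  hypothesis of \<open>hL_tail_zero\<close>, because remainders have no coefficient in positive
  degree.\<close>

lemma hL_inj_normal:
  assumes U: "open U" and w: "w \<in> seq_sec M U" "w' \<in> seq_sec M U" and n: "n \<in> deg_lt U 1" "n' \<in> deg_lt U 1"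
    and eq: "n \<oplus>\<^bsub>sect L U\<^esub> hL \<alpha> U w = n' \<oplus>\<^bsub>sect L U\<^esub> hL \<alpha> U w'"
  shows "w = w' \<and> n = n'"
proof -
  interpret A: abelian_group "sect L U" by (rule L.abelian_group_sect[OF U])
  interpret B: abelian_group "sect M U" by (rule M.abelian_group_sect[OF U])
  let ?m = "L.sc U (-1) w'"
  have ms: "?m \<in> seq_sec M U" by (rule L_sc_mem[OF U w(2)])
  have wc: "w \<in> carrier (sect L U)" "w' \<in> carrier (sect L U)" using w U by simp_all
  note hs = hL_mem[OF U w(1), of \<alpha>] hL_mem[OF U w(2), of \<alpha>]
  have comp: "hL \<alpha> U w (Suc j) = hL \<alpha> U w' (Suc j)" for j
  proof -
    have "(n \<oplus>\<^bsub>sect L U\<^esub> hL \<alpha> U w) (Suc j) = (n' \<oplus>\<^bsub>sect L U\<^esub> hL \<alpha> U w') (Suc j)" using eq by simp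
    moreover have "n (Suc j) = z0 U" "n' (Suc j) = z0 U" using n by (auto simp: deg_lt_def)
    ultimately show ?thesis
      using L_add[OF U deg_lt_seq_sec[OF U n(1)] hs(1)] L_add[OF U deg_lt_seq_sec[OF U n(2)] hs(2)]
        seq_sec_comp[OF hs(1)] seq_sec_comp[OF hs(2)] by simp
  qed
  have "hL \<alpha> U (w \<oplus>\<^bsub>sect L U\<^esub> ?m) (Suc j) = z0 U" for j
  proof -
    have "hL \<alpha> U (w \<oplus>\<^bsub>sect L U\<^esub> ?m) = hL \<alpha> U w \<oplus>\<^bsub>sect L U\<^esub> L.sc U (-1) (hL \<alpha> U w')"
      unfolding hL_add[OF U w(1) ms] hL_sc[OF U w(2)] by (rule refl)
    then have "hL \<alpha> U (w \<oplus>\<^bsub>sect L U\<^esub> ?m) (Suc j) = hL \<alpha> U w' (Suc j) \<oplus>\<^bsub>sect M U\<^esub> M.sc U (-1) (hL \<alpha> U w' (Suc j))"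
      using L_add[OF U hs(1) L_sc_mem[OF U hs(2)], of "-1"] L_sc_comp[OF U hs(2)] comp by simp
    then show ?thesis
      using seq_sec_comp[OF hs(2), of "Suc j"] M.minus_eq_sc[OF U] B.r_neg by simp
  qed
  then have z: "w \<oplus>\<^bsub>sect L U\<^esub> ?m = \<zero>\<^bsub>sect L U\<^esub>" by (rule hL_tail_zero[OF U seq_sec_add[OF U w(1) ms]])
  then have "w \<oplus>\<^bsub>sect L U\<^esub> \<ominus>\<^bsub>sect L U\<^esub> w' = \<zero>\<^bsub>sect L U\<^esub>" using L.minus_eq_sc[OF U wc(2)] by simp
  then have "w = \<ominus>\<^bsub>sect L U\<^esub> (\<ominus>\<^bsub>sect L U\<^esub> w')" using A.minus_equality[of w "\<ominus>\<^bsub>sect L U\<^esub> w'"] wc by (simp del: L_carrier)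
  then have ww: "w = w'" using A.minus_minus[OF wc(2)] by simp
  have nc: "n \<in> carrier (sect L U)" "n' \<in> carrier (sect L U)" "hL \<alpha> U w' \<in> carrier (sect L U)"
    using deg_lt_seq_sec[OF U n(1)] deg_lt_seq_sec[OF U n(2)] hs U by simp_all
  have "n = n'" using eq nc unfolding ww by (simp del: L_carrier)
  then show ?thesis using ww by simp
qed

text \<open>Division with remainder by the monic polynomial \<open>s + \<alpha>\<close>.\<close>

lemma normal_form_deg_lt:
  assumes U: "open U"
  shows "m \<in> deg_lt U d \<Longrightarrow> \<exists>n\<in>deg_lt U 1. \<exists>w\<in>seq_sec M U. m = n \<oplus>\<^bsub>sect L U\<^esub> hL \<alpha> U w"
proof (induction d arbitrary: m)
  case 0
  interpret A: abelian_group "sect L U" by (rule L.abelian_group_sect[OF U])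
  have zs: "\<zero>\<^bsub>sect L U\<^esub> \<in> seq_sec M U" using A.zero_closed U by simp
  have "hL \<alpha> U \<zero>\<^bsub>sect L U\<^esub> = \<zero>\<^bsub>sect L U\<^esub>"
    using hL_sc[OF U zs, of \<alpha> 0] L.sc_zero[OF U, of "hL \<alpha> U \<zero>\<^bsub>sect L U\<^esub>"] hL_mem[OF U zs, of \<alpha>] U by simp
  moreover have "m = \<zero>\<^bsub>sect L U\<^esub>" using deg_lt_0[OF 0] L_zero[OF U] by simp
  moreover have "\<zero>\<^bsub>sect L U\<^esub> \<in> deg_lt U 1" using deg_lt_zero[OF U] L_zero[OF U] by simp
  ultimately show ?case using zs A.r_zero[OF A.zero_closed] by metis
next
  case (Suc d)
  interpret A: abelian_group "sect L U" by (rule L.abelian_group_sect[OF U])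
  let ?t = "\<lambda>j. m (Suc j)"
  have mc: "m j \<in> carrier (sect M U)" for j using Suc.prems by (simp add: deg_lt_def)
  note T = deg_lt_seq_sec[OF U deg_lt_tail[OF Suc.prems]]
  obtain n w where n: "n \<in> deg_lt U 1" and w: "w \<in> seq_sec M U" and e: "?t = n \<oplus>\<^bsub>sect L U\<^esub> hL \<alpha> U w"
    using Suc.IH[OF deg_lt_tail[OF Suc.prems]] by blast
  let ?d = "delta (z0 U) (m 0)"
  have D: "?d \<in> deg_lt U 1" using deg_lt_delta[OF U mc, of 0] by simp
  have c: "?d \<in> carrier (sect L U)" "?t \<in> carrier (sect L U)" "n \<in> carrier (sect L U)" "w \<in> carrier (sect L U)"
    "hL \<alpha> U ?t \<in> carrier (sect L U)" "hL \<alpha> U w \<in> carrier (sect L U)" "shift (z0 U) ?t \<in> carrier (sect L U)"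
    using deg_lt_seq_sec[OF U D] T deg_lt_seq_sec[OF U n] w hL_mem[OF U T] hL_mem[OF U w] seq_sec_shift[OF U T] U by simp_all
  have sc: "L.sc U a x \<in> carrier (sect L U)" if "x \<in> carrier (sect L U)" for a x by (rule L.sc_mem[OF U that])
  have neg: "L.sc U \<alpha> x \<oplus>\<^bsub>sect L U\<^esub> L.sc U (-\<alpha>) x = \<zero>\<^bsub>sect L U\<^esub>" if "x \<in> carrier (sect L U)" for x
    using L.sc_add_scalar[OF U that, of \<alpha> "-\<alpha>"] L.sc_zero[OF U that] by simp
  have "shift (z0 U) ?t = hL \<alpha> U ?t \<oplus>\<^bsub>sect L U\<^esub> L.sc U (-\<alpha>) ?t"
    unfolding hL_eq[OF U T] using A.a_assoc[OF c(7) sc[OF c(2)] sc[OF c(2)]] neg[OF c(2)] A.r_zero[OF c(7)] by simp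
  also have "L.sc U (-\<alpha>) ?t = L.sc U (-\<alpha>) n \<oplus>\<^bsub>sect L U\<^esub> hL \<alpha> U (L.sc U (-\<alpha>) w)"
    unfolding hL_sc[OF U w] L.sc_add[OF U c(3,6), symmetric] by (rule arg_cong[OF e])
  finally have s: "shift (z0 U) ?t = hL \<alpha> U ?t \<oplus>\<^bsub>sect L U\<^esub> (L.sc U (-\<alpha>) n \<oplus>\<^bsub>sect L U\<^esub> hL \<alpha> U (L.sc U (-\<alpha>) w))" .
  have hw: "hL \<alpha> U (L.sc U (-\<alpha>) w) \<in> carrier (sect L U)" using hL_mem[OF U L_sc_mem[OF U w]] U by simp
  have "m = ?d \<oplus>\<^bsub>sect L U\<^esub> (hL \<alpha> U ?t \<oplus>\<^bsub>sect L U\<^esub> (L.sc U (-\<alpha>) n \<oplus>\<^bsub>sect L U\<^esub> hL \<alpha> U (L.sc U (-\<alpha>) w)))"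
    unfolding s[symmetric] by (rule L_split_first[OF U Suc.prems])
  also have "\<dots> = (?d \<oplus>\<^bsub>sect L U\<^esub> L.sc U (-\<alpha>) n) \<oplus>\<^bsub>sect L U\<^esub> (hL \<alpha> U ?t \<oplus>\<^bsub>sect L U\<^esub> hL \<alpha> U (L.sc U (-\<alpha>) w))"
    using c hw sc[OF c(3)] by (simp add: A.a_ac del: L_carrier)
  also have "hL \<alpha> U ?t \<oplus>\<^bsub>sect L U\<^esub> hL \<alpha> U (L.sc U (-\<alpha>) w) = hL \<alpha> U (?t \<oplus>\<^bsub>sect L U\<^esub> L.sc U (-\<alpha>) w)"
    by (rule hL_add[OF U T L_sc_mem[OF U w], symmetric])
  finally have m: "m = (?d \<oplus>\<^bsub>sect L U\<^esub> L.sc U (-\<alpha>) n) \<oplus>\<^bsub>sect L U\<^esub> hL \<alpha> U (?t \<oplus>\<^bsub>sect L U\<^esub> L.sc U (-\<alpha>) w)" .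
  have scn: "L.sc U (-\<alpha>) n \<in> deg_lt U 1"
    unfolding L_sc_comp[OF U deg_lt_seq_sec[OF U n]] using n M.sc_mem[OF U] M.sc_zero_right[OF U] by (auto simp: deg_lt_def)
  have "?d \<oplus>\<^bsub>sect L U\<^esub> L.sc U (-\<alpha>) n \<in> deg_lt U 1"
    using L_add[OF U deg_lt_seq_sec[OF U D] deg_lt_seq_sec[OF U scn]] deg_lt_add[OF U D scn] by simp
  moreover have "?t \<oplus>\<^bsub>sect L U\<^esub> L.sc U (-\<alpha>) w \<in> seq_sec M U" by (rule seq_sec_add[OF U T L_sc_mem[OF U w]])
  ultimately show ?case using m by (intro bexI[where x="?d \<oplus>\<^bsub>sect L U\<^esub> L.sc U (-\<alpha>) n"] bexI[where x="?t \<oplus>\<^bsub>sect L U\<^esub> L.sc U (-\<alpha>) w"])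
qed

text \<open>Local quotients agree on overlaps by uniqueness, so they glue; that the remainder has
  degree 0 can be checked locally.\<close>

lemma normal_form_exists:
  assumes U: "open U" and m: "m \<in> seq_sec M U"
  shows "\<exists>n\<in>deg_lt U 1. \<exists>w\<in>seq_sec M U. m = n \<oplus>\<^bsub>sect L U\<^esub> hL \<alpha> U w"
proof -
  interpret A: abelian_group "sect L U" by (rule L.abelian_group_sect[OF U])
  have "\<exists>V n w. open V \<and> x \<in> V \<and> V \<subseteq> U \<and> n \<in> deg_lt V 1 \<and> w \<in> seq_sec M V \<and>
    restr L U V m = n \<oplus>\<^bsub>sect L V\<^esub> hL \<alpha> V w" if x: "x \<in> U" for x
  proof -
    from seq_sec_local[OF m U x] obtain V d where V: "open V" "x \<in> V" "V \<subseteq> U" "rs U V m \<in> deg_lt V d" .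
    obtain n w where "n \<in> deg_lt V 1" "w \<in> seq_sec M V" "rs U V m = n \<oplus>\<^bsub>sect L V\<^esub> hL \<alpha> V w"
      using normal_form_deg_lt[OF V(1,4), of \<alpha>] by blast
    then show ?thesis using V rs_eq_restr_L[OF U V(1,3) m] by (intro exI[of _ V] exI[of _ n] exI[of _ w]) simp
  qed
  then have "\<forall>x. \<exists>V n w. x \<in> U \<longrightarrow> open V \<and> x \<in> V \<and> V \<subseteq> U \<and> n \<in> deg_lt V 1 \<and> w \<in> seq_sec M V \<and>
    restr L U V m = n \<oplus>\<^bsub>sect L V\<^esub> hL \<alpha> V w" by blast
  from choice[OF this] obtain V where "\<forall>x. \<exists>n w. x \<in> U \<longrightarrow> open (V x) \<and> x \<in> V x \<and> V x \<subseteq> U \<and> n \<in> deg_lt (V x) 1 \<and> w \<in> seq_sec M (V x) \<and>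
    restr L U (V x) m = n \<oplus>\<^bsub>sect L (V x)\<^esub> hL \<alpha> (V x) w" ..
  from choice[OF this] obtain n where "\<forall>x. \<exists>w. x \<in> U \<longrightarrow> open (V x) \<and> x \<in> V x \<and> V x \<subseteq> U \<and> n x \<in> deg_lt (V x) 1 \<and> w \<in> seq_sec M (V x) \<and>
    restr L U (V x) m = n x \<oplus>\<^bsub>sect L (V x)\<^esub> hL \<alpha> (V x) w" ..
  from choice[OF this] obtain w where *: "\<forall>x. x \<in> U \<longrightarrow> open (V x) \<and> x \<in> V x \<and> V x \<subseteq> U \<and> n x \<in> deg_lt (V x) 1 \<and> w x \<in> seq_sec M (V x) \<and>
    restr L U (V x) m = n x \<oplus>\<^bsub>sect L (V x)\<^esub> hL \<alpha> (V x) (w x)" ..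
  have V: "open (V x)" "x \<in> V x" "V x \<subseteq> U" "n x \<in> deg_lt (V x) 1" "w x \<in> seq_sec M (V x)"
    "restr L U (V x) m = n x \<oplus>\<^bsub>sect L (V x)\<^esub> hL \<alpha> (V x) (w x)" if "x \<in> U" for x
    using * that by auto
  have res: "restr L U W m = restr L (V x) W (n x) \<oplus>\<^bsub>sect L W\<^esub> hL \<alpha> W (restr L (V x) W (w x))" "restr L (V x) W (n x) \<in> deg_lt W 1"
    "restr L (V x) W (w x) \<in> seq_sec M W" if x: "x \<in> U" and W: "open W" "W \<subseteq> V x" for x W
  proof -
    note Vx = V[OF x]
    have ns: "n x \<in> seq_sec M (V x)" by (rule deg_lt_seq_sec[OF Vx(1,4)])
    have hs: "hL \<alpha> (V x) (w x) \<in> seq_sec M (V x)" by (rule hL_mem[OF Vx(1,5)])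
    have "restr L U W m = restr L (V x) W (restr L U (V x) m)"
      using L.restr_restr[OF U Vx(1) W(1,2) Vx(3), of m] m U by simp
    also have "\<dots> = restr L (V x) W (n x) \<oplus>\<^bsub>sect L W\<^esub> restr L (V x) W (hL \<alpha> (V x) (w x))"
      unfolding Vx(6) by (rule L.restr_add[OF Vx(1) W]) (use ns hs Vx(1) in simp_all)
    also have "restr L (V x) W (hL \<alpha> (V x) (w x)) = hL \<alpha> W (restr L (V x) W (w x))"
      by (rule hL_restr[OF Vx(1) W Vx(5), symmetric])
    finally show "restr L U W m = restr L (V x) W (n x) \<oplus>\<^bsub>sect L W\<^esub> hL \<alpha> W (restr L (V x) W (w x))" .
    show "restr L (V x) W (n x) \<in> deg_lt W 1" unfolding rs_eq_restr_L[OF Vx(1) W ns] by (rule deg_lt_restr[OF Vx(1) W Vx(4)])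
    show "restr L (V x) W (w x) \<in> seq_sec M W" unfolding rs_eq_restr_L[OF Vx(1) W Vx(5)] by (rule rs_mem[OF Vx(1) W Vx(5)])
  qed
  have comp: "restr L (V x) (V x \<inter> V y) (w x) = restr L (V y) (V x \<inter> V y) (w y)" if x: "x \<in> U" and y: "y \<in> U" for x y
  proof -
    have o: "open (V x \<inter> V y)" using V(1)[OF x] V(1)[OF y] by auto
    note rx = res[OF x o Int_lower1] and ry = res[OF y o Int_lower2]
    show ?thesis by (rule conjunct1[OF hL_inj_normal[OF o rx(3) ry(3) rx(2) ry(2), of \<alpha>]]) (use rx(1) ry(1) in simp)
  qed
  have un: "U = (\<Union>x\<in>U. V x)" using V by blast
  obtain W where Wc: "W \<in> carrier (sect L U)" and Wr: "\<And>x. x \<in> U \<Longrightarrow> restr L U (V x) W = w x"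
    by (rule L.section_glue[of U V w U, OF _ _ comp un]) (use V in auto)
  have Ws: "W \<in> seq_sec M U" using Wc U by simp
  have hWc: "hL \<alpha> U W \<in> carrier (sect L U)" using hL_mem[OF U Ws] U by simp
  have mc: "m \<in> carrier (sect L U)" using m U by simp
  define k where "k = m \<oplus>\<^bsub>sect L U\<^esub> \<ominus>\<^bsub>sect L U\<^esub> hL \<alpha> U W"
  have kc: "k \<in> carrier (sect L U)" unfolding k_def using mc hWc by (intro A.a_closed A.a_inv_closed)
  have ks: "k \<in> seq_sec M U" using kc U by simp
  have mk: "m = k \<oplus>\<^bsub>sect L U\<^esub> hL \<alpha> U W"
    unfolding k_def A.a_assoc[OF mc A.a_inv_closed[OF hWc] hWc] A.l_neg[OF hWc] using mc by (simp del: L_carrier)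
  have "k j = z0 U" if j: "j \<ge> 1" for j
  proof (rule M.section_eqI[OF U seq_sec_comp[OF ks] M.zero_mem[OF U]])
    fix x assume x: "x \<in> U"
    note Vx = V[OF x]
    interpret B: abelian_group "sect L (V x)" by (rule L.abelian_group_sect[OF Vx(1)])
    have "restr L U (V x) m = restr L U (V x) k \<oplus>\<^bsub>sect L (V x)\<^esub> hL \<alpha> (V x) (w x)"
      unfolding mk L.restr_add[OF U Vx(1,3) kc hWc] using hL_restr[OF U Vx(1,3) Ws, of \<alpha>] Wr[OF x] by simp
    then have e: "n x \<oplus>\<^bsub>sect L (V x)\<^esub> hL \<alpha> (V x) (w x) = restr L U (V x) k \<oplus>\<^bsub>sect L (V x)\<^esub> hL \<alpha> (V x) (w x)"
      using Vx(6) by simp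
    have c: "n x \<in> carrier (sect L (V x))" "hL \<alpha> (V x) (w x) \<in> carrier (sect L (V x))" "restr L U (V x) k \<in> carrier (sect L (V x))"
      using deg_lt_seq_sec[OF Vx(1,4)] hL_mem[OF Vx(1,5)] L.restr_closed[OF U Vx(1,3) kc] Vx(1) by simp_all
    have "n x = restr L U (V x) k" using e c by (simp del: L_carrier)
    then have "n x = rs U (V x) k" using rs_eq_restr_L[OF U Vx(1,3) ks] by simp
    then have "restr M U (V x) (k j) = n x j" by simp
    also have "\<dots> = z0 (V x)" using Vx(4) j by (simp add: deg_lt_def)
    finally show "\<exists>V. open V \<and> x \<in> V \<and> V \<subseteq> U \<and> restr M U V (k j) = restr M U V (z0 U)"
      using Vx U by (intro exI[of _ "V x"]) simp
  qed
  then have "k \<in> deg_lt U 1" using seq_sec_comp[OF ks] by (simp add: deg_lt_def)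
  then show ?thesis using mk Ws by blast
qed

text \<open>The normal forms are the constants, which amounts to evaluation at \<open>s =
  -\<alpha>\<close>.\<close>

lemma normal_form: "normal_form_quotient X L (hL \<alpha>) (\<lambda>U. deg_lt U 1)"
proof unfold_locales
  show "sheaf_hom (D_ring X) L L (s_act L)" by (rule L_s_hom)
  show "sheaf_hom (D_ring X) L L (hL \<alpha>)" by (rule hL_hom)
  fix U :: "'a set" assume U: "open U"
  interpret A: abelian_group "sect L U" by (rule L.abelian_group_sect[OF U])
  have z1: "\<zero>\<^bsub>sect L U\<^esub> \<in> deg_lt U 1" using deg_lt_zero[OF U] L_zero[OF U] by simp
  show "inj_on (hL \<alpha> U) (carrier (sect L U))"
  proof (rule inj_onI)
    fix m m' assume "m \<in> carrier (sect L U)" "m' \<in> carrier (sect L U)" "hL \<alpha> U m = hL \<alpha> U m'"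
    then show "m = m'" using hL_inj_normal[OF U _ _ z1 z1, of m m' \<alpha>] U by simp
  qed
  show "deg_lt U 1 \<subseteq> carrier (sect L U)" using deg_lt_seq_sec[OF U] U by auto
  show "\<exists>n\<in>deg_lt U 1. \<exists>w\<in>carrier (sect L U). m = n \<oplus>\<^bsub>sect L U\<^esub> hL \<alpha> U w" if "m \<in> carrier (sect L U)" for m
    using normal_form_exists[OF U, of m \<alpha>] that U by simp
  show "n = n'" if n: "n \<in> deg_lt U 1" "n' \<in> deg_lt U 1" and w: "w \<in> carrier (sect L U)" and e: "n = n' \<oplus>\<^bsub>sect L U\<^esub> hL \<alpha> U w" for n n' w
  proof -
    have zs: "\<zero>\<^bsub>sect L U\<^esub> \<in> seq_sec M U" by (rule deg_lt_seq_sec[OF U z1])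
    have ws: "w \<in> seq_sec M U" using w U by simp
    have "hL \<alpha> U \<zero>\<^bsub>sect L U\<^esub> = \<zero>\<^bsub>sect L U\<^esub>"
      using hL_sc[OF U zs, of \<alpha> 0] L.sc_zero[OF U, of "hL \<alpha> U \<zero>\<^bsub>sect L U\<^esub>"] hL_mem[OF U zs, of \<alpha>] U by simp
    then have "n \<oplus>\<^bsub>sect L U\<^esub> hL \<alpha> U \<zero>\<^bsub>sect L U\<^esub> = n"
      using A.r_zero[of n] deg_lt_seq_sec[OF U n(1)] U by simp
    then show ?thesis using conjunct2[OF hL_inj_normal[OF U zs ws n]] e by simp
  qed
next
  fix U m assume U: "open U" and "m \<in> carrier (sect L U)"
  then have m: "m \<in> seq_sec M U" by simp
  have sc: "L.sc U \<alpha> (shift (z0 U) m) = shift (z0 U) (L.sc U \<alpha> m)"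
    unfolding L.sc_def by (rule smult_shift[OF U L.scal_mem[OF U] m])
  show "hL \<alpha> U (s_act L U m) = s_act L U (hL \<alpha> U m)"
    unfolding L_facts(5)[OF U m] L_facts(5)[OF U hL_mem[OF U m]] unfolding hL_eq[OF U m] hL_eq[OF U seq_sec_shift[OF U m]] sc
    by (rule shift_add[OF U seq_sec_shift[OF U m] L_sc_mem[OF U m], symmetric])
next
  fix U V n assume "open U" "open V" "V \<subseteq> U" "n \<in> deg_lt U 1"
  then show "restr L U V n \<in> deg_lt V 1" using rs_eq_restr_L[of U V n] deg_lt_restr[of U V n 1] deg_lt_seq_sec[of U n 1] by simp
qed

lemma ident_hL:
  assumes U: "open U" and m: "m \<in> seq_sec M U"
  shows "\<Phi> U (hL \<alpha> U m) = sN (cyl U) (\<Phi> U m) \<oplus>\<^bsub>sect N (cyl U)\<^esub> N.sc (cyl U) \<alpha> (\<Phi> U m)"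
proof -
  have "\<Phi> U (L.sc U \<alpha> m) = N.sc (cyl U) \<alpha> (\<Phi> U m)"
    unfolding L.sc_def N.sc_def using ident_smult[OF U L.scal_mem[OF U] m] lift_op_scal[OF X] by simp
  then show ?thesis unfolding hL_eq[OF U m] ident_add[OF U seq_sec_shift[OF U m] L_sc_mem[OF U m]] ident_shift[OF U m] by simp
qed

end


section \<open>The lexicographic order\<close>

lemma clex_less_trans: "clex_less a b \<Longrightarrow> clex_less b c \<Longrightarrow> clex_less a c"
  by (auto simp: clex_less_def)

lemma clex_le_less_trans: "clex_le a b \<Longrightarrow> clex_less b c \<Longrightarrow> clex_less a c"
  by (auto simp: clex_le_def intro: clex_less_trans)

lemma clex_less_le_trans: "clex_less a b \<Longrightarrow> clex_le b c \<Longrightarrow> clex_less a c"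
  by (auto simp: clex_le_def intro: clex_less_trans)

lemma clex_le_trans: "clex_le a b \<Longrightarrow> clex_le b c \<Longrightarrow> clex_le a c"
  by (auto simp: clex_le_def intro: clex_less_trans)

lemma clex_irrefl: "\<not> clex_less a a"
  by (auto simp: clex_less_def)

lemma clex_linear: "clex_less a b \<or> clex_le b a"
  by (auto simp: clex_less_def clex_le_def complex_eq_iff)

lemma clex_le_refl: "clex_le a a" by (simp add: clex_le_def)

lemma clex_less_imp_le: "clex_less a b \<Longrightarrow> clex_le a b" by (simp add: clex_le_def)

lemma finite_clex_least:
  assumes "finite S" "S \<noteq> {}"
  shows "\<exists>c\<in>S. \<forall>d\<in>S. clex_le c d"
  using assms
proof (induction rule: finite_ne_induct)
  case (singleton x) then show ?case by (simp add: clex_le_refl)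
next
  case (insert x F)
  then obtain c where c: "c \<in> F" "\<forall>d\<in>F. clex_le c d" by blast
  show ?case
  proof (cases "clex_less x c")
    case True
    have "clex_le x d" if "d \<in> F" for d
      using clex_le_trans[OF clex_less_imp_le[OF True]] c(2) that by blast
    then show ?thesis by (intro bexI[of _ x]) (auto simp: clex_le_refl)
  next
    case False
    then have "clex_le c x" using clex_linear[of x c] by blast
    then show ?thesis using c by (intro bexI[of _ c]) auto
  qed
qed

text \<open>The points at which the filtration may change between the indices
  \<open>\<gamma>\<close> and \<open>\<beta>\<close>. The interval contains \<open>\<gamma>\<close>
  but not \<open>\<beta>\<close>, as the filtration is left-continuous.\<close>

definition jumps :: "complex set \<Rightarrow> complex \<Rightarrow> complex \<Rightarrow> complex set" where
  "jumps A \<gamma> \<beta> = {c. clex_le \<gamma> c \<and> clex_less c \<beta> \<and> (\<exists>a\<in>A. \<exists>k::int. c = a + of_int k)}"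

text \<open>Translates by different integers have different real parts, and the lexicographic order
  bounds the real parts.\<close>

lemma finite_jumps:
  assumes "finite A"
  shows "finite (jumps A \<gamma> \<beta>)"
proof -
  have "jumps A \<gamma> \<beta> \<subseteq> (\<Union>a\<in>A. (\<lambda>k. a + of_int k) ` {\<lceil>Re \<gamma> - Re a\<rceil>..\<lfloor>Re \<beta> - Re a\<rfloor>})"
  proof
    fix c assume "c \<in> jumps A \<gamma> \<beta>"
    then obtain a k where ak: "a \<in> A" "c = a + of_int k" "clex_le \<gamma> c" "clex_less c \<beta>" by (auto simp: jumps_def)
    then have "Re \<gamma> \<le> Re a + of_int k" "Re a + of_int k \<le> Re \<beta>" by (auto simp: clex_le_def clex_less_def)
    then have "k \<in> {\<lceil>Re \<gamma> - Re a\<rceil>..\<lfloor>Re \<beta> - Re a\<rfloor>}" by (auto simp: ceiling_le_iff le_floor_iff)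
    then show "c \<in> (\<Union>a\<in>A. (\<lambda>k. a + of_int k) ` {\<lceil>Re \<gamma> - Re a\<rceil>..\<lfloor>Re \<beta> - Re a\<rfloor>})" using ak by blast
  qed
  then show ?thesis by (rule finite_subset) (use assms in auto)
qed

section \<open>The operator \<open>s + \<alpha>\<close> and the Kashiwara-Malgrange filtration\<close>

context graph_setting
begin

abbreviation hN :: "('a \<times> complex) set \<Rightarrow> complex \<Rightarrow> (nat \<Rightarrow> 'm) \<Rightarrow> nat \<Rightarrow> 'm" where
  "hN W c \<equiv> (\<lambda>u. sN W u \<oplus>\<^bsub>sect N W\<^esub> N.sc W c u)"

context
  fixes W :: "('a \<times> complex) set"
  assumes W: "open W"
begin

interpretation A: abelian_group "sect N W" by (rule N.abelian_group_sect[OF W])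

lemma hN_mem: "u \<in> carrier (sect N W) \<Longrightarrow> hN W c u \<in> carrier (sect N W)"
  by (intro N.add_mem W sN_mem N.sc_mem)

lemma hN_add: "u \<in> carrier (sect N W) \<Longrightarrow> v \<in> carrier (sect N W) \<Longrightarrow>
    hN W c (u \<oplus>\<^bsub>sect N W\<^esub> v) = hN W c u \<oplus>\<^bsub>sect N W\<^esub> hN W c v"
  using sN_mem[OF W, of u] sN_mem[OF W, of v] N.sc_mem[OF W, of u c] N.sc_mem[OF W, of v c]
  by (simp add: sN_add[OF W] N.sc_add[OF W] A.a_ac del: N_carrier)

lemma hN_sc: "u \<in> carrier (sect N W) \<Longrightarrow> hN W c (N.sc W a u) = N.sc W a (hN W c u)"
  using sN_mem[OF W, of u] N.sc_mem[OF W, of u c]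
  by (simp add: sN_sc[OF W] N.sc_add[OF W] N.sc_sc[OF W] mult.commute del: N_carrier)

lemma hN_sN: "u \<in> carrier (sect N W) \<Longrightarrow> hN W c (sN W u) = sN W (hN W c u)"
  using sN_mem[OF W, of u] N.sc_mem[OF W, of u c]
  by (simp add: sN_add[OF W] sN_sc[OF W] sN_mem[OF W] del: N_carrier)

lemma hN_commute: "u \<in> carrier (sect N W) \<Longrightarrow> hN W c (hN W d u) = hN W d (hN W c u)"
  using hN_add[of "sN W u" "N.sc W d u" c] hN_sN[of u c] hN_sc[of u c d] hN_sc[of u d c] sN_mem[OF W, of u] N.sc_mem[OF W, of u d]
  by (simp del: N_carrier)

lemma hN_shift_scalar:
  assumes u: "u \<in> carrier (sect N W)"
  shows "N.sc W (c - \<alpha>) u = hN W c u \<oplus>\<^bsub>sect N W\<^esub> N.sc W (-1) (hN W \<alpha> u)"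
proof -
  have m: "N.sc W a u \<in> carrier (sect N W)" for a by (rule N.sc_mem[OF W u])
  have s: "sN W u \<in> carrier (sect N W)" by (rule sN_mem[OF W u])
  have "hN W c u = hN W \<alpha> u \<oplus>\<^bsub>sect N W\<^esub> N.sc W (c - \<alpha>) u"
    using N.sc_add_scalar[OF W u, of \<alpha> "c - \<alpha>"] A.a_assoc[OF s m m] by simp
  moreover have "N.sc W (-1) (hN W \<alpha> u) = \<ominus>\<^bsub>sect N W\<^esub> hN W \<alpha> u"
    by (rule N.minus_eq_sc[OF W hN_mem[OF u], symmetric])
  ultimately show ?thesis using hN_mem[OF u, of \<alpha>] m
    by (simp add: A.a_ac A.r_neg A.r_neg1 A.r_neg2 del: N_carrier)
qed

text \<open>The two operators differ by the constant \<open>c - \<alpha>\<close>, which can be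
  divided by.\<close>

lemma hN_solve:
  assumes u: "u \<in> carrier (sect N W)" and c: "c \<noteq> \<alpha>"
  shows "u = N.sc W (1 / (c - \<alpha>)) (hN W c u \<oplus>\<^bsub>sect N W\<^esub> N.sc W (-1) (hN W \<alpha> u))"
  unfolding hN_shift_scalar[OF u, symmetric] using N.sc_sc[OF W u, of "1 / (c - \<alpha>)" "c - \<alpha>"] N.sc_one[OF W u] c by simp

text \<open>The next two lemmas say that \<open>s + \<alpha>\<close> is bijective modulo \<open>G\<close> where \<open>s + c\<close> is nilpotent modulo
  \<open>G\<close>. By \<open>hN_solve\<close> an element is recovered from its images under \<open>s + c\<close> and \<open>s + \<alpha>\<close>, and the
  image under \<open>s + c\<close> is killed by a smaller power.\<close>

lemma nilpotent_injective:
  assumes G: "G \<subseteq> carrier (sect N W)"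
    and G_add: "\<And>u v. u \<in> G \<Longrightarrow> v \<in> G \<Longrightarrow> u \<oplus>\<^bsub>sect N W\<^esub> v \<in> G"
    and G_sc: "\<And>u a. u \<in> G \<Longrightarrow> N.sc W a u \<in> G" and G_s: "\<And>u. u \<in> G \<Longrightarrow> sN W u \<in> G"
    and c: "c \<noteq> \<alpha>"
  shows "w \<in> carrier (sect N W) \<Longrightarrow> hN W \<alpha> w \<in> G \<Longrightarrow> (hN W c ^^ k) w \<in> G \<Longrightarrow> w \<in> G"
proof (induction k arbitrary: w)
  case (Suc k)
  have G_h: "hN W d u \<in> G" if "u \<in> G" for d u by (intro G_add G_s G_sc that)
  have "hN W c w \<in> G"
  proof (rule Suc.IH)
    show "hN W c w \<in> carrier (sect N W)" by (rule hN_mem[OF Suc.prems(1)])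
    show "hN W \<alpha> (hN W c w) \<in> G" 
      using G_h[OF Suc.prems(2), of c] hN_commute[OF Suc.prems(1), of \<alpha> c] by simp
    show "(hN W c ^^ k) (hN W c w) \<in> G" using Suc.prems(3) by (simp only: funpow_Suc_right o_apply)
  qed
  then show ?case by (subst hN_solve[OF Suc.prems(1) c]) (rule G_sc[OF G_add[OF _ G_sc[OF Suc.prems(2)]]])
qed simp

lemma nilpotent_surjective:
  assumes G: "G \<subseteq> carrier (sect N W)"
    and G_add: "\<And>u v. u \<in> G \<Longrightarrow> v \<in> G \<Longrightarrow> u \<oplus>\<^bsub>sect N W\<^esub> v \<in> G"
    and G_sc: "\<And>u a. u \<in> G \<Longrightarrow> N.sc W a u \<in> G"
    and c: "c \<noteq> \<alpha>"
  shows "v \<in> carrier (sect N W) \<Longrightarrow> (hN W c ^^ k) v \<in> G \<Longrightarrow>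
    \<exists>y\<in>carrier (sect N W). \<exists>g\<in>G. v = hN W \<alpha> y \<oplus>\<^bsub>sect N W\<^esub> g"
proof (induction k arbitrary: v)
  case 0
  then have "v = hN W \<alpha> \<zero>\<^bsub>sect N W\<^esub> \<oplus>\<^bsub>sect N W\<^esub> v"
    using sN_zero[OF W] N.sc_zero_right[OF W] by (simp del: N_carrier)
  moreover have "v \<in> G" using 0 by simp
  ultimately show ?case using A.zero_closed by blast
next
  case (Suc k)
  note v = Suc.prems(1)
  have "(hN W c ^^ k) (hN W c v) \<in> G" using Suc.prems(2) by (simp only: funpow_Suc_right o_apply)
  from Suc.IH[OF hN_mem[OF v] this] obtain y g where y: "y \<in> carrier (sect N W)" and g: "g \<in> G"
    and e: "hN W c v = hN W \<alpha> y \<oplus>\<^bsub>sect N W\<^esub> g" by blast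
  define \<kappa> where "\<kappa> = 1 / (c - \<alpha>)"
  have gc: "g \<in> carrier (sect N W)" using g G by blast
  have mv: "N.sc W (-1) v \<in> carrier (sect N W)" by (rule N.sc_mem[OF W v])
  have c1: "hN W \<alpha> y \<in> carrier (sect N W)" "N.sc W (-1) (hN W \<alpha> v) \<in> carrier (sect N W)"
    by (rule hN_mem[OF y], rule N.sc_mem[OF W hN_mem[OF v]])
  have "v = N.sc W \<kappa> ((hN W \<alpha> y \<oplus>\<^bsub>sect N W\<^esub> g) \<oplus>\<^bsub>sect N W\<^esub> N.sc W (-1) (hN W \<alpha> v))"
    unfolding \<kappa>_def e[symmetric] by (rule hN_solve[OF v c])
  also have "(hN W \<alpha> y \<oplus>\<^bsub>sect N W\<^esub> g) \<oplus>\<^bsub>sect N W\<^esub> N.sc W (-1) (hN W \<alpha> v) =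
      (hN W \<alpha> y \<oplus>\<^bsub>sect N W\<^esub> N.sc W (-1) (hN W \<alpha> v)) \<oplus>\<^bsub>sect N W\<^esub> g"
    unfolding A.a_assoc[OF c1(1) gc c1(2)] A.a_assoc[OF c1(1) c1(2) gc] A.a_comm[OF gc c1(2)] by (rule refl)
  also have "hN W \<alpha> y \<oplus>\<^bsub>sect N W\<^esub> N.sc W (-1) (hN W \<alpha> v) = hN W \<alpha> (y \<oplus>\<^bsub>sect N W\<^esub> N.sc W (-1) v)"
    unfolding hN_add[OF y mv] hN_sc[OF v] by (rule refl)
  also have "N.sc W \<kappa> (hN W \<alpha> (y \<oplus>\<^bsub>sect N W\<^esub> N.sc W (-1) v) \<oplus>\<^bsub>sect N W\<^esub> g) =
      hN W \<alpha> (N.sc W \<kappa> (y \<oplus>\<^bsub>sect N W\<^esub> N.sc W (-1) v)) \<oplus>\<^bsub>sect N W\<^esub> N.sc W \<kappa> g"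
    unfolding hN_sc[OF N.add_mem[OF W y mv]] by (rule N.sc_add[OF W hN_mem[OF N.add_mem[OF W y mv]] gc])
  finally have "v = hN W \<alpha> (N.sc W \<kappa> (y \<oplus>\<^bsub>sect N W\<^esub> N.sc W (-1) v)) \<oplus>\<^bsub>sect N W\<^esub> N.sc W \<kappa> g" .
  moreover have "N.sc W \<kappa> (y \<oplus>\<^bsub>sect N W\<^esub> N.sc W (-1) v) \<in> carrier (sect N W)"
    by (intro N.sc_mem W N.add_mem y mv)
  ultimately show ?case using G_sc[OF g] by blast
qed

end

lemma hN_restr:
  assumes W: "open W" "open V" "V \<subseteq> W" and u: "u \<in> carrier (sect N W)"
  shows "restr N W V (hN W c u) = hN V c (restr N W V u)"
  unfolding N.restr_add[OF W sN_mem[OF W(1) u] N.sc_mem[OF W(1) u]] sN_restr[OF W u] N.restr_sc[OF W u] by (rule refl)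

lemma N_empty: "open W \<Longrightarrow> pre W = {} \<Longrightarrow> u \<in> carrier (sect N W) \<Longrightarrow> u = \<zero>\<^bsub>sect N W\<^esub>"
  using M.empty_section seq_sec_comp[of u "{}"] by (auto simp: N_zero fun_eq_iff)

text \<open>Sections of the direct image are sequences of sections of \<open>M\<close> over the trace of the open set on
  the graph, and restriction is componentwise.\<close>

lemma N_restr_same_trace:
  assumes W: "open W" "open T" "T \<subseteq> W" "pre T = pre W" and u: "u \<in> carrier (sect N W)"
  shows "restr N W T u = u"
  using N_facts(2)[OF W(1-3), of u] u W seq_sec_comp by simp

end

locale km_setting = graph_setting X M f L N
  for X :: "('a::topological_space) cmfd" and M :: "('a, 'm) msheaf" and f
    and L :: "('a, nat \<Rightarrow> 'm) smsheaf" and N :: "('a \<times> complex, nat \<Rightarrow> 'm) msheaf" +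
  fixes V :: "complex \<Rightarrow> ('a \<times> complex) set \<Rightarrow> (nat \<Rightarrow> 'm) set" and \<alpha> \<beta> :: complex
  assumes KM: "is_KM_filtration X N V" and le: "clex_le \<beta> \<alpha>"
begin

lemma V_submodule: "submodule_sheaf (V0D_ring X) N (V \<gamma>) UNIV"
  using KM by (simp add: is_KM_filtration_def)

lemma V_facts:
  assumes "open W"
  shows "V \<gamma> W \<subseteq> carrier (sect N W)" and "\<zero>\<^bsub>sect N W\<^esub> \<in> V \<gamma> W"
    and "u \<in> V \<gamma> W \<Longrightarrow> v \<in> V \<gamma> W \<Longrightarrow> u \<oplus>\<^bsub>sect N W\<^esub> v \<in> V \<gamma> W"
    and "P \<in> VD_sec X 0 W \<Longrightarrow> u \<in> V \<gamma> W \<Longrightarrow> P \<odot>\<^bsub>sect N W\<^esub> u \<in> V \<gamma> W"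
    and "open T \<Longrightarrow> T \<subseteq> W \<Longrightarrow> u \<in> V \<gamma> W \<Longrightarrow> restr N W T u \<in> V \<gamma> T"
    and "u \<in> carrier (sect N W) \<Longrightarrow>
      (\<And>p. p \<in> W \<Longrightarrow> \<exists>T. open T \<and> p \<in> T \<and> T \<subseteq> W \<and> restr N W T u \<in> V \<gamma> T) \<Longrightarrow> u \<in> V \<gamma> W"
  using V_submodule[of \<gamma>] assms unfolding submodule_sheaf_def by (simp_all add: V0D_ring_def op_ring_def)

lemma V_mem: "open W \<Longrightarrow> u \<in> V \<gamma> W \<Longrightarrow> u \<in> carrier (sect N W)"
  using V_facts(1) by (rule subsetD)

lemma V_antimono: "open W \<Longrightarrow> clex_le \<gamma> \<delta> \<Longrightarrow> V \<delta> W \<subseteq> V \<gamma> W"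
proof -
  assume "open W" "clex_le \<gamma> \<delta>"
  moreover have "is_C_filtration N V" using KM by (simp add: is_KM_filtration_def)
  then have "\<forall>\<gamma> \<delta> W. open W \<and> clex_le \<gamma> \<delta> \<longrightarrow> V \<delta> W \<subseteq> V \<gamma> W"
    unfolding is_C_filtration_def by (rule conjunct1)
  ultimately show ?thesis by simp
qed

lemma V_exhaustive: "open W \<Longrightarrow> u \<in> carrier (sect N W) \<Longrightarrow> p \<in> W \<Longrightarrow>
    \<exists>T \<gamma>. open T \<and> p \<in> T \<and> T \<subseteq> W \<and> restr N W T u \<in> V \<gamma> T"
  using KM by (simp add: is_KM_filtration_def is_C_filtration_def del: N_carrier)

lemma V_jumps: "\<exists>T A. open T \<and> p \<in> T \<and> finite A \<and>
        (\<forall>\<gamma> \<delta>. clex_le \<gamma> \<delta> \<and>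
           (\<forall>a\<in>A. \<forall>k::int. \<not> (clex_le \<gamma> (a + of_int k) \<and> clex_less (a + of_int k) \<delta>)) \<longrightarrow>
           (\<forall>W. open W \<and> W \<subseteq> T \<longrightarrow> V \<gamma> W = V \<delta> W))"
proof -
  have "is_C_filtration N V" using KM by (simp add: is_KM_filtration_def)
  from this[unfolded is_C_filtration_def, THEN conjunct2, THEN conjunct2, THEN conjunct2]
  show ?thesis by (rule spec)
qed

lemma V_nilpotent: "\<exists>T (\<nu>::nat). open T \<and> p \<in> T \<and> (\<forall>W. open W \<and> W \<subseteq> T \<longrightarrow>
    (\<forall>u\<in>V \<gamma> W. (hN W \<gamma> ^^ \<nu>) u \<in> V_greater N V \<gamma> W))"
proof -
  from KM[unfolded is_KM_filtration_def, THEN conjunct2, THEN conjunct2, THEN conjunct2, THEN spec[of _ \<gamma>], THEN spec[of _ p]]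
  show ?thesis unfolding N.sc_def scal_def .
qed

lemma V_sN: "open W \<Longrightarrow> u \<in> V \<gamma> W \<Longrightarrow> sN W u \<in> V \<gamma> W"
  using sN_eq[of W u] V_mem[of W u \<gamma>] V_facts(4)[of W "s_op X W" u \<gamma>] s_op_VD_sec[OF X, of W] by simp

lemma V_sc: "open W \<Longrightarrow> u \<in> V \<gamma> W \<Longrightarrow> N.sc W a u \<in> V \<gamma> W"
  unfolding N.sc_def using V_facts(4)[of W "scal (times_C X) W a" u \<gamma>] scal_VD_sec[OF X, of W a] by simp

lemma V_hN: "open W \<Longrightarrow> u \<in> V \<gamma> W \<Longrightarrow> hN W c u \<in> V \<gamma> W"
  by (intro V_facts(3) V_sN V_sc)

lemma V_lift: "open U \<Longrightarrow> P \<in> D_sec X U \<Longrightarrow> u \<in> V \<gamma> (cyl U) \<Longrightarrow> lift_op X U P \<odot>\<^bsub>sect N (cyl U)\<^esub> u \<in> V \<gamma> (cyl U)"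
  by (intro V_facts(4) open_cyl lift_op_VD_sec[OF X])

abbreviation VG where "VG \<equiv> V_greater N V"

lemma VG_mem: "u \<in> VG \<gamma> W \<Longrightarrow> u \<in> carrier (sect N W)"
  by (simp add: V_greater_def)

lemma VG_local: "u \<in> VG \<gamma> W \<Longrightarrow> p \<in> W \<Longrightarrow> \<exists>T \<delta>. open T \<and> p \<in> T \<and> T \<subseteq> W \<and> clex_less \<gamma> \<delta> \<and> restr N W T u \<in> V \<delta> T"
  by (simp add: V_greater_def)

lemma VG_I:
  assumes "u \<in> carrier (sect N W)"
    and "\<And>p. p \<in> W \<Longrightarrow> \<exists>T \<delta>. open T \<and> p \<in> T \<and> T \<subseteq> W \<and> clex_less \<gamma> \<delta> \<and> restr N W T u \<in> V \<delta> T"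
  shows "u \<in> VG \<gamma> W"
  using assms by (simp add: V_greater_def)

lemma V_subset_VG: "open W \<Longrightarrow> clex_less \<gamma> \<delta> \<Longrightarrow> u \<in> V \<delta> W \<Longrightarrow> u \<in> VG \<gamma> W"
  using V_mem[of W u \<delta>] V_facts(5)[of W W u \<delta>] by (intro VG_I exI[of _ W] exI[of _ \<delta>]) simp_all

lemma VG_add:
  assumes W: "open W" and u: "u \<in> VG \<gamma> W" and v: "v \<in> VG \<gamma> W"
  shows "u \<oplus>\<^bsub>sect N W\<^esub> v \<in> VG \<gamma> W"
proof (rule VG_I)
  note uc = VG_mem[OF u] and vc = VG_mem[OF v]
  show "u \<oplus>\<^bsub>sect N W\<^esub> v \<in> carrier (sect N W)" by (rule N.add_mem[OF W uc vc])
  fix p assume p: "p \<in> W"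
  from VG_local[OF u p] obtain T \<delta> where T: "open T" "p \<in> T" "T \<subseteq> W" "clex_less \<gamma> \<delta>" "restr N W T u \<in> V \<delta> T" by (elim exE conjE)
  from VG_local[OF v p] obtain T' \<delta>' where T': "open T'" "p \<in> T'" "T' \<subseteq> W" "clex_less \<gamma> \<delta>'" "restr N W T' v \<in> V \<delta>' T'" by (elim exE conjE)
  define \<epsilon> where "\<epsilon> = (if clex_less \<delta> \<delta>' then \<delta> else \<delta>')"
  have \<epsilon>: "clex_less \<gamma> \<epsilon>" "clex_le \<epsilon> \<delta>" "clex_le \<epsilon> \<delta>'"
    using T(4) T'(4) clex_linear[of \<delta> \<delta>'] by (auto simp: \<epsilon>_def clex_le_refl clex_less_imp_le)
  let ?S = "T \<inter> T'"
  have S: "open ?S" "?S \<subseteq> W" "?S \<subseteq> T" "?S \<subseteq> T'" using T T' by auto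
  have "restr N W ?S u \<in> V \<epsilon> ?S"
    using V_facts(5)[OF T(1) S(1,3) T(5)] N.restr_restr[OF W T(1) S(1,3) T(3) uc] V_antimono[OF S(1) \<epsilon>(2)] by auto
  moreover have "restr N W ?S v \<in> V \<epsilon> ?S"
    using V_facts(5)[OF T'(1) S(1,4) T'(5)] N.restr_restr[OF W T'(1) S(1,4) T'(3) vc] V_antimono[OF S(1) \<epsilon>(3)] by auto
  ultimately have "restr N W ?S (u \<oplus>\<^bsub>sect N W\<^esub> v) \<in> V \<epsilon> ?S"
    unfolding N.restr_add[OF W S(1,2) uc vc] by (rule V_facts(3)[OF S(1)])
  then show "\<exists>T \<delta>. open T \<and> p \<in> T \<and> T \<subseteq> W \<and> clex_less \<gamma> \<delta> \<and> restr N W T (u \<oplus>\<^bsub>sect N W\<^esub> v) \<in> V \<delta> T"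
    using S T(2) T'(2) \<epsilon>(1) by (intro exI[of _ ?S] exI[of _ \<epsilon>]) simp
qed

lemma VG_sN:
  assumes W: "open W" and u: "u \<in> VG \<gamma> W"
  shows "sN W u \<in> VG \<gamma> W"
proof (rule VG_I[OF sN_mem[OF W VG_mem[OF u]]])
  fix p assume p: "p \<in> W"
  from VG_local[OF u p] obtain T \<delta> where T: "open T" "p \<in> T" "T \<subseteq> W" "clex_less \<gamma> \<delta>" "restr N W T u \<in> V \<delta> T" by (elim exE conjE)
  then show "\<exists>T \<delta>. open T \<and> p \<in> T \<and> T \<subseteq> W \<and> clex_less \<gamma> \<delta> \<and> restr N W T (sN W u) \<in> V \<delta> T"
    using sN_restr[OF W T(1,3) VG_mem[OF u]] V_sN[OF T(1,5)] by (intro exI[of _ T] exI[of _ \<delta>]) simp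
qed

lemma VG_sc:
  assumes W: "open W" and u: "u \<in> VG \<gamma> W"
  shows "N.sc W a u \<in> VG \<gamma> W"
proof (rule VG_I[OF N.sc_mem[OF W VG_mem[OF u]]])
  fix p assume p: "p \<in> W"
  from VG_local[OF u p] obtain T \<delta> where T: "open T" "p \<in> T" "T \<subseteq> W" "clex_less \<gamma> \<delta>" "restr N W T u \<in> V \<delta> T" by (elim exE conjE)
  then show "\<exists>T \<delta>. open T \<and> p \<in> T \<and> T \<subseteq> W \<and> clex_less \<gamma> \<delta> \<and> restr N W T (N.sc W a u) \<in> V \<delta> T"
    using N.restr_sc[OF W T(1,3) VG_mem[OF u]] V_sc[OF T(1,5)] by (intro exI[of _ T] exI[of _ \<delta>]) simp
qed

lemma VG_subset: "VG \<gamma> W \<subseteq> carrier (sect N W)"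
  using VG_mem by blast

subsection \<open>Climbing the filtration up to \<open>\<beta>\<close>\<close>

text \<open>On \<open>T\<close> the jumps lie in \<open>A + \<int>\<close>.\<close>

definition jump_data :: "('a \<times> complex) set \<Rightarrow> complex set \<Rightarrow> bool" where
  "jump_data T A \<longleftrightarrow> finite A \<and> (\<forall>\<gamma> \<delta>. clex_le \<gamma> \<delta> \<and>
           (\<forall>a\<in>A. \<forall>k::int. \<not> (clex_le \<gamma> (a + of_int k) \<and> clex_less (a + of_int k) \<delta>)) \<longrightarrow>
           (\<forall>W. open W \<and> W \<subseteq> T \<longrightarrow> V \<gamma> W = V \<delta> W))"

lemma jump_dataD:
  assumes J: "jump_data T A" and le: "clex_le \<gamma> \<delta>" and no: "jumps A \<gamma> \<delta> = {}" and W: "open W" "W \<subseteq> T"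
  shows "V \<gamma> W = V \<delta> W"
proof -
  have "\<forall>a\<in>A. \<forall>k::int. \<not> (clex_le \<gamma> (a + of_int k) \<and> clex_less (a + of_int k) \<delta>)"
    using no by (auto simp: jumps_def)
  then show ?thesis using J le W by (simp add: jump_data_def)
qed

text \<open>Up to the first element of \<open>A + \<int>\<close> the filtration is constant. As the
  order on the complex numbers is not complete, the first element exists only because the candidates
  are finitely many.\<close>

lemma least_jump:
  assumes J: "jump_data T A" and lt: "clex_less \<gamma> \<beta>" and ne: "jumps A \<gamma> \<beta> \<noteq> {}"
  obtains c where "c \<in> jumps A \<gamma> \<beta>" "\<And>W. open W \<Longrightarrow> W \<subseteq> T \<Longrightarrow> V \<gamma> W = V c W"
proof -
  have "finite (jumps A \<gamma> \<beta>)" using J by (intro finite_jumps) (simp add: jump_data_def)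
  from finite_clex_least[OF this ne] obtain c where c: "c \<in> jumps A \<gamma> \<beta>" "\<forall>d\<in>jumps A \<gamma> \<beta>. clex_le c d" ..
  have "clex_le \<gamma> c" "clex_less c \<beta>" using c(1) by (auto simp: jumps_def)
  have "jumps A \<gamma> c = {}"
  proof (rule ccontr)
    assume "jumps A \<gamma> c \<noteq> {}"
    then obtain d where d: "d \<in> jumps A \<gamma> c" by blast
    then have "d \<in> jumps A \<gamma> \<beta>" using clex_less_trans[OF _ \<open>clex_less c \<beta>\<close>] by (auto simp: jumps_def)
    then have "clex_le c d" using c(2) by blast
    moreover have "clex_less d c" using d by (simp add: jumps_def)
    ultimately show False using clex_le_less_trans clex_irrefl by blast
  qed
  then show thesis using that[OF c(1)] jump_dataD[OF J \<open>clex_le \<gamma> c\<close>] by blast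
qed

lemma jumps_decrease:
  assumes A: "finite A" and c: "c \<in> jumps A \<gamma> \<beta>" and d: "clex_less c \<delta>"
  shows "card (jumps A \<delta> \<beta>) < card (jumps A \<gamma> \<beta>)"
proof (rule psubset_card_mono[OF finite_jumps[OF A]])
  have gc: "clex_le \<gamma> c" using c by (simp add: jumps_def)
  have "jumps A \<delta> \<beta> \<subseteq> jumps A \<gamma> \<beta>"
    using clex_le_trans[OF clex_less_imp_le[OF clex_le_less_trans[OF gc d]]] by (auto simp: jumps_def)
  moreover have "c \<notin> jumps A \<delta> \<beta>"
    using d clex_less_le_trans[OF d, of c] clex_irrefl by (auto simp: jumps_def)
  ultimately show "jumps A \<delta> \<beta> \<subset> jumps A \<gamma> \<beta>" using c by blast
qed

text \<open>The indices climbed through lie strictly below \<open>\<beta>\<close>, hence strictly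
  below \<open>\<alpha>\<close>.\<close>

lemma jump_neq_alpha: "c \<in> jumps A \<gamma> \<beta> \<Longrightarrow> c \<noteq> \<alpha>"
  using clex_less_le_trans[OF _ le] clex_irrefl by (auto simp: jumps_def)

text \<open>A section not yet in \<open>V\<^sup>\<beta>\<close> sits at a first jump
  \<open>c\<close> below \<open>\<beta>\<close>, where \<open>s + c\<close> is locally nilpotent
  modulo the next step.\<close>

lemma climb_step:
  assumes J: "jump_data T A" and W: "open W" "p \<in> W" "W \<subseteq> T" and w: "w \<in> V \<gamma> W" and n: "w \<notin> V \<beta> W"
  obtains c R \<nu> where "c \<in> jumps A \<gamma> \<beta>" "open R" "p \<in> R" "R \<subseteq> W" "restr N W R w \<in> V c R"
    "(hN R c ^^ \<nu>) (restr N W R w) \<in> VG c R"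
proof -
  have lt: "clex_less \<gamma> \<beta>"
  proof (rule ccontr)
    assume "\<not> clex_less \<gamma> \<beta>"
    then have "clex_le \<beta> \<gamma>" using clex_linear[of \<gamma> \<beta>] by simp
    from subsetD[OF V_antimono[OF W(1) this] w] n show False by simp
  qed
  have ne: "jumps A \<gamma> \<beta> \<noteq> {}"
  proof
    assume "jumps A \<gamma> \<beta> = {}"
    from jump_dataD[OF J clex_less_imp_le[OF lt] this W(1,3)] w n show False by simp
  qed
  obtain c where c: "c \<in> jumps A \<gamma> \<beta>" "\<And>W. open W \<Longrightarrow> W \<subseteq> T \<Longrightarrow> V \<gamma> W = V c W"
    by (fact least_jump[OF J lt ne])
  have wV: "w \<in> V c W" using c(2)[OF W(1,3)] w by simp
  from V_nilpotent[of p c] obtain S \<nu> where S: "open S" "p \<in> S" "\<forall>W. open W \<and> W \<subseteq> S \<longrightarrow>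
    (\<forall>u\<in>V c W. (hN W c ^^ \<nu>) u \<in> VG c W)" by (elim exE conjE)
  have R: "open (W \<inter> S)" "W \<inter> S \<subseteq> W" "W \<inter> S \<subseteq> S" "p \<in> W \<inter> S" using W S by auto
  have wR: "restr N W (W \<inter> S) w \<in> V c (W \<inter> S)" by (rule V_facts(5)[OF W(1) R(1,2) wV])
  then have "(hN (W \<inter> S) c ^^ \<nu>) (restr N W (W \<inter> S) w) \<in> VG c (W \<inter> S)" using S(3) R by blast
  then show thesis by (rule that[OF c(1) R(1,4,2) wR])
qed

text \<open>A section of \<open>V\<^sup>>\<^sup>c\<close> lies near a given point in some
  \<open>V\<^sup>\<delta>\<close> with \<open>\<delta>\<close> beyond \<open>c\<close>, so
  \<open>c\<close> is no longer among the jumps still to pass. Their number is the measure for the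
  two inductions that follow.\<close>

lemma climb_next:
  assumes J: "jump_data T A" and c: "c \<in> jumps A \<gamma> \<beta>" and g: "g \<in> VG c R" and p: "p \<in> R"
  obtains S \<delta> where "open S" "p \<in> S" "S \<subseteq> R" "restr N R S g \<in> V \<delta> S"
    "card (jumps A \<delta> \<beta>) < card (jumps A \<gamma> \<beta>)"
proof -
  from VG_local[OF g p] obtain S \<delta> where S: "open S" "p \<in> S" "S \<subseteq> R" "clex_less c \<delta>" "restr N R S g \<in> V \<delta> S"
    by (elim exE conjE)
  have "card (jumps A \<delta> \<beta>) < card (jumps A \<gamma> \<beta>)"
    using J by (intro jumps_decrease[OF _ c S(4)]) (simp add: jump_data_def)
  then show thesis by (rule that[OF S(1-3,5)])
qed

text \<open>At each jump \<open>s + \<alpha>\<close> is injective on the graded piece, and \<open>(s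
  + \<alpha>) w\<close> is zero there, being in \<open>V\<^sup>\<beta>\<close>.\<close>

lemma climb_kernel:
  assumes J: "jump_data T A"
  shows "open W \<Longrightarrow> p \<in> W \<Longrightarrow> W \<subseteq> T \<Longrightarrow> w \<in> V \<gamma> W \<Longrightarrow> hN W \<alpha> w \<in> V \<beta> W \<Longrightarrow>
    \<exists>W'. open W' \<and> p \<in> W' \<and> W' \<subseteq> W \<and> restr N W W' w \<in> V \<beta> W'"
proof (induction "card (jumps A \<gamma> \<beta>)" arbitrary: \<gamma> W w rule: less_induct)
  case less
  note W = less.prems(1-3) and w = less.prems(4) and hw = less.prems(5)
  note wc = V_mem[OF W(1) w]
  show ?case
  proof (cases "w \<in> V \<beta> W")
    case True
    then show ?thesis using W by (intro exI[of _ W]) (simp add: N.restr_id[OF W(1) wc])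
  next
    case False
    obtain c R \<nu> where c: "c \<in> jumps A \<gamma> \<beta>" and R: "open R" "p \<in> R" "R \<subseteq> W"
      and wR: "restr N W R w \<in> V c R" "(hN R c ^^ \<nu>) (restr N W R w) \<in> VG c R"
      by (rule climb_step[OF J W w False])
    have hR: "hN S \<alpha> (restr N W S w) \<in> V \<beta> S" if "open S" "S \<subseteq> W" for S
      using hN_restr[OF W(1) that wc, of \<alpha>] V_facts(5)[OF W(1) that hw] by simp
    have "clex_less c \<beta>" using c by (simp add: jumps_def)
    note h = V_subset_VG[OF R(1) this hR[OF R(1,3)]]
    have "restr N W R w \<in> VG c R"
      by (rule nilpotent_injective[OF R(1) VG_subset VG_add[OF R(1)] VG_sc[OF R(1)] VG_sN[OF R(1)]
        jump_neq_alpha[OF c] V_mem[OF R(1) wR(1)] h wR(2)])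
    then obtain S \<delta> where S: "open S" "p \<in> S" "S \<subseteq> R" "restr N R S (restr N W R w) \<in> V \<delta> S"
      "card (jumps A \<delta> \<beta>) < card (jumps A \<gamma> \<beta>)" by (rule climb_next[OF J c _ R(2)])
    have SW: "S \<subseteq> W" "S \<subseteq> T" using S(3) R(3) W(3) by auto
    have "restr N W S w \<in> V \<delta> S" using S(4) N.restr_restr[OF W(1) R(1) S(1,3) R(3) wc] by simp
    from less.hyps[OF S(5,1,2) SW(2) this hR[OF S(1) SW(1)]]
    obtain W' where W': "open W'" "p \<in> W'" "W' \<subseteq> S" "restr N S W' (restr N W S w) \<in> V \<beta> W'" by (elim exE conjE)
    have "restr N S W' (restr N W S w) = restr N W W' w" by (rule N.restr_restr[OF W(1) S(1) W'(1,3) SW(1) wc])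
    then show ?thesis using W' SW(1) by (intro exI[of _ W']) auto
  qed
qed

text \<open>At each jump \<open>s + \<alpha>\<close> is surjective on the graded piece; what is left
  after subtracting an element of the image lies higher up, and the elements subtracted add up to
  \<open>y\<close>.\<close>

lemma climb_cokernel:
  assumes J: "jump_data T A"
  shows "open W \<Longrightarrow> p \<in> W \<Longrightarrow> W \<subseteq> T \<Longrightarrow> v \<in> V \<gamma> W \<Longrightarrow>
    \<exists>W' y u. open W' \<and> p \<in> W' \<and> W' \<subseteq> W \<and> y \<in> carrier (sect N W') \<and> u \<in> V \<beta> W' \<and>
      restr N W W' v = hN W' \<alpha> y \<oplus>\<^bsub>sect N W'\<^esub> u"
proof (induction "card (jumps A \<gamma> \<beta>)" arbitrary: \<gamma> W v rule: less_induct)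
  case less
  note W = less.prems(1-3) and v = less.prems(4)
  note vc = V_mem[OF W(1) v]
  show ?case
  proof (cases "v \<in> V \<beta> W")
    case True
    interpret A: abelian_group "sect N W" by (rule N.abelian_group_sect[OF W(1)])
    have "restr N W W v = hN W \<alpha> \<zero>\<^bsub>sect N W\<^esub> \<oplus>\<^bsub>sect N W\<^esub> v"
      using sN_zero[OF W(1)] N.sc_zero_right[OF W(1)] N.restr_id[OF W(1) vc] vc by (simp del: N_carrier)
    then show ?thesis using W True A.zero_closed by blast
  next
    case False
    obtain c R \<nu> where c: "c \<in> jumps A \<gamma> \<beta>" and R: "open R" "p \<in> R" "R \<subseteq> W"
      and vR: "restr N W R v \<in> V c R" "(hN R c ^^ \<nu>) (restr N W R v) \<in> VG c R"
      by (rule climb_step[OF J W v False])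
    obtain y g where y: "y \<in> carrier (sect N R)" and g: "g \<in> VG c R" and e: "restr N W R v = hN R \<alpha> y \<oplus>\<^bsub>sect N R\<^esub> g"
      using nilpotent_surjective[OF R(1) VG_subset VG_add[OF R(1)] VG_sc[OF R(1)] jump_neq_alpha[OF c]
        V_mem[OF R(1) vR(1)] vR(2)] by blast
    note gc = VG_mem[OF g]
    obtain S \<delta> where S: "open S" "p \<in> S" "S \<subseteq> R" "restr N R S g \<in> V \<delta> S"
      "card (jumps A \<delta> \<beta>) < card (jumps A \<gamma> \<beta>)" by (rule climb_next[OF J c g R(2)])
    have "S \<subseteq> T" using S(3) R(3) W(3) by auto
    from less.hyps[OF S(5,1,2) this S(4)]
    obtain W' y' u where W': "open W'" "p \<in> W'" "W' \<subseteq> S" "y' \<in> carrier (sect N W')" "u \<in> V \<beta> W'"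
      "restr N S W' (restr N R S g) = hN W' \<alpha> y' \<oplus>\<^bsub>sect N W'\<^esub> u" by (elim exE conjE)
    have W'W: "W' \<subseteq> R" "W' \<subseteq> W" using W'(3) S(3) R(3) by auto
    interpret A: abelian_group "sect N W'" by (rule N.abelian_group_sect[OF W'(1)])
    let ?y = "restr N R W' y"
    have yc: "?y \<in> carrier (sect N W')" by (rule N.restr_closed[OF R(1) W'(1) W'W(1) y])
    note hy = hN_mem[OF W'(1) yc, of \<alpha>] and hy' = hN_mem[OF W'(1) W'(4), of \<alpha>] and uc = V_mem[OF W'(1,5)]
    have "restr N W W' v = restr N R W' (restr N W R v)" by (rule N.restr_restr[OF W(1) R(1) W'(1) W'W(1) R(3) vc, symmetric])
    also have "\<dots> = hN W' \<alpha> ?y \<oplus>\<^bsub>sect N W'\<^esub> restr N R W' g"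
      unfolding e N.restr_add[OF R(1) W'(1) W'W(1) hN_mem[OF R(1) y] gc] hN_restr[OF R(1) W'(1) W'W(1) y] by (rule refl)
    also have "restr N R W' g = hN W' \<alpha> y' \<oplus>\<^bsub>sect N W'\<^esub> u"
      using W'(6) N.restr_restr[OF R(1) S(1) W'(1,3) S(3) gc] by simp
    also have "hN W' \<alpha> ?y \<oplus>\<^bsub>sect N W'\<^esub> (hN W' \<alpha> y' \<oplus>\<^bsub>sect N W'\<^esub> u) = hN W' \<alpha> (?y \<oplus>\<^bsub>sect N W'\<^esub> y') \<oplus>\<^bsub>sect N W'\<^esub> u"
      unfolding hN_add[OF W'(1) yc W'(4)] by (rule A.a_assoc[OF hy hy' uc, symmetric])
    finally show ?thesis using W' W'W(2) N.add_mem[OF W'(1) yc W'(4)] by blast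
  qed
qed

lemma obtain_jump_data:
  obtains T A where "open T" "p \<in> T" "jump_data T A"
  using V_jumps[of p] unfolding jump_data_def by blast

text \<open>Exhaustiveness provides an index to start from, and membership in
  \<open>V\<^sup>\<beta>\<close> is local.\<close>

lemma kernel_in_V:
  assumes W: "open W" and w: "w \<in> carrier (sect N W)" and h: "hN W \<alpha> w \<in> V \<beta> W"
  shows "w \<in> V \<beta> W"
proof (rule V_facts(6)[OF W w])
  fix p assume p: "p \<in> W"
  from V_exhaustive[OF W w p] obtain S \<gamma> where S: "open S" "p \<in> S" "S \<subseteq> W" "restr N W S w \<in> V \<gamma> S" by (elim exE conjE)
  obtain T A where T: "open T" "p \<in> T" "jump_data T A" by (rule obtain_jump_data)
  let ?R = "S \<inter> T"
  have R: "open ?R" "?R \<subseteq> S" "?R \<subseteq> T" "?R \<subseteq> W" "p \<in> ?R" using S T by auto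
  have wR: "restr N W ?R w \<in> V \<gamma> ?R"
    using V_facts(5)[OF S(1) R(1,2) S(4)] N.restr_restr[OF W S(1) R(1,2) S(3) w] by simp
  have hR: "hN ?R \<alpha> (restr N W ?R w) \<in> V \<beta> ?R"
    using hN_restr[OF W R(1,4) w, of \<alpha>] V_facts(5)[OF W R(1,4) h] by simp
  from climb_kernel[OF T(3) R(1,5,3) wR hR]
  obtain W' where W': "open W'" "p \<in> W'" "W' \<subseteq> ?R" "restr N ?R W' (restr N W ?R w) \<in> V \<beta> W'" by (elim exE conjE)
  have "restr N ?R W' (restr N W ?R w) = restr N W W' w" by (rule N.restr_restr[OF W R(1) W'(1,3) R(4) w])
  then show "\<exists>T. open T \<and> p \<in> T \<and> T \<subseteq> W \<and> restr N W T w \<in> V \<beta> T"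
    using W' R(4) by (intro exI[of _ W']) auto
qed

text \<open>Membership is local. Near a point of the graph \<open>W\<close> and \<open>T\<close>
  coincide; the graph being closed, any other point has a neighbourhood that does not meet it, where
  all sections vanish.\<close>

lemma same_trace_in_V:
  assumes W: "open W" "open T" "T \<subseteq> W" "pre T = pre W" and u: "u \<in> V \<gamma> T"
  shows "u \<in> V \<gamma> W"
proof (rule V_facts(6)[OF W(1)])
  have uT: "u \<in> carrier (sect N T)" by (rule V_mem[OF W(2) u])
  then show uW: "u \<in> carrier (sect N W)" using W by simp
  fix p assume p: "p \<in> W"
  show "\<exists>T. open T \<and> p \<in> T \<and> T \<subseteq> W \<and> restr N W T u \<in> V \<gamma> T"
  proof (cases "snd p = f (fst p)")
    case True
    then have "fst p \<in> pre W" using p by (cases p) (simp add: graph_pre_def)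
    then have "fst p \<in> pre T" using W(4) by simp
    then have "p \<in> T" using True by (cases p) (simp add: graph_pre_def)
    then show ?thesis using W u N_restr_same_trace[OF W uW] by (intro exI[of _ T]) simp
  next
    case False
    define O' where "O' = W \<inter> {q. snd q \<noteq> f (fst q)}"
    have "continuous_on UNIV (\<lambda>q::'a \<times> complex. snd q - f (fst q))"
      by (intro continuous_intros continuous_on_compose2[OF f_continuous]) auto
    then have "open ((\<lambda>q::'a \<times> complex. snd q - f (fst q)) -` (- {0}))" by (intro open_vimage) auto
    moreover have "{q::'a \<times> complex. snd q \<noteq> f (fst q)} = (\<lambda>q. snd q - f (fst q)) -` (- {0})" by auto
    ultimately have O: "open O'" "O' \<subseteq> W" "p \<in> O'" using W(1) p False by (auto simp: O'_def)
    have "pre O' = {}" by (auto simp: O'_def graph_pre_def)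
    then have "restr N W O' u = \<zero>\<^bsub>sect N O'\<^esub>"
      by (rule N_empty[OF O(1) _ N.restr_closed[OF W(1) O(1,2) uW]])
    then show ?thesis using O V_facts(2)[OF O(1)] by (intro exI[of _ O']) simp
  qed
qed

text \<open>Climbing gives the decomposition on a neighbourhood of \<open>(x, f x)\<close>, whereas
  sections over \<open>X\<close> are sections over cylinders. The neighbourhood and the cylinder
  over its trace on the graph carry the same sections, also of
  \<open>V\<^sup>\<beta>\<close>.\<close>

lemma cokernel_from_V:
  assumes U: "open U" and u: "u \<in> carrier (sect N (cyl U))" and x: "x \<in> U"
  shows "\<exists>S y v. open S \<and> x \<in> S \<and> S \<subseteq> U \<and> y \<in> carrier (sect N (cyl S)) \<and> v \<in> V \<beta> (cyl S) \<and>
    rN U S u = hN (cyl S) \<alpha> y \<oplus>\<^bsub>sect N (cyl S)\<^esub> v"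
proof -
  let ?p = "(x, f x)"
  have p: "?p \<in> cyl U" using x by simp
  from V_exhaustive[OF open_cyl[OF U] u p] obtain S \<gamma> where S: "open S" "?p \<in> S" "S \<subseteq> cyl U" "restr N (cyl U) S u \<in> V \<gamma> S"
    by (elim exE conjE)
  obtain T A where T: "open T" "?p \<in> T" "jump_data T A" by (rule obtain_jump_data)
  let ?R = "S \<inter> T"
  have R: "open ?R" "?R \<subseteq> S" "?R \<subseteq> T" "?R \<subseteq> cyl U" "?p \<in> ?R" using S T by auto
  have uR: "restr N (cyl U) ?R u \<in> V \<gamma> ?R"
    using V_facts(5)[OF S(1) R(1,2) S(4)] N.restr_restr[OF open_cyl[OF U] S(1) R(1,2) S(3) u] by simp
  from climb_cokernel[OF T(3) R(1,5,3) uR]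
  obtain W' y v where W': "open W'" "?p \<in> W'" "W' \<subseteq> ?R" "y \<in> carrier (sect N W')" "v \<in> V \<beta> W'"
    "restr N ?R W' (restr N (cyl U) ?R u) = hN W' \<alpha> y \<oplus>\<^bsub>sect N W'\<^esub> v" by (elim exE conjE)
  have W'U: "W' \<subseteq> cyl U" using W'(3) R(4) by blast
  have e: "restr N (cyl U) W' u = hN W' \<alpha> y \<oplus>\<^bsub>sect N W'\<^esub> v"
    using W'(6) N.restr_restr[OF open_cyl[OF U] R(1) W'(1,3) R(4) u] by simp
  define G where "G = pre W'"
  have "open G" unfolding G_def by (rule open_pre[OF W'(1)])
  moreover have "x \<in> G" "G \<subseteq> U" using W'(2) W'U by (auto simp: G_def graph_pre_def)
  ultimately have G: "open G" "x \<in> G" "G \<subseteq> U" .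
  (* Contained in both the neighbourhood and the cylinder, with the same trace on the graph as
     either. *)
  let ?Z = "W' \<inter> cyl G"
  have Z: "open ?Z" "?Z \<subseteq> W'" "?Z \<subseteq> cyl G" using W'(1) open_cyl[OF G(1)] by auto
  have pZ: "pre ?Z = pre (cyl G)" by (auto simp: G_def graph_pre_def)
  have pZ': "pre ?Z = G" using pZ by simp
  let ?y = "restr N W' ?Z y" and ?v = "restr N W' ?Z v"
  have yZ: "?y \<in> carrier (sect N ?Z)" by (rule N.restr_closed[OF W'(1) Z(1,2) W'(4)])
  have vZ: "?v \<in> V \<beta> ?Z" by (rule V_facts(5)[OF W'(1) Z(1,2) W'(5)])
  have yG: "?y \<in> carrier (sect N (cyl G))" using yZ pZ' Z(1) G(1) by simp
  have vG: "?v \<in> V \<beta> (cyl G)" by (rule same_trace_in_V[OF open_cyl[OF G(1)] Z(1,3) pZ vZ])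
  note vGc = V_mem[OF open_cyl[OF G(1)] vG]
  note tr = N_restr_same_trace[OF open_cyl[OF G(1)] Z(1,3) pZ]
  have uG: "rN U G u \<in> carrier (sect N (cyl G))" by (rule rN_mem[OF U G(1,3) u])
  have hG: "hN (cyl G) \<alpha> ?y \<oplus>\<^bsub>sect N (cyl G)\<^esub> ?v \<in> carrier (sect N (cyl G))"
    by (intro N.add_mem open_cyl G(1) hN_mem[OF open_cyl[OF G(1)] yG] vGc)
  have "rN U G u = restr N (cyl G) ?Z (rN U G u)" by (rule tr[OF uG, symmetric])
  also have "\<dots> = restr N (cyl U) ?Z u"
    by (rule N.restr_restr[OF open_cyl[OF U] open_cyl[OF G(1)] Z(1,3) cyl_mono[OF G(3)] u])
  also have "\<dots> = restr N W' ?Z (restr N (cyl U) W' u)"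
    by (rule N.restr_restr[OF open_cyl[OF U] W'(1) Z(1,2) W'U u, symmetric])
  also have "\<dots> = hN ?Z \<alpha> ?y \<oplus>\<^bsub>sect N ?Z\<^esub> ?v"
    unfolding e N.restr_add[OF W'(1) Z(1,2) hN_mem[OF W'(1,4)] V_mem[OF W'(1,5)]] hN_restr[OF W'(1) Z(1,2) W'(4)] by (rule refl)
  also have "\<dots> = restr N (cyl G) ?Z (hN (cyl G) \<alpha> ?y \<oplus>\<^bsub>sect N (cyl G)\<^esub> ?v)"
    unfolding N.restr_add[OF open_cyl[OF G(1)] Z(1,3) hN_mem[OF open_cyl[OF G(1)] yG] vGc]
      hN_restr[OF open_cyl[OF G(1)] Z(1,3) yG] tr[OF yG] tr[OF vGc] by (rule refl)
  also have "\<dots> = hN (cyl G) \<alpha> ?y \<oplus>\<^bsub>sect N (cyl G)\<^esub> ?v" by (rule tr[OF hG])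
  finally show ?thesis using G yG vG by blast
qed

end


section \<open>The exact sequence\<close>

context km_setting
begin

abbreviation EV :: "('a, nat \<Rightarrow> 'm) smsheaf" where "EV \<equiv> V_on_X X N V \<beta>"

lemma EV_simps [simp]:
  "carrier (sect EV U) = V \<beta> (cyl U)" "zero (sect EV U) = \<zero>\<^bsub>sect N (cyl U)\<^esub>"
  "add (sect EV U) = add (sect N (cyl U))"
  "smult (sect EV U) = (\<lambda>P u. lift_op X U P \<odot>\<^bsub>sect N (cyl U)\<^esub> u)"
  "restr EV U U' = restr N (cyl U) (cyl U')" "s_act EV U = sN (cyl U)"
  by (simp_all add: V_on_X_def)

lemma V_minus:
  assumes "open W" "u \<in> V \<gamma> W"
  shows "\<ominus>\<^bsub>sect N W\<^esub> u \<in> V \<gamma> W"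
  unfolding N.minus_eq_sc[OF assms(1) V_mem[OF assms]] by (rule V_sc[OF assms])

lemma EV_left_module:
  assumes U: "open U"
  shows "left_module (D_ring X U) (sect EV U)"
proof -
  interpret A: abelian_group "sect N (cyl U)" by (rule N.abelian_group_sect[OF open_cyl[OF U]])
  interpret R: ring "D_ring X U" using M.left_module_sect[OF U] by (simp add: left_module_def)
  note c = V_mem[OF open_cyl[OF U]]
  have "abelian_group (sect EV U)"
  proof (rule abelian_groupI)
    fix x assume x: "x \<in> carrier (sect EV U)"
    then have x': "x \<in> V \<beta> (cyl U)" by simp
    show "\<exists>y\<in>carrier (sect EV U). y \<oplus>\<^bsub>sect EV U\<^esub> x = \<zero>\<^bsub>sect EV U\<^esub>"
      using V_minus[OF open_cyl[OF U] x'] A.l_neg[OF c[OF x']] by auto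
    show "\<zero>\<^bsub>sect EV U\<^esub> \<oplus>\<^bsub>sect EV U\<^esub> x = x" using A.l_zero[OF c[OF x']] by simp
    fix y assume "y \<in> carrier (sect EV U)"
    then have y': "y \<in> V \<beta> (cyl U)" by simp
    show "x \<oplus>\<^bsub>sect EV U\<^esub> y \<in> carrier (sect EV U)" using V_facts(3)[OF open_cyl[OF U] x' y'] by simp
    show "x \<oplus>\<^bsub>sect EV U\<^esub> y = y \<oplus>\<^bsub>sect EV U\<^esub> x" using A.a_comm[OF c[OF x'] c[OF y']] by simp
    fix z assume "z \<in> carrier (sect EV U)"
    then have z': "z \<in> V \<beta> (cyl U)" by simp
    show "x \<oplus>\<^bsub>sect EV U\<^esub> y \<oplus>\<^bsub>sect EV U\<^esub> z = x \<oplus>\<^bsub>sect EV U\<^esub> (y \<oplus>\<^bsub>sect EV U\<^esub> z)"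
      using A.a_assoc[OF c[OF x'] c[OF y'] c[OF z']] by simp
  next
    show "\<zero>\<^bsub>sect EV U\<^esub> \<in> carrier (sect EV U)" using V_facts(2)[OF open_cyl[OF U]] by simp
  qed
  moreover have "left_module_axioms (D_ring X U) (sect EV U)"
  proof
    fix P x assume "P \<in> carrier (D_ring X U)" "x \<in> carrier (sect EV U)"
    then have P: "P \<in> D_sec X U" and x: "x \<in> V \<beta> (cyl U)" by simp_all
    show "P \<odot>\<^bsub>sect EV U\<^esub> x \<in> carrier (sect EV U)" using V_lift[OF U P x] by simp
    fix Q assume "Q \<in> carrier (D_ring X U)"
    then have Q: "Q \<in> D_sec X U" by simp
    show "(P \<oplus>\<^bsub>D_ring X U\<^esub> Q) \<odot>\<^bsub>sect EV U\<^esub> x = P \<odot>\<^bsub>sect EV U\<^esub> x \<oplus>\<^bsub>sect EV U\<^esub> Q \<odot>\<^bsub>sect EV U\<^esub> x"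
      using N.op_add_smult[OF open_cyl[OF U] lift_mem[OF U P] lift_mem[OF U Q] c[OF x]] by (simp add: lift_op_add)
    show "(P \<otimes>\<^bsub>D_ring X U\<^esub> Q) \<odot>\<^bsub>sect EV U\<^esub> x = P \<odot>\<^bsub>sect EV U\<^esub> (Q \<odot>\<^bsub>sect EV U\<^esub> x)"
      using N.op_comp_smult[OF open_cyl[OF U] lift_mem[OF U P] lift_mem[OF U Q] c[OF x]]
        lift_op_comp[OF X D_sec_end_sec[OF lift_mem[OF U P]] D_sec_end_sec[OF lift_mem[OF U Q]]] by simp
  next
    fix P x y assume "P \<in> carrier (D_ring X U)" "x \<in> carrier (sect EV U)" "y \<in> carrier (sect EV U)"
    then have P: "P \<in> D_sec X U" and x: "x \<in> V \<beta> (cyl U)" and y: "y \<in> V \<beta> (cyl U)" by simp_all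
    show "P \<odot>\<^bsub>sect EV U\<^esub> (x \<oplus>\<^bsub>sect EV U\<^esub> y) = P \<odot>\<^bsub>sect EV U\<^esub> x \<oplus>\<^bsub>sect EV U\<^esub> P \<odot>\<^bsub>sect EV U\<^esub> y"
      using N.smult_add[OF open_cyl[OF U] lift_mem[OF U P] c[OF x] c[OF y]] by simp
  next
    fix x assume "x \<in> carrier (sect EV U)"
    then have x: "x \<in> V \<beta> (cyl U)" by simp
    show "\<one>\<^bsub>D_ring X U\<^esub> \<odot>\<^bsub>sect EV U\<^esub> x = x"
      using N.op_id_smult[OF open_cyl[OF U] c[OF x]] lift_op_scal[OF X, of U 1] by (simp add: scal_one)
  qed
  ultimately show ?thesis using R.ring_axioms by (intro left_module.intro)
qed

text \<open>Gluing takes place in the direct image; membership of the result in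
  \<open>V\<^sup>\<beta>\<close> is local. A point of the product is covered by the cylinder over a
  neighbourhood of its first component.\<close>

lemma EV_glue:
  assumes o: "\<And>S. S \<in> \<U> \<Longrightarrow> open S" and s: "\<And>S. S \<in> \<U> \<Longrightarrow> \<sigma> S \<in> carrier (sect EV S)"
    and c: "\<And>S S'. S \<in> \<U> \<Longrightarrow> S' \<in> \<U> \<Longrightarrow> restr EV S (S \<inter> S') (\<sigma> S) = restr EV S' (S \<inter> S') (\<sigma> S')"
  shows "\<exists>m\<in>carrier (sect EV (\<Union>\<U>)). \<forall>S\<in>\<U>. restr EV (\<Union>\<U>) S m = \<sigma> S"
proof -
  have oU: "open (\<Union>\<U>)" using o by blast
  have s': "\<sigma> S \<in> V \<beta> (cyl S)" if "S \<in> \<U>" for S using s[OF that] by simp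
  have c': "restr N (cyl S) (cyl S \<inter> cyl S') (\<sigma> S) = restr N (cyl S') (cyl S \<inter> cyl S') (\<sigma> S')"
    if "S \<in> \<U>" "S' \<in> \<U>" for S S' using c[OF that] by (simp add: cyl_Int)
  have un: "cyl (\<Union>\<U>) = (\<Union>S\<in>\<U>. cyl S)" by auto
  have o': "open (cyl S)" if "S \<in> \<U>" for S by (rule open_cyl[OF o[OF that]])
  have sc: "\<sigma> S \<in> carrier (sect N (cyl S))" if "S \<in> \<U>" for S by (rule V_mem[OF o'[OF that] s'[OF that]])
  obtain m where m: "m \<in> carrier (sect N (cyl (\<Union>\<U>)))" "\<And>S. S \<in> \<U> \<Longrightarrow> restr N (cyl (\<Union>\<U>)) (cyl S) m = \<sigma> S"
    using N.section_glue[of \<U> cyl \<sigma> "cyl (\<Union>\<U>)", OF o' sc c' un] by blast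
  have "m \<in> V \<beta> (cyl (\<Union>\<U>))"
  proof (rule V_facts(6)[OF open_cyl[OF oU] m(1)])
    fix p :: "'a \<times> complex" assume "p \<in> cyl (\<Union>\<U>)"
    then obtain S where S: "S \<in> \<U>" "p \<in> cyl S" by auto
    then show "\<exists>T. open T \<and> p \<in> T \<and> T \<subseteq> cyl (\<Union>\<U>) \<and> restr N (cyl (\<Union>\<U>)) T m \<in> V \<beta> T"
      using m(2)[OF S(1)] s'[OF S(1)] o'[OF S(1)] by (intro exI[of _ "cyl S"]) auto
  qed
  then show ?thesis using m(2) by auto
qed

lemma EV_module_sheaf: "module_sheaf (D_ring X) EV"
proof (rule module_sheafI)
  show "left_module (D_ring X U) (sect EV U)" if "open U" for U by (rule EV_left_module[OF that])
  fix U S :: "'a set" and m assume o: "open U" "open S" "S \<subseteq> U" and "m \<in> carrier (sect EV U)"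
  then have m: "m \<in> V \<beta> (cyl U)" by simp
  note c = V_mem[OF open_cyl[OF o(1)]]
  note oc = open_cyl[OF o(1)] open_cyl[OF o(2)] cyl_mono[OF o(3)]
  show "restr EV U S m \<in> carrier (sect EV S)" using V_facts(5)[OF oc m] by simp
  show "restr EV U S (m \<oplus>\<^bsub>sect EV U\<^esub> m') = restr EV U S m \<oplus>\<^bsub>sect EV S\<^esub> restr EV U S m'"
    if "m' \<in> carrier (sect EV U)" for m'
    using N.restr_add[OF oc c[OF m] c, of m'] that by simp
  show "restr EV U S (P \<odot>\<^bsub>sect EV U\<^esub> m) = op_res S P \<odot>\<^bsub>sect EV S\<^esub> restr EV U S m"
    if "P \<in> carrier (D_ring X U)" for P
    using rN_lift[OF o(1-3) _ c[OF m], of P] that by simp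
next
  fix U m assume U: "open U" and "m \<in> carrier (sect EV U)"
  then show "restr EV U U m = m" using N.restr_id[OF open_cyl[OF U] V_mem[OF open_cyl[OF U]]] by simp
next
  fix U S W :: "'a set" and m assume o: "open U" "open S" "open W" "W \<subseteq> S" "S \<subseteq> U" and "m \<in> carrier (sect EV U)"
  then show "restr EV S W (restr EV U S m) = restr EV U W m" using rN_rN[OF o V_mem[OF open_cyl[OF o(1)]]] by simp
next
  fix U m m' assume U: "open U" and m: "m \<in> carrier (sect EV U)" "m' \<in> carrier (sect EV U)"
    and loc: "\<And>x. x \<in> U \<Longrightarrow> \<exists>V. open V \<and> x \<in> V \<and> V \<subseteq> U \<and> restr EV U V m = restr EV U V m'"
  show "m = m'"
  proof (rule N_cyl_eqI[OF U])
    show "m \<in> carrier (sect N (cyl U))" "m' \<in> carrier (sect N (cyl U))"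
      using m by (simp_all add: V_mem[OF open_cyl[OF U]] del: N_carrier N_cyl_carrier)
    show "\<exists>V. open V \<and> x \<in> V \<and> V \<subseteq> U \<and> rN U V m = rN U V m'" if "x \<in> U" for x
      using loc[OF that] by simp
  qed
next
  fix \<U> \<sigma>
  assume "\<And>V. V \<in> \<U> \<Longrightarrow> open V" "\<And>V. V \<in> \<U> \<Longrightarrow> \<sigma> V \<in> carrier (sect EV V)"
    "\<And>V W. V \<in> \<U> \<Longrightarrow> W \<in> \<U> \<Longrightarrow> restr EV V (V \<inter> W) (\<sigma> V) = restr EV W (V \<inter> W) (\<sigma> W)"
  then show "\<exists>m\<in>carrier (sect EV (\<Union>\<U>)). \<forall>V\<in>\<U>. restr EV (\<Union>\<U>) V m = \<sigma> V" by (rule EV_glue)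
qed

lemma EV_s_hom: "sheaf_hom (D_ring X) EV EV (s_act EV)"
  unfolding sheaf_hom_def
proof (intro allI impI conjI ballI)
  fix U :: "'a set" and m assume U: "open U" and "m \<in> carrier (sect EV U)"
  then have m: "m \<in> V \<beta> (cyl U)" by simp
  note oU = open_cyl[OF U] and c = V_mem[OF open_cyl[OF U]]
  show "s_act EV U m \<in> carrier (sect EV U)" using V_sN[OF oU m] by simp
  show "s_act EV U (m \<oplus>\<^bsub>sect EV U\<^esub> m') = s_act EV U m \<oplus>\<^bsub>sect EV U\<^esub> s_act EV U m'" if "m' \<in> carrier (sect EV U)" for m'
    using sN_add[OF oU c[OF m] c, of m'] that by simp
  show "s_act EV U (P \<odot>\<^bsub>sect EV U\<^esub> m) = P \<odot>\<^bsub>sect EV U\<^esub> s_act EV U m" if "P \<in> carrier (D_ring X U)" for P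
    using sN_lift[OF U _ c[OF m], of P] that by simp
  show "s_act EV S (restr EV U S m) = restr EV U S (s_act EV U m)" if "open S \<and> S \<subseteq> U" for S
    using sN_restr[OF oU open_cyl cyl_mono c[OF m], of S] that by simp
qed

lemma EV_Ds: "Ds_module_sheaf X EV"
  using EV_module_sheaf EV_s_hom by (simp add: Ds_module_sheaf_def)

abbreviation hE :: "'a set \<Rightarrow> (nat \<Rightarrow> 'm) \<Rightarrow> nat \<Rightarrow> 'm" where
  "hE \<equiv> s_plus X \<alpha> EV"

lemma hE_eq: "hE U u = hN (cyl U) \<alpha> u"
proof -
  have "lift_op X U (mul_op X U (fres U (\<lambda>x. \<alpha>))) = scal (times_C X) (cyl U) \<alpha>"
    using lift_op_scal[OF X, of U \<alpha>] by (simp add: scal_def)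
  then show ?thesis by (simp add: s_plus_def N.sc_def)
qed

lemma hE_hom: "Ds_hom X EV EV hE"
  unfolding Ds_hom_def sheaf_hom_def
proof (intro allI impI conjI ballI)
  fix U :: "'a set" and m assume U: "open U" and "m \<in> carrier (sect EV U)"
  then have m: "m \<in> V \<beta> (cyl U)" by simp
  note oU = open_cyl[OF U] and c = V_mem[OF open_cyl[OF U]]
  show "hE U m \<in> carrier (sect EV U)" using V_hN[OF oU m, of \<alpha>] unfolding hE_eq by simp
  show "hE U (m \<oplus>\<^bsub>sect EV U\<^esub> m') = hE U m \<oplus>\<^bsub>sect EV U\<^esub> hE U m'" if "m' \<in> carrier (sect EV U)" for m'
    using that hN_add[OF oU c[OF m], of m' \<alpha>] c[of m'] unfolding hE_eq by (simp del: N_carrier N_cyl_carrier)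
  show "hE U (P \<odot>\<^bsub>sect EV U\<^esub> m) = P \<odot>\<^bsub>sect EV U\<^esub> hE U m" if "P \<in> carrier (D_ring X U)" for P
  proof -
    have P: "P \<in> D_sec X U" using that by simp
    show ?thesis unfolding hE_eq EV_simps sN_lift[OF U P c[OF m]] N.smult_sc[OF oU lift_mem[OF U P] c[OF m], symmetric]
      by (rule N.smult_add[OF oU lift_mem[OF U P] sN_mem[OF oU c[OF m]] N.sc_mem[OF oU c[OF m]], symmetric])
  qed
  show "hE S (restr EV U S m) = restr EV U S (hE U m)" if "open S \<and> S \<subseteq> U" for S
    using hN_restr[OF oU open_cyl cyl_mono c[OF m], of S \<alpha>] that unfolding hE_eq by simp
  show "hE U (s_act EV U m) = s_act EV U (hE U m)"
    using hN_sN[OF oU c[OF m], of \<alpha>] unfolding hE_eq by simp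
qed

sublocale Q: normal_form_quotient X L "hL \<alpha>" "\<lambda>U. deg_lt U 1"
  by (rule normal_form)

definition \<Psi> :: "'a set \<Rightarrow> (nat \<Rightarrow> 'm) \<Rightarrow> nat \<Rightarrow> 'm" where
  "\<Psi> U = inv_into (carrier (sect L U)) (\<Phi> U)"

context
  fixes U :: "'a set" assumes U: "open U"
begin

lemma inv_ident_mem: "u \<in> carrier (sect N (cyl U)) \<Longrightarrow> \<Psi> U u \<in> seq_sec M U"
  unfolding \<Psi>_def using ident_bij[OF U] inv_into_into[of u "\<Phi> U" "seq_sec M U"] U
  by (simp add: bij_betw_def del: N_carrier N_cyl_carrier)

lemma ident_inv: "u \<in> carrier (sect N (cyl U)) \<Longrightarrow> \<Phi> U (\<Psi> U u) = u"
  unfolding \<Psi>_def using ident_bij[OF U] f_inv_into_f[of u "\<Phi> U" "seq_sec M U"] U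
  by (simp add: bij_betw_def del: N_carrier N_cyl_carrier)

lemma inv_identI: "m \<in> seq_sec M U \<Longrightarrow> \<Phi> U m = u \<Longrightarrow> \<Psi> U u = m"
  unfolding \<Psi>_def L_carrier[OF U] using inv_into_f_f[OF ident_inj[OF U], of m] by blast

lemma inv_ident_add: "u \<in> carrier (sect N (cyl U)) \<Longrightarrow> v \<in> carrier (sect N (cyl U)) \<Longrightarrow>
    \<Psi> U (u \<oplus>\<^bsub>sect N (cyl U)\<^esub> v) = \<Psi> U u \<oplus>\<^bsub>sect L U\<^esub> \<Psi> U v"
  by (rule inv_identI) (simp_all add: ident_add[OF U] inv_ident_mem ident_inv seq_sec_add[OF U] del: N_carrier N_cyl_carrier)

lemma inv_ident_smult: "P \<in> D_sec X U \<Longrightarrow> u \<in> carrier (sect N (cyl U)) \<Longrightarrow>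
    \<Psi> U (lift_op X U P \<odot>\<^bsub>sect N (cyl U)\<^esub> u) = P \<odot>\<^bsub>sect L U\<^esub> \<Psi> U u"
  by (rule inv_identI) (simp_all add: ident_smult[OF U] inv_ident_mem ident_inv seq_sec_smult[OF U] del: N_carrier N_cyl_carrier)

lemma inv_ident_s: "u \<in> carrier (sect N (cyl U)) \<Longrightarrow> \<Psi> U (sN (cyl U) u) = s_act L U (\<Psi> U u)"
  by (rule inv_identI)
    (simp_all add: L_facts(5)[OF U] ident_shift[OF U] inv_ident_mem ident_inv seq_sec_shift[OF U] del: N_carrier N_cyl_carrier)

lemma inv_ident_hN: "u \<in> carrier (sect N (cyl U)) \<Longrightarrow> \<Psi> U (hN (cyl U) c u) = hL c U (\<Psi> U u)"
  by (rule inv_identI) (simp_all add: ident_hL[OF U] inv_ident_mem ident_inv hL_mem[OF U] del: N_carrier N_cyl_carrier)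

lemma inv_ident_restr: "open S \<Longrightarrow> S \<subseteq> U \<Longrightarrow> u \<in> carrier (sect N (cyl U)) \<Longrightarrow>
    restr L U S (\<Psi> U u) = \<Psi> S (rN U S u)"
proof -
  assume S: "open S" "S \<subseteq> U" and u: "u \<in> carrier (sect N (cyl U))"
  note m = inv_ident_mem[OF u]
  have e: "restr L U S (\<Psi> U u) = rs U S (\<Psi> U u)" by (rule rs_eq_restr_L[OF U S m])
  have "\<Phi> S (rs U S (\<Psi> U u)) = rN U S u" using ident_restr[OF U m S] ident_inv[OF u] by simp
  then have "\<Psi> S (rN U S u) = rs U S (\<Psi> U u)"
    unfolding \<Psi>_def[of S] using inv_into_f_f[OF ident_inj[OF S(1)] rs_mem[OF U S m]] S by simp
  then show ?thesis using e by simp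
qed

text \<open>Inherited from \<open>M[s] f\<^sup>s\<close>, where \<open>s\<close> shifts
  coefficients.\<close>

lemma hN_injective: "inj_on (hN (cyl U) \<alpha>) (carrier (sect N (cyl U)))"
proof (rule inj_onI)
  fix u v assume u: "u \<in> carrier (sect N (cyl U))" and v: "v \<in> carrier (sect N (cyl U))"
    and e: "hN (cyl U) \<alpha> u = hN (cyl U) \<alpha> v"
  have "hL \<alpha> U (\<Psi> U u) = hL \<alpha> U (\<Psi> U v)"
    unfolding inv_ident_hN[OF u, symmetric] inv_ident_hN[OF v, symmetric] e by (rule refl)
  then have "\<Psi> U u = \<Psi> U v"
    using inj_onD[OF Q.h_inj[OF U]] inv_ident_mem[OF u] inv_ident_mem[OF v] U by simp
  from arg_cong[OF this, of "\<Phi> U"] show "u = v" unfolding ident_inv[OF u] ident_inv[OF v] .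
qed

end

lemma ev_eq: "ev X M L N \<alpha> U u = Q.cl U (\<Psi> U u)"
  by (simp add: ev_def Q.cl_def Q.im_def \<Psi>_def)

lemma Mf_eq: "Mf_power X L \<alpha> = Q.Q"
  by (simp add: Mf_power_def)

lemma ev_hom: "Ds_hom X EV Q.Q (ev X M L N \<alpha>)"
  unfolding Ds_hom_def sheaf_hom_def
proof (intro allI impI conjI ballI)
  fix U :: "'a set" and m assume U: "open U" and "m \<in> carrier (sect EV U)"
  then have m: "m \<in> V \<beta> (cyl U)" by simp
  note oU = open_cyl[OF U] and c = V_mem[OF open_cyl[OF U]]
  have i: "\<Psi> U u \<in> carrier (sect L U)" if "u \<in> V \<beta> (cyl U)" for u using inv_ident_mem[OF U c[OF that]] U by simp
  show "ev X M L N \<alpha> U m \<in> carrier (sect Q.Q U)" unfolding ev_eq Q.Q_carrier using i[OF m] by blast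
  show "ev X M L N \<alpha> U (m \<oplus>\<^bsub>sect EV U\<^esub> m') = ev X M L N \<alpha> U m \<oplus>\<^bsub>sect Q.Q U\<^esub> ev X M L N \<alpha> U m'"
    if "m' \<in> carrier (sect EV U)" for m'
  proof -
    have m': "m' \<in> V \<beta> (cyl U)" using that by simp
    show ?thesis unfolding ev_eq Q.Q_add[OF U i[OF m] i[OF m']] EV_simps inv_ident_add[OF U c[OF m] c[OF m']] by (rule refl)
  qed
  show "ev X M L N \<alpha> U (P \<odot>\<^bsub>sect EV U\<^esub> m) = P \<odot>\<^bsub>sect Q.Q U\<^esub> ev X M L N \<alpha> U m" if "P \<in> carrier (D_ring X U)" for P
  proof -
    have P: "P \<in> D_sec X U" using that by simp
    show ?thesis unfolding ev_eq Q.Q_smult[OF U P i[OF m]] EV_simps inv_ident_smult[OF U P c[OF m]] by (rule refl)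
  qed
  show "ev X M L N \<alpha> S (restr EV U S m) = restr Q.Q U S (ev X M L N \<alpha> U m)" if "open S \<and> S \<subseteq> U" for S
  proof -
    have S: "open S" "S \<subseteq> U" using that by auto
    show ?thesis unfolding ev_eq Q.Q_restr[OF U S i[OF m]] inv_ident_restr[OF U S c[OF m]] EV_simps by (rule refl)
  qed
  show "ev X M L N \<alpha> U (s_act EV U m) = s_act Q.Q U (ev X M L N \<alpha> U m)"
    unfolding ev_eq Q.Q_s[OF U i[OF m]] EV_simps inv_ident_s[OF U c[OF m]] by (rule refl)
qed

text \<open>The quotient map kills exactly the \<open>(s + \<alpha>) w\<close> with \<open>w\<close>
  in the whole direct image, and \<open>kernel_in_V\<close> places \<open>w\<close> in
  \<open>V\<^sup>\<beta>\<close>. So the kernel is the image of \<open>s + \<alpha>\<close> on the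
  sections over \<open>U\<close>, even before sheafification.\<close>

lemma ev_zero_iff:
  assumes U: "open U" and u: "u \<in> V \<beta> (cyl U)"
  shows "ev X M L N \<alpha> U u = \<zero>\<^bsub>sect Q.Q U\<^esub> \<longleftrightarrow> (\<exists>w\<in>V \<beta> (cyl U). u = hE U w)"
proof -
  interpret A: abelian_group "sect L U" by (rule L.abelian_group_sect[OF U])
  note uc = V_mem[OF open_cyl[OF U] u]
  have m: "\<Psi> U u \<in> carrier (sect L U)" using inv_ident_mem[OF U uc] U by simp
  have "ev X M L N \<alpha> U u = \<zero>\<^bsub>sect Q.Q U\<^esub> \<longleftrightarrow> (\<exists>w\<in>carrier (sect L U). \<Psi> U u = hL \<alpha> U w)"
    unfolding ev_eq Q.Q_zero[OF U] Q.cl_eq_iff[OF U m A.zero_closed]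
    using Q.h_mem[OF U] by (intro bex_cong refl) (simp del: L_carrier)
  also have "\<dots> \<longleftrightarrow> (\<exists>w\<in>V \<beta> (cyl U). u = hE U w)"
  proof
    assume "\<exists>w\<in>carrier (sect L U). \<Psi> U u = hL \<alpha> U w"
    then obtain w where w: "w \<in> seq_sec M U" "\<Psi> U u = hL \<alpha> U w" using U by auto
    have e: "u = hN (cyl U) \<alpha> (\<Phi> U w)" using ident_hL[OF U w(1), of \<alpha>] ident_inv[OF U uc] w(2) by simp
    have "\<Phi> U w \<in> V \<beta> (cyl U)"
      by (rule kernel_in_V[OF open_cyl[OF U] ident_mem[OF U w(1)]]) (use u e in simp)
    then show "\<exists>w\<in>V \<beta> (cyl U). u = hE U w" using e unfolding hE_eq by blast
  next
    assume "\<exists>w\<in>V \<beta> (cyl U). u = hE U w"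
    then obtain w where w: "w \<in> V \<beta> (cyl U)" "u = hN (cyl U) \<alpha> w" unfolding hE_eq by blast
    note wc = V_mem[OF open_cyl[OF U] w(1)]
    show "\<exists>w\<in>carrier (sect L U). \<Psi> U u = hL \<alpha> U w"
      using inv_ident_hN[OF U wc, of \<alpha>] inv_ident_mem[OF U wc] w(2) U by (intro bexI[of _ "\<Psi> U w"]) simp_all
  qed
  finally show ?thesis .
qed

text \<open>The quotient is separated, so a section killed locally is killed.\<close>

lemma hE_local_image:
  assumes U: "open U" and u: "u \<in> V \<beta> (cyl U)"
    and loc: "\<And>x. x \<in> U \<Longrightarrow> \<exists>S. open S \<and> x \<in> S \<and> S \<subseteq> U \<and> rN U S u \<in> hE S ` V \<beta> (cyl S)"
  shows "ev X M L N \<alpha> U u = \<zero>\<^bsub>sect Q.Q U\<^esub>"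
proof (rule Q.Q_separated[OF U])
  have hom: "sheaf_hom (D_ring X) EV Q.Q (ev X M L N \<alpha>)" using ev_hom by (simp add: Ds_hom_def)
  show "ev X M L N \<alpha> U u \<in> carrier (sect Q.Q U)" using hom U u by (simp add: sheaf_hom_def)
  show z: "\<zero>\<^bsub>sect Q.Q U\<^esub> \<in> carrier (sect Q.Q U)"
    unfolding Q.Q_zero[OF U] Q.Q_carrier using L.zero_mem[OF U] by blast
  fix x assume "x \<in> U"
  from loc[OF this] obtain S where S: "open S" "x \<in> S" "S \<subseteq> U" "rN U S u \<in> hE S ` V \<beta> (cyl S)" by (elim exE conjE)
  have r: "rN U S u \<in> V \<beta> (cyl S)" by (rule V_facts(5)[OF open_cyl[OF U] open_cyl[OF S(1)] cyl_mono[OF S(3)] u])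
  have "restr Q.Q U S (ev X M L N \<alpha> U u) = ev X M L N \<alpha> S (rN U S u)"
    using hom U S u by (simp add: sheaf_hom_def)
  also have "\<dots> = \<zero>\<^bsub>sect Q.Q S\<^esub>" using ev_zero_iff[OF S(1) r] S(4) by blast
  also have "\<dots> = restr Q.Q U S \<zero>\<^bsub>sect Q.Q U\<^esub>"
    unfolding Q.Q_zero[OF U] Q.Q_zero[OF S(1)] Q.Q_restr[OF U S(1,3) L.zero_mem[OF U]] L.restr_zero[OF U S(1,3)] by (rule refl)
  finally show "\<exists>V. open V \<and> x \<in> V \<and> V \<subseteq> U \<and> restr Q.Q U V (ev X M L N \<alpha> U u) = restr Q.Q U V \<zero>\<^bsub>sect Q.Q U\<^esub>"
    using S by (intro exI[of _ S]) simp
qed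

text \<open>By \<open>cokernel_from_V\<close>, a representative is locally congruent to a section of
  \<open>V\<^sup>\<beta>\<close> modulo the image of \<open>s + \<alpha>\<close>.\<close>

lemma ev_locally_surjective:
  assumes U: "open U" and g: "g \<in> carrier (sect Q.Q U)" and x: "x \<in> U"
  shows "\<exists>S. open S \<and> x \<in> S \<and> S \<subseteq> U \<and> restr Q.Q U S g \<in> ev X M L N \<alpha> S ` V \<beta> (cyl S)"
proof -
  obtain m where "m \<in> carrier (sect L U)" and gm: "g = Q.cl U m" using g by (auto simp: Q.Q_carrier)
  then have m: "m \<in> seq_sec M U" "m \<in> carrier (sect L U)" using U by simp_all
  note uc = ident_mem[OF U m(1)]
  from cokernel_from_V[OF U uc x] obtain S y v where S: "open S" "x \<in> S" "S \<subseteq> U"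
    and y: "y \<in> carrier (sect N (cyl S))" and v: "v \<in> V \<beta> (cyl S)"
    and e: "rN U S (\<Phi> U m) = hN (cyl S) \<alpha> y \<oplus>\<^bsub>sect N (cyl S)\<^esub> v" by (elim exE conjE)
  interpret A: abelian_group "sect L S" by (rule L.abelian_group_sect[OF S(1)])
  note vc = V_mem[OF open_cyl[OF S(1)] v]
  have "\<Psi> U (\<Phi> U m) = m" by (rule inv_identI[OF U m(1) refl])
  then have "restr L U S m = \<Psi> S (rN U S (\<Phi> U m))" using inv_ident_restr[OF U S(1,3) uc] by simp
  also have "\<dots> = hL \<alpha> S (\<Psi> S y) \<oplus>\<^bsub>sect L S\<^esub> \<Psi> S v"
    unfolding e inv_ident_add[OF S(1) hN_mem[OF open_cyl[OF S(1)] y] vc] inv_ident_hN[OF S(1) y] by (rule refl)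
  finally have r: "restr L U S m = hL \<alpha> S (\<Psi> S y) \<oplus>\<^bsub>sect L S\<^esub> \<Psi> S v" .
  have c: "\<Psi> S y \<in> carrier (sect L S)" "\<Psi> S v \<in> carrier (sect L S)"
    using inv_ident_mem[OF S(1) y] inv_ident_mem[OF S(1) vc] S(1) by simp_all
  have "restr Q.Q U S g = Q.cl S (restr L U S m)" unfolding gm by (rule Q.Q_restr[OF U S(1,3) m(2)])
  also have "\<dots> = Q.cl S (\<Psi> S v)"
    using Q.cl_eq_iff[OF S(1) L.restr_closed[OF U S(1,3) m(2)] c(2)] r
      A.a_comm[OF Q.h_mem[OF S(1) c(1)] c(2)] c(1) by auto
  also have "\<dots> = ev X M L N \<alpha> S v" by (rule ev_eq[symmetric])
  finally show ?thesis using S v by blast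
qed

text \<open>The reduction of the assertion on sheaves to the three facts above: injectivity of
  \<open>s + \<alpha>\<close>, and the comparison of its kernel and cokernel on
  \<open>V\<^sup>\<beta>\<close> with those on the direct image.\<close>

theorem km_short_exact: "short_exact X EV hE EV (ev X M L N \<alpha>) (Mf_power X L \<alpha>)"
  unfolding short_exact_def Mf_eq
proof (intro conjI allI impI ballI)
  show "Ds_module_sheaf X EV" "Ds_module_sheaf X EV" by (rule EV_Ds)+
  show "Ds_module_sheaf X Q.Q" by (rule Q.Q_Ds_module_sheaf)
  show "Ds_hom X EV EV hE" by (rule hE_hom)
  show "Ds_hom X EV Q.Q (ev X M L N \<alpha>)" by (rule ev_hom)
  fix U :: "'a set" assume U: "open U"
  show "inj_on (hE U) (carrier (sect EV U))"
    unfolding EV_simps hE_eq[abs_def] by (rule inj_on_subset[OF hN_injective[OF U] V_facts(1)[OF open_cyl[OF U]]])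
  show "(ev X M L N \<alpha> U m = \<zero>\<^bsub>sect Q.Q U\<^esub>) = (\<forall>x\<in>U. \<exists>S. open S \<and> x \<in> S \<and> S \<subseteq> U \<and> restr EV U S m \<in> hE S ` carrier (sect EV S))"
    if "m \<in> carrier (sect EV U)" for m
  proof
    have m: "m \<in> V \<beta> (cyl U)" using that by simp
    assume z: "ev X M L N \<alpha> U m = \<zero>\<^bsub>sect Q.Q U\<^esub>"
    obtain w where w: "w \<in> V \<beta> (cyl U)" "m = hE U w" using ev_zero_iff[OF U m] z by blast
    have "restr EV U U m = hE U w" using N.restr_id[OF open_cyl[OF U] V_mem[OF open_cyl[OF U] m]] w(2) by simp
    then have "restr EV U U m \<in> hE U ` carrier (sect EV U)" using w(1) by (intro image_eqI[of _ _ w]) simp_all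
    then show "\<forall>x\<in>U. \<exists>S. open S \<and> x \<in> S \<and> S \<subseteq> U \<and> restr EV U S m \<in> hE S ` carrier (sect EV S)"
      using U by (intro ballI exI[of _ U]) simp
  next
    have m: "m \<in> V \<beta> (cyl U)" using that by simp
    assume l: "\<forall>x\<in>U. \<exists>S. open S \<and> x \<in> S \<and> S \<subseteq> U \<and> restr EV U S m \<in> hE S ` carrier (sect EV S)"
    show "ev X M L N \<alpha> U m = \<zero>\<^bsub>sect Q.Q U\<^esub>"
    proof (rule hE_local_image[OF U m])
      fix x assume "x \<in> U"
      from bspec[OF l this] show "\<exists>S. open S \<and> x \<in> S \<and> S \<subseteq> U \<and> rN U S m \<in> hE S ` V \<beta> (cyl S)"
        unfolding EV_simps .
    qed
  qed
  show "\<exists>S. open S \<and> x \<in> S \<and> S \<subseteq> U \<and> restr Q.Q U S g \<in> ev X M L N \<alpha> S ` carrier (sect EV S)"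
    if "g \<in> carrier (sect Q.Q U)" "x \<in> U" for g x
    unfolding EV_simps by (rule ev_locally_surjective[OF U that])
qed

end

theorem theorem4p1:
  fixes X :: "('a::{t2_space,second_countable_topology}) cmfd"
    and M :: "('a, 'm) msheaf"
    and f :: "'a \<Rightarrow> complex"
    and L :: "('a, nat \<Rightarrow> 'm) smsheaf"
    and N :: "('a \<times> complex, nat \<Rightarrow> 'm) msheaf"
    and V :: "complex \<Rightarrow> ('a \<times> complex) set \<Rightarrow> (nat \<Rightarrow> 'm) set"
    and \<alpha> \<beta> :: complex
  assumes "complex_manifold X"
    and "f \<in> hol_sec X UNIV"
    and "holonomic X M"
    and "acts_bijectively X M f"
    and "is_Ms_fs X M f L"
    and "is_graph_direct_image X M f N"
    and "is_KM_filtration X N V"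
    and "clex_le \<beta> \<alpha>"
  shows "short_exact X (V_on_X X N V \<beta>) (s_plus X \<alpha> (V_on_X X N V \<beta>))
           (V_on_X X N V \<beta>) (ev X M L N \<alpha>) (Mf_power X L \<alpha>)"
proof -
  have "module_sheaf (D_ring X) M" using assms(3) by (simp add: holonomic_def)
  then interpret km_setting X M f L N V \<alpha> \<beta>
    using assms complex_manifold_charted[OF assms(1)] by unfold_locales
  show ?thesis by (rule km_short_exact)
qed

end
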